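(* Let $Z$ be a real Gaussian random field on $\mathbb{R}^2$ with constant mean and isotropic autocovariance $\operatorname{cov}(Z(\mathbf{t}),Z(\mathbf{s}))=R(|\mathbf{t}-\mathbf{s}|)$, such that $R(|t|)=R(0)-|t|^\alpha+o(|t|^{\alpha+\gamma})$ as $|t|\to 0$ for some $0<\alpha<2$ and $\gamma>0$, $R$ is $C^4$ away from the origin, and there is $c_0>0$ with $|R^{(4)}(t)|\le c_0t^{\alpha-4}$ for all sufficiently small $t>0$. Let $\Omega\subset\mathbb{R}^2$ be a bounded simply connected domain and let $f$ be a $C^2$ diffeomorphism (in the sense of the context), with complex dilatation $\mu=\overline\partial f/\partial f$ and log-scale $\tau=\log|\partial f|$. Let $K:\mathbb{R}^2\to\mathbb{R}$ have bounded, continuous first and second order (mixed) partial derivatives, with $\int\!\!\int K(\mathbf{x})\,d\mathbf{x}=1$ and $\int\!\!\int|\mathbf{x}|K(\mathbf{x})\,d\mathbf{x}<\infty$. Let $(b_n)$ be positive numbers with $b_n\to0$ and $n^{-1}b_n^{-3}=O(n^{-\beta})$ for some $\beta>0$. Let $\hat\mu=\hat\mu_n$ and $\hat\tau=\hat\tau_n$ be the estimates defined in the context with bandwidth $b_n$. Then for every compact $\Theta\subset\Omega$, with probability one, $$\sup_{\Theta}|\hat\mu_n-\mu|\to0\quad\text{and}\quad\sup_{\Theta}|\hat\tau_n-\tau|\to0\qquad(n\to\infty).$$ If, in addition, $K$ is compactly supported, $f$ is a $C^3$ diffeomorphism, and $n^{-1}b_n^{-4}=O(n^{-\beta})$ for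 some $\beta>0$ with $\beta>1-4\gamma$, then also, for every compact $\Theta\subset\Omega$, with probability one, $\sup_{\Theta}|\partial\hat\mu_n-\partial\mu|\to0$ as $n\to\infty$.
   Context: A $C^r$ diffeomorphism ($r\ge1$) means an injective map $f:\mathbb{R}^2\to\mathbb{R}^2$ having continuous (mixed) partial derivatives up to order $r$, whose inverse is $C^1$ on $f(\mathbb{R}^2)$, and with Jacobian determinant $\det J_f^{\mathbf{t}}>0$ for every $\mathbf{t}\in\mathbb{R}^2$. $\mathbb{R}^2$ is identified with $\mathbb{C}$, $\partial=\frac12(\partial_x-i\partial_y)$, $\overline\partial=\frac12(\partial_x+i\partial_y)$. Put $Y=Z\circ f$, $\Delta_{\mathbf{h}}Y(\mathbf{t})=Y(\mathbf{t}+\mathbf{h})-Y(\mathbf{t})$, $\Delta^2_{\mathbf{h}}=\Delta_{\mathbf{h}}\Delta_{\mathbf{h}}$, $\Omega_n=\Omega\cap(\mathbb{Z}^2/n)$, and for nonzero $\mathbf{h}\in\mathbb{R}^2$ $$B^{\mathbf{h}}_{n,b}(\mathbf{t})=\frac{1}{n^2b^2}\sum_{\mathbf{w}\in\Omega_n}K\Big(\frac{\mathbf{w}-\mathbf{t}}{b}\Big)\,n^{\alpha}\,(\Delta^2_{\mathbf{h}/n}Y(\mathbf{w}))^2,\qquad\mathbf{t}\in\Omega.$$ For $\mathbf{h}_1=(1,0)$, $\mathbf{h}_2=(0,1)$, $\mathbf{h}_3=(1,1)$ put $W_{j,n}=\big(B^{\mathbf{h}_j}_{n,b_n}/(8-2^{\alpha+1})\big)^{1/\alpha}$,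 and $$A_n=W_{1,n}^2,\quad C_n=W_{2,n}^2,\quad D_n=W_{3,n}^2-W_{1,n}^2-W_{2,n}^2,\quad S_n=\sqrt{4A_nC_n-D_n^2}+A_n+C_n,$$ $$\hat\mu_n=\frac{A_n-C_n}{S_n}+i\,\frac{D_n}{S_n},\qquad \hat\tau_n=\tfrac12\big(\log S_n-\log4\big).$$ The assertions include that, with probability one, these expressions are well defined on (a neighborhood of) $\Theta$ for all sufficiently large $n$. *)

theory Defs
  imports "HOL-Probability.Probability" "HOL-Library.Landau_Symbols"
begin

text \<open>The plane is the type \<^typ>\<open>complex\<close>; the coordinate directions are \<^term>\<open>1\<close> and \<^term>\<open>\<i>\<close>.\<close>

definition has_partial :: "complex \<Rightarrow> (complex \<Rightarrow> 'b::real_normed_vector) \<Rightarrow> complex \<Rightarrow> bool" where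
  "has_partial v g z \<longleftrightarrow> (\<lambda>s::real. g (z + s *\<^sub>R v)) differentiable (at 0)"

definition partial :: "complex \<Rightarrow> (complex \<Rightarrow> 'b::real_normed_vector) \<Rightarrow> complex \<Rightarrow> 'b" where
  "partial v g z = vector_derivative (\<lambda>s::real. g (z + s *\<^sub>R v)) (at 0)"

text \<open>Continuous (mixed) partial derivatives up to order \<open>k\<close>; meant for open sets \<open>S\<close>,
  as the partial derivatives are two-sided and taken in the plane.\<close>

primrec cont_diff_on :: "nat \<Rightarrow> complex set \<Rightarrow> (complex \<Rightarrow> 'b::real_normed_vector) \<Rightarrow> bool" where
  "cont_diff_on 0 S g \<longleftrightarrow> continuous_on S g"
| "cont_diff_on (Suc k) S g \<longleftrightarrow> continuous_on S g \<and>
     (\<forall>v\<in>{1, \<i>}. (\<forall>z\<in>S. has_partial v g z) \<and> cont_diff_on k S (partial v g))"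

definition jacobian_det :: "(complex \<Rightarrow> complex) \<Rightarrow> complex \<Rightarrow> real" where
  "jacobian_det f z =
     Re (partial 1 f z) * Im (partial \<i> f z) - Re (partial \<i> f z) * Im (partial 1 f z)"

text \<open>The range of \<open>f\<close> need not be the whole plane; it is open because the Jacobian is
  positive.\<close>

definition diffeo :: "nat \<Rightarrow> (complex \<Rightarrow> complex) \<Rightarrow> bool" where
  "diffeo r f \<longleftrightarrow> inj f \<and> cont_diff_on r UNIV f \<and> cont_diff_on 1 (range f) (inv f) \<and>
     (\<forall>z. jacobian_det f z > 0)"

definition wirtinger :: "(complex \<Rightarrow> complex) \<Rightarrow> complex \<Rightarrow> complex" where
  "wirtinger g z = (partial 1 g z - \<i> * partial \<i> g z) / 2"

definition wirtinger_bar :: "(complex \<Rightarrow> complex) \<Rightarrow> complex \<Rightarrow> complex" where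
  "wirtinger_bar g z = (partial 1 g z + \<i> * partial \<i> g z) / 2"

definition dilatation :: "(complex \<Rightarrow> complex) \<Rightarrow> complex \<Rightarrow> complex" where
  "dilatation f z = wirtinger_bar f z / wirtinger f z"

definition log_scale :: "(complex \<Rightarrow> complex) \<Rightarrow> complex \<Rightarrow> real" where
  "log_scale f z = ln (cmod (wirtinger f z))"

text \<open>Degenerate (almost surely constant) normal variables are included.\<close>

definition normal_rv :: "'w measure \<Rightarrow> ('w \<Rightarrow> real) \<Rightarrow> bool" where
  "normal_rv M X \<longleftrightarrow> X \<in> borel_measurable M \<and>
     ((\<exists>m. AE \<omega> in M. X \<omega> = m) \<or>
      (\<exists>m \<sigma>. \<sigma> > 0 \<and> distributed M lborel X (\<lambda>x. ennreal (normal_density m \<sigma> x))))"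

text \<open>Joint normality of the finite-dimensional distributions, by linear combinations.\<close>

definition gaussian_field :: "'w measure \<Rightarrow> (complex \<Rightarrow> 'w \<Rightarrow> real) \<Rightarrow> bool" where
  "gaussian_field M Z \<longleftrightarrow>
     (\<forall>T a. finite T \<longrightarrow> normal_rv M (\<lambda>\<omega>. \<Sum>t\<in>T. a t * Z t \<omega>))"

definition covariance :: "'w measure \<Rightarrow> ('w \<Rightarrow> real) \<Rightarrow> ('w \<Rightarrow> real) \<Rightarrow> real" where
  "covariance M X Y =
     (LINT \<omega>|M. (X \<omega> - (LINT \<omega>'|M. X \<omega>')) * (Y \<omega> - (LINT \<omega>'|M. Y \<omega>')))"

definition diff_op :: "complex \<Rightarrow> (complex \<Rightarrow> real) \<Rightarrow> complex \<Rightarrow> real" where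
  "diff_op h y t = y (t + h) - y t"

definition grid :: "complex set \<Rightarrow> nat \<Rightarrow> complex set" where
  "grid \<Omega> n = \<Omega> \<inter> {Complex (of_int j / real n) (of_int k / real n) | j k :: int. True}"

text \<open>In the estimators below, \<open>y\<close> is one realization of the field \<open>Y\<close>, and \<open>b\<close> is the
  bandwidth.\<close>

definition B_stat ::
  "real \<Rightarrow> (complex \<Rightarrow> real) \<Rightarrow> complex set \<Rightarrow> (complex \<Rightarrow> real) \<Rightarrow> nat \<Rightarrow> real \<Rightarrow> complex \<Rightarrow> complex \<Rightarrow> real"
where
  "B_stat \<alpha> K \<Omega> y n b h t =
     1 / ((real n)\<^sup>2 * b\<^sup>2) *
     (\<Sum>w\<in>grid \<Omega> n. K ((w - t) / of_real b) * real n powr \<alpha> *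
        (diff_op (h / of_nat n) (diff_op (h / of_nat n) y) w)\<^sup>2)"

definition W_stat ::
  "real \<Rightarrow> (complex \<Rightarrow> real) \<Rightarrow> complex set \<Rightarrow> (complex \<Rightarrow> real) \<Rightarrow> nat \<Rightarrow> real \<Rightarrow> complex \<Rightarrow> complex \<Rightarrow> real"
where
  "W_stat \<alpha> K \<Omega> y n b h t = (B_stat \<alpha> K \<Omega> y n b h t / (8 - 2 powr (\<alpha> + 1))) powr (1 / \<alpha>)"

definition A_stat ::
  "real \<Rightarrow> (complex \<Rightarrow> real) \<Rightarrow> complex set \<Rightarrow> (complex \<Rightarrow> real) \<Rightarrow> nat \<Rightarrow> real \<Rightarrow> complex \<Rightarrow> real"
where
  "A_stat \<alpha> K \<Omega> y n b t = (W_stat \<alpha> K \<Omega> y n b 1 t)\<^sup>2"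

definition C_stat ::
  "real \<Rightarrow> (complex \<Rightarrow> real) \<Rightarrow> complex set \<Rightarrow> (complex \<Rightarrow> real) \<Rightarrow> nat \<Rightarrow> real \<Rightarrow> complex \<Rightarrow> real"
where
  "C_stat \<alpha> K \<Omega> y n b t = (W_stat \<alpha> K \<Omega> y n b \<i> t)\<^sup>2"

definition D_stat ::
  "real \<Rightarrow> (complex \<Rightarrow> real) \<Rightarrow> complex set \<Rightarrow> (complex \<Rightarrow> real) \<Rightarrow> nat \<Rightarrow> real \<Rightarrow> complex \<Rightarrow> real"
where
  "D_stat \<alpha> K \<Omega> y n b t =
     (W_stat \<alpha> K \<Omega> y n b (1 + \<i>) t)\<^sup>2 - (W_stat \<alpha> K \<Omega> y n b 1 t)\<^sup>2 - (W_stat \<alpha> K \<Omega> y n b \<i> t)\<^sup>2"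

definition S_stat ::
  "real \<Rightarrow> (complex \<Rightarrow> real) \<Rightarrow> complex set \<Rightarrow> (complex \<Rightarrow> real) \<Rightarrow> nat \<Rightarrow> real \<Rightarrow> complex \<Rightarrow> real"
where
  "S_stat \<alpha> K \<Omega> y n b t =
     sqrt (4 * A_stat \<alpha> K \<Omega> y n b t * C_stat \<alpha> K \<Omega> y n b t - (D_stat \<alpha> K \<Omega> y n b t)\<^sup>2)
     + A_stat \<alpha> K \<Omega> y n b t + C_stat \<alpha> K \<Omega> y n b t"

definition mu_hat ::
  "real \<Rightarrow> (complex \<Rightarrow> real) \<Rightarrow> complex set \<Rightarrow> (complex \<Rightarrow> real) \<Rightarrow> nat \<Rightarrow> real \<Rightarrow> complex \<Rightarrow> complex"
where
  "mu_hat \<alpha> K \<Omega> y n b t =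
     of_real ((A_stat \<alpha> K \<Omega> y n b t - C_stat \<alpha> K \<Omega> y n b t) / S_stat \<alpha> K \<Omega> y n b t)
     + \<i> * of_real (D_stat \<alpha> K \<Omega> y n b t / S_stat \<alpha> K \<Omega> y n b t)"

definition tau_hat ::
  "real \<Rightarrow> (complex \<Rightarrow> real) \<Rightarrow> complex set \<Rightarrow> (complex \<Rightarrow> real) \<Rightarrow> nat \<Rightarrow> real \<Rightarrow> complex \<Rightarrow> real"
where
  "tau_hat \<alpha> K \<Omega> y n b t = (ln (S_stat \<alpha> K \<Omega> y n b t) - ln 4) / 2"

text \<open>The operations \<open>powr\<close>, \<open>sqrt\<close>, \<open>/\<close> and \<open>ln\<close> are total in HOL. The following says that,
  in the formulas for \<^const>\<open>mu_hat\<close> and \<^const>\<open>tau_hat\<close>, they are applied only where they have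
  their usual meaning.\<close>

definition estimators_defined ::
  "real \<Rightarrow> (complex \<Rightarrow> real) \<Rightarrow> complex set \<Rightarrow> (complex \<Rightarrow> real) \<Rightarrow> nat \<Rightarrow> real \<Rightarrow> complex \<Rightarrow> bool"
where
  "estimators_defined \<alpha> K \<Omega> y n b t \<longleftrightarrow>
     (\<forall>h\<in>{1, \<i>, 1 + \<i>}. B_stat \<alpha> K \<Omega> y n b h t \<ge> 0) \<and>
     4 * A_stat \<alpha> K \<Omega> y n b t * C_stat \<alpha> K \<Omega> y n b t - (D_stat \<alpha> K \<Omega> y n b t)\<^sup>2 \<ge> 0 \<and>
     S_stat \<alpha> K \<Omega> y n b t > 0"

text \<open>The supremum is taken in \<^typ>\<open>ennreal\<close>, so that it is meaningful for unbounded functions,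
  and is \<open>0\<close> on the empty set.\<close>

definition sup_dist :: "complex set \<Rightarrow> (complex \<Rightarrow> 'b::real_normed_vector) \<Rightarrow> (complex \<Rightarrow> 'b) \<Rightarrow> ennreal" where
  "sup_dist \<Theta> g h = (SUP t\<in>\<Theta>. ennreal (norm (g t - h t)))"

end

theory Submission
  imports Defs "HOL-Computational_Algebra.Polynomial"
begin

text \<open>The statistic \<open>B\<^sub>n(t)\<close> is a kernel average of squares of normalised second differences, whose
  variances are close to \<open>(8 - 2\<^bsup>\<alpha> + 1\<^esup>) \<bar>J\<^sub>f(t) h\<bar>\<^sup>\<alpha>\<close>. The lengths \<open>\<bar>J\<^sub>f(t) h\<bar>\<close> for the three
  directions \<open>h\<close> determine the first fundamental form of \<open>f\<close>, hence \<open>\<mu>\<close> and \<open>\<tau>\<close>, as smooth functions;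
  so it suffices that \<open>B\<^sub>n\<close> and, for the second part, its partial derivatives converge uniformly.

  The means converge by comparison of grid sums with integrals; for the derivatives the kernel is
  differentiated and the derivative is moved to the limit by integration by parts.
  For the fluctuations, the covariance of the second differences at two grid points at distance
  \<open>k / n\<close> is \<open>O(k\<^bsup>\<alpha> - 3\<^esup>)\<close>, by the mean value theorem for three of the four differences, so that
  the squared covariances have a sum of order \<open>n\<^sup>2\<close>. High moments of the centred quadratic form are
  bounded by powers of this sum: the moments of a Gaussian sum of squares agree with those for
  independent normal variables and a suitable matrix, where Stein's identity gives a recursion.
  Markov's inequality, a union bound over the grid and the Borel-Cantelli lemma conclude.\<close>

subsection \<open>Functions with all moments\<close>

text \<open>Second differences are what makes the squared covariances summable: at lag
  \<open>k\<close> the bound \<open>k powr (\<alpha> - 3)\<close> has square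
  \<open>k powr (2 * \<alpha> - 6)\<close>, and this is summable over a planar lattice exactly when
  \<alpha> < 2. First differences would give only \<open>k powr (\<alpha> - 2)\<close>, enough for
  \<alpha> < 1. Leaving one of the four differences unexploited costs one power of \<open>k\<close>,
  which the sum can afford. The weights in the quadratic form are of order n^(-1-\<beta>), so its
  variance is of order n^(-2\<beta>). For small \<beta> this is not summable, still less after a
  union over n^2 grid points; this is why moments of arbitrarily high order are needed, with an
  order that grows like 1/\<beta>. The rates come from the Lipschitz kernel: moving its argument by
  1/(n b) under the normalisation 1/b^2 costs 1/(n b^3), and one more factor 1/b after
  differentiation. The variances of the second differences have a bias of order n^(-\<gamma>) + 1/n
  that integration by parts cannot improve, so the derivative needs n^(-\<gamma>) = o(b); this is
  what \<beta> > 1 - 4\<gamma> provides.\<close>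

definition all_moments :: "'a measure \<Rightarrow> ('a \<Rightarrow> real) \<Rightarrow> bool" where
  "all_moments N F \<longleftrightarrow> F \<in> borel_measurable N \<and> (\<forall>k::nat. integrable N (\<lambda>x. F x ^ k))"

lemma all_moments_measurable: "all_moments N F \<Longrightarrow> F \<in> borel_measurable N"
  by (simp add: all_moments_def)

lemma all_moments_integrable_power: "all_moments N F \<Longrightarrow> integrable N (\<lambda>x. F x ^ k)"
  by (simp add: all_moments_def)

lemma all_moments_integrable: "all_moments N F \<Longrightarrow> integrable N F"
  using all_moments_integrable_power[of N F 1] by simp

lemma all_moments_const: "finite_measure N \<Longrightarrow> all_moments N (\<lambda>x. c)"
  by (simp add: all_moments_def finite_measure.integrable_const)

text \<open>The pointwise bound |a b|^k <= a^(2k) + b^(2k) trades a product for higher moments of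
  its factors. This is why all orders are required at once: the class is then closed under
  polynomial operations.\<close>

lemma all_moments_mult:
  assumes F: "all_moments N F" and G: "all_moments N G"
  shows "all_moments N (\<lambda>x. F x * G x)"
  unfolding all_moments_def
proof (intro conjI allI)
  note [measurable] = all_moments_measurable[OF F] all_moments_measurable[OF G]
  show "(\<lambda>x. F x * G x) \<in> borel_measurable N" by measurable
  fix k :: nat
  show "integrable N (\<lambda>x. (F x * G x) ^ k)"
  proof (rule Bochner_Integration.integrable_bound)
    show "integrable N (\<lambda>x. F x ^ (2*k) + G x ^ (2*k))"
      by (intro Bochner_Integration.integrable_add all_moments_integrable_power F G)
    have "norm ((a * b) ^ k) \<le> norm (a ^ (2*k) + b ^ (2*k))" for a b :: real
    proof -
      have "2 * \<bar>a ^ k\<bar> * \<bar>b ^ k\<bar> \<le> (a^k)\<^sup>2 + (b^k)\<^sup>2"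
        using sum_squares_bound[of "\<bar>a ^ k\<bar>" "\<bar>b ^ k\<bar>"] by simp
      moreover have "0 \<le> \<bar>a ^ k\<bar> * \<bar>b ^ k\<bar>" by simp
      ultimately have "\<bar>a ^ k\<bar> * \<bar>b ^ k\<bar> \<le> (a^k)\<^sup>2 + (b^k)\<^sup>2"
        by linarith
      then show ?thesis
        by (simp add: power_mult_distrib abs_mult power_mult[symmetric] mult.commute power_even_abs)
    qed
    then show "AE x in N. norm ((F x * G x) ^ k) \<le> norm (F x ^ (2*k) + G x ^ (2*k))"
      by simp
  qed measurable
qed

lemma all_moments_add:
  assumes F: "all_moments N F" and G: "all_moments N G"
  shows "all_moments N (\<lambda>x. F x + G x)"
  unfolding all_moments_def
proof (intro conjI allI)
  note [measurable] = all_moments_measurable[OF F] all_moments_measurable[OF G]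
  show "(\<lambda>x. F x + G x) \<in> borel_measurable N" by measurable
  fix k :: nat
  show "integrable N (\<lambda>x. (F x + G x) ^ k)"
  proof (rule Bochner_Integration.integrable_bound)
    show "integrable N (\<lambda>x. 2 ^ k * \<bar>F x ^ k\<bar> + 2 ^ k * \<bar>G x ^ k\<bar>)"
      by (intro Bochner_Integration.integrable_add integrable_mult_right integrable_abs
          all_moments_integrable_power F G)
    have "norm ((a + b) ^ k) \<le> norm (2 ^ k * \<bar>a ^ k\<bar> + 2 ^ k * \<bar>b ^ k\<bar>)" for a b :: real
    proof -
      have "\<bar>a + b\<bar> ^ k \<le> (2 * max \<bar>a\<bar> \<bar>b\<bar>) ^ k"
        by (intro power_mono) auto
      also have "\<dots> = 2 ^ k * (max \<bar>a\<bar> \<bar>b\<bar>) ^ k"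
        by (simp add: power_mult_distrib)
      also have "\<dots> \<le> 2 ^ k * (\<bar>a\<bar> ^ k + \<bar>b\<bar> ^ k)"
        by (intro mult_left_mono) (auto simp: max_def)
      finally show ?thesis
        by (simp add: power_abs distrib_left)
    qed
    then show "AE x in N. norm ((F x + G x) ^ k) \<le> norm (2 ^ k * \<bar>F x ^ k\<bar> + 2 ^ k * \<bar>G x ^ k\<bar>)"
      by simp
  qed measurable
qed

lemma all_moments_sum:
  assumes "finite_measure N" "\<And>i. i \<in> I \<Longrightarrow> all_moments N (F i)"
  shows "all_moments N (\<lambda>x. \<Sum>i\<in>I. F i x)"
  using assms(2)
proof (induction I rule: infinite_finite_induct)
  case (insert i I)
  then show ?case by (simp add: all_moments_add)
qed (simp_all add: all_moments_const assms(1))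

lemma all_moments_power:
  assumes "all_moments N F"
  shows "all_moments N (\<lambda>x. F x ^ n)"
  using assms by (auto simp: all_moments_def power_mult[symmetric])

lemma all_moments_cmult:
  "finite_measure N \<Longrightarrow> all_moments N F \<Longrightarrow> all_moments N (\<lambda>x. c * F x)"
  by (rule all_moments_mult[OF all_moments_const])

lemma all_moments_diff:
  assumes "finite_measure N" "all_moments N F" "all_moments N G"
  shows "all_moments N (\<lambda>x. F x - G x)"
  using all_moments_add[OF assms(2) all_moments_cmult[OF assms(1,3), of "-1"]] by simp

lemmas all_moments_intros =
  all_moments_const all_moments_mult all_moments_add all_moments_sum all_moments_power
  all_moments_cmult all_moments_diff

text \<open>Brings in coordinates and components of product spaces through their known laws.\<close>

lemma all_moments_distr:
  assumes "g \<in> measurable N L" "all_moments (distr N L g) F"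
  shows "all_moments N (\<lambda>x. F (g x))"
proof -
  have [measurable]: "F \<in> borel_measurable L"
    using assms(2) by (simp add: all_moments_def)
  show ?thesis
    using assms(2) by (auto simp: all_moments_def integrable_distr_eq[OF assms(1)]
        intro!: measurable_compose[OF assms(1)])
qed

subsection \<open>Moments of normal variables\<close>

text \<open>The double factorial (2k-1)!!, which is the moment of order 2k of a standard normal
  variable.\<close>

definition normal_moment :: "nat \<Rightarrow> real" where
  "normal_moment k = fact (2 * k) / (2 ^ k * fact k)"

lemma normal_moment_pos: "normal_moment k > 0"
  by (simp add: normal_moment_def)

lemma normal_moment_0 [simp]: "normal_moment 0 = 1"
  by (simp add: normal_moment_def)

lemma normal_moment_Suc: "normal_moment (Suc k) = (2 * real k + 1) * normal_moment k"
proof -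
  have "fact (2 * Suc k) = (2 * (real k + 1)) * ((2 * real k + 1) * fact (2 * k))"
    by (simp add: algebra_simps)
  then show ?thesis
    unfolding normal_moment_def by (simp del: fact_Suc add: fact_Suc[of k]) (simp add: divide_simps)
qed

lemma normal_rv_all_moments:
  assumes M: "prob_space M" and X: "normal_rv M X"
  shows "all_moments M X"
proof -
  interpret prob_space M by fact
  have [measurable]: "X \<in> borel_measurable M"
    using X by (simp add: normal_rv_def)
  consider m where "AE \<omega> in M. X \<omega> = m"
    | m \<sigma> where "\<sigma> > 0" "distributed M lborel X (\<lambda>x. ennreal (normal_density m \<sigma> x))"
    using X unfolding normal_rv_def by blast
  then show ?thesis
  proof cases
    case 1
    have "integrable M (\<lambda>x. X x ^ k)" for k
    proof (subst integrable_cong_AE)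
      show "AE x in M. X x ^ k = m ^ k" using 1 by auto
    qed auto
    then show ?thesis by (simp add: all_moments_def)
  next
    case 2
    have "integrable M (\<lambda>x. (X x - m) ^ k)" for k
      using distributed_integrable[OF 2(2), of "\<lambda>x. (x - m)^k"]
        integrable_normal_moment[OF 2(1), of m k] by simp
    then have "all_moments M (\<lambda>x. X x - m)"
      by (simp add: all_moments_def)
    from all_moments_add[OF this all_moments_const[OF finite_measure_axioms, of m]]
    show ?thesis by simp
  qed
qed

text \<open>Phrased with the second moment instead of \<sigma>, so that degenerate variables obey
  the same formula: a centred constant is 0, and both sides vanish unless
  \<open>k = 0\<close>.\<close>

lemma normal_rv_even_moment:
  assumes M: "prob_space M" and X: "normal_rv M X" and mean: "(LINT \<omega>|M. X \<omega>) = 0"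
  shows "(LINT \<omega>|M. X \<omega> ^ (2 * k)) = normal_moment k * (LINT \<omega>|M. (X \<omega>)\<^sup>2) ^ k"
proof -
  interpret prob_space M by fact
  have [measurable]: "X \<in> borel_measurable M"
    using X by (simp add: normal_rv_def)
  consider m where "AE \<omega> in M. X \<omega> = m"
    | m \<sigma> where "\<sigma> > 0" "distributed M lborel X (\<lambda>x. ennreal (normal_density m \<sigma> x))"
    using X unfolding normal_rv_def by blast
  then show ?thesis
  proof cases
    case 1
    have E: "(LINT \<omega>|M. X \<omega> ^ j) = m ^ j" for j
    proof -
      have "(LINT \<omega>|M. X \<omega> ^ j) = (LINT \<omega>|M. m ^ j)"
        using 1 by (intro integral_cong_AE) auto
      then show ?thesis by (simp add: prob_space)
    qed
    from E[of 1] mean have "m = 0" by simp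
    then show ?thesis using E[of "2*k"] E[of 2] by (cases k) auto
  next
    case 2
    have E: "(LINT \<omega>|M. (X \<omega> - m) ^ j) = (LINT x|lborel. normal_density m \<sigma> x * (x - m) ^ j)" for j
      using distributed_integral[OF 2(2), of "\<lambda>x. (x - m)^j"] by simp
    have "(LINT \<omega>|M. X \<omega> - m) = 0"
      using E[of 1] integral_normal_moment_odd[OF 2(1), of m 0] by simp
    moreover have "integrable M X"
      using normal_rv_all_moments[OF M X] by (rule all_moments_integrable)
    ultimately have m: "m = 0"
      using mean by (simp add: prob_space)
    have *: "(LINT \<omega>|M. X \<omega> ^ (2 * j)) = fact (2 * j) / ((2 / \<sigma>\<^sup>2)^j * fact j)" for j
      using E[of "2*j"] integral_normal_moment_even[OF 2(1), of m j] by (simp add: m)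
    show ?thesis
      using *[of k] *[of 1] 2(1)
      by (simp add: normal_moment_def power_divide power2_eq_square[of "X _"])
  qed
qed

section \<open>The standard normal law and Stein's identity\<close>

definition std_normal :: "real measure" where
  "std_normal = density lborel (\<lambda>x. ennreal (std_normal_density x))"

lemma prob_space_std_normal: "prob_space std_normal"
  unfolding std_normal_def by (rule prob_space_normal_density) simp

lemma sets_std_normal [measurable_cong]: "sets std_normal = sets borel"
  by (simp add: std_normal_def)

lemma std_normal_integrable_power: "integrable std_normal (\<lambda>x. x ^ k)"
  unfolding std_normal_def
  by (subst integrable_density) (auto simp: integrable_std_normal_moment)

text \<open>Stein's identity for the monomial \<open>x ^ i\<close>. At \<open>i = 0\<close> the
  truncated exponent \<open>i - 1\<close> is harmless because of the factor
  \<open>real i\<close>.\<close>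

lemma std_normal_moment_step:
  "(LINT x|std_normal. x ^ Suc i) = real i * (LINT x|std_normal. x ^ (i - 1))"
proof -
  have E: "(LINT x|std_normal. x ^ j) = (LINT x|lborel. std_normal_density x * x ^ j)" for j
    unfolding std_normal_def by (subst integral_density) auto
  have odd: "(LINT x|std_normal. x ^ j) = 0" if "odd j" for j
    using that E[of j] integral_std_normal_moment_odd by (auto elim!: oddE)
  have even: "(LINT x|std_normal. x ^ (2 * j)) = normal_moment j" for j
    unfolding E normal_moment_def by (rule integral_std_normal_moment_even)
  show ?thesis
  proof (cases "even i")
    case True
    then show ?thesis using odd[of "Suc i"] odd[of "i - 1"] by (cases "i = 0") auto
  next
    case False
    then obtain j where j: "i = 2 * j + 1" by (elim oddE)
    then show ?thesis using even[of "Suc j"] even[of j] by (simp add: normal_moment_Suc)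
  qed
qed

lemma pderiv_sum: "pderiv (\<Sum>i\<in>I. p i) = (\<Sum>i\<in>I. pderiv (p i))"
  by (induction I rule: infinite_finite_induct) (auto simp: pderiv_add)

text \<open>Linear in the coefficients, hence reduced to monomials. Polynomials suffice, since every
  functional below is polynomial in each coordinate; no decay at infinity has to be argued.\<close>

lemma stein_poly:
  "(LINT x|std_normal. x * poly p x) = (LINT x|std_normal. poly (pderiv p) x)"
proof -
  let ?n = "degree p"
  have p: "p = (\<Sum>i\<le>?n. monom (coeff p i) i)"
    by (simp add: poly_as_sum_of_monoms)
  have "poly (pderiv p) x = (\<Sum>i\<le>?n. coeff p i * (real i * x ^ (i - 1)))" for x
    by (subst p) (simp add: pderiv_sum poly_sum poly_monom pderiv_monom mult_ac)
  then have "(LINT x|std_normal. poly (pderiv p) x)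
      = (\<Sum>i\<le>?n. coeff p i * (real i * (LINT x|std_normal. x ^ (i - 1))))"
    by (simp add: std_normal_integrable_power)
  also have "\<dots> = (\<Sum>i\<le>?n. coeff p i * (LINT x|std_normal. x ^ Suc i))"
    by (simp only: std_normal_moment_step)
  also have "\<dots> = (LINT x|std_normal. (\<Sum>i\<le>?n. coeff p i * x ^ Suc i))"
    using std_normal_integrable_power[of "Suc _"] by (simp del: power_Suc)
  also have "\<dots> = (LINT x|std_normal. x * poly p x)"
    by (intro Bochner_Integration.integral_cong) (auto simp: poly_altdef sum_distrib_left mult_ac)
  finally show ?thesis by simp
qed

subsection \<open>Quadratic forms in independent standard normal variables\<close>

abbreviation std_normal_vec :: "'i set \<Rightarrow> ('i \<Rightarrow> real) measure" where
  "std_normal_vec I \<equiv> Pi\<^sub>M I (\<lambda>_. std_normal)"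

lemma prob_space_std_normal_vec: "prob_space (std_normal_vec I)"
  by (intro prob_space_PiM prob_space_std_normal)

lemma finite_measure_std_normal_vec: "finite_measure (std_normal_vec I)"
  using prob_space_std_normal_vec by (rule prob_space.finite_measure)

lemma all_moments_coordinate:
  assumes "j \<in> I"
  shows "all_moments (std_normal_vec I) (\<lambda>x. x j)"
proof (rule all_moments_distr[where g = "\<lambda>x. x j" and F = "\<lambda>y. y" and L = std_normal])
  interpret product_prob_space "\<lambda>_. std_normal" I
    by (auto intro!: product_prob_spaceI prob_space_std_normal)
  show "(\<lambda>x. x j) \<in> measurable (std_normal_vec I) std_normal"
    using assms by measurable
  show "all_moments (distr (std_normal_vec I) std_normal (\<lambda>x. x j)) (\<lambda>y. y)"
    using assms by (simp add: PiM_component all_moments_def std_normal_integrable_power)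
qed

text \<open>Fubini isolates the coordinate \<open>j\<close>. The polynomial \<open>p x\<close> has
  coefficients that depend on the other coordinates, so that \<open>pderiv\<close> plays the part of
  the partial derivative in direction \<open>j\<close>.\<close>

lemma stein_coordinate:
  assumes I: "finite I" "j \<in> I"
    and F: "all_moments (std_normal_vec I) F" and G: "all_moments (std_normal_vec I) G"
    and Fp: "\<And>x t. F (x(j := t)) = poly (p x) t"
    and Gp: "\<And>x t. G (x(j := t)) = poly (pderiv (p x)) t"
  shows "(LINT x|std_normal_vec I. x j * F x) = (LINT x|std_normal_vec I. G x)"
proof -
  interpret product_prob_space "\<lambda>_. std_normal" I
    by (auto intro!: product_prob_spaceI prob_space_std_normal)
  define J where "J = I - {j}"
  have J: "finite J" "j \<notin> J" "I = insert j J" using I by (auto simp: J_def)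
  have "(LINT x|std_normal_vec I. x j * F x)
      = (LINT x|std_normal_vec J. LINT y|std_normal. (x(j:=y)) j * F (x(j := y)))"
    unfolding J(3)
    by (rule product_integral_insert)
      (use J F all_moments_coordinate[OF I(2)] in
        \<open>auto intro!: all_moments_integrable all_moments_mult\<close>)
  also have "\<dots> = (LINT x|std_normal_vec J. LINT y|std_normal. G (x(j := y)))"
    by (simp add: Fp Gp stein_poly)
  also have "\<dots> = (LINT x|std_normal_vec I. G x)"
    unfolding J(3)
    by (rule product_integral_insert[symmetric])
      (use J G in \<open>auto intro!: all_moments_integrable\<close>)
  finally show ?thesis .
qed

lemma sum_fun_upd:
  fixes a x :: "'i \<Rightarrow> real"
  assumes "finite I" "j \<in> I"
  shows "(\<Sum>i\<in>I. a i * (x(j := t)) i) = (\<Sum>i\<in>I-{j}. a i * x i) + a j * t"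
  using assms by (simp add: sum.remove[of I j])

text \<open>One factor of the form is expanded as a sum of \<open>a j * x j\<close>, and Stein's
  identity in each coordinate yields the factor (2k+1) times the sum of squares: the recursion that
  \<open>normal_moment\<close> satisfies. Stability of normal laws under convolution is not
  invoked.\<close>

lemma linear_form_moment:
  fixes a :: "'i \<Rightarrow> real"
  assumes I: "finite I"
  shows "(LINT x|std_normal_vec I. (\<Sum>i\<in>I. a i * x i) ^ (2 * k)) = normal_moment k * (\<Sum>i\<in>I. (a i)\<^sup>2) ^ k"
proof (induction k)
  case 0
  show ?case by (simp add: prob_space.prob_space[OF prob_space_std_normal_vec])
next
  case (Suc k)
  let ?N = "std_normal_vec I"
  note fm = finite_measure_std_normal_vec[of I]
  let ?L = "\<lambda>x. \<Sum>i\<in>I. a i * x i"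
  have L: "all_moments ?N ?L"
    by (intro all_moments_intros fm all_moments_coordinate)
  have stein: "(LINT x|?N. x j * ?L x ^ (2 * k + 1)) = (LINT x|?N. (2 * real k + 1) * a j * ?L x ^ (2 * k))"
    if j: "j \<in> I" for j
  proof (rule stein_coordinate[where p = "\<lambda>x. [:(\<Sum>i\<in>I-{j}. a i * x i), a j:] ^ Suc (2 * k)", OF I j])
    show "all_moments ?N (\<lambda>x. ?L x ^ (2 * k + 1))"
      by (rule all_moments_power[OF L])
    show "all_moments ?N (\<lambda>x. (2 * real k + 1) * a j * ?L x ^ (2 * k))"
      by (rule all_moments_cmult[OF fm all_moments_power[OF L]])
    fix x t
    show "?L (x(j := t)) ^ (2 * k + 1) = poly ([:(\<Sum>i\<in>I-{j}. a i * x i), a j:] ^ Suc (2 * k)) t"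
      unfolding sum_fun_upd[OF I j] by (simp add: algebra_simps)
    show "(2 * real k + 1) * a j * ?L (x(j := t)) ^ (2 * k)
        = poly (pderiv ([:(\<Sum>i\<in>I-{j}. a i * x i), a j:] ^ Suc (2 * k))) t"
      unfolding sum_fun_upd[OF I j] pderiv_power_Suc
      by (simp add: pderiv_pCons mult_ac)
  qed
  have "(LINT x|?N. ?L x ^ (2 * Suc k)) = (LINT x|?N. (\<Sum>j\<in>I. a j * (x j * ?L x ^ (2 * k + 1))))"
    by (simp add: sum_distrib_right mult_ac)
  also have "\<dots> = (\<Sum>j\<in>I. a j * (LINT x|?N. x j * ?L x ^ (2 * k + 1)))"
    by (subst Bochner_Integration.integral_sum)
      (auto intro!: all_moments_integrable all_moments_intros fm L all_moments_coordinate)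
  also have "\<dots> = (\<Sum>j\<in>I. (a j)\<^sup>2 * ((2 * real k + 1) * (LINT x|?N. ?L x ^ (2 * k))))"
    by (intro sum.cong refl, simp only: stein) (simp add: power2_eq_square)
  also have "\<dots> = normal_moment (Suc k) * (\<Sum>i\<in>I. (a i)\<^sup>2) ^ Suc k"
    unfolding Suc.IH by (simp add: sum_distrib_right[symmetric] normal_moment_Suc)
  finally show ?case .
qed


text \<open>The quadratic form of \<open>S\<close> minus its trace, hence centred under the standard
  normal law: an element of the second Wiener chaos.\<close>

definition quad_chaos :: "'i set \<Rightarrow> ('i \<Rightarrow> 'i \<Rightarrow> real) \<Rightarrow> ('i \<Rightarrow> real) \<Rightarrow> real" where
  "quad_chaos I S x = (\<Sum>j\<in>I. x j * (\<Sum>i\<in>I. S j i * x i)) - (\<Sum>j\<in>I. S j j)"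

text \<open>Symmetry merges the row and the column through \<open>j\<close>, which gives the factor
  2. The outcome is a quadratic polynomial in \<open>t\<close>, as \<open>stein_coordinate\<close>
  requires.\<close>

lemma quad_chaos_fun_upd:
  assumes I: "finite I" "j \<in> I" and S: "\<And>i k. i \<in> I \<Longrightarrow> k \<in> I \<Longrightarrow> S i k = S k i"
  shows "quad_chaos I S (x(j := t))
    = ((\<Sum>k\<in>I-{j}. x k * (\<Sum>i\<in>I-{j}. S k i * x i)) - (\<Sum>k\<in>I. S k k))
      + 2 * (\<Sum>i\<in>I-{j}. S j i * x i) * t + S j j * t\<^sup>2"
proof -
  have "(\<Sum>k\<in>I. (x(j := t)) k * (\<Sum>i\<in>I. S k i * (x(j := t)) i))
      = t * ((\<Sum>i\<in>I-{j}. S j i * x i) + S j j * t)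
        + (\<Sum>k\<in>I-{j}. x k * ((\<Sum>i\<in>I-{j}. S k i * x i) + S k j * t))"
    unfolding sum_fun_upd[OF I] using I by (simp add: sum.remove[of I j])
  also have "(\<Sum>k\<in>I-{j}. x k * ((\<Sum>i\<in>I-{j}. S k i * x i) + S k j * t))
      = (\<Sum>k\<in>I-{j}. x k * (\<Sum>i\<in>I-{j}. S k i * x i)) + t * (\<Sum>i\<in>I-{j}. S j i * x i)"
    using S[OF _ I(2)] by (simp add: distrib_left sum.distrib sum_distrib_left mult_ac)
  finally show ?thesis
    by (simp add: quad_chaos_def algebra_simps power2_eq_square)
qed

lemma all_moments_quad_chaos: "all_moments (std_normal_vec I) (quad_chaos I S)"
  unfolding quad_chaos_def[abs_def]
  by (intro all_moments_intros finite_measure_std_normal_vec all_moments_coordinate)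

lemma all_moments_linear_form: "all_moments (std_normal_vec I) (\<lambda>x. \<Sum>i\<in>I. a i * x i)"
  by (intro all_moments_intros finite_measure_std_normal_vec all_moments_coordinate)

text \<open>Write T for the chaos and u = S x. Stein's identity is applied to x_j against u_j T^m.
  Differentiating u_j produces S_jj T^m, whose sum cancels the trace subtracted in T;
  differentiating T^m produces 2 m T^(m-1) u_j^2, since the partial derivative of T is 2
  u_j.\<close>

lemma quad_chaos_recursion:
  assumes I: "finite I" and S: "\<And>i k. i \<in> I \<Longrightarrow> k \<in> I \<Longrightarrow> S i k = S k i"
  shows "(LINT x|std_normal_vec I. quad_chaos I S x ^ Suc m)
    = 2 * real m * (LINT x|std_normal_vec I. quad_chaos I S x ^ (m - 1) * (\<Sum>j\<in>I. (\<Sum>i\<in>I. S j i * x i)\<^sup>2))"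
proof -
  let ?N = "std_normal_vec I"
  let ?T = "quad_chaos I S" and ?u = "\<lambda>j x. \<Sum>i\<in>I. S j i * x i"
  note fm = finite_measure_std_normal_vec[of I]
  note T = all_moments_quad_chaos[of I S]
  note u = all_moments_linear_form[of I "S _"]
  have stein: "(LINT x|?N. x j * (?u j x * ?T x ^ m))
      = (LINT x|?N. S j j * ?T x ^ m + 2 * real m * (?T x ^ (m - 1) * (?u j x)\<^sup>2))" if j: "j \<in> I" for j
  proof -
    define B where "B x = (\<Sum>i\<in>I-{j}. S j i * x i)" for x
    define A where "A x = (\<Sum>k\<in>I-{j}. x k * (\<Sum>i\<in>I-{j}. S k i * x i)) - (\<Sum>k\<in>I. S k k)" for x
    have uj: "?u j (x(j := t)) = B x + S j j * t" for x t
      unfolding B_def by (rule sum_fun_upd[OF I j])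
    have Tj: "?T (x(j := t)) = A x + 2 * B x * t + S j j * t\<^sup>2" for x t
      unfolding A_def B_def by (rule quad_chaos_fun_upd[OF I j S])
    show ?thesis
    \<comment> \<open>In the coordinate \<open>j\<close> the form \<open>u j\<close> is linear and
      \<open>T\<close> is quadratic; \<open>A x\<close> and \<open>B x\<close> do not involve that
      coordinate.\<close>
    proof (rule stein_coordinate[where p = "\<lambda>x. [:B x, S j j:] * [:A x, 2 * B x, S j j:] ^ m", OF I j])
      show "all_moments ?N (\<lambda>x. ?u j x * ?T x ^ m)"
        by (intro all_moments_intros u T)
      show "all_moments ?N (\<lambda>x. S j j * ?T x ^ m + 2 * real m * (?T x ^ (m - 1) * (?u j x)\<^sup>2))"
        by (intro all_moments_intros u T fm)
      fix x t
      show "?u j (x(j := t)) * ?T (x(j := t)) ^ m = poly ([:B x, S j j:] * [:A x, 2 * B x, S j j:] ^ m) t"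
        unfolding uj Tj by (simp add: algebra_simps power2_eq_square)
      have p: "poly [:A x, 2 * B x, S j j:] t = A x + 2 * B x * t + S j j * t\<^sup>2"
        by (simp add: algebra_simps power2_eq_square)
      show "S j j * ?T (x(j := t)) ^ m + 2 * real m * (?T (x(j := t)) ^ (m - 1) * (?u j (x(j := t)))\<^sup>2)
        = poly (pderiv ([:B x, S j j:] * [:A x, 2 * B x, S j j:] ^ m)) t"
        unfolding uj Tj pderiv_mult pderiv_power poly_add poly_mult poly_smult poly_power p
        by (simp add: pderiv_pCons power2_eq_square algebra_simps)
    qed
  qed
  have "(LINT x|?N. ?T x ^ Suc m) = (LINT x|?N. (\<Sum>j\<in>I. x j * (?u j x * ?T x ^ m)) - (\<Sum>j\<in>I. S j j) * ?T x ^ m)"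
    by (intro Bochner_Integration.integral_cong)
      (simp_all add: quad_chaos_def[of I S] left_diff_distrib sum_distrib_right mult_ac)
  also have "\<dots> = (\<Sum>j\<in>I. (LINT x|?N. x j * (?u j x * ?T x ^ m))) - (\<Sum>j\<in>I. S j j) * (LINT x|?N. ?T x ^ m)"
  proof -
    have "integrable ?N (\<lambda>x. x j * (?u j x * ?T x ^ m))" if "j \<in> I" for j
      using that by (intro all_moments_integrable all_moments_intros fm u T all_moments_coordinate)
    moreover have "integrable ?N (\<lambda>x. ?T x ^ m)"
      by (intro all_moments_integrable all_moments_intros T)
    ultimately show ?thesis
      by (subst Bochner_Integration.integral_diff) simp_all
  qed
  also have "(\<Sum>j\<in>I. (LINT x|?N. x j * (?u j x * ?T x ^ m)))
      = (\<Sum>j\<in>I. S j j * (LINT x|?N. ?T x ^ m) + 2 * real m * (LINT x|?N. ?T x ^ (m - 1) * (?u j x)\<^sup>2))"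
    by (intro sum.cong refl, subst stein, assumption, subst Bochner_Integration.integral_add)
      (auto intro!: all_moments_integrable all_moments_intros fm u T)
  also have "\<dots> = (\<Sum>j\<in>I. S j j) * (LINT x|?N. ?T x ^ m) + 2 * real m * (\<Sum>j\<in>I. LINT x|?N. ?T x ^ (m - 1) * (?u j x)\<^sup>2)"
    by (simp add: sum.distrib sum_distrib_left sum_distrib_right)
  also have "(\<Sum>j\<in>I. LINT x|?N. ?T x ^ (m - 1) * (?u j x)\<^sup>2) = (LINT x|?N. (\<Sum>j\<in>I. ?T x ^ (m - 1) * (?u j x)\<^sup>2))"
    by (rule Bochner_Integration.integral_sum[symmetric])
      (auto intro!: all_moments_integrable all_moments_intros fm u T)
  finally show ?thesis
    by (simp add: sum_distrib_left)
qed

section \<open>Moment bounds for the second chaos\<close>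

lemma convex_on_power_nonneg: "convex_on {0::real..} (\<lambda>x. x ^ n)"
  using convex_power_even[of n] convex_power_odd[of n] by (cases "even n") (auto intro: convex_on_subset)

text \<open>Jensen's inequality for the power \<open>q\<close>, with probability weights
  \<open>v i / sum v I\<close> and values \<open>y i * (sum v I / v i)\<close>. With
  \<open>v i\<close> equal to the mean of \<open>y i\<close>, all the rescaled values have the same
  mean.\<close>

lemma sum_power_weighted:
  fixes y v :: "'i \<Rightarrow> real"
  assumes I: "finite I" and y: "\<And>i. i \<in> I \<Longrightarrow> y i \<ge> 0" and v: "\<And>i. i \<in> I \<Longrightarrow> v i > 0"
    and q: "q > 0"
  shows "(\<Sum>i\<in>I. y i) ^ q \<le> (\<Sum>i\<in>I. v i / sum v I * (y i * (sum v I / v i)) ^ q)"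
proof (cases "I = {}")
  case True
  then show ?thesis using q by (simp add: zero_power)
next
  case False
  have V: "sum v I > 0" using I False v by (simp add: sum_pos)
  have "(\<Sum>i\<in>I. (v i / sum v I) *\<^sub>R (y i * (sum v I / v i))) ^ q
      \<le> (\<Sum>i\<in>I. v i / sum v I * (y i * (sum v I / v i)) ^ q)"
    by (rule convex_on_sum[OF I False convex_on_power_nonneg, where a = "\<lambda>i. v i / sum v I"
          and y = "\<lambda>i. y i * (sum v I / v i)"])
      (use V v y in \<open>auto simp: sum_divide_distrib[symmetric] less_imp_le\<close>)
  moreover have "(\<Sum>i\<in>I. (v i / sum v I) *\<^sub>R (y i * (sum v I / v i))) = sum y I"
    using V v by (intro sum.cong) (auto simp: less_imp_neq[symmetric] order_less_imp_not_eq2)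
  ultimately show ?thesis by simp
qed

text \<open>Jensen with weights equal to the variances of the linear forms leaves the constant of a
  single form; it does not depend on the number of forms, which grows with the grid.\<close>

lemma sum_linear_forms_moment:
  assumes I: "finite I" and q: "q > 0"
  shows "(LINT x|std_normal_vec I. (\<Sum>j\<in>I. (\<Sum>i\<in>I. S j i * x i)\<^sup>2) ^ q)
    \<le> normal_moment q * (\<Sum>j\<in>I. \<Sum>i\<in>I. (S j i)\<^sup>2) ^ q"
proof -
  let ?N = "std_normal_vec I"
  let ?u = "\<lambda>j x. \<Sum>i\<in>I. S j i * x i"
  define v where "v j = (\<Sum>i\<in>I. (S j i)\<^sup>2)" for j
  \<comment> \<open>Jensen's weights must be positive. A form of zero variance has zero coefficients
    and drops out.\<close>
  define J where "J = {j\<in>I. v j > 0}"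
  have fin: "finite J" "J \<subseteq> I" using I by (auto simp: J_def)
  have v0: "v j \<ge> 0" for j by (simp add: v_def sum_nonneg)
  have z: "v j = 0" if "j \<in> I - J" for j using v0[of j] that by (auto simp: J_def)
  then have Sz: "S j i = 0" if "j \<in> I - J" "i \<in> I" for i j
    using that I unfolding v_def by (auto simp: sum_nonneg_eq_0_iff)
  have uz: "?u j x = 0" if "j \<in> I - J" for j x using Sz[OF that] by simp
  note fm = finite_measure_std_normal_vec[of I]
  note u = all_moments_linear_form[of I "S _"]
  have V: "sum v J = (\<Sum>j\<in>I. v j)"
    by (rule sum.mono_neutral_left) (use I fin z in auto)
  have E: "(LINT x|?N. ((?u j x)\<^sup>2) ^ q) = normal_moment q * v j ^ q" for j
    using linear_form_moment[OF I, of "S j" q] by (simp add: v_def power_mult)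
  have "(LINT x|?N. (\<Sum>j\<in>I. (?u j x)\<^sup>2) ^ q) = (LINT x|?N. (\<Sum>j\<in>J. (?u j x)\<^sup>2) ^ q)"
    by (intro Bochner_Integration.integral_cong refl arg_cong[where f = "\<lambda>z. z ^ q"]
        sum.mono_neutral_right) (use I fin uz in auto)
  also have "\<dots> \<le> (LINT x|?N. (\<Sum>j\<in>J. v j / sum v J * ((?u j x)\<^sup>2 * (sum v J / v j)) ^ q))"
  proof (rule integral_mono)
    show "integrable ?N (\<lambda>x. (\<Sum>j\<in>J. (?u j x)\<^sup>2) ^ q)"
      by (intro all_moments_integrable all_moments_intros fm u)
    show "integrable ?N (\<lambda>x. \<Sum>j\<in>J. v j / sum v J * ((?u j x)\<^sup>2 * (sum v J / v j)) ^ q)"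
      by (intro all_moments_integrable all_moments_intros fm u)
    show "(\<Sum>j\<in>J. (?u j x)\<^sup>2) ^ q \<le> (\<Sum>j\<in>J. v j / sum v J * ((?u j x)\<^sup>2 * (sum v J / v j)) ^ q)" for x
      by (rule sum_power_weighted[OF fin(1)]) (auto simp: J_def q)
  qed
  also have "\<dots> = (LINT x|?N. (\<Sum>j\<in>J. (v j / sum v J * (sum v J / v j) ^ q) * ((?u j x)\<^sup>2) ^ q))"
    by (simp only: power_mult_distrib mult_ac)
  also have "\<dots> = (\<Sum>j\<in>J. (v j / sum v J * (sum v J / v j) ^ q) * (LINT x|?N. ((?u j x)\<^sup>2) ^ q))"
  proof -
    have "integrable ?N (\<lambda>x. ((?u j x)\<^sup>2) ^ q)" for j
      by (intro all_moments_integrable all_moments_power u)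
    then show ?thesis by simp
  qed
  also have "\<dots> = (\<Sum>j\<in>J. v j / sum v J * (normal_moment q * sum v J ^ q))"
    unfolding E by (intro sum.cong) (auto simp: J_def power_divide)
  also have "\<dots> = sum v J / sum v J * (normal_moment q * sum v J ^ q)"
    by (simp only: sum_distrib_right[symmetric] sum_divide_distrib[symmetric])
  also have "\<dots> \<le> normal_moment q * sum v J ^ q"
    using normal_moment_pos[of q] sum_nonneg[of J v] v0 by (cases "sum v J = 0") auto
  finally show ?thesis unfolding V by (simp add: v_def)
qed

text \<open>The constant left by \<open>quad_chaos_moment\<close>: 2 from absorbing half of the
  moment, \<open>2 * (2 * real q - 1)\<close> from the recursion, a power of twice that number from
  the splitting inequality, and the moment of the linear forms. At \<open>q = 0\<close> both sides
  are 1.\<close>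

definition chaos_const :: "nat \<Rightarrow> real" where
  "chaos_const q = (if q = 0 then 1 else
     2 * (2 * (2 * real q - 1)) * (4 * (2 * real q - 1)) ^ (q - 1) * normal_moment q)"

text \<open>The recursion at \<open>m = 2 * q - 1\<close> leads to the mean of T^(2q-2) P, where P
  is the squared norm of S x. A Young type inequality splits this into a small multiple of the mean
  of T^(2q), which is absorbed on the left, and a multiple of the mean of P^q.\<close>

lemma quad_chaos_moment:
  assumes I: "finite I" and S: "\<And>i k. i \<in> I \<Longrightarrow> k \<in> I \<Longrightarrow> S i k = S k i"
  shows "(LINT x|std_normal_vec I. quad_chaos I S x ^ (2 * q))
    \<le> chaos_const q * (\<Sum>j\<in>I. \<Sum>i\<in>I. (S j i)\<^sup>2) ^ q"
proof (cases "q = 0")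
  case True
  then show ?thesis by (simp add: chaos_const_def prob_space.prob_space[OF prob_space_std_normal_vec])
next
  case False
  let ?N = "std_normal_vec I"
  let ?T = "quad_chaos I S" and ?P = "\<lambda>x. \<Sum>j\<in>I. (\<Sum>i\<in>I. S j i * x i)\<^sup>2"
  note fm = finite_measure_std_normal_vec[of I]
  note T = all_moments_quad_chaos[of I S]
  have P: "all_moments ?N ?P" by (intro all_moments_intros fm all_moments_linear_form)
  \<comment> \<open>Twice the factor \<open>2 * (2 * real q - 1)\<close> of the recursion, so that
    the term \<open>?E / D\<close> contributes exactly half of \<open>?E\<close>.\<close>
  define D where "D = 4 * (2 * real q - 1)"
  have D: "D > 0" using False by (simp add: D_def)
  \<comment> \<open>Compare \<open>p\<close> with \<open>a / D\<close>.\<close>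
  have young: "a ^ (q - 1) * p \<le> a ^ q / D + D ^ (q - 1) * p ^ q" if "a \<ge> 0" "p \<ge> 0" for a p :: real
  proof (cases "p \<le> a / D")
    case True
    have "a ^ (q - 1) * p \<le> a ^ (q - 1) * (a / D)"
      using True that by (intro mult_left_mono) auto
    also have "\<dots> = a ^ q / D" using False by (cases q) auto
    finally show ?thesis using that D by (smt (verit) mult_nonneg_nonneg zero_le_power)
  next
    case f: False
    then have "a \<le> D * p" using D by (simp add: field_simps)
    then have "a ^ (q - 1) * p \<le> (D * p) ^ (q - 1) * p"
      using that by (intro mult_right_mono power_mono) auto
    also have "\<dots> = D ^ (q - 1) * p ^ q" using False by (cases q) (auto simp: power_mult_distrib)
    finally show ?thesis using that D by (smt (verit) divide_nonneg_pos zero_le_power)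
  qed
  let ?E = "LINT x|?N. ?T x ^ (2 * q)"
  have "?E = 2 * (2 * real q - 1) * (LINT x|?N. ?T x ^ (2 * (q - 1)) * ?P x)"
    using quad_chaos_recursion[OF I S, where m = "2 * q - 1"] False
    by (simp add: right_diff_distrib' of_nat_diff diff_diff_add numeral_2_eq_2)
  also have "(LINT x|?N. ?T x ^ (2 * (q - 1)) * ?P x)
      \<le> (LINT x|?N. ?T x ^ (2 * q) / D + D ^ (q - 1) * ?P x ^ q)"
  proof (rule integral_mono)
    show "integrable ?N (\<lambda>x. ?T x ^ (2 * (q - 1)) * ?P x)"
      by (intro all_moments_integrable all_moments_intros fm T P)
    show "integrable ?N (\<lambda>x. ?T x ^ (2 * q) / D + D ^ (q - 1) * ?P x ^ q)"
      unfolding divide_inverse mult.commute[of _ "inverse D"]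
      by (intro all_moments_integrable all_moments_add all_moments_cmult all_moments_power fm T P)
    show "?T x ^ (2 * (q - 1)) * ?P x \<le> ?T x ^ (2 * q) / D + D ^ (q - 1) * ?P x ^ q" for x
      using young[of "(?T x)\<^sup>2" "?P x"] by (simp add: sum_nonneg power_mult)
  qed
  also have "\<dots> = ?E / D + D ^ (q - 1) * (LINT x|?N. ?P x ^ q)"
    by (subst Bochner_Integration.integral_add)
      (auto intro!: all_moments_integrable_power T P)
  also have "\<dots> \<le> ?E / D + D ^ (q - 1) * (normal_moment q * (\<Sum>j\<in>I. \<Sum>i\<in>I. (S j i)\<^sup>2) ^ q)"
    using D by (intro add_left_mono mult_left_mono sum_linear_forms_moment I) (use False in auto)
  finally have "?E \<le> 2 * (2 * real q - 1) *
      (?E / D + D ^ (q - 1) * (normal_moment q * (\<Sum>j\<in>I. \<Sum>i\<in>I. (S j i)\<^sup>2) ^ q))"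
    using False by simp
  also have "\<dots> = ?E / 2 + 2 * (2 * real q - 1) * D ^ (q - 1) * (normal_moment q * (\<Sum>j\<in>I. \<Sum>i\<in>I. (S j i)\<^sup>2) ^ q)"
    using D by (simp add: D_def field_simps)
  finally have "?E \<le> 2 * (2 * (2 * real q - 1) * D ^ (q - 1) * (normal_moment q * (\<Sum>j\<in>I. \<Sum>i\<in>I. (S j i)\<^sup>2) ^ q))"
    by linarith
  then show ?thesis using False
    by (simp only: chaos_const_def D_def mult.assoc if_False)
qed


subsection \<open>Quadratic forms in jointly normal variables\<close>

lemma (in prob_space) distr_pair_snd':
  assumes "prob_space N"
  shows "distr (N \<Otimes>\<^sub>M M) M snd = M"
proof (intro measure_eqI)
  interpret N: prob_space N by fact
  fix A assume A: "A \<in> sets (distr (N \<Otimes>\<^sub>M M) M snd)"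
  from A have "emeasure (distr (N \<Otimes>\<^sub>M M) M snd) A = emeasure (N \<Otimes>\<^sub>M M) (space N \<times> A)"
    by (auto simp add: emeasure_distr space_pair_measure dest: sets.sets_into_space intro!: arg_cong2[where f=emeasure])
  with A show "emeasure (distr (N \<Otimes>\<^sub>M M) M snd) A = emeasure M A"
    by (simp add: emeasure_pair_measure_Times N.emeasure_space_1)
qed simp

text \<open>Both sides are the mean of \<open>(\<Sum>i\<in>I. x i * V i \<omega>) ^ (2 * k)\<close> for independent standard
  normal \<open>x\<close>, divided by the \<open>2 * k\<close>-th standard normal moment. This transfers the moments to
  independent variables, using the laws of linear combinations of the \<open>V i\<close> only.\<close>

lemma sum_squares_moment_transfer:
  assumes M: "prob_space M" and I: "finite I"
    and normal: "\<And>a. normal_rv M (\<lambda>\<omega>. \<Sum>i\<in>I. a i * V i \<omega>)"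
    and V: "\<And>i. i \<in> I \<Longrightarrow> all_moments M (V i)"
    and mean: "\<And>i. i \<in> I \<Longrightarrow> (LINT \<omega>|M. V i \<omega>) = 0"
  shows "(LINT \<omega>|M. (\<Sum>i\<in>I. (V i \<omega>)\<^sup>2) ^ k)
    = (LINT x|std_normal_vec I. (\<Sum>j\<in>I. x j * (\<Sum>i\<in>I. (LINT \<omega>|M. V j \<omega> * V i \<omega>) * x i)) ^ k)"
proof -
  let ?N = "std_normal_vec I"
  interpret M: prob_space M by fact
  interpret N: prob_space ?N by (rule prob_space_std_normal_vec)
  interpret P: pair_prob_space ?N M ..
  have "all_moments (?N \<Otimes>\<^sub>M M) (\<lambda>z. fst z i * V i (snd z))" if i: "i \<in> I" for i
  proof (rule all_moments_mult)
    show "all_moments (?N \<Otimes>\<^sub>M M) (\<lambda>z. fst z i)"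
      by (rule all_moments_distr[where g = fst and F = "\<lambda>x. x i" and L = "?N"])
        (simp_all add: M.distr_pair_fst all_moments_coordinate i)
    show "all_moments (?N \<Otimes>\<^sub>M M) (\<lambda>z. V i (snd z))"
      by (rule all_moments_distr[where g = snd and F = "V i" and L = M])
        (simp_all add: M.distr_pair_snd' N.prob_space_axioms V i)
  qed
  then have "all_moments (?N \<Otimes>\<^sub>M M) (\<lambda>z. (\<Sum>i\<in>I. fst z i * V i (snd z)) ^ (2 * k))"
    by (intro all_moments_power all_moments_sum P.finite_measure_axioms)
  then have int: "integrable (?N \<Otimes>\<^sub>M M) (\<lambda>(x, \<omega>). (\<Sum>i\<in>I. x i * V i \<omega>) ^ (2 * k))"
    by (simp add: case_prod_unfold all_moments_integrable)
  have "(LINT x|?N. (\<Sum>i\<in>I. x i * V i \<omega>) ^ (2 * k)) = normal_moment k * (\<Sum>i\<in>I. (V i \<omega>)\<^sup>2) ^ k" for \<omega>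
    using linear_form_moment[OF I, of "\<lambda>i. V i \<omega>"] by (simp add: mult.commute)
  moreover
  have "(LINT \<omega>|M. (\<Sum>i\<in>I. x i * V i \<omega>) ^ (2 * k))
      = normal_moment k * (\<Sum>j\<in>I. x j * (\<Sum>i\<in>I. (LINT \<omega>|M. V j \<omega> * V i \<omega>) * x i)) ^ k" for x
  proof -
    have "(LINT \<omega>|M. (\<Sum>i\<in>I. x i * V i \<omega>)) = 0"
      using V mean by (simp add: all_moments_integrable)
    note normal_rv_even_moment[OF M normal this]
    also have "(LINT \<omega>|M. (\<Sum>i\<in>I. x i * V i \<omega>)\<^sup>2) = (LINT \<omega>|M. (\<Sum>j\<in>I. \<Sum>i\<in>I. x j * (x i * (V j \<omega> * V i \<omega>))))"
      by (simp add: power2_eq_square sum_product mult_ac)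
    also have "\<dots> = (\<Sum>j\<in>I. \<Sum>i\<in>I. x j * (x i * (LINT \<omega>|M. V j \<omega> * V i \<omega>)))"
      using V by (simp add: all_moments_integrable all_moments_mult)
    also have "\<dots> = (\<Sum>j\<in>I. x j * (\<Sum>i\<in>I. (LINT \<omega>|M. V j \<omega> * V i \<omega>) * x i))"
      by (simp add: sum_distrib_left mult_ac)
    finally show ?thesis .
  qed
  ultimately show ?thesis
    using P.Fubini_integral[OF int] normal_moment_pos[of k] by simp
qed

text \<open>The transfer lemma equates only raw moments of the sum of squares. Expanding around the
  mean expresses the centred moments through them, and the chaos bound applies with the covariance
  matrix as \<open>S\<close>; neither a square root of that matrix nor a joint density is
  needed.\<close>

theorem gaussian_sum_squares_moment:
  assumes M: "prob_space M" and I: "finite I"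
    and normal: "\<And>a. normal_rv M (\<lambda>\<omega>. \<Sum>i\<in>I. a i * V i \<omega>)"
    and V: "\<And>i. i \<in> I \<Longrightarrow> all_moments M (V i)"
    and mean: "\<And>i. i \<in> I \<Longrightarrow> (LINT \<omega>|M. V i \<omega>) = 0"
  shows "(LINT \<omega>|M. (\<Sum>i\<in>I. (V i \<omega>)\<^sup>2 - (LINT \<omega>'|M. (V i \<omega>')\<^sup>2)) ^ (2 * q))
    \<le> chaos_const q * (\<Sum>j\<in>I. \<Sum>i\<in>I. (LINT \<omega>|M. V j \<omega> * V i \<omega>)\<^sup>2) ^ q"
proof -
  let ?N = "std_normal_vec I"
  interpret M: prob_space M by fact
  define S where "S j i = (LINT \<omega>|M. V j \<omega> * V i \<omega>)" for j i
  define c where "c = - (\<Sum>i\<in>I. S i i)"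
  define Q where "Q \<omega> = (\<Sum>i\<in>I. (V i \<omega>)\<^sup>2)" for \<omega>
  define q' where "q' x = (\<Sum>j\<in>I. x j * (\<Sum>i\<in>I. S j i * x i))" for x
  have Q: "all_moments M Q" unfolding Q_def[abs_def]
    using V by (intro all_moments_intros M.finite_measure_axioms)
  have q': "all_moments ?N q'" unfolding q'_def[abs_def]
    by (intro all_moments_intros finite_measure_std_normal_vec all_moments_coordinate)
  have eq: "(LINT \<omega>|M. Q \<omega> ^ k) = (LINT x|?N. q' x ^ k)" for k
    unfolding Q_def q'_def S_def by (rule sum_squares_moment_transfer[OF M I normal V mean])
  have "(LINT \<omega>|M. (\<Sum>i\<in>I. (V i \<omega>)\<^sup>2 - (LINT \<omega>'|M. (V i \<omega>')\<^sup>2)) ^ (2 * q))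
      = (LINT \<omega>|M. (Q \<omega> + c) ^ (2 * q))"
    by (simp add: Q_def c_def S_def sum_subtractf power2_eq_square)
  also have "\<dots> = (\<Sum>k\<le>2*q. of_nat (2*q choose k) * (LINT \<omega>|M. Q \<omega> ^ k) * c ^ (2 * q - k))"
    unfolding binomial_ring using Q by (simp add: all_moments_integrable_power)
  also have "\<dots> = (LINT x|?N. (q' x + c) ^ (2 * q))"
    unfolding binomial_ring eq using q' by (simp add: all_moments_integrable_power)
  also have "\<dots> = (LINT x|?N. quad_chaos I S x ^ (2 * q))"
    by (simp add: q'_def c_def quad_chaos_def)
  also have "\<dots> \<le> chaos_const q * (\<Sum>j\<in>I. \<Sum>i\<in>I. (S j i)\<^sup>2) ^ q"
    by (rule quad_chaos_moment[OF I]) (simp add: S_def mult.commute)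
  finally show ?thesis by (simp add: S_def)
qed

subsection \<open>Derivatives of the covariance function\<close>

text \<open>Both \<open>g + u\<close> and \<open>u - g\<close> are nondecreasing for an
  antiderivative \<open>u\<close> of the bound. As \<open>p < 0\<close>, the integral from
  \<open>t\<close> to \<open>r\<close> is governed by its lower end, and the value at
  \<open>r\<close> is absorbed because \<open>r powr p \<le> t powr p\<close>.\<close>

lemma integrate_power_bound:
  fixes g g' :: "real \<Rightarrow> real"
  assumes g: "\<And>t. t > 0 \<Longrightarrow> (g has_real_derivative g' t) (at t)"
    and c: "\<And>t. 0 < t \<Longrightarrow> t \<le> r \<Longrightarrow> \<bar>g' t\<bar> \<le> c * t powr (p - 1)"
    and p: "p < 0" and r: "r > 0"
  shows "\<exists>C. \<forall>t. 0 < t \<and> t \<le> r \<longrightarrow> \<bar>g t\<bar> \<le> C * t powr p"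
proof (intro exI allI impI)
  fix t assume t: "0 < t \<and> t \<le> r"
  define u where "u s = (c / p) * s powr p" for s
  have u: "(u has_real_derivative c * s powr (p - 1)) (at s)" if "s > 0" for s
    unfolding u_def using that p by (auto intro!: derivative_eq_intros simp: powr_diff)
  have 1: "g t + u t \<le> g r + u r"
  proof (rule DERIV_nonneg_imp_nondecreasing[where f = "\<lambda>s. g s + u s"])
    show "\<exists>y. ((\<lambda>s. g s + u s) has_real_derivative y) (at s) \<and> 0 \<le> y" if "t \<le> s" "s \<le> r" for s
      using that t c[of s] by (intro exI[of _ "g' s + c * s powr (p - 1)"] conjI DERIV_add g u) auto
  qed (use t in auto)
  have 2: "u t - g t \<le> u r - g r"
  proof (rule DERIV_nonneg_imp_nondecreasing[where f = "\<lambda>s. u s - g s"])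
    show "\<exists>y. ((\<lambda>s. u s - g s) has_real_derivative y) (at s) \<and> 0 \<le> y" if "t \<le> s" "s \<le> r" for s
      using that t c[of s] by (intro exI[of _ "c * s powr (p - 1) - g' s"] conjI DERIV_diff g u) auto
  qed (use t in auto)
  \<comment> \<open>The sign of \<open>c\<close> is not assumed; it follows from the bound at
    \<open>t = r\<close>.\<close>
  have "c * r powr (p - 1) \<ge> 0" using c[of r] r by (smt (verit))
  then have c0: "c \<ge> 0" using r by (simp add: zero_le_mult_iff not_le)
  then have ur: "u r \<le> 0" using p by (simp add: u_def divide_nonneg_neg mult_nonpos_nonneg)
  have "\<bar>g t\<bar> \<le> \<bar>g r\<bar> + (- u t)" using 1 2 ur by linarith
  also have "\<bar>g r\<bar> \<le> \<bar>g r\<bar> * r powr (-p) * t powr p"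
  proof -
    have "r powr p \<le> t powr p" using p t by (intro powr_mono2') auto
    then have "r powr (-p) * r powr p \<le> r powr (-p) * t powr p" by (intro mult_left_mono) auto
    then have "1 \<le> r powr (-p) * t powr p" using r by (simp add: powr_add[symmetric])
    then have "\<bar>g r\<bar> * 1 \<le> \<bar>g r\<bar> * (r powr (-p) * t powr p)" by (intro mult_left_mono) auto
    then show ?thesis by simp
  qed
  finally show "\<bar>g t\<bar> \<le> (\<bar>g r\<bar> * r powr (-p) + (- (c / p))) * t powr p"
    by (simp add: u_def algebra_simps)
qed

text \<open>On \<open>{r..D}\<close> the quotient of \<open>g\<close> by the power is continuous on
  a compact set, hence bounded.\<close>

lemma extend_power_bound:
  fixes g :: "real \<Rightarrow> real"
  assumes g: "continuous_on {0<..} g"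
    and b: "\<exists>C. \<forall>t. 0 < t \<and> t \<le> r \<longrightarrow> \<bar>g t\<bar> \<le> C * t powr p" and r: "r > 0"
  shows "\<exists>C. \<forall>t. 0 < t \<and> t \<le> D \<longrightarrow> \<bar>g t\<bar> \<le> C * t powr p"
proof -
  obtain C1 where C1: "\<And>t. 0 < t \<Longrightarrow> t \<le> r \<Longrightarrow> \<bar>g t\<bar> \<le> C1 * t powr p" using b by blast
  have "compact ((\<lambda>t. g t / t powr p) ` {r..D})"
    using r by (intro compact_continuous_image continuous_intros continuous_on_subset[OF g]) auto
  then obtain C2 where "\<forall>y\<in>(\<lambda>t. g t / t powr p) ` {r..D}. norm y \<le> C2"
    using compact_imp_bounded bounded_iff by metis
  then have C2: "\<And>t. t \<in> {r..D} \<Longrightarrow> \<bar>g t / t powr p\<bar> \<le> C2" by auto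
  have "\<bar>g t\<bar> \<le> max C1 C2 * t powr p" if t: "0 < t" "t \<le> D" for t
  proof (cases "t \<le> r")
    case True
    then have "\<bar>g t\<bar> \<le> C1 * t powr p" using C1 t by simp
    also have "\<dots> \<le> max C1 C2 * t powr p" by (intro mult_right_mono) auto
    finally show ?thesis .
  next
    case False
    then have "\<bar>g t\<bar> / t powr p \<le> C2" using C2[of t] t by (simp add: abs_divide)
    then have "\<bar>g t\<bar> \<le> C2 * t powr p" using t by (simp add: divide_le_eq)
    also have "\<dots> \<le> max C1 C2 * t powr p" by (intro mult_right_mono) auto
    finally show ?thesis .
  qed
  then show ?thesis by blast
qed

text \<open>Integration from the fourth derivative gives the third and the second, as \<alpha> - 3
  and \<alpha> - 2 are negative. It stops there, since \<alpha> - 1 may be positive; the first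
  derivative is instead interpolated between \<open>R\<close> and its second derivative.\<close>

lemma covariance_derivative_bounds:
  fixes R :: "real \<Rightarrow> real"
  assumes \<alpha>: "0 < \<alpha>" "\<alpha> < 2"
    and small: "\<exists>r>0. \<forall>t. 0 < t \<and> t \<le> r \<longrightarrow> \<bar>R t - R 0\<bar> \<le> 2 * t powr \<alpha>"
    and diff: "\<And>j t. j < 4 \<Longrightarrow> t > 0 \<Longrightarrow> (deriv ^^ j) R field_differentiable (at t)"
    and R4: "\<exists>c>0. \<forall>\<^sub>F t in at_right 0. \<bar>(deriv ^^ 4) R t\<bar> \<le> c * t powr (\<alpha> - 4)"
  shows "\<exists>C. \<forall>t. 0 < t \<and> t \<le> D \<longrightarrow> \<bar>(deriv ^^ 1) R t\<bar> \<le> C * t powr (\<alpha> - 1)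
      \<and> \<bar>(deriv ^^ 2) R t\<bar> \<le> C * t powr (\<alpha> - 2) \<and> \<bar>(deriv ^^ 3) R t\<bar> \<le> C * t powr (\<alpha> - 3)"
proof -
  let ?R = "\<lambda>j. (deriv ^^ j) R"
  have der: "(?R j has_real_derivative ?R (Suc j) t) (at t)" if "j < 4" "t > 0" for j t
    using diff[OF that] by (simp add: field_differentiable_derivI)
  have cont: "continuous_on {0<..} (?R j)" if "j < 4" for j
    by (rule continuous_at_imp_continuous_on) (use der[OF that] in \<open>auto intro: DERIV_isCont\<close>)
  obtain c where c: "\<forall>\<^sub>F t in at_right 0. \<bar>?R 4 t\<bar> \<le> c * t powr (\<alpha> - 4)" using R4 by blast
  then obtain e where e: "e > 0" "\<And>t. 0 < t \<Longrightarrow> t < e \<Longrightarrow> \<bar>?R 4 t\<bar> \<le> c * t powr (\<alpha> - 4)"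
    unfolding eventually_at_right_field by blast
  define r where "r = e / 2"
  have r: "r > 0" using e by (simp add: r_def)
  have b3: "\<exists>C. \<forall>t. 0 < t \<and> t \<le> r \<longrightarrow> \<bar>?R 3 t\<bar> \<le> C * t powr (\<alpha> - 3)"
  proof (rule integrate_power_bound[where g' = "?R 4"])
    show "(?R 3 has_real_derivative ?R 4 t) (at t)" if "t > 0" for t
      using der[of 3 t] that by (simp add: numeral_eq_Suc)
    show "\<bar>?R 4 t\<bar> \<le> c * t powr (\<alpha> - 3 - 1)" if "0 < t" "t \<le> r" for t
      using e(2)[of t] that e(1) by (simp add: r_def)
  qed (use \<alpha> r in auto)
  then obtain c3 where c3: "\<And>t. 0 < t \<Longrightarrow> t \<le> r \<Longrightarrow> \<bar>?R 3 t\<bar> \<le> c3 * t powr (\<alpha> - 3)" by blast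
  have b2: "\<exists>C. \<forall>t. 0 < t \<and> t \<le> r \<longrightarrow> \<bar>?R 2 t\<bar> \<le> C * t powr (\<alpha> - 2)"
  proof (rule integrate_power_bound[where g' = "?R 3"])
    show "(?R 2 has_real_derivative ?R 3 t) (at t)" if "t > 0" for t
      using der[of 2 t] that by (simp add: numeral_eq_Suc)
    show "\<bar>?R 3 t\<bar> \<le> c3 * t powr (\<alpha> - 2 - 1)" if "0 < t" "t \<le> r" for t
      using c3[of t] that by simp
  qed (use \<alpha> r in auto)
  then obtain c2 where c2: "\<And>t. 0 < t \<Longrightarrow> t \<le> r \<Longrightarrow> \<bar>?R 2 t\<bar> \<le> c2 * t powr (\<alpha> - 2)" by blast
  obtain r' where r': "r' > 0" "\<And>t. 0 < t \<Longrightarrow> t \<le> r' \<Longrightarrow> \<bar>R t - R 0\<bar> \<le> 2 * t powr \<alpha>"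
    using small by blast
  \<comment> \<open>Halved, so that \<open>2 * t\<close> lies in both ranges when
    \<open>t \<le> s\<close>.\<close>
  define s where "s = min r r' / 2"
  have s: "s > 0" "2 * s \<le> r" "2 * s \<le> r'" using r r' by (auto simp: s_def)
  have b1: "\<exists>C. \<forall>t. 0 < t \<and> t \<le> s \<longrightarrow> \<bar>?R 1 t\<bar> \<le> C * t powr (\<alpha> - 1)"
  proof (intro exI allI impI)
    fix t assume t: "0 < t \<and> t \<le> s"
    have d0: "(R has_real_derivative ?R 1 x) (at x)" if "x > 0" for x
      using der[of 0 x] that by simp
    have d1: "(?R 1 has_real_derivative ?R 2 x) (at x)" if "x > 0" for x
      using der[of 1 x] that by (simp add: numeral_eq_Suc)
    \<comment> \<open>Interpolation: the increment of \<open>R\<close> over \<open>[t, 2 t]\<close>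
      controls the first derivative at some \<xi>, and the second derivative carries the bound from
      \<xi> back to \<open>t\<close>.\<close>
    obtain \<xi> where \<xi>: "t < \<xi>" "\<xi> < 2 * t" "R (2 * t) - R t = (2 * t - t) * ?R 1 \<xi>"
      using MVT2[of t "2 * t" R "?R 1"] t d0 by auto
    obtain \<eta> where \<eta>: "t < \<eta>" "\<eta> < \<xi>" "?R 1 \<xi> - ?R 1 t = (\<xi> - t) * ?R 2 \<eta>"
      using MVT2[of t \<xi> "?R 1" "?R 2"] t \<xi>(1) d1 by auto
    have "0 \<le> c2 * \<eta> powr (\<alpha> - 2)" using c2[of \<eta>] \<eta> \<xi> t s by (smt (verit))
    then have c20: "c2 \<ge> 0" using \<eta> t by (simp add: zero_le_mult_iff not_le)
    have "\<bar>?R 2 \<eta>\<bar> \<le> c2 * \<eta> powr (\<alpha> - 2)" using c2[of \<eta>] \<eta> \<xi> t s by auto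
    also have "\<dots> \<le> c2 * t powr (\<alpha> - 2)"
      using c20 \<alpha> t \<eta> by (intro mult_left_mono powr_mono2') auto
    finally have "(\<xi> - t) * \<bar>?R 2 \<eta>\<bar> \<le> t * (c2 * t powr (\<alpha> - 2))"
      using \<xi> t by (intro mult_mono) auto
    moreover have "t powr (\<alpha> - 1) = t powr (\<alpha> - 2) * t"
      using powr_add[of t "\<alpha> - 2" 1] t by simp
    moreover have "\<bar>?R 1 \<xi> - ?R 1 t\<bar> = (\<xi> - t) * \<bar>?R 2 \<eta>\<bar>"
      unfolding \<eta>(3) abs_mult using \<xi> by simp
    ultimately have A: "\<bar>?R 1 \<xi> - ?R 1 t\<bar> \<le> c2 * t powr (\<alpha> - 1)"
      by (simp only: mult_ac)
    have "\<bar>R (2 * t) - R t\<bar> \<le> 2 * (2 * t) powr \<alpha> + 2 * t powr \<alpha>"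
      using r'(2)[of t] r'(2)[of "2 * t"] t s by linarith
    also have "\<dots> \<le> 10 * t powr \<alpha>"
    proof -
      \<comment> \<open>The constant 10 is 2 * 4 + 2.\<close>
      have "(2::real) powr \<alpha> \<le> 2 powr 2" using \<alpha> by (intro powr_mono) auto
      then have "2 powr \<alpha> * t powr \<alpha> \<le> 4 * t powr \<alpha>" by (intro mult_right_mono) auto
      then show ?thesis using t by (simp add: powr_mult)
    qed
    finally have "t * \<bar>?R 1 \<xi>\<bar> \<le> 10 * t powr \<alpha>" using \<xi>(3) t by (simp add: abs_mult)
    then have "\<bar>?R 1 \<xi>\<bar> \<le> 10 * t powr (\<alpha> - 1)"
      using t by (simp add: powr_diff field_simps)
    with A show "\<bar>?R 1 t\<bar> \<le> (10 + c2) * t powr (\<alpha> - 1)" by (simp add: algebra_simps)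
  qed
  obtain C1 where C1: "\<forall>t. 0 < t \<and> t \<le> D \<longrightarrow> \<bar>?R 1 t\<bar> \<le> C1 * t powr (\<alpha> - 1)"
    using extend_power_bound[OF cont b1 s(1), of D] by auto
  obtain C2 where C2: "\<forall>t. 0 < t \<and> t \<le> D \<longrightarrow> \<bar>?R 2 t\<bar> \<le> C2 * t powr (\<alpha> - 2)"
    using extend_power_bound[OF cont b2 r, of D] by auto
  obtain C3 where C3: "\<forall>t. 0 < t \<and> t \<le> D \<longrightarrow> \<bar>?R 3 t\<bar> \<le> C3 * t powr (\<alpha> - 3)"
    using extend_power_bound[OF cont b3 r, of D] by auto
  show ?thesis
  proof (intro exI[of _ "max C1 (max C2 C3)"] allI impI conjI)
    fix t assume t: "0 < t \<and> t \<le> D"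
    note mono = order_trans[OF _ mult_right_mono[OF _ powr_ge_zero]]
    show "\<bar>?R 1 t\<bar> \<le> max C1 (max C2 C3) * t powr (\<alpha> - 1)"
      by (rule mono[of _ C1]) (use C1 t in auto)
    show "\<bar>?R 2 t\<bar> \<le> max C1 (max C2 C3) * t powr (\<alpha> - 2)"
      by (rule mono[of _ C2]) (use C2 t in auto)
    show "\<bar>?R 3 t\<bar> \<le> max C1 (max C2 C3) * t powr (\<alpha> - 3)"
      by (rule mono[of _ C3]) (use C3 t in auto)
  qed
qed

text \<open>\<open>R\<close> as a function of the squared distance, which is smooth in both points.\<close>

lemma covariance_of_square:
  fixes R :: "real \<Rightarrow> real"
  assumes diff: "\<And>j t. j < 4 \<Longrightarrow> t > 0 \<Longrightarrow> (deriv ^^ j) R field_differentiable (at t)"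
    and b: "\<And>t. 0 < t \<Longrightarrow> t \<le> D \<Longrightarrow> \<bar>(deriv ^^ 1) R t\<bar> \<le> C * t powr (\<alpha> - 1)"
      "\<And>t. 0 < t \<Longrightarrow> t \<le> D \<Longrightarrow> \<bar>(deriv ^^ 2) R t\<bar> \<le> C * t powr (\<alpha> - 2)"
      "\<And>t. 0 < t \<Longrightarrow> t \<le> D \<Longrightarrow> \<bar>(deriv ^^ 3) R t\<bar> \<le> C * t powr (\<alpha> - 3)"
  shows "\<exists>H1 H2 H3.
    (\<forall>q>0. ((\<lambda>q. R (sqrt q)) has_real_derivative H1 q) (at q) \<and>
       (H1 has_real_derivative H2 q) (at q) \<and> (H2 has_real_derivative H3 q) (at q)) \<and>
    (\<forall>t. 0 < t \<and> t \<le> D \<longrightarrow> \<bar>H1 (t\<^sup>2)\<bar> \<le> C * t powr (\<alpha> - 2) \<and> \<bar>H2 (t\<^sup>2)\<bar> \<le> C * t powr (\<alpha> - 4)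
       \<and> \<bar>H3 (t\<^sup>2)\<bar> \<le> C * t powr (\<alpha> - 6))"
proof -
  let ?R = "\<lambda>j. (deriv ^^ j) R"
  have der: "(?R j has_real_derivative ?R (Suc j) t) (at t)" if "j < 4" "t > 0" for j t
    using diff[OF that] by (simp add: field_differentiable_derivI)
  have d0: "(R has_real_derivative ?R 1 t) (at t)" if "t > 0" for t
    using der[of 0 t] that by simp
  have d1: "(?R 1 has_real_derivative ?R 2 t) (at t)" if "t > 0" for t
    using der[of 1 t] that by (simp add: numeral_eq_Suc)
  have d2: "(?R 2 has_real_derivative ?R 3 t) (at t)" if "t > 0" for t
    using der[of 2 t] that by (simp add: numeral_eq_Suc)
  define r1 r2 r3 where "r1 = ?R 1" and "r2 = ?R 2" and "r3 = ?R 3"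
  have dsq: "(sqrt has_real_derivative 1 / (2 * sqrt q)) (at q)" if "q > 0" for q
    using DERIV_real_sqrt[OF that] by (simp add: field_simps)
  note chains = d0[folded r1_def] d1[folded r1_def r2_def] d2[folded r2_def r3_def]
  have e0: "((\<lambda>q. R (sqrt q)) has_real_derivative r1 (sqrt q) * (1 / (2 * sqrt q))) (at q)" if "q > 0" for q
    by (rule DERIV_chain2[OF chains(1) dsq]) (use that in auto)
  have e1: "((\<lambda>q. r1 (sqrt q)) has_real_derivative r2 (sqrt q) * (1 / (2 * sqrt q))) (at q)" if "q > 0" for q
    by (rule DERIV_chain2[OF chains(2) dsq]) (use that in auto)
  have e2: "((\<lambda>q. r2 (sqrt q)) has_real_derivative r3 (sqrt q) * (1 / (2 * sqrt q))) (at q)" if "q > 0" for q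
    by (rule DERIV_chain2[OF chains(3) dsq]) (use that in auto)
  \<comment> \<open>Each differentiation in \<open>q = t\<^sup>2\<close> divides by a multiple of
    \<open>t\<close>, in addition to lowering the order in \<open>t\<close>; this explains the
    exponents \<alpha> - 2, \<alpha> - 4 and \<alpha> - 6.\<close>
  define H1 where "H1 q = r1 (sqrt q) / (2 * sqrt q)" for q
  define H2 where "H2 q = r2 (sqrt q) / (4 * q) - r1 (sqrt q) / (4 * (sqrt q * q))" for q
  define H3 where "H3 q = r3 (sqrt q) / (8 * (sqrt q * q)) - 3 * r2 (sqrt q) / (8 * q\<^sup>2)
    + 3 * r1 (sqrt q) / (8 * (sqrt q * q\<^sup>2))" for q
  have h1: "((\<lambda>q. R (sqrt q)) has_real_derivative H1 q) (at q)" if "q > 0" for q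
    using e0[OF that] by (simp add: H1_def)
  have h2: "(H1 has_real_derivative H2 q) (at q)" if "q > 0" for q
  proof -
    define s where "s = sqrt q"
    have s: "s > 0" "q = s * s" using that by (auto simp: s_def)
    show ?thesis
      unfolding H1_def[abs_def]
      by (rule DERIV_cong[OF DERIV_divide[OF e1[OF that] DERIV_cmult[OF dsq[OF that]]]])
        (simp_all only: H2_def s_def[symmetric] s(2), use s(1) in \<open>simp_all add: field_simps\<close>)
  qed
  have h3: "(H2 has_real_derivative H3 q) (at q)" if "q > 0" for q
  proof -
    define s where "s = sqrt q"
    have s: "s > 0" "q = s * s" using that by (auto simp: s_def)
    show ?thesis
      unfolding H2_def[abs_def]
      by (rule DERIV_cong[OF DERIV_diff[OF DERIV_divide[OF e2[OF that] DERIV_cmult[OF DERIV_ident]]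
            DERIV_divide[OF e1[OF that] DERIV_cmult[OF DERIV_mult[OF dsq[OF that] DERIV_ident]]]]])
        (simp_all only: H3_def s_def[symmetric] s(2), use s(1) in \<open>simp_all add: field_simps power2_eq_square\<close>)
  qed
  have bound: "\<bar>H1 (t\<^sup>2)\<bar> \<le> C * t powr (\<alpha> - 2) \<and> \<bar>H2 (t\<^sup>2)\<bar> \<le> C * t powr (\<alpha> - 4)
       \<and> \<bar>H3 (t\<^sup>2)\<bar> \<le> C * t powr (\<alpha> - 6)" if t: "0 < t" "t \<le> D" for t
  proof -
    define P where "P = C * t powr \<alpha>"
    have pw: "t powr (\<alpha> - real k) = t powr \<alpha> / t ^ k" for k :: nat
      using t by (simp add: powr_diff powr_realpow)
    have b1: "\<bar>r1 t\<bar> \<le> P / t" using b(1)[OF t] pw[of 1] by (simp add: r1_def P_def)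
    have b2: "\<bar>r2 t\<bar> \<le> P / t ^ 2" using b(2)[OF t] pw[of 2] by (simp add: r2_def P_def)
    have b3: "\<bar>r3 t\<bar> \<le> P / t ^ 3" using b(3)[OF t] pw[of 3] by (simp add: r3_def P_def)
    have P0: "P \<ge> 0" using b1 t by (smt (verit) divide_neg_pos)
    have x1: "\<bar>r1 t\<bar> * t \<le> P" and x2: "\<bar>r2 t\<bar> * t ^ 2 \<le> P" and x3: "\<bar>r3 t\<bar> * t ^ 3 \<le> P"
      using b1 b2 b3 t by (simp_all add: field_simps)
    have st: "sqrt (t\<^sup>2) = t" using t by simp
    have "H1 (t\<^sup>2) = (r1 t * t) / 2 / t ^ 2"
      unfolding H1_def st using t by (simp add: field_simps power2_eq_square)
    then have "\<bar>H1 (t\<^sup>2)\<bar> = (\<bar>r1 t\<bar> * t) / 2 / t ^ 2" using t by (simp add: abs_mult)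
    also have "\<dots> \<le> P / t ^ 2" using x1 P0 t by (intro divide_right_mono) auto
    finally have 1: "\<bar>H1 (t\<^sup>2)\<bar> \<le> P / t ^ 2" .
    have "H2 (t\<^sup>2) = (r2 t * t ^ 2 - r1 t * t) / 4 / t ^ 4"
      unfolding H2_def st using t by (simp add: field_simps eval_nat_numeral)
    then have "\<bar>H2 (t\<^sup>2)\<bar> = \<bar>r2 t * t ^ 2 - r1 t * t\<bar> / 4 / t ^ 4" using t by simp
    also have "\<bar>r2 t * t ^ 2 - r1 t * t\<bar> \<le> P + P"
      using x1 x2 t by (intro order_trans[OF abs_triangle_ineq4] add_mono) (auto simp: abs_mult)
    finally have "\<bar>H2 (t\<^sup>2)\<bar> \<le> (P + P) / 4 / t ^ 4" using t by (simp add: divide_right_mono)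
    also have "\<dots> \<le> P / t ^ 4" using P0 t by (intro divide_right_mono) auto
    finally have 2: "\<bar>H2 (t\<^sup>2)\<bar> \<le> P / t ^ 4" .
    have "H3 (t\<^sup>2) = (r3 t * t ^ 3 - 3 * (r2 t * t ^ 2) + 3 * (r1 t * t)) / 8 / t ^ 6"
      unfolding H3_def st using t by (simp add: field_simps eval_nat_numeral)
    then have "\<bar>H3 (t\<^sup>2)\<bar> = \<bar>r3 t * t ^ 3 - 3 * (r2 t * t ^ 2) + 3 * (r1 t * t)\<bar> / 8 / t ^ 6" using t by simp
    also have "\<bar>r3 t * t ^ 3 - 3 * (r2 t * t ^ 2) + 3 * (r1 t * t)\<bar> \<le> P + 3 * P + 3 * P"
    proof -
      have "\<bar>r3 t * t ^ 3\<bar> \<le> P" "\<bar>r2 t * t ^ 2\<bar> \<le> P" "\<bar>r1 t * t\<bar> \<le> P"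
        using x1 x2 x3 t by (simp_all add: abs_mult)
      then show ?thesis by linarith
    qed
    finally have "\<bar>H3 (t\<^sup>2)\<bar> \<le> (P + 3 * P + 3 * P) / 8 / t ^ 6" using t by (simp add: divide_right_mono)
    also have "\<dots> \<le> P / t ^ 6" using P0 t by (intro divide_right_mono) auto
    finally have 3: "\<bar>H3 (t\<^sup>2)\<bar> \<le> P / t ^ 6" .
    show ?thesis using 1 2 3 pw[of 2] pw[of 4] pw[of 6] by (simp add: P_def)
  qed
  show ?thesis
    by (rule exI[of _ H1], rule exI[of _ H2], rule exI[of _ H3]) (use h1 h2 h3 bound in blast)
qed

subsection \<open>Mixed differences\<close>

text \<open>Mean value theorem for the first difference \<open>g (x + \<delta>) - g x\<close>, then
  for \<open>g1\<close> over a step of length \<delta>.\<close>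

lemma second_difference_bound:
  fixes g g1 g2 :: "real \<Rightarrow> real"
  assumes d: "\<delta> \<ge> 0"
    and g: "\<And>x. 0 \<le> x \<Longrightarrow> x \<le> 2 * \<delta> \<Longrightarrow> (g has_real_derivative g1 x) (at x)"
    and g1: "\<And>x. 0 \<le> x \<Longrightarrow> x \<le> 2 * \<delta> \<Longrightarrow> (g1 has_real_derivative g2 x) (at x)"
    and M: "\<And>x. 0 \<le> x \<Longrightarrow> x \<le> 2 * \<delta> \<Longrightarrow> \<bar>g2 x\<bar> \<le> M"
  shows "\<bar>g (2 * \<delta>) - 2 * g \<delta> + g 0\<bar> \<le> \<delta>\<^sup>2 * M"
proof (cases "\<delta> = 0")
  case False
  then have d: "\<delta> > 0" using d by simp
  have D: "((\<lambda>x. g (x + \<delta>) - g x) has_real_derivative g1 (x + \<delta>) - g1 x) (at x)"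
    if "0 \<le> x" "x \<le> \<delta>" for x
    using that d by (intro DERIV_diff g DERIV_shift[THEN iffD1]) auto
  obtain \<xi> where \<xi>: "0 < \<xi>" "\<xi> < \<delta>"
    "(g (\<delta> + \<delta>) - g \<delta>) - (g (0 + \<delta>) - g 0) = (\<delta> - 0) * (g1 (\<xi> + \<delta>) - g1 \<xi>)"
    using MVT2[of 0 \<delta> "\<lambda>x. g (x + \<delta>) - g x" "\<lambda>x. g1 (x + \<delta>) - g1 x"] d D by blast
  obtain \<eta> where \<eta>: "\<xi> < \<eta>" "\<eta> < \<xi> + \<delta>" "g1 (\<xi> + \<delta>) - g1 \<xi> = (\<xi> + \<delta> - \<xi>) * g2 \<eta>"
    using MVT2[of \<xi> "\<xi> + \<delta>" g1 g2] d \<xi> g1 by auto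
  have "g (2 * \<delta>) - 2 * g \<delta> + g 0 = \<delta>\<^sup>2 * g2 \<eta>"
    using \<xi>(3) \<eta>(3) by (simp add: power2_eq_square mult_2 algebra_simps)
  moreover have "\<bar>g2 \<eta>\<bar> \<le> M" using M[of \<eta>] \<eta> \<xi> d by auto
  ultimately show ?thesis by (simp add: abs_mult mult_left_mono)
qed simp

text \<open>Two derivatives are taken along the first curve and one along the second, so that bounds
  on \<open>F2\<close> and \<open>E1\<close> suffice. In the mixed third derivative of H(q) the
  derivatives of order one of q are O(r). The leading term is H3 times three of them, of order
  r^(\<alpha>-6) r^3; the two terms with H2 have the same order r^(\<alpha>-3), and the term with H1
  is smaller by the factor r <= D.\<close>

lemma mixed_difference_bound:
  fixes F F1 F2 E E1 :: "real \<Rightarrow> complex"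
  assumes H: "\<And>q. q > 0 \<Longrightarrow> (H has_real_derivative H1 q) (at q)"
      "\<And>q. q > 0 \<Longrightarrow> (H1 has_real_derivative H2 q) (at q)"
      "\<And>q. q > 0 \<Longrightarrow> (H2 has_real_derivative H3 q) (at q)"
    and Hb: "\<And>t. 0 < t \<Longrightarrow> t \<le> D \<Longrightarrow> \<bar>H1 (t\<^sup>2)\<bar> \<le> C * t powr (\<alpha> - 2)"
      "\<And>t. 0 < t \<Longrightarrow> t \<le> D \<Longrightarrow> \<bar>H2 (t\<^sup>2)\<bar> \<le> C * t powr (\<alpha> - 4)"
      "\<And>t. 0 < t \<Longrightarrow> t \<le> D \<Longrightarrow> \<bar>H3 (t\<^sup>2)\<bar> \<le> C * t powr (\<alpha> - 6)"
    and \<alpha>: "\<alpha> < 2" and C: "C \<ge> 0" and L: "L \<ge> 1" and r: "0 < r" "r \<le> D" and \<delta>: "\<delta> > 0"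
    and F: "\<And>x. 0 \<le> x \<Longrightarrow> x \<le> 2 * \<delta> \<Longrightarrow> (F has_vector_derivative F1 x) (at x)"
      "\<And>x. 0 \<le> x \<Longrightarrow> x \<le> 2 * \<delta> \<Longrightarrow> (F1 has_vector_derivative F2 x) (at x)"
      "\<And>x. 0 \<le> x \<Longrightarrow> x \<le> 2 * \<delta> \<Longrightarrow> norm (F1 x) \<le> L" "\<And>x. 0 \<le> x \<Longrightarrow> x \<le> 2 * \<delta> \<Longrightarrow> norm (F2 x) \<le> L"
    and E: "\<And>y. 0 \<le> y \<Longrightarrow> y \<le> 2 * \<delta> \<Longrightarrow> (E has_vector_derivative E1 y) (at y)"
      "\<And>y. 0 \<le> y \<Longrightarrow> y \<le> 2 * \<delta> \<Longrightarrow> norm (E1 y) \<le> L"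
    and sep: "\<And>x y. 0 \<le> x \<Longrightarrow> x \<le> 2 * \<delta> \<Longrightarrow> 0 \<le> y \<Longrightarrow> y \<le> 2 * \<delta> \<Longrightarrow>
        r \<le> norm (F x - E y) \<and> norm (F x - E y) \<le> L * r \<and> norm (F x - E y) \<le> D"
    and y: "0 \<le> y0" "y0 < y1" "y1 \<le> 2 * \<delta>"
  defines "\<phi> \<equiv> \<lambda>x y. H ((norm (F x - E y))\<^sup>2)"
  shows "\<bar>(\<phi> (2 * \<delta>) y1 - \<phi> (2 * \<delta>) y0) - 2 * (\<phi> \<delta> y1 - \<phi> \<delta> y0) + (\<phi> 0 y1 - \<phi> 0 y0)\<bar>
    \<le> \<delta>\<^sup>2 * ((y1 - y0) * (32 * (1 + D) * L ^ 6 * C * r powr (\<alpha> - 3)))"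
proof -
  define q where "q x y = (norm (F x - E y))\<^sup>2" for x y
  define qx where "qx x y = 2 * (F1 x \<bullet> (F x - E y))" for x y
  define qy where "qy x y = - 2 * (E1 y \<bullet> (F x - E y))" for x y
  define qxx where "qxx x y = 2 * (F2 x \<bullet> (F x - E y)) + 2 * (F1 x \<bullet> F1 x)" for x y
  define qxy where "qxy x y = - 2 * (F1 x \<bullet> E1 y)" for x y
  define qxxy where "qxxy x y = - 2 * (F2 x \<bullet> E1 y)" for x y
  have qi: "q x y = (F x - E y) \<bullet> (F x - E y)" for x y by (simp add: q_def power2_norm_eq_inner)
  have D: "D > 0" using r by simp
  let ?I = "\<lambda>x. 0 \<le> x \<and> x \<le> 2 * \<delta>"
  have q0: "q x y > 0" if "?I x" "?I y" for x y
    using sep[of x y] that r by (auto simp: q_def)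
  have dqx: "((\<lambda>x. q x y) has_real_derivative qx x y) (at x)" if "?I x" for x y
  proof -
    have "(F has_derivative (\<lambda>h. h *\<^sub>R F1 x)) (at x)" using F(1)[of x] that by (simp add: has_vector_derivative_def)
    from has_derivative_inner[OF has_derivative_diff[OF this has_derivative_const[of "E y"]]
        has_derivative_diff[OF this has_derivative_const[of "E y"]]]
    show ?thesis unfolding qi has_field_derivative_def
      by (rule has_derivative_eq_rhs) (auto simp: qx_def inner_commute algebra_simps)
  qed
  have dqy: "((\<lambda>y. q x y) has_real_derivative qy x y) (at y)" if "?I y" for x y
  proof -
    have "(E has_derivative (\<lambda>h. h *\<^sub>R E1 y)) (at y)" using E(1)[of y] that by (simp add: has_vector_derivative_def)
    from has_derivative_inner[OF has_derivative_diff[OF has_derivative_const[of "F x"] this]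
        has_derivative_diff[OF has_derivative_const[of "F x"] this]]
    show ?thesis unfolding qi has_field_derivative_def
      by (rule has_derivative_eq_rhs) (auto simp: qy_def inner_commute algebra_simps)
  qed
  have dqxx: "((\<lambda>x. qx x y) has_real_derivative qxx x y) (at x)" if "?I x" for x y
  proof -
    have "(F has_derivative (\<lambda>h. h *\<^sub>R F1 x)) (at x)" "(F1 has_derivative (\<lambda>h. h *\<^sub>R F2 x)) (at x)"
      using F(1,2)[of x] that by (simp_all add: has_vector_derivative_def)
    from has_derivative_mult_right[OF has_derivative_inner[OF this(2) has_derivative_diff[OF this(1) has_derivative_const[of "E y"]]], of 2]
    show ?thesis unfolding qx_def has_field_derivative_def
      by (rule has_derivative_eq_rhs) (auto simp: qxx_def inner_commute algebra_simps)
  qed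
  have dqxy: "((\<lambda>y. qx x y) has_real_derivative qxy x y) (at y)" if "?I y" for x y
  proof -
    have "(E has_derivative (\<lambda>h. h *\<^sub>R E1 y)) (at y)" using E(1)[of y] that by (simp add: has_vector_derivative_def)
    from has_derivative_mult_right[OF has_derivative_inner[OF has_derivative_const[of "F1 x"] has_derivative_diff[OF has_derivative_const[of "F x"] this]], of 2]
    show ?thesis unfolding qx_def has_field_derivative_def
      by (rule has_derivative_eq_rhs) (auto simp: qxy_def inner_commute algebra_simps)
  qed
  have dqxxy: "((\<lambda>y. qxx x y) has_real_derivative qxxy x y) (at y)" if "?I y" for x y
  proof -
    have "(E has_derivative (\<lambda>h. h *\<^sub>R E1 y)) (at y)" using E(1)[of y] that by (simp add: has_vector_derivative_def)
    from has_derivative_add[OF has_derivative_mult_right[OF has_derivative_inner[OF has_derivative_const[of "F2 x"] has_derivative_diff[OF has_derivative_const[of "F x"] this]], of 2] has_derivative_const]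
    show ?thesis unfolding qxx_def has_field_derivative_def
      by (rule has_derivative_eq_rhs) (auto simp: qxxy_def inner_commute algebra_simps)
  qed
  define \<phi>x where "\<phi>x x y = H1 (q x y) * qx x y" for x y
  define \<phi>xx where "\<phi>xx x y = H2 (q x y) * qx x y * qx x y + H1 (q x y) * qxx x y" for x y
  define \<phi>xxy where "\<phi>xxy x y = H3 (q x y) * qy x y * qx x y * qx x y + 2 * H2 (q x y) * qx x y * qxy x y
    + H2 (q x y) * qy x y * qxx x y + H1 (q x y) * qxxy x y" for x y
  have dphix: "((\<lambda>x. \<phi> x y) has_real_derivative \<phi>x x y) (at x)" if "?I x" "?I y" for x y
    unfolding \<phi>_def \<phi>x_def q_def[symmetric]
    by (rule DERIV_chain2[OF H(1)[OF q0[OF that]] dqx[OF that(1)]])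
  have dphixx: "((\<lambda>x. \<phi>x x y) has_real_derivative \<phi>xx x y) (at x)" if "?I x" "?I y" for x y
    unfolding \<phi>x_def
    by (rule DERIV_cong[OF DERIV_mult[OF DERIV_chain2[OF H(2)[OF q0[OF that]] dqx[OF that(1)]] dqxx[OF that(1)]]])
      (simp add: \<phi>xx_def algebra_simps)
  have dphixxy: "((\<lambda>y. \<phi>xx x y) has_real_derivative \<phi>xxy x y) (at y)" if "?I x" "?I y" for x y
    unfolding \<phi>xx_def
    by (rule DERIV_cong[OF DERIV_add[OF
          DERIV_mult[OF DERIV_mult[OF DERIV_chain2[OF H(3)[OF q0[OF that]] dqy[OF that(2)]] dqxy[OF that(2)]] dqxy[OF that(2)]]
          DERIV_mult[OF DERIV_chain2[OF H(2)[OF q0[OF that]] dqy[OF that(2)]] dqxxy[OF that(2)]]]])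
      (simp add: \<phi>xxy_def algebra_simps)
  \<comment> \<open>The four terms contribute 8, 8, \<open>4 * (1 + D)\<close> and
    \<open>2 * D\<close> times the common factor; the sum \<open>20 + 6 * D\<close> is below
    \<open>32 * (1 + D)\<close>.\<close>
  let ?B = "32 * (1 + D) * L ^ 6 * C * r powr (\<alpha> - 3)"
  have B: "\<bar>\<phi>xxy x y\<bar> \<le> ?B" if xy: "?I x" "?I y" for x y
  proof -
    define t where "t = norm (F x - E y)"
    have t: "r \<le> t" "t \<le> L * r" "t \<le> D" "t > 0" using sep[of x y] xy r by (auto simp: t_def)
    define P where "P = C * r powr (\<alpha> - 3)"
    have P0: "P \<ge> 0" using C by (simp add: P_def)
    have mono: "C * t powr (\<alpha> - k) \<le> C * r powr (\<alpha> - k)" if "k \<ge> 2" for k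
      using that \<alpha> r t C by (intro mult_left_mono powr_mono2') auto
    have rp: "r powr (\<alpha> - 2) = r powr (\<alpha> - 3) * r" "r powr (\<alpha> - 4) = r powr (\<alpha> - 3) / r"
       "r powr (\<alpha> - 6) = r powr (\<alpha> - 3) / r ^ 3"
      using powr_add[of r "\<alpha> - 3" 1] powr_add[of r "\<alpha> - 3" "-1"] powr_add[of r "\<alpha> - 3" "-3"] r
      by (simp_all add: powr_minus_divide powr_numeral)
    have h1: "\<bar>H1 (q x y)\<bar> \<le> P * r"
      using Hb(1)[of t] mono[of 2] t rp(1) by (simp add: q_def t_def[symmetric] P_def)
    have h2: "\<bar>H2 (q x y)\<bar> \<le> P / r"
      using Hb(2)[of t] mono[of 4] t rp(2) by (simp add: q_def t_def[symmetric] P_def)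
    have h3: "\<bar>H3 (q x y)\<bar> \<le> P / r ^ 3"
      using Hb(3)[of t] mono[of 6] t rp(3) by (simp add: q_def t_def[symmetric] P_def)
    have L0: "L \<ge> 0" using L by simp
    have ip: "\<bar>a \<bullet> b\<bar> \<le> A * B" if "norm a \<le> A" "norm b \<le> B" "A \<ge> 0" for a b :: complex and A B
      using order_trans[OF Cauchy_Schwarz_ineq2 mult_mono[OF that(1,2,3) norm_ge_zero]] .
    have nF: "norm (F x - E y) \<le> L * r" using t by (simp add: t_def)
    have F1b: "norm (F1 x) \<le> L" and F2b: "norm (F2 x) \<le> L" and E1b: "norm (E1 y) \<le> L" using F E xy by auto
    have bx: "\<bar>qx x y\<bar> \<le> 2 * L ^ 2 * r" using ip[OF F1b nF L0] by (simp add: qx_def power2_eq_square abs_mult)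
    have by': "\<bar>qy x y\<bar> \<le> 2 * L ^ 2 * r" using ip[OF E1b nF L0] by (simp add: qy_def power2_eq_square abs_mult)
    have bxx: "\<bar>qxx x y\<bar> \<le> 2 * L ^ 2 * (1 + D)"
    proof -
      have "\<bar>F2 x \<bullet> (F x - E y)\<bar> \<le> L * D" using ip[OF F2b _ L0, of _ D] t by (simp add: t_def)
      moreover have "L * D \<le> L ^ 2 * D" using L D by (simp add: power2_eq_square)
      moreover have "\<bar>F1 x \<bullet> F1 x\<bar> \<le> L ^ 2" using ip[OF F1b F1b L0] by (simp add: power2_eq_square)
      ultimately have "\<bar>qxx x y\<bar> \<le> 2 * (L ^ 2 * D) + 2 * L ^ 2" unfolding qxx_def by linarith
      then show ?thesis by (simp add: algebra_simps)
    qed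
    have bxy: "\<bar>qxy x y\<bar> \<le> 2 * L ^ 2" using ip[OF F1b E1b L0] by (simp add: qxy_def power2_eq_square abs_mult)
    have bxxy: "\<bar>qxxy x y\<bar> \<le> 2 * L ^ 2" using ip[OF F2b E1b L0] by (simp add: qxxy_def power2_eq_square abs_mult)
    have m1: "\<bar>H3 (q x y) * qy x y * qx x y * qx x y\<bar> \<le> P / r ^ 3 * (2 * L ^ 2 * r) * (2 * L ^ 2 * r) * (2 * L ^ 2 * r)"
      unfolding abs_mult using P0 L0 r by (intro mult_mono h3 by' bx) auto
    have m2: "\<bar>2 * H2 (q x y) * qx x y * qxy x y\<bar> \<le> 2 * (P / r) * (2 * L ^ 2 * r) * (2 * L ^ 2)"
      unfolding abs_mult using P0 L0 r by (intro mult_mono h2 bx bxy) auto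
    have m3: "\<bar>H2 (q x y) * qy x y * qxx x y\<bar> \<le> (P / r) * (2 * L ^ 2 * r) * (2 * L ^ 2 * (1 + D))"
      unfolding abs_mult using P0 L0 r D by (intro mult_mono h2 by' bxx) auto
    have m4: "\<bar>H1 (q x y) * qxxy x y\<bar> \<le> P * r * (2 * L ^ 2)"
      unfolding abs_mult using P0 L0 r D by (intro mult_mono h1 bxxy) auto
    have L26: "L ^ 2 \<le> L ^ 6" "L ^ 4 \<le> L ^ 6" using L by (intro power_increasing; simp)+
    have "\<bar>\<phi>xxy x y\<bar> \<le> P / r ^ 3 * (2 * L ^ 2 * r) * (2 * L ^ 2 * r) * (2 * L ^ 2 * r)
        + 2 * (P / r) * (2 * L ^ 2 * r) * (2 * L ^ 2) + (P / r) * (2 * L ^ 2 * r) * (2 * L ^ 2 * (1 + D))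
        + P * r * (2 * L ^ 2)"
      unfolding \<phi>xxy_def using m1 m2 m3 m4 by linarith
    also have "\<dots> = P * (8 * L ^ 6 + (8 + 4 * (1 + D)) * L ^ 4 + 2 * r * L ^ 2)"
      using r by (simp add: field_simps eval_nat_numeral)
    also have "\<dots> \<le> P * (8 * L ^ 6 + (8 + 4 * (1 + D)) * L ^ 6 + 2 * D * L ^ 6)"
      using P0 L26 r D L0 by (intro mult_left_mono add_mono mult_mono) auto
    also have "\<dots> = P * ((20 + 6 * D) * L ^ 6)" by (simp add: algebra_simps)
    also have "\<dots> \<le> P * ((32 * (1 + D)) * L ^ 6)"
      using P0 D L0 by (intro mult_left_mono mult_right_mono) auto
    finally show ?thesis by (simp add: P_def mult_ac)
  qed
  have I01: "?I y0" "?I y1" using y by auto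
  \<comment> \<open>The second difference in \<open>x\<close> is taken of the increment over
    \<open>[y0, y1]\<close>; the mean value theorem in \<open>y\<close> is needed only for the
    second \<open>x\<close>-derivative of that increment.\<close>
  show ?thesis
  proof (rule second_difference_bound[where ?g1.0 = "\<lambda>x. \<phi>x x y1 - \<phi>x x y0" and ?g2.0 = "\<lambda>x. \<phi>xx x y1 - \<phi>xx x y0"])
    fix x assume x: "0 \<le> x" "x \<le> 2 * \<delta>"
    show "((\<lambda>x. \<phi> x y1 - \<phi> x y0) has_real_derivative \<phi>x x y1 - \<phi>x x y0) (at x)"
      using x I01 by (intro DERIV_diff dphix) auto
    show "((\<lambda>x. \<phi>x x y1 - \<phi>x x y0) has_real_derivative \<phi>xx x y1 - \<phi>xx x y0) (at x)"
      using x I01 by (intro DERIV_diff dphixx) auto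
    obtain \<eta> where \<eta>: "y0 < \<eta>" "\<eta> < y1" "\<phi>xx x y1 - \<phi>xx x y0 = (y1 - y0) * \<phi>xxy x \<eta>"
      using MVT2[of y0 y1 "\<phi>xx x" "\<phi>xxy x"] x y dphixxy by auto
    have "\<bar>\<phi>xxy x \<eta>\<bar> \<le> ?B" using B[of x \<eta>] x y \<eta> by auto
    then show "\<bar>\<phi>xx x y1 - \<phi>xx x y0\<bar> \<le> (y1 - y0) * ?B"
      unfolding \<eta>(3) abs_mult using y by (intro mult_mono) auto
  qed (use \<delta> in auto)
qed

subsection \<open>Continuously differentiable maps of the plane\<close>

text \<open>Expressed through the two coordinate partials, the only ones that
  \<open>cont_diff_on\<close> controls; \<open>C1_has_derivative\<close> identifies it with the
  total derivative.\<close>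

definition dir_deriv :: "complex \<Rightarrow> (complex \<Rightarrow> 'b::real_normed_vector) \<Rightarrow> complex \<Rightarrow> 'b" where
  "dir_deriv v g z = Re v *\<^sub>R partial 1 g z + Im v *\<^sub>R partial \<i> g z"

lemma has_partial_shift:
  assumes "has_partial v g (z + s *\<^sub>R v)"
  shows "((\<lambda>x. g (z + x *\<^sub>R v)) has_vector_derivative partial v g (z + s *\<^sub>R v)) (at s)"
proof -
  have "((\<lambda>x. g ((z + s *\<^sub>R v) + x *\<^sub>R v)) has_vector_derivative partial v g (z + s *\<^sub>R v)) (at 0)"
    using assms unfolding has_partial_def partial_def by (rule vector_derivative_works[THEN iffD1])
  then have "((\<lambda>x. g ((z + s *\<^sub>R v) + (x - s) *\<^sub>R v)) has_vector_derivative partial v g (z + s *\<^sub>R v)) (at s)"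
  proof -
    have "((\<lambda>x. x - s) has_vector_derivative 1 - 0) (at s)"
      by (intro has_vector_derivative_diff has_vector_derivative_id has_vector_derivative_const)
    then show ?thesis
      using vector_diff_chain_at[of "\<lambda>x. x - s" 1 s "\<lambda>x. g ((z + s *\<^sub>R v) + x *\<^sub>R v)"]
      \<open>((\<lambda>x. g ((z + s *\<^sub>R v) + x *\<^sub>R v)) has_vector_derivative partial v g (z + s *\<^sub>R v)) (at 0)\<close>
      by (simp add: o_def)
  qed
  then show ?thesis by (simp add: algebra_simps)
qed

lemma partial_eqI:
  assumes "((\<lambda>x. g (z + x *\<^sub>R v)) has_vector_derivative d) (at 0)"
  shows "has_partial v g z" "partial v g z = d"
  using assms unfolding has_partial_def partial_def
  by (auto intro: vector_derivative_at differentiableI_vector)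

text \<open>Continuous partial derivatives give total differentiability. The argument takes place on
  pairs of reals and is transported along \<open>z \<mapsto> (Re z, Im z)\<close>.\<close>

lemma C1_has_derivative:
  fixes g :: "complex \<Rightarrow> 'b::real_normed_vector"
  assumes g: "cont_diff_on (Suc 0) UNIV g"
  shows "(g has_derivative (\<lambda>v. dir_deriv v g z)) (at z)"
proof -
  have p1: "((\<lambda>x. g (Complex x y)) has_vector_derivative partial 1 g (Complex x y)) (at x)" for x y
  proof -
    have "Complex 0 y + of_real t = Complex t y" for t by (simp add: complex_eq_iff)
    then show ?thesis
      using has_partial_shift[of 1 g "Complex 0 y" x] g by (simp add: scaleR_conv_of_real)
  qed
  have p2: "((\<lambda>y. g (Complex x y)) has_vector_derivative partial \<i> g (Complex x y)) (at y)" for x y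
  proof -
    have "Complex x 0 + of_real t * \<i> = Complex x t" for t by (simp add: complex_eq_iff)
    then show ?thesis
      using has_partial_shift[of \<i> g "Complex x 0" y] g by (simp add: scaleR_conv_of_real)
  qed
  have c2: "continuous_on UNIV (partial \<i> g)" using g by simp
  have "((\<lambda>(x, y). g (Complex x y)) has_derivative
     (\<lambda>(tx, ty). tx *\<^sub>R partial 1 g (Complex x y) + blinfun_scaleR_left (partial \<i> g (Complex x y)) ty)) (at (x, y) within UNIV \<times> UNIV)" for x y
  proof (rule has_derivative_partialsI)
    show "((\<lambda>x. g (Complex x y)) has_derivative (\<lambda>tx. tx *\<^sub>R partial 1 g (Complex x y))) (at x within UNIV)"
      using p1 by (simp add: has_vector_derivative_def)
    show "((\<lambda>y. g (Complex x y)) has_derivative blinfun_apply (blinfun_scaleR_left (partial \<i> g (Complex x y)))) (at y within UNIV)" for x y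
      using p2[of x y] by (simp add: has_vector_derivative_def blinfun_scaleR_left.rep_eq[abs_def])
    have "continuous_on UNIV (\<lambda>p. blinfun_scaleR_left (partial \<i> g (Complex (fst p) (snd p))))"
      by (intro bounded_linear.continuous_on[OF bounded_linear_blinfun_scaleR_left]
          continuous_on_compose2[OF c2] continuous_intros) auto
    then show "continuous (at (x, y) within UNIV \<times> UNIV) (\<lambda>(x, y). blinfun_scaleR_left (partial \<i> g (Complex x y)))"
      by (simp add: continuous_on_eq_continuous_at case_prod_unfold)
  qed auto
  from this[of "Re z" "Im z"] have
    "((\<lambda>(x, y). g (Complex x y)) has_derivative (\<lambda>p. fst p *\<^sub>R partial 1 g z + snd p *\<^sub>R partial \<i> g z)) (at (Re z, Im z))"
    by (simp add: case_prod_unfold)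
  moreover have "((\<lambda>z. (Re z, Im z)) has_derivative (\<lambda>v. (Re v, Im v))) (at z)"
    by (auto intro!: derivative_eq_intros)
  ultimately have "((\<lambda>(x, y). g (Complex x y)) \<circ> (\<lambda>z. (Re z, Im z)) has_derivative
      (\<lambda>p. fst p *\<^sub>R partial 1 g z + snd p *\<^sub>R partial \<i> g z) \<circ> (\<lambda>v. (Re v, Im v))) (at z)"
    by (intro diff_chain_at) auto
  then show ?thesis by (simp add: o_def dir_deriv_def)
qed

lemma C1_curve:
  fixes g :: "complex \<Rightarrow> 'b::real_normed_vector"
  assumes g: "cont_diff_on (Suc 0) UNIV g"
  shows "((\<lambda>x. g (w + x *\<^sub>R v)) has_vector_derivative dir_deriv v g (w + s *\<^sub>R v)) (at s)"
proof -
  have "(g has_derivative (\<lambda>u. dir_deriv u g (w + s *\<^sub>R v))) (at (w + s *\<^sub>R v))"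
    by (rule C1_has_derivative[OF g])
  moreover have "((\<lambda>x. w + x *\<^sub>R v) has_derivative (\<lambda>x. x *\<^sub>R v)) (at s)"
    by (auto intro!: derivative_eq_intros)
  ultimately have "((\<lambda>x. g (w + x *\<^sub>R v)) has_derivative (\<lambda>x. dir_deriv (x *\<^sub>R v) g (w + s *\<^sub>R v))) (at s)"
    using diff_chain_at[of "\<lambda>x. w + x *\<^sub>R v"] by (fastforce simp: o_def)
  then show ?thesis
    by (simp add: has_vector_derivative_def dir_deriv_def scaleR_add_right)
qed

lemma continuous_on_dir_deriv:
  assumes "cont_diff_on (Suc 0) UNIV g"
  shows "continuous_on UNIV (dir_deriv v g)"
  unfolding dir_deriv_def[abs_def] using assms by (auto intro!: continuous_intros)

text \<open>Differentiates each coordinate partial along \<open>v\<close>, so that the equality of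
  mixed partial derivatives never enters.\<close>

definition dir_deriv2 :: "complex \<Rightarrow> (complex \<Rightarrow> 'b::real_normed_vector) \<Rightarrow> complex \<Rightarrow> 'b" where
  "dir_deriv2 v g z = Re v *\<^sub>R dir_deriv v (partial 1 g) z + Im v *\<^sub>R dir_deriv v (partial \<i> g) z"

lemma C2_imp_C1: "cont_diff_on 2 S g \<Longrightarrow> cont_diff_on (Suc 0) S g"
  by (auto simp: numeral_2_eq_2)

lemma C2_partial: "cont_diff_on 2 S g \<Longrightarrow> v \<in> {1, \<i>} \<Longrightarrow> cont_diff_on (Suc 0) S (partial v g)"
  by (auto simp: numeral_2_eq_2)

lemma C2_curve:
  fixes g :: "complex \<Rightarrow> 'b::real_normed_vector"
  assumes g: "cont_diff_on 2 UNIV g"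
  shows "((\<lambda>x. dir_deriv v g (w + x *\<^sub>R v)) has_vector_derivative dir_deriv2 v g (w + s *\<^sub>R v)) (at s)"
  using C1_curve[OF C2_partial[OF g, of 1], of w v s] C1_curve[OF C2_partial[OF g, of \<i>], of w v s]
  unfolding dir_deriv_def[of v g] dir_deriv2_def
  by (auto simp: has_vector_derivative_def scaleR_add_right mult.commute intro!: derivative_eq_intros)

lemma continuous_on_dir_deriv2:
  assumes "cont_diff_on 2 UNIV g"
  shows "continuous_on UNIV (dir_deriv2 v g)"
  unfolding dir_deriv2_def[abs_def]
  by (intro continuous_intros continuous_on_dir_deriv C2_partial[OF assms]) auto

lemma curve_bound:
  fixes u :: "real \<Rightarrow> 'b::real_normed_vector"
  assumes "a \<le> b" and u: "\<And>x. a \<le> x \<Longrightarrow> x \<le> b \<Longrightarrow> (u has_vector_derivative u' x) (at x)"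
    and B: "\<And>x. a \<le> x \<Longrightarrow> x \<le> b \<Longrightarrow> norm (u' x) \<le> B"
  shows "norm (u b - u a) \<le> B * (b - a)"
proof (cases "a = b")
  case False
  then have "a < b" using assms by simp
  then have "norm (u b - u a) \<le> B * b - B * a"
  proof (rule differentiable_bound_general[where f' = u' and \<phi>' = "\<lambda>_. B"])
    show "continuous_on {a..b} u"
      by (intro continuous_at_imp_continuous_on ballI has_vector_derivative_continuous[OF u]) auto
    show "((*) B has_vector_derivative B) (at x)" for x
      by (auto intro!: derivative_eq_intros)
  qed (use u B in \<open>auto intro!: continuous_intros\<close>)
  then show ?thesis by (simp add: algebra_simps)
qed simp

lemma C1_lipschitz:
  fixes g :: "complex \<Rightarrow> 'b::real_normed_vector"
  assumes g: "cont_diff_on (Suc 0) UNIV g" and S: "convex S"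
    and B: "\<And>z. z \<in> S \<Longrightarrow> norm (partial 1 g z) \<le> B" "\<And>z. z \<in> S \<Longrightarrow> norm (partial \<i> g z) \<le> B"
    and st: "s \<in> S" "t \<in> S"
  shows "norm (g s - g t) \<le> 2 * B * norm (s - t)"
proof -
  have seg: "t + x *\<^sub>R (s - t) \<in> S" if "0 \<le> x" "x \<le> 1" for x
    using convexD_alt[OF S st(2,1) that] by (simp add: algebra_simps)
  have "norm (g (t + 1 *\<^sub>R (s - t)) - g (t + 0 *\<^sub>R (s - t))) \<le> (2 * B * norm (s - t)) * (1 - 0)"
  proof (rule curve_bound[where u = "\<lambda>x. g (t + x *\<^sub>R (s - t))", OF _ C1_curve[OF g]])
    fix x :: real assume x: "0 \<le> x" "x \<le> 1"
    have "norm (dir_deriv (s - t) g (t + x *\<^sub>R (s - t))) \<le> \<bar>Re (s - t)\<bar> * B + \<bar>Im (s - t)\<bar> * B"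
      unfolding dir_deriv_def
      by (intro norm_triangle_le add_mono) (auto intro!: mult_left_mono B seg x)
    also have "\<dots> \<le> norm (s - t) * B + norm (s - t) * B"
      using order_trans[OF norm_ge_zero B(1)[OF st(1)]]
      by (intro add_mono mult_right_mono abs_Re_le_cmod abs_Im_le_cmod)
    finally show "norm (dir_deriv (s - t) g (t + x *\<^sub>R (s - t))) \<le> 2 * B * norm (s - t)"
      by (simp add: algebra_simps)
  qed simp
  then show ?thesis by simp
qed

section \<open>Lower bounds for the distortion of distances\<close>

lemma jacobian_dir_deriv_nonzero:
  assumes "jacobian_det f z > 0" "v \<noteq> 0"
  shows "dir_deriv v f z \<noteq> 0"
proof
  assume "dir_deriv v f z = 0"
  then have 1: "Re v * Re (partial 1 f z) = - Im v * Re (partial \<i> f z)"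
    and 2: "Re v * Im (partial 1 f z) = - Im v * Im (partial \<i> f z)"
    by (auto simp: dir_deriv_def complex_eq_iff)
  have "Re v * jacobian_det f z = (Re v * Re (partial 1 f z)) * Im (partial \<i> f z) - Re (partial \<i> f z) * (Re v * Im (partial 1 f z))"
    by (simp add: jacobian_det_def algebra_simps)
  also have "\<dots> = 0" unfolding 1 2 by simp
  finally have "Re v = 0" using assms by simp
  then have "Im v * jacobian_det f z = 0" using 1 2 by (auto simp: jacobian_det_def)
  with assms \<open>Re v = 0\<close> show False by (simp add: complex_eq_iff)
qed

text \<open>Two regimes. For close points the positive Jacobian matters: by compactness of
  \<open>S\<close> times the unit circle the derivative stretches every vector by at least
  \<open>m\<close>, and its uniform continuity makes the linear approximation accurate up to
  \<open>m / 2\<close>. For distant points injectivity matters: a continuous positive quotient on a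
  compact set of pairs has a positive minimum.\<close>

lemma bilipschitz_on_compact:
  fixes f :: "complex \<Rightarrow> complex"
  assumes f: "cont_diff_on (Suc 0) UNIV f" and inj: "inj f" and J: "\<And>z. jacobian_det f z > 0"
    and S: "compact S" "convex S"
  shows "\<exists>c>0. \<forall>s\<in>S. \<forall>t\<in>S. c * norm (s - t) \<le> norm (f s - f t)"
proof (cases "S = {}")
  case True
  then show ?thesis by (auto intro: exI[of _ 1])
next
  case ne: False
  have cp: "continuous_on UNIV (partial 1 f)" "continuous_on UNIV (partial \<i> f)" using f by auto
  let ?T = "S \<times> sphere (0::complex) 1"
  have "compact ?T" "?T \<noteq> {}" using S ne by (auto intro!: compact_Times)
  moreover have "continuous_on ?T (\<lambda>p. norm (dir_deriv (snd p) f (fst p)))"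
    unfolding dir_deriv_def
    by (intro continuous_intros continuous_on_compose2[OF cp(1)] continuous_on_compose2[OF cp(2)]) auto
  ultimately obtain p where p: "p \<in> ?T" "\<And>q. q \<in> ?T \<Longrightarrow> norm (dir_deriv (snd p) f (fst p)) \<le> norm (dir_deriv (snd q) f (fst q))"
    using continuous_attains_inf[of ?T "\<lambda>p. norm (dir_deriv (snd p) f (fst p))"] by blast
  define m where "m = norm (dir_deriv (snd p) f (fst p))"
  have "snd p \<noteq> 0" using p(1) by auto
  then have m: "m > 0" unfolding m_def using jacobian_dir_deriv_nonzero[OF J] by simp
  have scale: "dir_deriv (a *\<^sub>R v) f z = a *\<^sub>R dir_deriv v f z" for a v z
    by (simp add: dir_deriv_def scaleR_add_right)
  have low: "m * norm v \<le> norm (dir_deriv v f z)" if z: "z \<in> S" for v z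
  proof (cases "v = 0")
    case False
    then have "m \<le> norm (dir_deriv ((1 / norm v) *\<^sub>R v) f z)"
      using p(2)[of "(z, (1 / norm v) *\<^sub>R v)"] z by (simp add: m_def)
    then show ?thesis using False by (simp add: scale field_simps)
  qed simp
  have "uniformly_continuous_on S (partial 1 f)" "uniformly_continuous_on S (partial \<i> f)"
    by (auto intro!: compact_uniformly_continuous S continuous_on_subset[OF cp(1)] continuous_on_subset[OF cp(2)])
  then obtain d1 d2 where d1: "d1 > 0" "\<And>s t. s \<in> S \<Longrightarrow> t \<in> S \<Longrightarrow> dist s t < d1 \<Longrightarrow> dist (partial 1 f s) (partial 1 f t) < m / 4"
    and d2: "d2 > 0" "\<And>s t. s \<in> S \<Longrightarrow> t \<in> S \<Longrightarrow> dist s t < d2 \<Longrightarrow> dist (partial \<i> f s) (partial \<i> f t) < m / 4"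
    using m unfolding uniformly_continuous_on_def by (metis divide_pos_pos zero_less_numeral)
  define d where "d = min d1 d2"
  have d: "d > 0" using d1 d2 by (simp add: d_def)
  \<comment> \<open>Subtracting the linearisation at \<open>t\<close> leaves a curve with speed at
    most \<open>m / 2 * norm ?v\<close>; each of the two partials accounts for
    \<open>m / 4\<close>.\<close>
  have near: "m / 2 * norm (s - t) \<le> norm (f s - f t)" if st: "s \<in> S" "t \<in> S" "norm (s - t) < d" for s t
  proof -
    let ?v = "s - t"
    let ?u = "\<lambda>x. f (t + x *\<^sub>R ?v) - x *\<^sub>R dir_deriv ?v f t"
    have "norm (?u 1 - ?u 0) \<le> (m / 2 * norm ?v) * (1 - 0)"
    proof (rule curve_bound)
      fix x :: real assume x: "0 \<le> x" "x \<le> 1"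
      show "(?u has_vector_derivative dir_deriv ?v f (t + x *\<^sub>R ?v) - dir_deriv ?v f t) (at x)"
        by (auto intro!: derivative_eq_intros C1_curve[OF f])
      let ?z = "t + x *\<^sub>R ?v"
      have zS: "?z \<in> S" using convexD_alt[OF S(2) st(2,1) x] by (simp add: algebra_simps)
      have "norm (?z - t) \<le> norm ?v" using x by (simp add: mult_left_le_one_le)
      then have zt: "dist ?z t < d" using st by (simp add: dist_norm)
      have "dir_deriv ?v f ?z - dir_deriv ?v f t = Re ?v *\<^sub>R (partial 1 f ?z - partial 1 f t) + Im ?v *\<^sub>R (partial \<i> f ?z - partial \<i> f t)"
        by (simp add: dir_deriv_def algebra_simps)
      also have "norm \<dots> \<le> norm ?v * (m / 4) + norm ?v * (m / 4)"
      proof (intro norm_triangle_le add_mono)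
        show "norm (Re ?v *\<^sub>R (partial 1 f ?z - partial 1 f t)) \<le> norm ?v * (m / 4)"
          unfolding norm_scaleR real_norm_def
          using d1(2)[OF zS st(2)] zt by (intro mult_mono abs_Re_le_cmod) (auto simp: d_def dist_norm)
        show "norm (Im ?v *\<^sub>R (partial \<i> f ?z - partial \<i> f t)) \<le> norm ?v * (m / 4)"
          unfolding norm_scaleR real_norm_def
          using d2(2)[OF zS st(2)] zt by (intro mult_mono abs_Im_le_cmod) (auto simp: d_def dist_norm)
      qed
      finally show "norm (dir_deriv ?v f ?z - dir_deriv ?v f t) \<le> m / 2 * norm ?v" by simp
    qed simp
    then have "norm ((f s - f t) - dir_deriv ?v f t) \<le> m / 2 * norm ?v" by (simp add: algebra_simps)
    moreover have "m * norm ?v \<le> norm (dir_deriv ?v f t)" by (rule low[OF st(2)])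
    moreover have "norm (dir_deriv ?v f t) \<le> norm (f s - f t) + norm ((f s - f t) - dir_deriv ?v f t)"
      using norm_triangle_ineq4[of "f s - f t" "(f s - f t) - dir_deriv ?v f t"] by simp
    ultimately show ?thesis by simp
  qed
  \<comment> \<open>The pairs at distance at least \<open>d\<close>, on which the difference
    quotient is continuous.\<close>
  let ?K = "(S \<times> S) \<inter> {p. d \<le> norm (fst p - snd p)}"
  have cf: "continuous_on UNIV f" using f by auto
  have K: "compact ?K"
    by (intro compact_Int_closed compact_Times S closed_Collect_le continuous_intros)
  have "\<exists>c>0. \<forall>p\<in>?K. c * norm (fst p - snd p) \<le> norm (f (fst p) - f (snd p))"
  proof (cases "?K = {}")
    case False
    have nz: "norm (fst p - snd p) > 0" if "p \<in> ?K" for p using that d by auto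
    have "continuous_on ?K (\<lambda>p. norm (f (fst p) - f (snd p)) / norm (fst p - snd p))"
      using d by (intro continuous_intros continuous_on_compose2[OF cf]) auto
    then obtain p where p: "p \<in> ?K" "\<And>q. q \<in> ?K \<Longrightarrow>
        norm (f (fst p) - f (snd p)) / norm (fst p - snd p) \<le> norm (f (fst q) - f (snd q)) / norm (fst q - snd q)"
      using continuous_attains_inf[OF K False, of "\<lambda>p. norm (f (fst p) - f (snd p)) / norm (fst p - snd p)"] by blast
    have "f (fst p) \<noteq> f (snd p)" using nz[OF p(1)] inj by (auto dest: injD)
    then have "norm (f (fst p) - f (snd p)) / norm (fst p - snd p) > 0" using nz[OF p(1)] by simp
    moreover have "norm (f (fst p) - f (snd p)) / norm (fst p - snd p) * norm (fst q - snd q) \<le> norm (f (fst q) - f (snd q))" if "q \<in> ?K" for q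
      using p(2)[OF that] nz[OF that] by (simp add: pos_le_divide_eq)
    ultimately show ?thesis by blast
  qed (auto intro!: exI[of _ 1])
  then obtain c where c: "c > 0" "\<And>p. p \<in> ?K \<Longrightarrow> c * norm (fst p - snd p) \<le> norm (f (fst p) - f (snd p))" by blast
  show ?thesis
  proof (intro exI[of _ "min c (m / 2)"] conjI ballI)
    fix s t assume st: "s \<in> S" "t \<in> S"
    show "min c (m / 2) * norm (s - t) \<le> norm (f s - f t)"
    proof (cases "norm (s - t) < d")
      case True
      show ?thesis
        by (rule order_trans[OF mult_right_mono near[OF st True]]) auto
    next
      case False
      show ?thesis
        by (rule order_trans[OF mult_right_mono c(2)[of "(s, t)", simplified]]) (use st False in auto)
    qed
  qed (use c m in auto)
qed

subsection \<open>Variance and covariance of second differences\<close>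

text \<open>\<open>x powr (\<alpha> - 1)\<close> is monotone, in a direction that depends on
  \<alpha>; the sum of its values at both ends covers the two cases.\<close>

lemma powr_lipschitz:
  fixes a b c M \<alpha> :: real
  assumes "0 < c" "c \<le> a" "a \<le> M" "c \<le> b" "b \<le> M" "\<alpha> > 0"
  shows "\<bar>a powr \<alpha> - b powr \<alpha>\<bar> \<le> \<alpha> * (c powr (\<alpha> - 1) + M powr (\<alpha> - 1)) * \<bar>a - b\<bar>"
proof -
  have "norm (a powr \<alpha> - b powr \<alpha>) \<le> \<alpha> * (c powr (\<alpha> - 1) + M powr (\<alpha> - 1)) * norm (a - b)"
  proof (rule field_differentiable_bound[of "{c..M}" "\<lambda>x. x powr \<alpha>" "\<lambda>x. \<alpha> * x powr (\<alpha> - 1)"])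
    fix x assume x: "x \<in> {c..M}"
    then show "((\<lambda>x. x powr \<alpha>) has_field_derivative \<alpha> * x powr (\<alpha> - 1)) (at x within {c..M})"
      using assms(1) by (intro has_field_derivative_at_within[OF has_real_derivative_powr]) auto
    have "x powr (\<alpha> - 1) \<le> c powr (\<alpha> - 1) + M powr (\<alpha> - 1)"
    proof (cases "\<alpha> \<le> 1")
      case True
      then have "x powr (\<alpha> - 1) \<le> c powr (\<alpha> - 1)" using x assms by (intro powr_mono2') auto
      then show ?thesis using powr_ge_zero[of M "\<alpha> - 1"] by linarith
    next
      case False
      then have "x powr (\<alpha> - 1) \<le> M powr (\<alpha> - 1)" using x assms by (intro powr_mono2) auto
      then show ?thesis using powr_ge_zero[of c "\<alpha> - 1"] by linarith
    qed
    then show "norm (\<alpha> * x powr (\<alpha> - 1)) \<le> \<alpha> * (c powr (\<alpha> - 1) + M powr (\<alpha> - 1))"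
      using assms(6) by (simp add: abs_mult)
  qed (use assms in auto)
  then show ?thesis by simp
qed

text \<open>Here \<open>k\<close> is 1 or 2, for one step or two steps of the second difference.
  There are two sources of error: the distance \<open>d\<close> differs from
  \<open>k * \<delta> * p\<close> by the curvature of the map, relatively O(\<delta>), and
  \<open>R\<close> differs from its leading terms by a relative error of order
  \<open>\<delta> powr \<gamma>\<close>.\<close>

lemma variogram_estimate:
  fixes R :: "real \<Rightarrow> real"
  assumes \<alpha>: "\<alpha> > 0" and \<gamma>: "\<gamma> > 0"
    and R: "\<And>t. 0 \<le> t \<Longrightarrow> t \<le> r \<Longrightarrow> \<bar>R t - (R 0 - t powr \<alpha>)\<bar> \<le> t powr (\<alpha> + \<gamma>)"
    and c: "c > 0" "c \<le> p" "p \<le> L" "L \<ge> c" and k: "1 \<le> k" "k \<le> 2"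
    and \<delta>: "0 < \<delta>" "4 * L * \<delta> \<le> c / 2" "3 * L * \<delta> \<le> r"
    and d: "d \<ge> 0" "\<bar>d - k * \<delta> * p\<bar> \<le> 4 * L * \<delta>\<^sup>2"
  shows "\<bar>\<delta> powr (-\<alpha>) * (R 0 - R d) - (k * p) powr \<alpha>\<bar>
    \<le> ((3 * L) powr (\<alpha> + \<gamma>) + \<alpha> * ((c / 2) powr (\<alpha> - 1) + (3 * L) powr (\<alpha> - 1)) * (4 * L)) * (\<delta> powr \<gamma> + \<delta>)"
proof -
  define e where "e = d / \<delta>"
  have de: "d = \<delta> * e" using \<delta> by (simp add: e_def)
  have "\<delta> * \<bar>e - k * p\<bar> = \<bar>\<delta> * (e - k * p)\<bar>" using \<delta> by (simp add: abs_mult)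
  also have "\<delta> * (e - k * p) = d - k * \<delta> * p" by (simp add: de algebra_simps)
  finally have "\<delta> * \<bar>e - k * p\<bar> = \<bar>d - k * \<delta> * p\<bar>" .
  then have "\<delta> * \<bar>e - k * p\<bar> \<le> \<delta> * (4 * L * \<delta>)" using d by (simp add: power2_eq_square mult_ac)
  then have e: "\<bar>e - k * p\<bar> \<le> 4 * L * \<delta>" using \<delta> by simp
  have kp: "c \<le> k * p" "k * p \<le> 2 * L"
    using mult_mono[of 1 k c p] mult_mono[of k 2 p L] c k by auto
  have e1: "c / 2 \<le> e" "e \<le> 3 * L" using e kp \<delta> c by linarith+
  have "\<bar>e powr \<alpha> - (k * p) powr \<alpha>\<bar> \<le> \<alpha> * ((c / 2) powr (\<alpha> - 1) + (3 * L) powr (\<alpha> - 1)) * \<bar>e - k * p\<bar>"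
    by (rule powr_lipschitz) (use e1 kp c \<alpha> in auto)
  also have "\<dots> \<le> \<alpha> * ((c / 2) powr (\<alpha> - 1) + (3 * L) powr (\<alpha> - 1)) * (4 * L * \<delta>)"
    using e \<alpha> by (intro mult_left_mono) auto
  finally have A: "\<bar>e powr \<alpha> - (k * p) powr \<alpha>\<bar> \<le> \<alpha> * ((c / 2) powr (\<alpha> - 1) + (3 * L) powr (\<alpha> - 1)) * (4 * L) * \<delta>"
    by (simp add: mult_ac)
  have "d \<le> \<delta> * (3 * L)" using e1 \<delta> by (simp add: de)
  then have "\<bar>R d - (R 0 - d powr \<alpha>)\<bar> \<le> d powr (\<alpha> + \<gamma>)" using R[of d] d \<delta> by (simp add: mult_ac)
  also have "\<dots> \<le> (\<delta> * (3 * L)) powr (\<alpha> + \<gamma>)"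
    using \<open>d \<le> \<delta> * (3 * L)\<close> d \<alpha> \<gamma> by (intro powr_mono2) auto
  finally have "\<delta> powr (-\<alpha>) * \<bar>R d - (R 0 - d powr \<alpha>)\<bar> \<le> \<delta> powr (-\<alpha>) * (\<delta> * (3 * L)) powr (\<alpha> + \<gamma>)"
    by (rule mult_left_mono) simp
  also have "\<dots> = (3 * L) powr (\<alpha> + \<gamma>) * \<delta> powr \<gamma>"
    using \<delta> c by (simp add: powr_mult powr_add powr_minus field_simps)
  finally have B: "\<delta> powr (-\<alpha>) * \<bar>R d - (R 0 - d powr \<alpha>)\<bar> \<le> (3 * L) powr (\<alpha> + \<gamma>) * \<delta> powr \<gamma>" .
  have "\<delta> powr (-\<alpha>) * (R 0 - R d) - (k * p) powr \<alpha>
      = (e powr \<alpha> - (k * p) powr \<alpha>) - \<delta> powr (-\<alpha>) * (R d - (R 0 - d powr \<alpha>))"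
  proof -
    have "\<delta> powr (-\<alpha>) * d powr \<alpha> = e powr \<alpha>"
      using \<delta> e1 c by (simp add: de powr_mult powr_minus field_simps)
    then show ?thesis by (simp add: algebra_simps)
  qed
  also have "\<bar>\<dots>\<bar> \<le> \<bar>e powr \<alpha> - (k * p) powr \<alpha>\<bar> + \<delta> powr (-\<alpha>) * \<bar>R d - (R 0 - d powr \<alpha>)\<bar>"
    using abs_triangle_ineq4[of "e powr \<alpha> - (k * p) powr \<alpha>" "\<delta> powr (-\<alpha>) * (R d - (R 0 - d powr \<alpha>))"]
    by (simp add: abs_mult)
  also have "\<dots> \<le> \<alpha> * ((c / 2) powr (\<alpha> - 1) + (3 * L) powr (\<alpha> - 1)) * (4 * L) * \<delta> + (3 * L) powr (\<alpha> + \<gamma>) * \<delta> powr \<gamma>"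
    using A B by linarith
  also have "\<dots> \<le> \<alpha> * ((c / 2) powr (\<alpha> - 1) + (3 * L) powr (\<alpha> - 1)) * (4 * L) * (\<delta> powr \<gamma> + \<delta>)
       + (3 * L) powr (\<alpha> + \<gamma>) * (\<delta> powr \<gamma> + \<delta>)"
    using \<alpha> c \<delta> by (intro add_mono mult_left_mono) auto
  finally show ?thesis by (simp add: algebra_simps)
qed

text \<open>Contains every point visited by a second difference that starts in \<open>S\<close> with
  a step of length factor at most 1.\<close>

lemma compact_segments:
  fixes S :: "complex set"
  assumes "compact S"
  shows "compact ((\<lambda>p. fst p + snd p *\<^sub>R h) ` (S \<times> {0..2::real}))"
  by (rule compact_continuous_image) (auto intro!: compact_Times assms continuous_intros)

lemma bounded_on_compact:
  fixes g :: "complex \<Rightarrow> 'b::real_normed_vector"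
  assumes "continuous_on UNIV g" "compact T"
  shows "\<exists>B\<ge>1. \<forall>z\<in>T. norm (g z) \<le> B"
proof -
  have "bounded (g ` T)"
    by (intro compact_imp_bounded compact_continuous_image continuous_on_subset[OF assms(1)] assms) auto
  then obtain B where "\<forall>y\<in>g ` T. norm y \<le> B" unfolding bounded_iff by blast
  then show ?thesis by (intro exI[of _ "max B 1"]) (auto simp: le_max_iff_disj)
qed

text \<open>For a variable X2 - 2 X1 + X0 the coefficients sum to zero, so its variance involves
  only the differences v = R 0 - R and equals 4 v1 + 4 v2 - 2 v3, with v3 taken over the double
  step. Inserting v = (distance)^\<alpha> gives the factor 4 + 4 - 2 * 2^\<alpha>.\<close>

lemma second_difference_variance:
  fixes R :: "real \<Rightarrow> real" and f :: "complex \<Rightarrow> complex"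
  assumes \<alpha>: "\<alpha> > 0" and \<gamma>: "\<gamma> > 0"
    and R: "\<exists>r>0. \<forall>t. 0 \<le> t \<and> t \<le> r \<longrightarrow> \<bar>R t - (R 0 - t powr \<alpha>)\<bar> \<le> t powr (\<alpha> + \<gamma>)"
    and f: "cont_diff_on 2 UNIV f" and J: "\<And>z. jacobian_det f z > 0" and h: "h \<noteq> 0"
    and S: "compact S"
  shows "\<exists>C \<delta>0. C \<ge> 0 \<and> \<delta>0 > 0 \<and> (\<forall>\<delta> w. 0 < \<delta> \<and> \<delta> \<le> \<delta>0 \<and> w \<in> S \<longrightarrow>
    \<bar>\<delta> powr (-\<alpha>) * (4 * (R 0 - R (cmod (f (w + \<delta> *\<^sub>R h) - f w)))
       + 4 * (R 0 - R (cmod (f (w + (2 * \<delta>) *\<^sub>R h) - f (w + \<delta> *\<^sub>R h))))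
       - 2 * (R 0 - R (cmod (f (w + (2 * \<delta>) *\<^sub>R h) - f w))))
      - (8 - 2 powr (\<alpha> + 1)) * cmod (dir_deriv h f w) powr \<alpha>\<bar> \<le> C * (\<delta> powr \<gamma> + \<delta>))"
proof (cases "S = {}")
  case True
  then show ?thesis by (auto intro: exI[of _ 0] exI[of _ 1])
next
  case ne: False
  define T where "T = (\<lambda>p. fst p + snd p *\<^sub>R h) ` (S \<times> {0..2::real})"
  have T: "compact T" unfolding T_def by (rule compact_segments[OF S])
  have wT: "w + x *\<^sub>R h \<in> T" if "w \<in> S" "0 \<le> x" "x \<le> 2" for w x
    using that unfolding T_def by (intro image_eqI[of _ _ "(w, x)"]) auto
  note C1 = C2_imp_C1[OF f]
  note cont = continuous_on_dir_deriv[OF C1, of h] and cont2 = continuous_on_dir_deriv2[OF f, of h]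
  obtain L1 where L1: "L1 \<ge> 1" "\<And>z. z \<in> T \<Longrightarrow> norm (dir_deriv h f z) \<le> L1"
    using bounded_on_compact[OF cont T] by blast
  obtain L2 where L2: "L2 \<ge> 1" "\<And>z. z \<in> T \<Longrightarrow> norm (dir_deriv2 h f z) \<le> L2"
    using bounded_on_compact[OF cont2 T] by blast
  obtain w0 where w0: "w0 \<in> S" "\<And>w. w \<in> S \<Longrightarrow> norm (dir_deriv h f w0) \<le> norm (dir_deriv h f w)"
    using continuous_attains_inf[OF S ne, of "\<lambda>w. norm (dir_deriv h f w)"]
      continuous_on_norm[OF continuous_on_subset[OF cont]] by blast
  define c where "c = norm (dir_deriv h f w0)"
  define L where "L = max L1 L2"
  have c: "c > 0" using jacobian_dir_deriv_nonzero[OF J h] by (simp add: c_def)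
  have S_T: "w \<in> T" if "w \<in> S" for w using wT[OF that, of 0] by simp
  have p: "c \<le> norm (dir_deriv h f w)" "norm (dir_deriv h f w) \<le> L" if "w \<in> S" for w
    using w0(2)[OF that] L1(2)[OF S_T[OF that]] by (auto simp: c_def L_def)
  have cL: "c \<le> L" using p[OF w0(1)] by simp
  have L0: "L \<ge> 1" using L1 by (simp add: L_def)
  obtain r where r: "r > 0" "\<And>t. 0 \<le> t \<Longrightarrow> t \<le> r \<Longrightarrow> \<bar>R t - (R 0 - t powr \<alpha>)\<bar> \<le> t powr (\<alpha> + \<gamma>)"
    using R by blast
  \<comment> \<open>The three entries keep the segment inside \<open>T\<close> and provide the two
    smallness conditions of \<open>variogram_estimate\<close>.\<close>
  define \<delta>0 where "\<delta>0 = min 1 (min (c / (8 * L)) (r / (3 * L)))"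
  define C where "C = ((3 * L) powr (\<alpha> + \<gamma>) + \<alpha> * ((c / 2) powr (\<alpha> - 1) + (3 * L) powr (\<alpha> - 1)) * (4 * L))"
  have C0: "C \<ge> 0" using \<alpha> L0 by (simp add: C_def)
  have d0: "\<delta>0 > 0" using c L0 r by (simp add: \<delta>0_def)
  show ?thesis
  proof (rule exI[of _ "10 * C"], rule exI[of _ \<delta>0], intro conjI allI impI)
    fix \<delta> w assume dw: "0 < \<delta> \<and> \<delta> \<le> \<delta>0 \<and> w \<in> S"
    then have \<delta>: "0 < \<delta>" "\<delta> \<le> 1" "4 * L * \<delta> \<le> c / 2" "3 * L * \<delta> \<le> r" and w: "w \<in> S"
      using L0 by (auto simp: \<delta>0_def pos_le_divide_eq mult_ac)
    let ?p = "norm (dir_deriv h f w)" and ?P = "dir_deriv h f w"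
    let ?F = "\<lambda>x. f (w + x *\<^sub>R h)"
    \<comment> \<open>On the segment the derivative deviates from its value at \<open>w\<close> by
      at most \<open>L * (2 * \<delta>)\<close>; over a length of at most
      \<open>2 * \<delta>\<close> this accumulates to
      \<open>4 * L * \<delta>\<^sup>2\<close>.\<close>
    have inc: "\<bar>norm (?F y - ?F x) - (y - x) * ?p\<bar> \<le> 4 * L * \<delta>\<^sup>2" if xy: "0 \<le> x" "x \<le> y" "y \<le> 2 * \<delta>" for x y
    proof -
      have F1: "norm (dir_deriv h f (w + z *\<^sub>R h) - ?P) \<le> L * (2 * \<delta>)" if z: "0 \<le> z" "z \<le> 2 * \<delta>" for z
      proof -
        have "norm (dir_deriv h f (w + z *\<^sub>R h) - dir_deriv h f (w + 0 *\<^sub>R h)) \<le> L2 * (z - 0)"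
          by (rule curve_bound[OF _ C2_curve[OF f]]) (use z \<delta> w in \<open>auto intro!: L2 wT\<close>)
        also have "\<dots> \<le> L * (2 * \<delta>)" using z L2 by (intro mult_mono) (auto simp: L_def)
        finally show ?thesis by simp
      qed
      have "norm ((?F y - y *\<^sub>R ?P) - (?F x - x *\<^sub>R ?P)) \<le> L * (2 * \<delta>) * (y - x)"
      proof (rule curve_bound[where u = "\<lambda>x. ?F x - x *\<^sub>R ?P" and u' = "\<lambda>z. dir_deriv h f (w + z *\<^sub>R h) - ?P"])
        fix z assume z: "x \<le> z" "z \<le> y"
        show "((\<lambda>x. ?F x - x *\<^sub>R ?P) has_vector_derivative dir_deriv h f (w + z *\<^sub>R h) - ?P) (at z)"
          by (auto intro!: derivative_eq_intros C1_curve[OF C1])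
        show "norm (dir_deriv h f (w + z *\<^sub>R h) - ?P) \<le> L * (2 * \<delta>)" using F1[of z] z xy by simp
      qed (use xy in auto)
      also have "\<dots> \<le> L * (2 * \<delta>) * (2 * \<delta>)" using xy L0 \<delta> by (intro mult_left_mono) auto
      finally have "norm ((?F y - ?F x) - (y - x) *\<^sub>R ?P) \<le> 4 * L * \<delta>\<^sup>2"
        by (simp add: algebra_simps power2_eq_square)
      moreover have "norm ((y - x) *\<^sub>R ?P) = (y - x) * ?p" using xy by simp
      ultimately show ?thesis
        using norm_triangle_ineq3[of "?F y - ?F x" "(y - x) *\<^sub>R ?P"] by linarith
    qed
    note est = variogram_estimate[OF \<alpha> \<gamma> r(2) c p[OF w] cL _ _ \<delta>(1,3,4) norm_ge_zero, folded C_def]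
    define v1 where "v1 = R 0 - R (cmod (f (w + \<delta> *\<^sub>R h) - f w))"
    define v2 where "v2 = R 0 - R (cmod (f (w + (2 * \<delta>) *\<^sub>R h) - f (w + \<delta> *\<^sub>R h)))"
    define v3 where "v3 = R 0 - R (cmod (f (w + (2 * \<delta>) *\<^sub>R h) - f w))"
    define \<epsilon> where "\<epsilon> = C * (\<delta> powr \<gamma> + \<delta>)"
    have 1: "\<bar>\<delta> powr (-\<alpha>) * v1 - (1 * ?p) powr \<alpha>\<bar> \<le> \<epsilon>" unfolding v1_def \<epsilon>_def
      by (rule est) (use inc[of 0 \<delta>] \<delta> in \<open>auto simp: mult_ac\<close>)
    have 2: "\<bar>\<delta> powr (-\<alpha>) * v2 - (1 * ?p) powr \<alpha>\<bar> \<le> \<epsilon>" unfolding v2_def \<epsilon>_def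
      by (rule est) (use inc[of \<delta> "2 * \<delta>"] \<delta> in \<open>auto simp: mult_ac\<close>)
    have 3: "\<bar>\<delta> powr (-\<alpha>) * v3 - (2 * ?p) powr \<alpha>\<bar> \<le> \<epsilon>" unfolding v3_def \<epsilon>_def
      by (rule est) (use inc[of 0 "2 * \<delta>"] \<delta> in \<open>auto simp: mult_ac\<close>)
    have p0: "?p > 0" using p[OF w] c by linarith
    \<comment> \<open>The factor 10 is 4 + 4 + 2.\<close>
    have lin: "\<bar>4 * x1 + 4 * x2 - 2 * x3\<bar> \<le> 10 * \<epsilon>" if "\<bar>x1\<bar> \<le> \<epsilon>" "\<bar>x2\<bar> \<le> \<epsilon>" "\<bar>x3\<bar> \<le> \<epsilon>" for x1 x2 x3
      using that by linarith
    have "\<delta> powr (-\<alpha>) * (4 * v1 + 4 * v2 - 2 * v3) - (8 - 2 powr (\<alpha> + 1)) * ?p powr \<alpha>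
      = 4 * (\<delta> powr (-\<alpha>) * v1 - (1 * ?p) powr \<alpha>) + 4 * (\<delta> powr (-\<alpha>) * v2 - (1 * ?p) powr \<alpha>)
        - 2 * (\<delta> powr (-\<alpha>) * v3 - (2 * ?p) powr \<alpha>)"
      using p0 by (simp add: powr_mult powr_add algebra_simps)
    then have "\<bar>\<delta> powr (-\<alpha>) * (4 * v1 + 4 * v2 - 2 * v3) - (8 - 2 powr (\<alpha> + 1)) * ?p powr \<alpha>\<bar> \<le> 10 * \<epsilon>"
      using lin[OF 1 2 3] by simp
    then show "\<bar>\<delta> powr (-\<alpha>) * (4 * (R 0 - R (cmod (f (w + \<delta> *\<^sub>R h) - f w)))
       + 4 * (R 0 - R (cmod (f (w + (2 * \<delta>) *\<^sub>R h) - f (w + \<delta> *\<^sub>R h))))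
       - 2 * (R 0 - R (cmod (f (w + (2 * \<delta>) *\<^sub>R h) - f w))))
      - (8 - 2 powr (\<alpha> + 1)) * cmod (dir_deriv h f w) powr \<alpha>\<bar> \<le> 10 * C * (\<delta> powr \<gamma> + \<delta>)"
      by (simp add: v1_def v2_def v3_def \<epsilon>_def)
  qed (use C0 d0 in auto)
qed

lemma abs_second_difference_le:
  fixes p00 :: real
  assumes "\<bar>(p22 - p21) - 2 * (p12 - p11) + (p02 - p01)\<bar> \<le> M"
    and "\<bar>(p21 - p20) - 2 * (p11 - p10) + (p01 - p00)\<bar> \<le> M"
  shows "\<bar>(p22 - 2 * p21 + p20) - 2 * (p12 - 2 * p11 + p10) + (p02 - 2 * p01 + p00)\<bar> \<le> 2 * M"
proof -
  have "(p22 - 2 * p21 + p20) - 2 * (p12 - 2 * p11 + p10) + (p02 - 2 * p01 + p00)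
    = ((p22 - p21) - 2 * (p12 - p11) + (p02 - p01)) - ((p21 - p20) - 2 * (p11 - p10) + (p01 - p00))"
    by simp
  then show ?thesis
    using order_trans[OF abs_triangle_ineq4 add_mono[OF assms]] by simp
qed

text \<open>\<open>mixed_difference_bound\<close> is used twice: the second difference at
  \<open>w'\<close> is split into two first differences, whence the factor 2. The separation
  hypothesis is made so that the displacements, together at most
  \<open>2 * \<delta> * norm h\<close>, change the distance of the points by at most a half.\<close>

lemma second_difference_covariance:
  fixes R :: "real \<Rightarrow> real" and f :: "complex \<Rightarrow> complex"
  assumes \<alpha>: "0 < \<alpha>" "\<alpha> < 2"
    and small: "\<exists>r>0. \<forall>t. 0 < t \<and> t \<le> r \<longrightarrow> \<bar>R t - R 0\<bar> \<le> 2 * t powr \<alpha>"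
    and diff: "\<And>j t. j < 4 \<Longrightarrow> t > 0 \<Longrightarrow> (deriv ^^ j) R field_differentiable (at t)"
    and R4: "\<exists>c>0. \<forall>\<^sub>F t in at_right 0. \<bar>(deriv ^^ 4) R t\<bar> \<le> c * t powr (\<alpha> - 4)"
    and f: "cont_diff_on 2 UNIV f" and inj: "inj f" and J: "\<And>z. jacobian_det f z > 0"
    and S: "compact S"
  shows "\<exists>C\<ge>0. \<forall>\<delta> w w'. 0 < \<delta> \<and> \<delta> \<le> 1 \<and> w \<in> S \<and> w' \<in> S \<and> w \<noteq> w' \<and> 4 * norm h * \<delta> \<le> norm (w - w') \<longrightarrow>
    (let G = (\<lambda>x y. R (cmod (f (w + (x * \<delta>) *\<^sub>R h) - f (w' + (y * \<delta>) *\<^sub>R h)))) in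
     \<bar>(G 2 2 - 2 * G 2 1 + G 2 0) - 2 * (G 1 2 - 2 * G 1 1 + G 1 0) + (G 0 2 - 2 * G 0 1 + G 0 0)\<bar>
       \<le> C * \<delta> ^ 3 * norm (w - w') powr (\<alpha> - 3))"
proof -
  define T where "T = (\<lambda>p. fst p + snd p *\<^sub>R h) ` (S \<times> {0..2::real})"
  have T: "compact T" unfolding T_def by (rule compact_segments[OF S])
  obtain \<rho> where "\<forall>z\<in>T. norm z \<le> \<rho>"
    using compact_imp_bounded[OF T] unfolding bounded_iff by blast
  then have \<rho>: "T \<subseteq> cball 0 \<rho>" by auto
  have wT: "w + x *\<^sub>R h \<in> cball 0 \<rho>" if "w \<in> S" "0 \<le> x" "x \<le> 2" for w x
  proof -
    have "w + x *\<^sub>R h \<in> T"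
      using that unfolding T_def by (intro image_eqI[of _ _ "(w, x)"]) auto
    then show ?thesis using \<rho> by blast
  qed
  note C1 = C2_imp_C1[OF f]
  note cont = continuous_on_dir_deriv[OF C1, of h] and cont2 = continuous_on_dir_deriv2[OF f, of h]
  have K: "compact (cball (0::complex) \<rho>)" "convex (cball (0::complex) \<rho>)" by auto
  obtain L1 where L1: "L1 \<ge> 1" "\<And>z. z \<in> cball 0 \<rho> \<Longrightarrow> norm (dir_deriv h f z) \<le> L1"
    using bounded_on_compact[OF cont K(1)] by blast
  obtain L2 where L2: "L2 \<ge> 1" "\<And>z. z \<in> cball 0 \<rho> \<Longrightarrow> norm (dir_deriv2 h f z) \<le> L2"
    using bounded_on_compact[OF cont2 K(1)] by blast
  have "continuous_on UNIV (partial 1 f)" "continuous_on UNIV (partial \<i> f)" using C1 by auto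
  from this[THEN bounded_on_compact[OF _ K(1)]]
  obtain B1 B2 where B: "\<And>z. z \<in> cball 0 \<rho> \<Longrightarrow> norm (partial 1 f z) \<le> B1" "\<And>z. z \<in> cball 0 \<rho> \<Longrightarrow> norm (partial \<i> f z) \<le> B2"
     and B1: "B1 \<ge> 1" by blast
  define Lf where "Lf = 2 * max B1 B2"
  have Lf: "norm (f s - f t) \<le> Lf * norm (s - t)" if "s \<in> cball 0 \<rho>" "t \<in> cball 0 \<rho>" for s t
    unfolding Lf_def by (rule C1_lipschitz[OF C1 K(2) _ _ that]) (use B in \<open>force simp: le_max_iff_disj\<close>)+
  have Lf0: "Lf > 0" using B1 by (simp add: Lf_def)
  obtain c where c: "c > 0" "\<And>s t. s \<in> cball 0 \<rho> \<Longrightarrow> t \<in> cball 0 \<rho> \<Longrightarrow> c * norm (s - t) \<le> norm (f s - f t)"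
    using bilipschitz_on_compact[OF C1 inj J K] by blast
  \<comment> \<open>The last entry comes from the ratio of the upper bound
    \<open>Lf * (3 / 2)\<close> to the lower bound \<open>c / 2\<close> for image distances, both
    relative to the distance of the grid points.\<close>
  define L where "L = max (max L1 L2) (3 * Lf / c)"
  have L: "L \<ge> 1" using L1 by (simp add: L_def)
  \<comment> \<open>Dominates every distance of image points of the ball. The maximum with 1 makes
    \<open>t = 1\<close> admissible, which is used to see that \<open>C \<ge> 0\<close>.\<close>
  define D where "D = max 1 (Lf * (2 * \<rho>))"
  obtain C where C: "\<And>t. 0 < t \<Longrightarrow> t \<le> D \<Longrightarrow> \<bar>(deriv ^^ 1) R t\<bar> \<le> C * t powr (\<alpha> - 1)"
      "\<And>t. 0 < t \<Longrightarrow> t \<le> D \<Longrightarrow> \<bar>(deriv ^^ 2) R t\<bar> \<le> C * t powr (\<alpha> - 2)"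
      "\<And>t. 0 < t \<Longrightarrow> t \<le> D \<Longrightarrow> \<bar>(deriv ^^ 3) R t\<bar> \<le> C * t powr (\<alpha> - 3)"
    using covariance_derivative_bounds[OF \<alpha> small diff R4, of D] by blast
  have "0 \<le> C * 1" using C(2)[of 1] by (simp add: D_def order_trans[OF abs_ge_zero])
  then have C0: "C \<ge> 0" by simp
  obtain H1 H2 H3 where HH: "(\<forall>q>0. ((\<lambda>q. R (sqrt q)) has_real_derivative H1 q) (at q) \<and>
       (H1 has_real_derivative H2 q) (at q) \<and> (H2 has_real_derivative H3 q) (at q)) \<and>
    (\<forall>t. 0 < t \<and> t \<le> D \<longrightarrow> \<bar>H1 (t\<^sup>2)\<bar> \<le> C * t powr (\<alpha> - 2) \<and> \<bar>H2 (t\<^sup>2)\<bar> \<le> C * t powr (\<alpha> - 4)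
       \<and> \<bar>H3 (t\<^sup>2)\<bar> \<le> C * t powr (\<alpha> - 6))"
  proof -
    have "\<exists>H1 H2 H3. (\<forall>q>0. ((\<lambda>q. R (sqrt q)) has_real_derivative H1 q) (at q) \<and>
       (H1 has_real_derivative H2 q) (at q) \<and> (H2 has_real_derivative H3 q) (at q)) \<and>
    (\<forall>t. 0 < t \<and> t \<le> D \<longrightarrow> \<bar>H1 (t\<^sup>2)\<bar> \<le> C * t powr (\<alpha> - 2) \<and> \<bar>H2 (t\<^sup>2)\<bar> \<le> C * t powr (\<alpha> - 4)
       \<and> \<bar>H3 (t\<^sup>2)\<bar> \<le> C * t powr (\<alpha> - 6))"
      by (rule covariance_of_square; (rule diff C; assumption))
    then show ?thesis by (elim exE) (rule that)
  qed
  have H: "((\<lambda>q. R (sqrt q)) has_real_derivative H1 q) (at q)" "(H1 has_real_derivative H2 q) (at q)"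
      "(H2 has_real_derivative H3 q) (at q)" if "q > 0" for q
    using HH that by simp_all
  have Hb: "\<bar>H1 (t\<^sup>2)\<bar> \<le> C * t powr (\<alpha> - 2)" "\<bar>H2 (t\<^sup>2)\<bar> \<le> C * t powr (\<alpha> - 4)"
      "\<bar>H3 (t\<^sup>2)\<bar> \<le> C * t powr (\<alpha> - 6)" if "0 < t" "t \<le> D" for t
    using HH that by simp_all
  define B where "B = 32 * (1 + D) * L ^ 6 * C"
  have B0: "B \<ge> 0" using C0 L by (simp add: B_def D_def)
  show ?thesis
  proof (intro exI[of _ "2 * B * (c / 2) powr (\<alpha> - 3)"] conjI allI impI)
    show "0 \<le> 2 * B * (c / 2) powr (\<alpha> - 3)" using B0 by simp
    fix \<delta> w w'
    assume "0 < \<delta> \<and> \<delta> \<le> 1 \<and> w \<in> S \<and> w' \<in> S \<and> w \<noteq> w' \<and> 4 * norm h * \<delta> \<le> norm (w - w')"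
    then have \<delta>: "0 < \<delta>" "\<delta> \<le> 1" and w: "w \<in> S" "w' \<in> S" "w \<noteq> w'" and far: "4 * norm h * \<delta> \<le> norm (w - w')"
      by auto
    define r where "r = c / 2 * norm (w - w')"
    have r: "r > 0" using c w by (simp add: r_def)
    let ?F = "\<lambda>x. f (w + x *\<^sub>R h)" and ?E = "\<lambda>y. f (w' + y *\<^sub>R h)"
    have sep: "r \<le> norm (?F x - ?E y) \<and> norm (?F x - ?E y) \<le> L * r \<and> norm (?F x - ?E y) \<le> D"
      if xy: "0 \<le> x" "x \<le> 2 * \<delta>" "0 \<le> y" "y \<le> 2 * \<delta>" for x y
    proof -
      have in1: "w + x *\<^sub>R h \<in> cball 0 \<rho>" "w' + y *\<^sub>R h \<in> cball 0 \<rho>" using wT[OF w(1), of x] wT[OF w(2), of y] xy \<delta> by linarith+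
      let ?d = "(w + x *\<^sub>R h) - (w' + y *\<^sub>R h)"
      have "norm ((x - y) *\<^sub>R h) \<le> 2 * \<delta> * norm h"
        unfolding norm_scaleR using xy by (intro mult_right_mono) auto
      then have e: "norm ((x - y) *\<^sub>R h) \<le> norm (w - w') / 2" using far by (simp add: mult_ac)
      have d: "?d = (w - w') + (x - y) *\<^sub>R h" by (simp add: algebra_simps)
      have d1: "norm ?d \<ge> norm (w - w') / 2"
        unfolding d using norm_diff_ineq[of "w - w'" "(x - y) *\<^sub>R h"] e by linarith
      have d2: "norm ?d \<le> 3 / 2 * norm (w - w')"
        unfolding d using norm_triangle_ineq[of "w - w'" "(x - y) *\<^sub>R h"] e by linarith
      have "r \<le> c * norm ?d" using d1 c by (simp add: r_def)
      also have "\<dots> \<le> norm (?F x - ?E y)" by (rule c(2)[OF in1])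
      finally have 1: "r \<le> norm (?F x - ?E y)" .
      have "norm (?F x - ?E y) \<le> Lf * norm ?d" by (rule Lf[OF in1])
      also have "\<dots> \<le> Lf * (3 / 2 * norm (w - w'))" using d2 Lf0 by (intro mult_left_mono) auto
      also have "\<dots> = (3 * Lf / c) * r" using c by (simp add: r_def)
      also have "\<dots> \<le> L * r" using r by (intro mult_right_mono) (auto simp: L_def)
      finally have 2: "norm (?F x - ?E y) \<le> L * r" .
      have "norm ?d \<le> \<rho> + \<rho>" using in1 by (intro order_trans[OF norm_triangle_ineq4]) auto
      then have "Lf * norm ?d \<le> Lf * (2 * \<rho>)" using Lf0 by (intro mult_left_mono) auto
      then have 3: "norm (?F x - ?E y) \<le> D" using Lf[OF in1] by (simp add: D_def le_max_iff_disj)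
      show ?thesis using 1 2 3 by blast
    qed
    have rD: "r \<le> D" using sep[of 0 0] \<delta> by auto
    define \<phi> where "\<phi> x y = R (cmod (?F x - ?E y))" for x y
    have phi: "\<phi> x y = R (sqrt ((cmod (?F x - ?E y))\<^sup>2))" for x y by (simp add: \<phi>_def)
    have LL: "norm (dir_deriv h f (z + x *\<^sub>R h)) \<le> L" "norm (dir_deriv2 h f (z + x *\<^sub>R h)) \<le> L"
      if "z \<in> S" "0 \<le> x" "x \<le> 2 * \<delta>" for z x
      using L1(2)[OF wT[of z x]] L2(2)[OF wT[of z x]] that \<delta> unfolding L_def by linarith+
    have bd: "\<bar>(\<phi> (2 * \<delta>) y1 - \<phi> (2 * \<delta>) y0) - 2 * (\<phi> \<delta> y1 - \<phi> \<delta> y0) + (\<phi> 0 y1 - \<phi> 0 y0)\<bar>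
        \<le> \<delta>\<^sup>2 * ((y1 - y0) * (B * r powr (\<alpha> - 3)))" if y: "0 \<le> y0" "y0 < y1" "y1 \<le> 2 * \<delta>" for y0 y1
      unfolding phi B_def
      by (rule mixed_difference_bound[where H = "\<lambda>q. R (sqrt q)" and ?H1.0 = H1 and ?H2.0 = H2
            and ?H3.0 = H3 and F = ?F and ?F1.0 = "\<lambda>x. dir_deriv h f (w + x *\<^sub>R h)"
            and ?F2.0 = "\<lambda>x. dir_deriv2 h f (w + x *\<^sub>R h)" and E = ?E
            and ?E1.0 = "\<lambda>y. dir_deriv h f (w' + y *\<^sub>R h)"];
          (rule H Hb \<alpha>(2) C0 L r rD \<delta>(1) C1_curve[OF C1] C2_curve[OF f] LL w(1,2) sep y; (assumption | rule w)?))
    have G1: "\<bar>(\<phi> (2 * \<delta>) (2 * \<delta>) - \<phi> (2 * \<delta>) \<delta>) - 2 * (\<phi> \<delta> (2 * \<delta>) - \<phi> \<delta> \<delta>) + (\<phi> 0 (2 * \<delta>) - \<phi> 0 \<delta>)\<bar>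
        \<le> \<delta> ^ 3 * (B * r powr (\<alpha> - 3))"
      using bd[of \<delta> "2 * \<delta>"] \<delta> by (simp add: eval_nat_numeral mult_ac)
    have G2: "\<bar>(\<phi> (2 * \<delta>) \<delta> - \<phi> (2 * \<delta>) 0) - 2 * (\<phi> \<delta> \<delta> - \<phi> \<delta> 0) + (\<phi> 0 \<delta> - \<phi> 0 0)\<bar>
        \<le> \<delta> ^ 3 * (B * r powr (\<alpha> - 3))"
      using bd[of 0 \<delta>] \<delta> by (simp add: eval_nat_numeral mult_ac)
    have rp: "r powr (\<alpha> - 3) = (c / 2) powr (\<alpha> - 3) * norm (w - w') powr (\<alpha> - 3)"
      unfolding r_def by (rule powr_mult)
    have "\<bar>(\<phi> (2 * \<delta>) (2 * \<delta>) - 2 * \<phi> (2 * \<delta>) \<delta> + \<phi> (2 * \<delta>) 0)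
        - 2 * (\<phi> \<delta> (2 * \<delta>) - 2 * \<phi> \<delta> \<delta> + \<phi> \<delta> 0)
        + (\<phi> 0 (2 * \<delta>) - 2 * \<phi> 0 \<delta> + \<phi> 0 0)\<bar> \<le> 2 * (\<delta> ^ 3 * (B * r powr (\<alpha> - 3)))"
      by (rule abs_second_difference_le[OF G1 G2])
    also have "\<dots> = 2 * B * (c / 2) powr (\<alpha> - 3) * \<delta> ^ 3 * norm (w - w') powr (\<alpha> - 3)"
      unfolding rp by (simp only: mult_ac)
    finally show "let G = (\<lambda>x y. R (cmod (f (w + (x * \<delta>) *\<^sub>R h) - f (w' + (y * \<delta>) *\<^sub>R h)))) in
     \<bar>(G 2 2 - 2 * G 2 1 + G 2 0) - 2 * (G 1 2 - 2 * G 1 1 + G 1 0) + (G 0 2 - 2 * G 0 1 + G 0 0)\<bar>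
       \<le> 2 * B * (c / 2) powr (\<alpha> - 3) * \<delta> ^ 3 * norm (w - w') powr (\<alpha> - 3)"
      unfolding Let_def \<phi>_def[symmetric] by (simp only: mult_1 mult_zero_left)
  qed
qed

subsection \<open>The grid\<close>

definition grid_point :: "nat \<Rightarrow> complex \<Rightarrow> complex" where
  "grid_point n x = Complex (of_int \<lfloor>real n * Re x\<rfloor> / real n) (of_int \<lfloor>real n * Im x\<rfloor> / real n)"

text \<open>Half-open, so that the cells with corners in the lattice tile the plane, and
  \<open>x\<close> lies in exactly the one with corner \<open>grid_point n x\<close>.\<close>

definition cell :: "nat \<Rightarrow> complex \<Rightarrow> complex set" where
  "cell n w = {x. Re w \<le> Re x \<and> Re x < Re w + 1 / real n \<and> Im w \<le> Im x \<and> Im x < Im w + 1 / real n}"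

lemma cell_iff_grid_point:
  assumes n: "n \<ge> 1" and w: "w = Complex (of_int j / real n) (of_int k / real n)"
  shows "x \<in> cell n w \<longleftrightarrow> grid_point n x = w"
proof -
  have *: "(of_int j / real n \<le> r \<and> r < of_int j / real n + 1 / real n) \<longleftrightarrow> \<lfloor>real n * r\<rfloor> = j" for j r
    using n by (auto simp: floor_eq_iff field_simps)
  have "grid_point n x = w \<longleftrightarrow> \<lfloor>real n * Re x\<rfloor> = j \<and> \<lfloor>real n * Im x\<rfloor> = k"
    using n by (simp add: grid_point_def w)
  then show ?thesis
    using *[of j "Re x"] *[of k "Im x"] by (auto simp: cell_def w)
qed

lemma grid_point_in_grid: "grid_point n x \<in> \<Omega> \<Longrightarrow> grid_point n x \<in> grid \<Omega> n"
  unfolding grid_def grid_point_def by blast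

lemma dist_grid_point:
  assumes n: "n \<ge> 1"
  shows "norm (grid_point n x - x) \<le> 2 / real n"
proof -
  have *: "\<bar>of_int \<lfloor>real n * r\<rfloor> / real n - r\<bar> \<le> 1 / real n" for r
  proof -
    have "\<bar>of_int \<lfloor>real n * r\<rfloor> - real n * r\<bar> \<le> 1" by linarith
    then have "\<bar>of_int \<lfloor>real n * r\<rfloor> - real n * r\<bar> / real n \<le> 1 / real n"
      using n by (intro divide_right_mono) auto
    also have "\<bar>of_int \<lfloor>real n * r\<rfloor> - real n * r\<bar> / real n = \<bar>(of_int \<lfloor>real n * r\<rfloor> - real n * r) / real n\<bar>"
      by (simp add: abs_divide)
    also have "(of_int \<lfloor>real n * r\<rfloor> - real n * r) / real n = of_int \<lfloor>real n * r\<rfloor> / real n - r"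
      using n by (simp add: diff_divide_distrib)
    finally show ?thesis .
  qed
  have "norm (grid_point n x - x) \<le> \<bar>Re (grid_point n x - x)\<bar> + \<bar>Im (grid_point n x - x)\<bar>"
    by (rule cmod_le)
  also have "\<dots> \<le> 1 / real n + 1 / real n"
    using *[of "Re x"] *[of "Im x"] by (intro add_mono) (auto simp: grid_point_def)
  finally show ?thesis by simp
qed

lemma inj_grid_coordinates:
  assumes n: "n \<ge> 1"
  shows "inj_on (\<lambda>w. (\<lfloor>real n * Re w\<rfloor>, \<lfloor>real n * Im w\<rfloor>)) (grid \<Omega> n)"
  using n by (auto simp: inj_on_def grid_def)

lemma grid_coordinates_bounded:
  assumes "bounded \<Omega>"
  shows "\<exists>B\<ge>1. \<forall>n\<ge>1. (\<lambda>w. (\<lfloor>real n * Re w\<rfloor>, \<lfloor>real n * Im w\<rfloor>)) ` grid \<Omega> n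
    \<subseteq> {-\<lceil>real n * B\<rceil>-1..\<lceil>real n * B\<rceil>} \<times> {-\<lceil>real n * B\<rceil>-1..\<lceil>real n * B\<rceil>}"
proof -
  obtain B where B: "\<And>w. w \<in> \<Omega> \<Longrightarrow> norm w \<le> B" using assms unfolding bounded_iff by blast
  define B' where "B' = max 1 B"
  have "(\<lfloor>real n * Re w\<rfloor>, \<lfloor>real n * Im w\<rfloor>)
      \<in> {-\<lceil>real n * B'\<rceil>-1..\<lceil>real n * B'\<rceil>} \<times> {-\<lceil>real n * B'\<rceil>-1..\<lceil>real n * B'\<rceil>}" if "w \<in> grid \<Omega> n" for n w
  proof -
    have *: "\<lfloor>real n * r\<rfloor> \<in> {-\<lceil>real n * B'\<rceil>-1..\<lceil>real n * B'\<rceil>}" if "\<bar>r\<bar> \<le> B'" for r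
    proof -
      have "\<bar>real n * r\<bar> \<le> real n * B'" unfolding abs_mult using that by (intro mult_mono) auto
      then have 1: "real n * r \<le> real n * B'" and 2: "- (real n * B') \<le> real n * r" by linarith+
      have "\<lfloor>real n * r\<rfloor> \<le> \<lceil>real n * B'\<rceil>" using 1 by linarith
      moreover have "-\<lceil>real n * B'\<rceil>-1 \<le> \<lfloor>real n * r\<rfloor>" using 2 by linarith
      ultimately show ?thesis by simp
    qed
    have "norm w \<le> B'" using B[of w] that by (auto simp: grid_def B'_def)
    then have "\<bar>Re w\<bar> \<le> B'" "\<bar>Im w\<bar> \<le> B'" using abs_Re_le_cmod[of w] abs_Im_le_cmod[of w] by linarith+
    then show ?thesis using * by blast
  qed
  then show ?thesis by (intro exI[of _ B'] conjI allI impI image_subsetI) (auto simp: B'_def)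
qed

lemma finite_grid:
  assumes "bounded \<Omega>" "n \<ge> 1"
  shows "finite (grid \<Omega> n)"
proof -
  obtain B where "(\<lambda>w. (\<lfloor>real n * Re w\<rfloor>, \<lfloor>real n * Im w\<rfloor>)) ` grid \<Omega> n
    \<subseteq> {-\<lceil>real n * B\<rceil>-1..\<lceil>real n * B\<rceil>} \<times> {-\<lceil>real n * B\<rceil>-1..\<lceil>real n * B\<rceil>}"
    using grid_coordinates_bounded[OF assms(1)] assms(2) by blast
  then have "finite ((\<lambda>w. (\<lfloor>real n * Re w\<rfloor>, \<lfloor>real n * Im w\<rfloor>)) ` grid \<Omega> n)"
    by (rule finite_subset) simp
  then show ?thesis by (rule finite_imageD[OF _ inj_grid_coordinates[OF assms(2)]])
qed

lemma card_grid_le: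
  assumes "bounded \<Omega>"
  shows "\<exists>C. \<forall>n\<ge>1. real (card (grid \<Omega> n)) \<le> C * (real n)\<^sup>2"
proof -
  obtain B where B: "B \<ge> 1" and sub: "\<And>n. n \<ge> 1 \<Longrightarrow> (\<lambda>w. (\<lfloor>real n * Re w\<rfloor>, \<lfloor>real n * Im w\<rfloor>)) ` grid \<Omega> n
    \<subseteq> {-\<lceil>real n * B\<rceil>-1..\<lceil>real n * B\<rceil>} \<times> {-\<lceil>real n * B\<rceil>-1..\<lceil>real n * B\<rceil>}"
    using grid_coordinates_bounded[OF assms] by blast
  \<comment> \<open>With \<open>N \<le> n B + 1\<close> and \<open>n B \<ge> 1\<close>, the side
    \<open>2 * N + 2\<close> is at most \<open>6 n B\<close>, so the factor 7 leaves room.\<close>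
  have "real (card (grid \<Omega> n)) \<le> (7 * B)\<^sup>2 * (real n)\<^sup>2" if n: "n \<ge> 1" for n
  proof -
    define N where "N = \<lceil>real n * B\<rceil>"
    have N1: "real_of_int N \<le> real n * B + 1" unfolding N_def by linarith
    have n1: "1 \<le> real n * B" using mult_mono[of 1 "real n" 1 B] n B by simp
    have N0: "N \<ge> 0" unfolding N_def using n1 by linarith
    have "card (grid \<Omega> n) = card ((\<lambda>w. (\<lfloor>real n * Re w\<rfloor>, \<lfloor>real n * Im w\<rfloor>)) ` grid \<Omega> n)"
      by (rule card_image[OF inj_grid_coordinates[OF n], symmetric])
    also have "\<dots> \<le> card ({-N-1..N} \<times> {-N-1..N})"
      by (rule card_mono) (use sub[OF n] in \<open>simp_all add: N_def\<close>)
    also have "\<dots> = (nat (2 * N + 2))\<^sup>2" by (simp add: card_cartesian_product power2_eq_square add.commute)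
    finally have "real (card (grid \<Omega> n)) \<le> (real (nat (2 * N + 2)))\<^sup>2"
      by (simp flip: of_nat_power)
    also have "real (nat (2 * N + 2)) = 2 * of_int N + 2" using N0 by simp
    also have "(2 * of_int N + 2)\<^sup>2 \<le> (7 * (real n * B))\<^sup>2"
      using N1 n1 N0 by (intro power_mono) auto
    finally show ?thesis by (simp add: power_mult_distrib mult_ac)
  qed
  then show ?thesis by blast
qed

section \<open>Summation of powers over the lattice\<close>

lemma int_power_sum_bounded:
  assumes "\<eta> > 0"
  shows "\<exists>U. \<forall>A::int set. finite A \<longrightarrow> (\<Sum>a\<in>A. max 1 \<bar>real_of_int a\<bar> powr (-1-\<eta>)) \<le> U"
proof -
  \<comment> \<open>The maximum with 1 gives the term at 0 the value 1; \<open>0 powr x\<close>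
    would be 0. Integers are afterwards split by sign, so that the absolute value is injective on
    each half.\<close>
  define u where "u m = max 1 (real m) powr (-1-\<eta>)" for m :: nat
  have "summable (\<lambda>m. real m powr (-1-\<eta>))" using assms by (subst summable_real_powr_iff) auto
  moreover have "\<forall>\<^sub>F m in sequentially. real m powr (-1-\<eta>) = u m"
    using eventually_ge_at_top[of 1] by eventually_elim (simp add: u_def)
  ultimately have su: "summable u" using summable_cong by fast
  have u0: "u m \<ge> 0" for m by (simp add: u_def)
  have half: "(\<Sum>a\<in>A. max 1 \<bar>real_of_int a\<bar> powr (-1-\<eta>)) \<le> suminf u"
    if A: "finite A" "inj_on (\<lambda>a. nat \<bar>a\<bar>) A" for A
  proof -
    have "(\<Sum>a\<in>A. max 1 \<bar>real_of_int a\<bar> powr (-1-\<eta>)) = (\<Sum>a\<in>A. u (nat \<bar>a\<bar>))"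
      by (intro sum.cong) (auto simp: u_def)
    also have "\<dots> = sum u ((\<lambda>a. nat \<bar>a\<bar>) ` A)" by (simp add: sum.reindex[OF A(2)])
    also have "\<dots> \<le> suminf u" by (rule sum_le_suminf[OF su]) (use A u0 in auto)
    finally show ?thesis .
  qed
  show ?thesis
  proof (intro exI[of _ "suminf u + suminf u"] allI impI)
    fix A :: "int set" assume A: "finite A"
    have "(\<Sum>a\<in>A. max 1 \<bar>real_of_int a\<bar> powr (-1-\<eta>))
        = (\<Sum>a\<in>A \<inter> {0..}. max 1 \<bar>real_of_int a\<bar> powr (-1-\<eta>)) + (\<Sum>a\<in>A \<inter> {..<0}. max 1 \<bar>real_of_int a\<bar> powr (-1-\<eta>))"
      by (subst sum.union_disjoint[symmetric]) (use A in \<open>auto intro!: sum.cong\<close>)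
    also have "\<dots> \<le> suminf u + suminf u"
      by (intro add_mono half) (use A in \<open>auto simp: inj_on_def\<close>)
    finally show "(\<Sum>a\<in>A. max 1 \<bar>real_of_int a\<bar> powr (-1-\<eta>)) \<le> suminf u + suminf u" .
  qed
qed

text \<open>For a nonzero integer vector (a, b) the product of max 1 |a| and max 1 |b| is at most
  a^2 + b^2. Hence the power -2-2\<eta> of the norm is dominated by a product of powers -1-\<eta> of
  the coordinates, and the planar sum factors into two convergent one-dimensional sums, uniformly in
  \<open>n\<close> and \<open>w\<close>.\<close>

lemma grid_power_sum_bounded:
  assumes \<Omega>: "bounded \<Omega>" and \<eta>: "\<eta> > 0" and C: "C \<ge> 0" "k0 > 0"
  shows "\<exists>U\<ge>0. \<forall>n\<ge>1. \<forall>w\<in>grid \<Omega> n. \<forall>g.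
    (\<forall>w'\<in>grid \<Omega> n. g w' \<le> C \<and> (k0 \<le> real n * norm (w - w') \<and> w \<noteq> w' \<longrightarrow> g w' \<le> C * (real n * norm (w - w')) powr (-2 - 2 * \<eta>)))
    \<longrightarrow> (\<Sum>w'\<in>grid \<Omega> n. g w') \<le> U"
proof -
  let ?u = "\<lambda>a::int. max 1 \<bar>real_of_int a\<bar> powr (-1-\<eta>)"
  obtain U where U: "\<And>A. finite A \<Longrightarrow> sum ?u A \<le> U"
    using int_power_sum_bounded[OF \<eta>] by blast
  have U0: "U \<ge> 0" using U[of "{}"] by simp
  \<comment> \<open>The second summand serves the near points: below the distance \<open>k0\<close>
    the plain bound \<open>C\<close> is itself at most
    \<open>C * (max 1 k0) powr (2 + 2 * \<eta>)\<close> times the power of the distance.\<close>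
  define C' where "C' = C * (1 + (max 1 k0) powr (2 + 2 * \<eta>))"
  have C'0: "C' \<ge> 0" using C by (simp add: C'_def)
  show ?thesis
  proof (intro exI[of _ "C' * (U * U)"] conjI allI impI ballI)
    show "0 \<le> C' * (U * U)" using C'0 U0 by simp
    fix n :: nat and w g
    assume n: "1 \<le> n" and w: "w \<in> grid \<Omega> n"
      and g: "\<forall>w'\<in>grid \<Omega> n. g w' \<le> C \<and> (k0 \<le> real n * norm (w - w') \<and> w \<noteq> w' \<longrightarrow> g w' \<le> C * (real n * norm (w - w')) powr (-2 - 2 * \<eta>))"
    let ?c = "\<lambda>w'. (\<lfloor>real n * Re w\<rfloor> - \<lfloor>real n * Re w'\<rfloor>, \<lfloor>real n * Im w\<rfloor> - \<lfloor>real n * Im w'\<rfloor>)"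
    have inj: "inj_on ?c (grid \<Omega> n)"
      using inj_grid_coordinates[OF n, of \<Omega>] by (auto simp: inj_on_def)
    note fin = finite_grid[OF \<Omega> n]
    have le: "g w' \<le> C' * (?u (fst (?c w')) * ?u (snd (?c w')))" if w': "w' \<in> grid \<Omega> n" for w'
    proof -
      obtain j k j' k' where jk: "w = Complex (of_int j / real n) (of_int k / real n)"
         "w' = Complex (of_int j' / real n) (of_int k' / real n)"
        using w w' unfolding grid_def by blast
      define a b where "a = j - j'" and "b = k - k'"
      have c: "?c w' = (a, b)" using n by (simp add: jk a_def b_def)
      have "real n * norm (w - w') = norm (of_real (real n) * (w - w'))" by (simp add: norm_mult)
      also have "of_real (real n) * (w - w') = Complex (of_int a) (of_int b)"
        using n by (simp add: jk complex_eq_iff a_def b_def field_simps)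
      finally have d: "real n * norm (w - w') = sqrt ((of_int a)\<^sup>2 + (of_int b)\<^sup>2)"
        by (simp add: cmod_def)
      show ?thesis
      proof (cases "w = w'")
        case True
        then have "a = 0" "b = 0" using n jk by (auto simp: a_def b_def)
        then have "?u (fst (?c w')) * ?u (snd (?c w')) = 1" by (simp add: c)
        moreover have "g w' \<le> C * 1" using g w' by simp
        moreover have "C * 1 \<le> C'" unfolding C'_def using C by (intro mult_left_mono) auto
        ultimately show ?thesis by simp
      next
        case False
        define s where "s = real n * norm (w - w')"
        define m where "m = max 1 \<bar>real_of_int a\<bar> * max 1 \<bar>real_of_int b\<bar>"
        have ab: "a \<noteq> 0 \<or> b \<noteq> 0" using False by (auto simp: jk a_def b_def)
        have sq: "\<bar>x\<bar> \<le> x\<^sup>2" if "x \<in> \<int>" for x :: real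
        proof -
          have "\<bar>x\<bar> * 1 \<le> \<bar>x\<bar> * \<bar>x\<bar>"
          proof (cases "x = 0")
            case False
            then show ?thesis by (intro mult_left_mono Ints_nonzero_abs_ge1 that) auto
          qed simp
          then show ?thesis by (simp add: power2_eq_square)
        qed
        have m: "0 < m" "m \<le> s\<^sup>2"
        proof -
          show "0 < m" by (simp add: m_def less_max_iff_disj)
          have A: "1 \<le> \<bar>real_of_int a\<bar>" if "a \<noteq> 0" using that by linarith
          have B: "1 \<le> \<bar>real_of_int b\<bar>" if "b \<noteq> 0" using that by linarith
          have "m \<le> (of_int a)\<^sup>2 + (of_int b)\<^sup>2"
          proof (cases "a = 0 \<or> b = 0")
            case True
            then show ?thesis using ab A B sq[of "of_int a"] sq[of "of_int b"] by (auto simp: m_def)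
          next
            case False
            then have "m = \<bar>real_of_int a\<bar> * \<bar>real_of_int b\<bar>" using A B by (simp add: m_def)
            moreover have "2 * \<bar>real_of_int a\<bar> * \<bar>real_of_int b\<bar> \<le> (of_int a)\<^sup>2 + (of_int b)\<^sup>2"
              using sum_squares_bound[of "\<bar>real_of_int a\<bar>" "\<bar>real_of_int b\<bar>"] by simp
            moreover have "0 \<le> \<bar>real_of_int a\<bar> * \<bar>real_of_int b\<bar>" by simp
            ultimately show ?thesis by linarith
          qed
          then show "m \<le> s\<^sup>2" by (simp add: s_def d)
        qed
        have s0: "s > 0" using False n by (simp add: s_def)
        have ss: "s powr (-2 - 2 * \<eta>) = (s\<^sup>2) powr (-1-\<eta>)"
          using s0 powr_powr[of s 2 "-1-\<eta>"] by (simp add: powr_numeral algebra_simps)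
        have mm: "(s\<^sup>2) powr (-1-\<eta>) \<le> m powr (-1-\<eta>)"
          using m \<eta> by (intro powr_mono2') auto
        have me: "m powr (-1-\<eta>) = ?u (fst (?c w')) * ?u (snd (?c w'))"
          by (simp add: m_def c powr_mult)
        have "g w' \<le> C' * m powr (-1-\<eta>)"
        proof (cases "k0 \<le> s")
          case True
          then have "g w' \<le> C * s powr (-2 - 2 * \<eta>)" using g w' False by (simp add: s_def)
          also have "\<dots> \<le> C * m powr (-1-\<eta>)" unfolding ss using mm C by (intro mult_left_mono) auto
          also have "\<dots> \<le> C' * m powr (-1-\<eta>)" unfolding C'_def
            using C mult_left_mono[of 1 "1 + max 1 k0 powr (2 + 2 * \<eta>)" C] by (intro mult_right_mono) auto
          finally show ?thesis .
        next
          case f: False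
          have "1 = (max 1 k0) powr (2 + 2 * \<eta>) * (max 1 k0) powr (-2 - 2 * \<eta>)"
            by (simp add: powr_add[symmetric])
          also have "\<dots> \<le> (max 1 k0) powr (2 + 2 * \<eta>) * s powr (-2 - 2 * \<eta>)"
            using f s0 \<eta> by (intro mult_left_mono powr_mono2') auto
          also have "\<dots> \<le> (max 1 k0) powr (2 + 2 * \<eta>) * m powr (-1-\<eta>)"
            unfolding ss using mm by (intro mult_left_mono) auto
          also have "\<dots> \<le> (1 + (max 1 k0) powr (2 + 2 * \<eta>)) * m powr (-1-\<eta>)"
            by (intro mult_right_mono) auto
          finally have "C * 1 \<le> C * ((1 + (max 1 k0) powr (2 + 2 * \<eta>)) * m powr (-1-\<eta>))"
            using C by (intro mult_left_mono) auto
          moreover have "g w' \<le> C" using g w' by simp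
          ultimately show ?thesis by (simp add: C'_def mult_ac)
        qed
        then show ?thesis by (simp only: me)
      qed
    qed
    \<comment> \<open>The differences of coordinates are enclosed in a finite product set; the added
      terms are nonnegative.\<close>
    define A where "A = fst ` ?c ` grid \<Omega> n"
    define B where "B = snd ` ?c ` grid \<Omega> n"
    have AB: "finite A" "finite B" "?c ` grid \<Omega> n \<subseteq> A \<times> B" using fin
      by (auto simp: A_def B_def intro!: finite_imageI) (force simp: image_image)+
    have "(\<Sum>w'\<in>grid \<Omega> n. g w') \<le> (\<Sum>w'\<in>grid \<Omega> n. C' * (?u (fst (?c w')) * ?u (snd (?c w'))))"
      by (intro sum_mono le)
    also have "\<dots> = (\<Sum>p\<in>?c ` grid \<Omega> n. C' * (?u (fst p) * ?u (snd p)))"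
      by (simp only: sum.reindex[OF inj] o_def)
    also have "\<dots> \<le> (\<Sum>p\<in>A \<times> B. C' * (?u (fst p) * ?u (snd p)))"
      by (rule sum_mono2) (use AB C'0 in auto)
    also have "\<dots> = C' * (sum ?u A * sum ?u B)"
    proof -
      have "(\<Sum>p\<in>A \<times> B. ?u (fst p) * ?u (snd p)) = sum ?u A * sum ?u B"
        by (simp only: sum_product sum.cartesian_product case_prod_unfold)
      then show ?thesis by (simp only: sum_distrib_left[symmetric])
    qed
    also have "\<dots> \<le> C' * (U * U)"
      using C'0 U0 U[OF AB(1)] U[OF AB(2)] by (intro mult_left_mono mult_mono sum_nonneg) auto
    finally show "(\<Sum>w'\<in>grid \<Omega> n. g w') \<le> C' * (U * U)" .
  qed
qed

subsection \<open>Riemann sums over the grid\<close>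

text \<open>The test is made on \<open>grid_point n x\<close> and not on \<open>x\<close>, so that
  whole cells are kept or dropped and the integral is exactly the grid sum divided by
  \<open>n\<^sup>2\<close>.\<close>

definition step_fun :: "nat \<Rightarrow> complex set \<Rightarrow> (complex \<Rightarrow> real) \<Rightarrow> complex \<Rightarrow> real" where
  "step_fun n \<Omega> c x = (if grid_point n x \<in> \<Omega> then c (grid_point n x) else 0)"

lemma cell_measurable [measurable]: "cell n w \<in> sets borel"
  unfolding cell_def by measurable

lemma step_fun_eq_sum:
  assumes "bounded \<Omega>" "n \<ge> 1"
  shows "step_fun n \<Omega> c x = (\<Sum>w\<in>grid \<Omega> n. c w * indicator (cell n w) x)"
proof -
  have "(\<Sum>w\<in>grid \<Omega> n. c w * indicator (cell n w) x) = (\<Sum>w\<in>grid \<Omega> n. if w = grid_point n x then c w else 0)"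
  proof (intro sum.cong refl)
    fix w assume "w \<in> grid \<Omega> n"
    then obtain j k where "w = Complex (of_int j / real n) (of_int k / real n)" unfolding grid_def by blast
    from cell_iff_grid_point[OF assms(2) this, of x]
    show "c w * indicator (cell n w) x = (if w = grid_point n x then c w else 0)"
      by (auto simp: indicator_def)
  qed
  also have "\<dots> = (if grid_point n x \<in> grid \<Omega> n then c (grid_point n x) else 0)"
    by (simp add: finite_grid[OF assms] sum.delta)
  also have "\<dots> = step_fun n \<Omega> c x"
    using grid_point_in_grid[of n x \<Omega>] by (auto simp: step_fun_def grid_def)
  finally show ?thesis by simp
qed

lemma step_fun_measurable:
  assumes "bounded \<Omega>" "n \<ge> 1"
  shows "step_fun n \<Omega> c \<in> borel_measurable borel"
  unfolding step_fun_eq_sum[OF assms, abs_def] by measurable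

lemma measure_cell:
  assumes "n \<ge> 1"
  shows "emeasure lborel (cell n w) = ennreal (1 / (real n)\<^sup>2)"
proof (rule antisym)
  let ?u = "w + Complex (1 / real n) (1 / real n)"
  have e: "emeasure lborel (cbox w ?u) = ennreal (1 / (real n)\<^sup>2)" "emeasure lborel (box w ?u) = ennreal (1 / (real n)\<^sup>2)"
    using assms by (simp_all add: emeasure_lborel_cbox_eq emeasure_lborel_box_eq Basis_complex_def
        inner_complex_def power2_eq_square)
  have "cell n w \<subseteq> cbox w ?u" "box w ?u \<subseteq> cell n w"
    by (auto simp: cell_def in_cbox_complex_iff in_box_complex_iff)
  then have "emeasure lborel (cell n w) \<le> emeasure lborel (cbox w ?u)" "emeasure lborel (box w ?u) \<le> emeasure lborel (cell n w)"
    by (auto intro!: emeasure_mono)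
  then show "emeasure lborel (cell n w) \<le> ennreal (1 / (real n)\<^sup>2)" "ennreal (1 / (real n)\<^sup>2) \<le> emeasure lborel (cell n w)"
    by (simp_all only: e)
qed

lemma step_fun_integral:
  assumes "bounded \<Omega>" "n \<ge> 1"
  shows "integrable lborel (step_fun n \<Omega> c)"
    "(LINT x|lborel. step_fun n \<Omega> c x) = (\<Sum>w\<in>grid \<Omega> n. c w) / (real n)\<^sup>2"
proof -
  have i: "integrable lborel (\<lambda>x. c w * indicator (cell n w) x)" for w
    by (intro integrable_mult_right integrable_real_indicator) (simp_all add: measure_cell[OF assms(2)])
  then show "integrable lborel (step_fun n \<Omega> c)"
    unfolding step_fun_eq_sum[OF assms, abs_def] by (intro Bochner_Integration.integrable_sum)
  have "measure lborel (cell n w) = 1 / (real n)\<^sup>2" for w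
    by (simp add: measure_def measure_cell[OF assms(2)])
  then show "(LINT x|lborel. step_fun n \<Omega> c x) = (\<Sum>w\<in>grid \<Omega> n. c w) / (real n)\<^sup>2"
    unfolding step_fun_eq_sum[OF assms, abs_def] using i
    by (simp add: sum_divide_distrib)
qed

lemma lborel_integral_affine:
  fixes g :: "complex \<Rightarrow> real"
  assumes [measurable]: "g \<in> borel_measurable borel" and c: "c > 0"
  shows "(LINT x|lborel. g x) = c\<^sup>2 * (LINT x|lborel. g (t + c *\<^sub>R x))"
proof -
  have "(LINT x|lborel. g x) = (LINT x|density (distr lborel borel (\<lambda>x. t + c *\<^sub>R x)) (\<lambda>_. ennreal (\<bar>c\<bar>^DIM(complex))). g x)"
    using lborel_affine[of c t] c by simp
  also have "\<dots> = (LINT x|distr lborel borel (\<lambda>x. t + c *\<^sub>R x). \<bar>c\<bar>^DIM(complex) * g x)"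
    by (subst integral_density) auto
  also have "\<dots> = (LINT x|lborel. \<bar>c\<bar>^DIM(complex) * g (t + c *\<^sub>R x))"
    by (subst integral_distr) auto
  finally show ?thesis using c by simp
qed

lemma lborel_integrable_affine:
  fixes g :: "complex \<Rightarrow> real"
  assumes g: "integrable lborel g" and c: "c > 0"
  shows "integrable lborel (\<lambda>x. g (t + c *\<^sub>R x))"
proof -
  have [measurable]: "g \<in> borel_measurable borel" using borel_measurable_integrable[OF g] by simp
  have "integrable (density (distr lborel borel (\<lambda>x. t + c *\<^sub>R x)) (\<lambda>_. ennreal (\<bar>c\<bar>^DIM(complex)))) g"
    using lborel_affine[of c t] c g by simp
  then have "integrable (distr lborel borel (\<lambda>x. t + c *\<^sub>R x)) (\<lambda>x. \<bar>c\<bar>^DIM(complex) * g x)"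
    by (subst (asm) integrable_density) auto
  then have "integrable lborel (\<lambda>x. \<bar>c\<bar>^DIM(complex) * g (t + c *\<^sub>R x))"
    by (subst (asm) integrable_distr_eq) auto
  then show ?thesis using c by simp
qed

text \<open>Only the kernel factor is released from the grid, while \<open>s\<close> stays a step
  function; so no regularity of \<open>s\<close> is involved. The argument of the kernel moves by at
  most 2 / (n b), and the normalisation 1 / b^2 turns this into an error of order 1 / (n
  b^3).\<close>

lemma riemann_sum_error:
  fixes k s :: "complex \<Rightarrow> real"
  assumes \<Omega>: "bounded \<Omega>" and n: "n \<ge> 1" and b: "b > 0" and L: "L \<ge> 0"
    and k: "k \<in> borel_measurable borel" and lip: "\<And>x y. \<bar>k x - k y\<bar> \<le> L * norm (x - y)"
    and s: "\<forall>w\<in>grid \<Omega> n. \<bar>s w\<bar> \<le> C" and C: "C \<ge> 0"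
  shows "integrable lborel (\<lambda>y. k y * step_fun n \<Omega> s (t + b *\<^sub>R y))"
    "\<bar>1 / ((real n)\<^sup>2 * b\<^sup>2) * (\<Sum>w\<in>grid \<Omega> n. k ((w - t) / of_real b) * s w)
      - (LINT y|lborel. k y * step_fun n \<Omega> s (t + b *\<^sub>R y))\<bar>
    \<le> 2 * L * C * (real (card (grid \<Omega> n)) / (real n)\<^sup>2) / (real n * b ^ 3)"
proof -
  note [measurable] = k step_fun_measurable[OF \<Omega> n]
  define g where "g x = k ((x - t) / of_real b) * step_fun n \<Omega> s x" for x
  define g' where "g' x = step_fun n \<Omega> (\<lambda>w. k ((w - t) / of_real b) * s w) x" for x
  define E where "E = 2 * L * C / (real n * b)"
  have gm[measurable]: "g \<in> borel_measurable borel" unfolding g_def by measurable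
  have g'm[measurable]: "g' \<in> borel_measurable borel" unfolding g'_def by measurable
  have g'i: "integrable lborel g'" unfolding g'_def by (rule step_fun_integral(1)[OF \<Omega> n])
  have 1: "integrable lborel (\<lambda>x. E * step_fun n \<Omega> (\<lambda>_. 1) x)"
    by (intro integrable_mult_right step_fun_integral(1)[OF \<Omega> n])
  have diff: "\<bar>g' x - g x\<bar> \<le> E * step_fun n \<Omega> (\<lambda>_. 1) x" for x
  proof (cases "grid_point n x \<in> \<Omega>")
    case True
    let ?w = "grid_point n x"
    have "g' x - g x = (k ((?w - t) / of_real b) - k ((x - t) / of_real b)) * s ?w"
      using True by (simp add: g_def g'_def step_fun_def algebra_simps)
    also have "\<bar>\<dots>\<bar> \<le> (2 * L / (real n * b)) * C"
      unfolding abs_mult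
    proof (intro mult_mono s[rule_format] grid_point_in_grid True)
      have "\<bar>k ((?w - t) / of_real b) - k ((x - t) / of_real b)\<bar> \<le> L * norm ((?w - t) / of_real b - (x - t) / of_real b)"
        by (rule lip)
      also have "(?w - t) / of_real b - (x - t) / of_real b = (?w - x) / of_real b"
        by (simp add: diff_divide_distrib)
      finally have "\<bar>k ((?w - t) / of_real b) - k ((x - t) / of_real b)\<bar> \<le> L * norm ((?w - x) / of_real b)" .
      moreover have "norm ((?w - x) / of_real b) \<le> 2 / real n / b"
        using divide_right_mono[OF dist_grid_point[OF n, of x], of b] b by (simp add: norm_divide)
      then have "L * norm ((?w - x) / of_real b) \<le> L * (2 / real n / b)"
        by (rule mult_left_mono[OF _ L])
      ultimately show "\<bar>k ((?w - t) / of_real b) - k ((x - t) / of_real b)\<bar> \<le> 2 * L / (real n * b)"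
        by (simp add: mult_ac)
    qed (use L b in auto)
    finally show ?thesis using True by (simp add: step_fun_def E_def mult_ac)
  qed (simp add: g_def g'_def step_fun_def)
  \<comment> \<open>\<open>k\<close> is merely measurable here; integrability of \<open>g\<close>
    comes from its distance to the step function \<open>g'\<close>.\<close>
  have gi: "integrable lborel g"
  proof (rule Bochner_Integration.integrable_bound)
    show "integrable lborel (\<lambda>x. \<bar>g' x\<bar> + E * step_fun n \<Omega> (\<lambda>_. 1) x)"
      by (intro Bochner_Integration.integrable_add integrable_abs g'i 1)
    show "AE x in lborel. norm (g x) \<le> norm (\<bar>g' x\<bar> + E * step_fun n \<Omega> (\<lambda>_. 1) x)"
      using diff by (intro AE_I2) (smt (verit) real_norm_def)
  qed simp
  have sub: "g (t + b *\<^sub>R y) = k y * step_fun n \<Omega> s (t + b *\<^sub>R y)" for y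
    using b by (simp add: g_def scaleR_conv_of_real)
  show "integrable lborel (\<lambda>y. k y * step_fun n \<Omega> s (t + b *\<^sub>R y))"
    using lborel_integrable_affine[OF gi b, of t] by (simp add: sub)
  have "(LINT x|lborel. g x) = b\<^sup>2 * (LINT y|lborel. k y * step_fun n \<Omega> s (t + b *\<^sub>R y))"
    using lborel_integral_affine[OF gm b, of t] by (simp add: sub)
  moreover have "(LINT x|lborel. g' x) = (\<Sum>w\<in>grid \<Omega> n. k ((w - t) / of_real b) * s w) / (real n)\<^sup>2"
    unfolding g'_def by (rule step_fun_integral(2)[OF \<Omega> n])
  ultimately have "1 / ((real n)\<^sup>2 * b\<^sup>2) * (\<Sum>w\<in>grid \<Omega> n. k ((w - t) / of_real b) * s w)
      - (LINT y|lborel. k y * step_fun n \<Omega> s (t + b *\<^sub>R y)) = ((LINT x|lborel. g' x) - (LINT x|lborel. g x)) / b\<^sup>2"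
    using b by (simp add: field_simps)
  also have "(LINT x|lborel. g' x) - (LINT x|lborel. g x) = (LINT x|lborel. g' x - g x)"
    using g'i gi by simp
  also have "\<bar>(LINT x|lborel. g' x - g x) / b\<^sup>2\<bar> \<le> (LINT x|lborel. E * step_fun n \<Omega> (\<lambda>_. 1) x) / b\<^sup>2"
  proof -
    have "\<bar>LINT x|lborel. g' x - g x\<bar> \<le> (LINT x|lborel. \<bar>g' x - g x\<bar>)"
      using integral_norm_bound[of lborel "\<lambda>x. g' x - g x"] by simp
    also have "\<dots> \<le> (LINT x|lborel. E * step_fun n \<Omega> (\<lambda>_. 1) x)"
      by (intro integral_mono integrable_abs Bochner_Integration.integrable_diff g'i gi 1 diff)
    finally show ?thesis by (simp add: abs_divide divide_right_mono)
  qed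
  also have "(LINT x|lborel. E * step_fun n \<Omega> (\<lambda>_. 1) x) = E * (real (card (grid \<Omega> n)) / (real n)\<^sup>2)"
    using step_fun_integral(2)[OF \<Omega> n, of "\<lambda>_. 1"] by simp
  finally show "\<bar>1 / ((real n)\<^sup>2 * b\<^sup>2) * (\<Sum>w\<in>grid \<Omega> n. k ((w - t) / of_real b) * s w)
      - (LINT y|lborel. k y * step_fun n \<Omega> s (t + b *\<^sub>R y))\<bar>
    \<le> 2 * L * C * (real (card (grid \<Omega> n)) / (real n)\<^sup>2) / (real n * b ^ 3)"
    by (simp add: E_def power2_eq_square power3_eq_cube mult_ac)
qed

section \<open>Kernel averages of deterministic functions\<close>

lemma tail_integral_tendsto:
  fixes k :: "complex \<Rightarrow> real"
  assumes k: "integrable lborel k" and r: "filterlim r at_top sequentially"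
  shows "(\<lambda>n. LINT y|lborel. \<bar>k y\<bar> * indicator {y. r n < norm y} y) \<longlonglongrightarrow> 0"
proof -
  have [measurable]: "k \<in> borel_measurable borel" using borel_measurable_integrable[OF k] by simp
  have "(\<lambda>n. LINT y|lborel. \<bar>k y\<bar> * indicator {y. r n < norm y} y) \<longlonglongrightarrow> (LINT y|(lborel :: complex measure). 0)"
  proof (rule integral_dominated_convergence[where w = "\<lambda>y. \<bar>k y\<bar>"])
    show "AE y in lborel. (\<lambda>n. \<bar>k y\<bar> * indicator {y. r n < norm y} y) \<longlonglongrightarrow> 0"
    proof (intro AE_I2 tendsto_eventually)
      fix y :: complex
      show "\<forall>\<^sub>F n in sequentially. \<bar>k y\<bar> * indicator {y. r n < norm y} y = 0"
        using filterlim_at_top[THEN iffD1, OF r, rule_format, of "norm y"]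
        by eventually_elim (auto simp: indicator_def)
    qed
  qed (use k in \<open>auto simp: indicator_def\<close>)
  then show ?thesis by simp
qed

text \<open>The kernel need not have bounded support. For \<open>y\<close> within \<delta> / b the
  averaged values are close to \<open>\<sigma> t\<close>, with an error \<eta> from \<open>s\<close>
  and another from the modulus of continuity; for larger \<open>y\<close> the crude bound
  \<open>2 * C\<close> meets a vanishing tail of the kernel. Positive distance from \<Theta> to the
  complement keeps the near grid points in \<Omega>.\<close>

lemma kernel_mean_convergence:
  fixes k :: "complex \<Rightarrow> real" and s :: "nat \<Rightarrow> complex \<Rightarrow> real"
  assumes \<Omega>: "open \<Omega>" "bounded \<Omega>" and \<Theta>: "compact \<Theta>" "\<Theta> \<subseteq> \<Omega>"
    and k: "integrable lborel k" and lip: "\<And>x y. \<bar>k x - k y\<bar> \<le> L * norm (x - y)" and L: "L \<ge> 0"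
    and b: "\<And>n. n \<ge> 1 \<Longrightarrow> b n > 0" "b \<longlonglongrightarrow> 0" "(\<lambda>n. 1 / (real n * b n ^ 3)) \<longlonglongrightarrow> 0"
    and \<sigma>: "continuous_on UNIV \<sigma>"
    and s: "\<forall>\<^sub>F n in sequentially. \<forall>w\<in>grid \<Omega> n. \<bar>s n w - \<sigma> w\<bar> \<le> e n" "e \<longlonglongrightarrow> 0"
  shows "uniform_limit \<Theta>
    (\<lambda>n t. 1 / ((real n)\<^sup>2 * (b n)\<^sup>2) * (\<Sum>w\<in>grid \<Omega> n. k ((w - t) / of_real (b n)) * s n w))
    (\<lambda>t. \<sigma> t * (LINT x|lborel. k x)) sequentially"
proof (rule uniform_limitI)
  fix \<epsilon> :: real assume \<epsilon>: "\<epsilon> > 0"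
  then have \<epsilon>3: "\<epsilon> / 3 > 0" by simp
  have km[measurable]: "k \<in> borel_measurable borel" using borel_measurable_integrable[OF k] by simp
  obtain \<rho> where \<rho>: "\<And>w. w \<in> \<Omega> \<Longrightarrow> norm w \<le> \<rho>" using \<Omega>(2) unfolding bounded_iff by blast
  obtain C0 where C0: "C0 \<ge> 1" "\<And>z. z \<in> cball 0 \<rho> \<Longrightarrow> \<bar>\<sigma> z\<bar> \<le> C0"
    using bounded_on_compact[OF \<sigma> compact_cball[of 0 \<rho>]] by auto
  define C where "C = C0 + 1"
  have C: "C \<ge> 0" "\<And>w. w \<in> \<Omega> \<Longrightarrow> \<bar>\<sigma> w\<bar> \<le> C" using C0 \<rho> by (auto simp: C_def intro!: add_increasing2)
  define I where "I = (LINT y|lborel. \<bar>k y\<bar>)"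
  have I: "I \<ge> 0" by (simp add: I_def)
  \<comment> \<open>Makes \<open>2 * \<eta> * I\<close> at most \<epsilon> / 3; the tail and the
    Riemann sum error take the other two thirds.\<close>
  define \<eta> where "\<eta> = \<epsilon> / (6 * (I + 1))"
  have \<eta>: "\<eta> > 0" using \<epsilon> I by (simp add: \<eta>_def)
  obtain \<delta>0 where \<delta>0: "\<delta>0 > 0" "(\<Union>t\<in>\<Theta>. cball t \<delta>0) \<subseteq> \<Omega>"
    using compact_subset_open_imp_cball_epsilon_subset[OF \<Theta>(1) \<Omega>(1) \<Theta>(2)] by blast
  have "uniformly_continuous_on (cball 0 \<rho>) \<sigma>"
    by (intro compact_uniformly_continuous continuous_on_subset[OF \<sigma>]) auto
  then obtain \<delta>1 where \<delta>1: "\<delta>1 > 0"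
    "\<And>x y. x \<in> cball 0 \<rho> \<Longrightarrow> y \<in> cball 0 \<rho> \<Longrightarrow> dist y x < \<delta>1 \<Longrightarrow> dist (\<sigma> y) (\<sigma> x) < \<eta>"
    unfolding uniformly_continuous_on_def using \<eta> by metis
  \<comment> \<open>Two moves of length at most \<delta> are made, from \<open>t\<close> to
    \<open>t + b y\<close> and on to its grid point; their total has to respect both \<delta>0 and
    \<delta>1.\<close>
  define \<delta> where "\<delta> = min \<delta>0 \<delta>1 / 3"
  have \<delta>: "\<delta> > 0" "2 * \<delta> \<le> \<delta>0" "2 * \<delta> < \<delta>1" using \<delta>0 \<delta>1 by (auto simp: \<delta>_def)
  obtain G where G: "\<And>n. n \<ge> 1 \<Longrightarrow> real (card (grid \<Omega> n)) \<le> G * (real n)\<^sup>2" using card_grid_le[OF \<Omega>(2)] by blast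
  have "filterlim (\<lambda>n. inverse (b n)) at_top sequentially"
    by (rule filterlim_inverse_at_top[OF b(2) eventually_sequentiallyI[of 1]]) (use b(1) in auto)
  then have r: "filterlim (\<lambda>n. \<delta> * inverse (b n)) at_top sequentially"
    by (rule filterlim_tendsto_pos_mult_at_top[OF tendsto_const \<delta>(1)])
  have tail: "(\<lambda>n. (2 * C) * (LINT y|lborel. \<bar>k y\<bar> * indicator {y. \<delta> * inverse (b n) < norm y} y)) \<longlonglongrightarrow> 0"
    using tendsto_mult_right_zero[OF tail_integral_tendsto[OF k r]] .
  have err: "(\<lambda>n. 2 * L * C * G * (1 / (real n * b n ^ 3))) \<longlonglongrightarrow> 0"
    using tendsto_mult_right_zero[OF b(3)] .
  have n2: "(\<lambda>n. 2 / real n) \<longlonglongrightarrow> 0" by (rule lim_const_over_n)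
  show "\<forall>\<^sub>F n in sequentially. \<forall>t\<in>\<Theta>. dist (1 / ((real n)\<^sup>2 * (b n)\<^sup>2) * (\<Sum>w\<in>grid \<Omega> n. k ((w - t) / of_real (b n)) * s n w))
     (\<sigma> t * (LINT x|lborel. k x)) < \<epsilon>"
    using eventually_ge_at_top[of 1] s(1) order_tendstoD(2)[OF s(2) \<eta>] order_tendstoD(2)[OF s(2) zero_less_one]
      order_tendstoD(2)[OF tail \<epsilon>3] order_tendstoD(2)[OF err \<epsilon>3] order_tendstoD(2)[OF n2 \<delta>(1)]
  proof eventually_elim
    case (elim n)
    have bn: "b n > 0" using b(1) elim by simp
    have sC: "\<bar>s n w\<bar> \<le> C" if "w \<in> grid \<Omega> n" for w
    proof -
      have "\<bar>s n w - \<sigma> w\<bar> \<le> e n" using elim that by blast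
      moreover have "\<bar>\<sigma> w\<bar> \<le> C0" using C0(2)[of w] \<rho>[of w] that by (auto simp: grid_def)
      ultimately show ?thesis using elim unfolding C_def by linarith
    qed
    have sC': "\<forall>w\<in>grid \<Omega> n. \<bar>s n w\<bar> \<le> C" using sC by blast
    show ?case
    proof
      fix t assume t: "t \<in> \<Theta>"
      let ?S = "\<lambda>y. step_fun n \<Omega> (s n) (t + b n *\<^sub>R y)"
      note core = riemann_sum_error[OF \<Omega>(2) elim(1) bn L km lip sC' C(1), where t = t]
      have t\<Omega>: "t \<in> \<Omega>" using t \<Theta> by auto
      have S: "\<bar>?S y - \<sigma> t\<bar> \<le> 2 * \<eta> + 2 * C * indicator {y. \<delta> * inverse (b n) < norm y} y" for y
      proof (cases "norm y \<le> \<delta> * inverse (b n)")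
        case True
        let ?x = "t + b n *\<^sub>R y" let ?w = "grid_point n ?x"
        have "b n * norm y \<le> \<delta>" using True bn by (simp add: field_simps)
        then have "norm (?x - t) \<le> \<delta>" using bn by simp
        moreover have "norm (?w - ?x) < \<delta>" using dist_grid_point[OF elim(1), of ?x] elim(7) by linarith
        ultimately have d: "norm (?w - t) < 2 * \<delta>"
          using norm_triangle_ineq[of "?w - ?x" "?x - t"] by (simp add: algebra_simps)
        then have "?w \<in> cball t \<delta>0" using \<delta> by (simp add: dist_norm norm_minus_commute)
        then have w: "?w \<in> \<Omega>" using \<delta>0(2) t by blast
        have 1: "\<bar>s n ?w - \<sigma> ?w\<bar> \<le> e n" using elim(2) grid_point_in_grid[OF w] by blast
        have 2: "\<bar>\<sigma> ?w - \<sigma> t\<bar> < \<eta>"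
          using \<delta>1(2)[of t ?w] \<rho>[OF w] \<rho>[OF t\<Omega>] d \<delta> by (simp add: dist_norm)
        have "\<bar>?S y - \<sigma> t\<bar> \<le> 2 * \<eta>" using 1 2 elim(3) w unfolding step_fun_def by simp
        then show ?thesis using C by (simp add: add_increasing2)
      next
        case False
        have "\<bar>?S y\<bar> \<le> C" using sC[OF grid_point_in_grid] C by (simp add: step_fun_def)
        moreover have "\<bar>\<sigma> t\<bar> \<le> C" using C t\<Omega> by simp
        ultimately have "\<bar>?S y - \<sigma> t\<bar> \<le> 2 * C" by linarith
        then show ?thesis using False \<eta> by (simp add: add_increasing)
      qed
      have i1: "integrable lborel (\<lambda>y. \<bar>k y\<bar> * indicator {y. \<delta> * inverse (b n) < norm y} y)"
        by (rule Bochner_Integration.integrable_bound[OF integrable_abs[OF k]]) (auto simp: indicator_def)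
      have "(LINT y|lborel. k y * ?S y) - \<sigma> t * (LINT x|lborel. k x) = (LINT y|lborel. k y * (?S y - \<sigma> t))"
        using core(1) k by (simp add: right_diff_distrib mult.commute)
      also have "\<bar>\<dots>\<bar> \<le> (LINT y|lborel. \<bar>k y * (?S y - \<sigma> t)\<bar>)"
        using integral_norm_bound[of lborel "\<lambda>y. k y * (?S y - \<sigma> t)"] by simp
      also have "\<dots> \<le> (LINT y|lborel. (2 * \<eta>) * \<bar>k y\<bar> + (2 * C) * (\<bar>k y\<bar> * indicator {y. \<delta> * inverse (b n) < norm y} y))"
      proof (rule integral_mono)
        show "integrable lborel (\<lambda>y. \<bar>k y * (?S y - \<sigma> t)\<bar>)"
          using core(1) k by (intro integrable_abs) (simp add: right_diff_distrib)
        show "integrable lborel (\<lambda>y. (2 * \<eta>) * \<bar>k y\<bar> + (2 * C) * (\<bar>k y\<bar> * indicator {y. \<delta> * inverse (b n) < norm y} y))"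
          by (intro Bochner_Integration.integrable_add integrable_mult_right integrable_abs k i1)
        show "\<bar>k y * (?S y - \<sigma> t)\<bar> \<le> (2 * \<eta>) * \<bar>k y\<bar> + (2 * C) * (\<bar>k y\<bar> * indicator {y. \<delta> * inverse (b n) < norm y} y)" for y
          using mult_left_mono[OF S[of y] abs_ge_zero[of "k y"]] unfolding abs_mult
          by (simp only: distrib_left mult_ac)
      qed
      also have "\<dots> = (2 * \<eta>) * I + (2 * C) * (LINT y|lborel. \<bar>k y\<bar> * indicator {y. \<delta> * inverse (b n) < norm y} y)"
        using i1 k by (simp add: I_def)
      also have "(2 * \<eta>) * I \<le> \<epsilon> / 3"
        using I \<epsilon> by (simp add: \<eta>_def field_simps)
      finally have A: "\<bar>(LINT y|lborel. k y * ?S y) - \<sigma> t * (LINT x|lborel. k x)\<bar> < \<epsilon> / 3 + \<epsilon> / 3"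
        using elim(5) \<epsilon> by linarith
      have "2 * L * C * (real (card (grid \<Omega> n)) / (real n)\<^sup>2) / (real n * b n ^ 3) \<le> 2 * L * C * G / (real n * b n ^ 3)"
        using G[OF elim(1)] elim(1) L C bn by (intro divide_right_mono mult_left_mono) (auto simp: divide_le_eq)
      also have "\<dots> < \<epsilon> / 3" using elim(6) \<epsilon> by simp
      finally show "dist (1 / ((real n)\<^sup>2 * (b n)\<^sup>2) * (\<Sum>w\<in>grid \<Omega> n. k ((w - t) / of_real (b n)) * s n w))
     (\<sigma> t * (LINT x|lborel. k x)) < \<epsilon>"
        unfolding dist_real_def using core(2) A by linarith
    qed
  qed
qed

text \<open>The partial derivative is a limit of difference quotients, each with integral 0 by
  translation invariance. The mean value theorem bounds the quotients by a multiple of the indicator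
  of a ball, so dominated convergence applies.\<close>

lemma integral_partial_zero:
  fixes u :: "complex \<Rightarrow> real"
  assumes u: "\<And>z. has_partial v u z" "continuous_on UNIV u" "continuous_on UNIV (partial v u)"
    and v: "norm v \<le> 1" and supp: "\<And>z. norm z > \<rho> \<Longrightarrow> u z = 0"
  shows "(LINT y|lborel. partial v u y) = 0" "integrable lborel (partial v u)" "integrable lborel u"
proof -
  note [measurable] = borel_measurable_continuous_onI[OF u(2)] borel_measurable_continuous_onI[OF u(3)]
  \<comment> \<open>The radius leaves room beyond the support for steps of length at most 1.\<close>
  obtain B where B: "B \<ge> 1" "\<And>z. z \<in> cball 0 (\<rho> + 2) \<Longrightarrow> \<bar>partial v u z\<bar> \<le> B"
    using bounded_on_compact[OF u(3) compact_cball[of 0 "\<rho> + 2"]] by auto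
  obtain B' where B': "B' \<ge> 1" "\<And>z. z \<in> cball 0 (\<rho> + 2) \<Longrightarrow> \<bar>u z\<bar> \<le> B'"
    using bounded_on_compact[OF u(2) compact_cball[of 0 "\<rho> + 2"]] by auto
  have ind: "integrable lborel (indicator (cball 0 (\<rho> + 2)) :: complex \<Rightarrow> real)"
    by (rule integrable_real_indicator) (use emeasure_bounded_finite[OF bounded_cball] in auto)
  have der: "((\<lambda>x. u (z + x *\<^sub>R v)) has_real_derivative partial v u (z + s *\<^sub>R v)) (at s)" for z s
    using has_partial_shift[OF u(1)] by (simp add: has_real_derivative_iff_has_vector_derivative)
  define q where "q n y = real (Suc n) * (u (y + (1 / real (Suc n)) *\<^sub>R v) - u y)" for n y
  have q_lim: "(\<lambda>n. q n y) \<longlonglongrightarrow> partial v u y" for y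
  proof -
    have "((\<lambda>h. (u (y + h *\<^sub>R v) - u y) / h) \<longlongrightarrow> partial v u y) (at 0)"
      using der[of y 0] unfolding has_field_derivative_iff by simp
    moreover have "filterlim (\<lambda>n. 1 / real (Suc n)) (at 0) sequentially"
      unfolding filterlim_at using LIMSEQ_inverse_real_of_nat by (auto simp: inverse_eq_divide)
    ultimately have "(\<lambda>n. (u (y + (1 / real (Suc n)) *\<^sub>R v) - u y) / (1 / real (Suc n))) \<longlonglongrightarrow> partial v u y"
      by (rule filterlim_compose)
    then show ?thesis unfolding q_def by (simp add: mult.commute del: of_nat_Suc)
  qed
  have p0: "\<bar>partial v u y\<bar> \<le> B * indicator (cball 0 (\<rho> + 2)) y" for y
  proof (cases "norm y \<le> \<rho> + 2")
    case False
    have "q n y = 0" for n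
    proof -
      have "norm ((1 / real (Suc n)) *\<^sub>R v) \<le> 1"
        unfolding norm_scaleR using v by (intro mult_le_one) auto
      then have "norm (y + (1 / real (Suc n)) *\<^sub>R v) > \<rho>"
        using norm_diff_ineq[of y "(1 / real (Suc n)) *\<^sub>R v"] False by linarith
      then show ?thesis using False supp by (simp add: q_def)
    qed
    then have "partial v u y = 0" using LIMSEQ_unique[OF q_lim[of y], of 0] by simp
    then show ?thesis using False by simp
  qed (use B in auto)
  have u0: "\<bar>u y\<bar> \<le> B' * indicator (cball 0 (\<rho> + 2)) y" for y
    using B' supp[of y] by (cases "norm y \<le> \<rho> + 2") auto
  show pi: "integrable lborel (partial v u)"
    by (rule Bochner_Integration.integrable_bound[OF integrable_mult_right[OF ind, of B]])
      (use p0 B in \<open>auto intro!: AE_I2 simp: abs_mult\<close>)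
  show ui: "integrable lborel u"
    by (rule Bochner_Integration.integrable_bound[OF integrable_mult_right[OF ind, of B']])
      (use u0 B' in \<open>auto intro!: AE_I2 simp: abs_mult\<close>)
  have qb: "\<bar>q n y\<bar> \<le> B * indicator (cball 0 (\<rho> + 2)) y" for n y
  proof -
    define h where "h = 1 / real (Suc n)"
    have h: "0 < h" "h \<le> 1" by (auto simp: h_def)
    obtain z where z: "0 < z" "z < h" "u (y + h *\<^sub>R v) - u (y + 0 *\<^sub>R v) = (h - 0) * partial v u (y + z *\<^sub>R v)"
      using MVT2[OF h(1), of "\<lambda>x. u (y + x *\<^sub>R v)" "\<lambda>x. partial v u (y + x *\<^sub>R v)"] der by blast
    have qz: "q n y = partial v u (y + z *\<^sub>R v)"
      using z(3) by (simp add: q_def h_def field_simps del: of_nat_Suc)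
    show ?thesis
    proof (cases "norm y \<le> \<rho> + 2")
      case True
      have "\<bar>partial v u (y + z *\<^sub>R v)\<bar> \<le> B * indicator (cball 0 (\<rho> + 2)) (y + z *\<^sub>R v)" by (rule p0)
      also have "\<dots> \<le> B * 1" using B by (intro mult_left_mono) (auto simp: indicator_def)
      finally show ?thesis using True qz by simp
    next
      case False
      have "norm (h *\<^sub>R v) \<le> 1" unfolding norm_scaleR using v h by (intro mult_le_one) auto
      then have "norm (y + h *\<^sub>R v) > \<rho>"
        using norm_diff_ineq[of y "h *\<^sub>R v"] False by linarith
      then have "q n y = 0" using False supp by (simp add: q_def h_def)
      then show ?thesis using False by simp
    qed
  qed
  have "(LINT y|lborel. q n y) = 0" for n
  proof -
    have "(LINT y|lborel. u y) = (LINT y|lborel. u ((1 / real (Suc n)) *\<^sub>R v + 1 *\<^sub>R y))"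
      using lborel_integral_affine[of u 1] by (simp del: of_nat_Suc)
    moreover have "integrable lborel (\<lambda>y. u ((1 / real (Suc n)) *\<^sub>R v + 1 *\<^sub>R y))"
      by (rule lborel_integrable_affine[OF ui]) simp
    ultimately show ?thesis using ui by (simp add: q_def add.commute del: of_nat_Suc)
  qed
  moreover have "(\<lambda>n. LINT y|lborel. q n y) \<longlonglongrightarrow> (LINT y|lborel. partial v u y)"
  proof (rule integral_dominated_convergence[where w = "\<lambda>y. B * indicator (cball 0 (\<rho> + 2)) y"])
    show "q n \<in> borel_measurable lborel" for n unfolding q_def[abs_def] by measurable
    show "integrable lborel (\<lambda>y. B * indicator (cball (0::complex) (\<rho> + 2)) y)" by (rule integrable_mult_right[OF ind])
  qed (use q_lim qb in auto)
  ultimately show "(LINT y|lborel. partial v u y) = 0" by (simp add: LIMSEQ_const_iff)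
qed

text \<open>Differentiating the kernel costs a factor 1 / b, which integration by parts recovers by
  moving the derivative to \<sigma>. The difference between \<open>s n\<close> and \<sigma> gains
  nothing from this, so it has to be o(b), which is the hypothesis on \<open>e n / b n\<close>; the
  Riemann sum error becomes 1 / (n b^4).\<close>

lemma kernel_derivative_mean_convergence:
  fixes K :: "complex \<Rightarrow> real" and s :: "nat \<Rightarrow> complex \<Rightarrow> real"
  assumes \<Omega>: "open \<Omega>" "bounded \<Omega>" and \<Theta>: "compact \<Theta>" "\<Theta> \<subseteq> \<Omega>"
    and v: "v \<in> {1, \<i>}"
    and K: "cont_diff_on (Suc 0) UNIV K" "\<And>z. norm z > \<rho>K \<Longrightarrow> K z = 0" "(LINT x|lborel. K x) = 1"
    and lip: "\<And>x y. \<bar>partial v K x - partial v K y\<bar> \<le> L * norm (x - y)" and L: "L \<ge> 0"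
    and b: "\<And>n. n \<ge> 1 \<Longrightarrow> b n > 0" "b \<longlonglongrightarrow> 0" "(\<lambda>n. 1 / (real n * b n ^ 4)) \<longlonglongrightarrow> 0"
    and \<sigma>: "cont_diff_on (Suc 0) UNIV \<sigma>"
    and s: "\<forall>\<^sub>F n in sequentially. \<forall>w\<in>grid \<Omega> n. \<bar>s n w - \<sigma> w\<bar> \<le> e n" "(\<lambda>n. e n / b n) \<longlonglongrightarrow> 0"
  shows "uniform_limit \<Theta>
    (\<lambda>n t. - (1 / ((real n)\<^sup>2 * (b n) ^ 3) * (\<Sum>w\<in>grid \<Omega> n. partial v K ((w - t) / of_real (b n)) * s n w)))
    (partial v \<sigma>) sequentially"
proof (rule uniform_limitI)
  fix \<epsilon> :: real assume \<epsilon>: "\<epsilon> > 0"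
  then have \<epsilon>3: "\<epsilon> / 3 > 0" by simp
  define k where "k = partial v K"
  have v1: "norm v \<le> 1" using v by auto
  have Kc: "continuous_on UNIV K" "continuous_on UNIV k" "\<And>z. has_partial v K z" using K(1) v by (auto simp: k_def)
  have \<sigma>c: "continuous_on UNIV \<sigma>" "continuous_on UNIV (partial v \<sigma>)" "\<And>z. has_partial v \<sigma> z" using \<sigma> v by auto
  note [measurable] = borel_measurable_continuous_onI[OF Kc(1)] borel_measurable_continuous_onI[OF Kc(2)]
    borel_measurable_continuous_onI[OF \<sigma>c(1)] borel_measurable_continuous_onI[OF \<sigma>c(2)]
  have ki: "integrable lborel k" and Ki: "integrable lborel K"
    using integral_partial_zero[OF Kc(3,1) _ v1 K(2)] Kc(2) by (simp_all add: k_def)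
  have dK: "((\<lambda>x. K (z + x *\<^sub>R v)) has_real_derivative k z) (at 0)" for z
    using has_partial_shift[of v K z 0] Kc(3) by (simp add: has_real_derivative_iff_has_vector_derivative k_def)
  have k0: "k z = 0" if z: "norm z > \<rho>K" for z
  proof -
    have "((\<lambda>x. K (z + x *\<^sub>R v)) has_real_derivative 0) (at 0)"
    proof (rule has_field_derivative_transform_within[OF DERIV_const[of 0]])
      show "0 < norm z - \<rho>K" using z by simp
      fix x :: real assume x: "dist x 0 < norm z - \<rho>K"
      have "norm (x *\<^sub>R v) \<le> \<bar>x\<bar> * 1" unfolding norm_scaleR using v1 by (intro mult_left_mono) auto
      then have "norm (z + x *\<^sub>R v) > \<rho>K"
        using norm_diff_ineq[of z "x *\<^sub>R v"] x by simp
      then show "0 = K (z + x *\<^sub>R v)" using K(2) by simp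
    qed auto
    then show ?thesis using dK DERIV_unique by blast
  qed
  have d\<sigma>: "((\<lambda>x. \<sigma> (z + x *\<^sub>R v)) has_real_derivative partial v \<sigma> z) (at 0)" for z
    using has_partial_shift[of v \<sigma> z 0] \<sigma>c(3) by (simp add: has_real_derivative_iff_has_vector_derivative)
  have ibp: "(LINT y|lborel. k y * \<sigma> (t + c *\<^sub>R y)) = - c * (LINT y|lborel. K y * partial v \<sigma> (t + c *\<^sub>R y))"
    "integrable lborel (\<lambda>y. k y * \<sigma> (t + c *\<^sub>R y))" "integrable lborel (\<lambda>y. K y * partial v \<sigma> (t + c *\<^sub>R y))" for t c
  proof -
    \<comment> \<open>Integration by parts: the partial derivative of this product has integral 0,
      and the chain rule produces the factor \<open>c\<close>.\<close>
    define u where "u y = K y * \<sigma> (t + c *\<^sub>R y)" for y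
    have du: "((\<lambda>x. u (y + x *\<^sub>R v)) has_real_derivative k y * \<sigma> (t + c *\<^sub>R y) + c * (K y * partial v \<sigma> (t + c *\<^sub>R y))) (at 0)" for y
    proof -
      have "((\<lambda>x. \<sigma> ((t + c *\<^sub>R y) + (c * x) *\<^sub>R v)) has_real_derivative partial v \<sigma> (t + c *\<^sub>R y) * c) (at 0)"
        by (rule DERIV_chain2[where f = "\<lambda>x. \<sigma> ((t + c *\<^sub>R y) + x *\<^sub>R v)" and g = "\<lambda>x. c * x"])
          (auto intro!: derivative_eq_intros d\<sigma>)
      from DERIV_mult[OF dK[of y] this] show ?thesis
        by (simp add: u_def algebra_simps)
    qed
    then have pu: "has_partial v u y" "partial v u y = k y * \<sigma> (t + c *\<^sub>R y) + c * (K y * partial v \<sigma> (t + c *\<^sub>R y))" for y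
      using partial_eqI[of u y v] by (auto simp: has_real_derivative_iff_has_vector_derivative)
    have cu: "continuous_on UNIV u" unfolding u_def
      by (intro continuous_intros Kc(1) continuous_on_compose2[OF \<sigma>c(1)]) auto
    have cpu: "continuous_on UNIV (partial v u)" unfolding pu(2)[abs_def]
      by (intro continuous_intros Kc(1,2) continuous_on_compose2[OF \<sigma>c(1)] continuous_on_compose2[OF \<sigma>c(2)]) auto
    have i: "integrable lborel (\<lambda>y. g y * h (t + c *\<^sub>R y))"
      if g: "continuous_on UNIV g" "\<And>z. norm z > \<rho>K \<Longrightarrow> g z = 0" and h: "continuous_on UNIV h" for g h :: "complex \<Rightarrow> real"
    proof -
      have c: "continuous_on UNIV (\<lambda>y. g y * h (t + c *\<^sub>R y))"
        by (intro continuous_intros g continuous_on_compose2[OF h]) auto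
      note [measurable] = borel_measurable_continuous_onI[OF c]
      obtain B where B: "B \<ge> 1" "\<And>z. z \<in> cball 0 \<rho>K \<Longrightarrow> \<bar>g z * h (t + c *\<^sub>R z)\<bar> \<le> B"
        using bounded_on_compact[OF c compact_cball[of 0 \<rho>K]] by auto
      have "integrable lborel (\<lambda>y. B * indicator (cball 0 \<rho>K) y :: real)"
        by (intro integrable_mult_right integrable_real_indicator) (use emeasure_bounded_finite[OF bounded_cball] in auto)
      then show ?thesis
      proof (rule Bochner_Integration.integrable_bound)
        show "AE y in lborel. norm (g y * h (t + c *\<^sub>R y)) \<le> norm (B * indicator (cball 0 \<rho>K) y)"
        proof (rule AE_I2)
          fix y show "norm (g y * h (t + c *\<^sub>R y)) \<le> norm (B * indicator (cball 0 \<rho>K) y)"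
            using B(2)[of y] B(1) g(2)[of y] by (cases "norm y \<le> \<rho>K") auto
        qed
      qed simp
    qed
    show i1: "integrable lborel (\<lambda>y. k y * \<sigma> (t + c *\<^sub>R y))" by (rule i[OF Kc(2) k0 \<sigma>c(1)])
    show i2: "integrable lborel (\<lambda>y. K y * partial v \<sigma> (t + c *\<^sub>R y))" by (rule i[OF Kc(1) K(2) \<sigma>c(2)])
    have "(LINT y|lborel. partial v u y) = 0"
      by (rule integral_partial_zero(1)[OF pu(1) cu cpu v1, of \<rho>K]) (simp add: u_def K(2))
    then show "(LINT y|lborel. k y * \<sigma> (t + c *\<^sub>R y)) = - c * (LINT y|lborel. K y * partial v \<sigma> (t + c *\<^sub>R y))"
      unfolding pu(2) using i1 i2 by simp
  qed
  obtain \<rho> where \<rho>: "\<And>w. w \<in> \<Omega> \<Longrightarrow> norm w \<le> \<rho>" using \<Omega>(2) unfolding bounded_iff by blast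
  obtain C0 where C0: "C0 \<ge> 1" "\<And>z. z \<in> cball 0 \<rho> \<Longrightarrow> \<bar>\<sigma> z\<bar> \<le> C0"
    using bounded_on_compact[OF \<sigma>c(1) compact_cball[of 0 \<rho>]] by auto
  have "continuous_on UNIV (partial 1 \<sigma>)" "continuous_on UNIV (partial \<i> \<sigma>)" using \<sigma> by auto
  from this[THEN bounded_on_compact[OF _ compact_cball[of 0 \<rho>]]]
  obtain B1 B2 where B: "B1 \<ge> 1" "\<And>z. z \<in> cball 0 \<rho> \<Longrightarrow> norm (partial 1 \<sigma> z) \<le> B1" "\<And>z. z \<in> cball 0 \<rho> \<Longrightarrow> norm (partial \<i> \<sigma> z) \<le> B2"
    by blast
  define M where "M = 2 * max B1 B2"
  have M0: "M \<ge> 0" using B by (simp add: M_def le_max_iff_disj)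
  have M: "\<bar>\<sigma> x - \<sigma> y\<bar> \<le> M * norm (x - y)" if "x \<in> \<Omega>" "y \<in> \<Omega>" for x y
    unfolding M_def real_norm_def[symmetric]
    by (rule C1_lipschitz[OF \<sigma> convex_cball[of 0 \<rho>]]) (use B \<rho> that in \<open>force simp: le_max_iff_disj\<close>)+
  define C where "C = C0 + 1"
  have C: "C \<ge> 0" using C0 by (simp add: C_def)
  define I where "I = (LINT y|lborel. \<bar>k y\<bar>)"
  define I' where "I' = (LINT y|lborel. \<bar>K y\<bar>)"
  have I: "I \<ge> 0" "I' \<ge> 0" by (simp_all add: I_def I'_def)
  define \<eta> where "\<eta> = \<epsilon> / (3 * (I' + 1))"
  have \<eta>: "\<eta> > 0" "\<eta> * I' < \<epsilon> / 3" using \<epsilon> I by (auto simp: \<eta>_def field_simps)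
  obtain \<delta>0 where \<delta>0: "\<delta>0 > 0" "(\<Union>t\<in>\<Theta>. cball t \<delta>0) \<subseteq> \<Omega>"
    using compact_subset_open_imp_cball_epsilon_subset[OF \<Theta>(1) \<Omega>(1) \<Theta>(2)] by blast
  have "uniformly_continuous_on (cball 0 \<rho>) (partial v \<sigma>)"
    by (intro compact_uniformly_continuous continuous_on_subset[OF \<sigma>c(2)]) auto
  then obtain \<delta>1 where \<delta>1: "\<delta>1 > 0"
    "\<And>x y. x \<in> cball 0 \<rho> \<Longrightarrow> y \<in> cball 0 \<rho> \<Longrightarrow> dist y x < \<delta>1 \<Longrightarrow> dist (partial v \<sigma> y) (partial v \<sigma> x) < \<eta>"
    unfolding uniformly_continuous_on_def using \<eta>(1) by metis
  define \<delta> where "\<delta> = min \<delta>0 \<delta>1 / 3"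
  have \<delta>: "\<delta> > 0" "2 * \<delta> \<le> \<delta>0" "2 * \<delta> < \<delta>1" using \<delta>0 \<delta>1 by (auto simp: \<delta>_def)
  obtain G where G: "\<And>n. n \<ge> 1 \<Longrightarrow> real (card (grid \<Omega> n)) \<le> G * (real n)\<^sup>2" using card_grid_le[OF \<Omega>(2)] by blast
  have b_rho: "(\<lambda>n. \<bar>\<rho>K\<bar> * b n) \<longlonglongrightarrow> 0"
    using tendsto_mult_right_zero[OF b(2)] .
  have n2: "(\<lambda>n. 2 / real n) \<longlonglongrightarrow> 0" by (rule lim_const_over_n)
  have err: "(\<lambda>n. 2 * L * C * G * (1 / (real n * b n ^ 4))) \<longlonglongrightarrow> 0"
    using tendsto_mult_right_zero[OF b(3)] .
  \<comment> \<open>Eventually \<open>b n < 1\<close>, so that the fourth power in the denominator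
    is the smaller one.\<close>
  have nb: "(\<lambda>n. 1 / (real n * b n)) \<longlonglongrightarrow> 0"
  proof (rule tendsto_sandwich[OF _ _ tendsto_const b(3)])
    show "\<forall>\<^sub>F n in sequentially. 0 \<le> 1 / (real n * b n)"
      using eventually_ge_at_top[of 1] by eventually_elim (use b(1) in \<open>simp add: less_imp_le\<close>)
    show "\<forall>\<^sub>F n in sequentially. 1 / (real n * b n) \<le> 1 / (real n * b n ^ 4)"
      using eventually_ge_at_top[of 1] order_tendstoD(2)[OF b(2) zero_less_one]
    proof eventually_elim
      case (elim n)
      then have "b n ^ 4 \<le> b n ^ 1" using b(1)[of n] by (intro power_decreasing) auto
      then show ?case using elim b(1)[of n] by (intro divide_left_mono mult_left_mono) auto
    qed
  qed
  have err2: "(\<lambda>n. (e n / b n + 2 * M * (1 / (real n * b n))) * I) \<longlonglongrightarrow> 0"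
    using tendsto_mult_left_zero[OF tendsto_add_zero[OF s(2) tendsto_mult_right_zero[OF nb]]] .
  have e0: "e \<longlonglongrightarrow> 0"
  proof -
    have "(\<lambda>n. (e n / b n) * b n) \<longlonglongrightarrow> 0 * 0" by (intro tendsto_mult s b)
    moreover have "\<forall>\<^sub>F n in sequentially. (e n / b n) * b n = e n"
      using eventually_ge_at_top[of 1] by eventually_elim (use b(1) in force)
    ultimately show ?thesis using tendsto_cong by fastforce
  qed
  show "\<forall>\<^sub>F n in sequentially. \<forall>t\<in>\<Theta>. dist (- (1 / ((real n)\<^sup>2 * (b n) ^ 3) * (\<Sum>w\<in>grid \<Omega> n. partial v K ((w - t) / of_real (b n)) * s n w)))
     (partial v \<sigma> t) < \<epsilon>"
    using eventually_ge_at_top[of 1] s(1) order_tendstoD(2)[OF b_rho \<delta>(1)] order_tendstoD(2)[OF e0 zero_less_one]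
      order_tendstoD(2)[OF err2 \<epsilon>3] order_tendstoD(2)[OF err \<epsilon>3] order_tendstoD(2)[OF n2 \<delta>(1)]
  proof eventually_elim
    case (elim n)
    have bn: "b n > 0" using b(1) elim by simp
    have sC: "\<bar>s n w\<bar> \<le> C" if "w \<in> grid \<Omega> n" for w
    proof -
      have "\<bar>s n w - \<sigma> w\<bar> \<le> e n" using elim that by blast
      moreover have "\<bar>\<sigma> w\<bar> \<le> C0" using C0(2)[of w] \<rho>[of w] that by (auto simp: grid_def)
      ultimately show ?thesis using elim unfolding C_def by linarith
    qed
    have sC': "\<forall>w\<in>grid \<Omega> n. \<bar>s n w\<bar> \<le> C" using sC by blast
    show ?case
    proof
      fix t assume t: "t \<in> \<Theta>"
      let ?S = "\<lambda>y. step_fun n \<Omega> (s n) (t + b n *\<^sub>R y)"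
      let ?x = "\<lambda>y. t + b n *\<^sub>R y"
      have km: "k \<in> borel_measurable borel" by measurable
      note core = riemann_sum_error[OF \<Omega>(2) elim(1) bn L km lip[folded k_def] sC' C, where t = t]
      have t\<Omega>: "t \<in> \<Omega>" using t \<Theta> by auto
      have near: "norm (?x y - t) < \<delta>" if "norm y \<le> \<rho>K" for y
      proof -
        have "b n * norm y \<le> b n * \<bar>\<rho>K\<bar>" using that bn by (intro mult_left_mono) auto
        moreover have "norm (?x y - t) = b n * norm y" using bn by simp
        moreover have "b n * \<bar>\<rho>K\<bar> < \<delta>" using elim(3) by (simp only: mult.commute)
        ultimately show ?thesis by linarith
      qed
      have x\<Omega>: "z \<in> \<Omega>" if "norm (z - t) < 2 * \<delta>" for z
      proof -
        have "z \<in> cball t \<delta>0" using that \<delta> by (simp add: dist_norm norm_minus_commute)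
        then show ?thesis using \<delta>0(2) t by blast
      qed
      have S: "\<bar>k y * (?S y - \<sigma> (?x y))\<bar> \<le> (e n + M * (2 / real n)) * \<bar>k y\<bar>" for y
      proof (cases "norm y \<le> \<rho>K")
        case True
        let ?w = "grid_point n (?x y)"
        have wx: "norm (?w - ?x y) \<le> 2 / real n" by (rule dist_grid_point[OF elim(1)])
        have "norm (?w - t) < 2 * \<delta>"
          using norm_triangle_ineq[of "?w - ?x y" "?x y - t"] wx elim(7) near[OF True] by simp
        then have w: "?w \<in> \<Omega>" by (rule x\<Omega>)
        have x: "?x y \<in> \<Omega>" using near[OF True] \<delta> by (intro x\<Omega>) simp
        have 1: "\<bar>s n ?w - \<sigma> ?w\<bar> \<le> e n" using elim(2) grid_point_in_grid[OF w] by blast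
        have 2: "\<bar>\<sigma> ?w - \<sigma> (?x y)\<bar> \<le> M * (2 / real n)"
          using M[OF w x] mult_left_mono[OF wx M0] by linarith
        have "\<bar>?S y - \<sigma> (?x y)\<bar> \<le> e n + M * (2 / real n)" using 1 2 w unfolding step_fun_def by simp
        from mult_right_mono[OF this abs_ge_zero[of "k y"]] show ?thesis by (simp add: abs_mult mult.commute)
      qed (simp add: k0)
      have "\<bar>(LINT y|lborel. k y * ?S y) - (LINT y|lborel. k y * \<sigma> (?x y))\<bar>
          = \<bar>LINT y|lborel. k y * (?S y - \<sigma> (?x y))\<bar>"
        using core(1) ibp(2) by (simp add: right_diff_distrib)
      also have "\<dots> \<le> (LINT y|lborel. \<bar>k y * (?S y - \<sigma> (?x y))\<bar>)"
        using integral_norm_bound[of lborel "\<lambda>y. k y * (?S y - \<sigma> (?x y))"] by simp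
      also have "\<dots> \<le> (LINT y|lborel. (e n + M * (2 / real n)) * \<bar>k y\<bar>)"
      proof (rule integral_mono[OF _ _ S])
        show "integrable lborel (\<lambda>y. \<bar>k y * (?S y - \<sigma> (?x y))\<bar>)"
          using core(1) ibp(2) by (intro integrable_abs) (simp add: right_diff_distrib)
      qed (use ki in auto)
      also have "\<dots> = (e n + M * (2 / real n)) * I" by (simp add: I_def)
      finally have A: "\<bar>(LINT y|lborel. k y * ?S y) - (LINT y|lborel. k y * \<sigma> (?x y))\<bar> \<le> (e n + M * (2 / real n)) * I" .
      have "\<bar>(LINT y|lborel. K y * partial v \<sigma> (?x y)) - partial v \<sigma> t\<bar> = \<bar>LINT y|lborel. K y * (partial v \<sigma> (?x y) - partial v \<sigma> t)\<bar>"
        using ibp(3) Ki K(3) by (simp add: right_diff_distrib)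
      also have "\<dots> \<le> (LINT y|lborel. \<bar>K y * (partial v \<sigma> (?x y) - partial v \<sigma> t)\<bar>)"
        using integral_norm_bound[of lborel "\<lambda>y. K y * (partial v \<sigma> (?x y) - partial v \<sigma> t)"] by simp
      also have "\<dots> \<le> (LINT y|lborel. \<eta> * \<bar>K y\<bar>)"
      proof (rule integral_mono)
        show "integrable lborel (\<lambda>y. \<bar>K y * (partial v \<sigma> (?x y) - partial v \<sigma> t)\<bar>)"
          using ibp(3) Ki by (intro integrable_abs) (simp add: right_diff_distrib)
        show "\<bar>K y * (partial v \<sigma> (?x y) - partial v \<sigma> t)\<bar> \<le> \<eta> * \<bar>K y\<bar>" for y
        proof (cases "norm y \<le> \<rho>K")
          case True
          have "?x y \<in> \<Omega>" using near[OF True] \<delta> by (intro x\<Omega>) simp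
          then have "?x y \<in> cball 0 \<rho>" "t \<in> cball 0 \<rho>" using \<rho> t\<Omega> by (simp_all only: mem_cball dist_0_norm)
          moreover have "dist (?x y) t < \<delta>1" using near[OF True] \<delta> unfolding dist_norm by linarith
          ultimately have "\<bar>partial v \<sigma> (?x y) - partial v \<sigma> t\<bar> \<le> \<eta>"
            using \<delta>1(2)[of t "?x y"] unfolding dist_real_def by linarith
          from mult_right_mono[OF this abs_ge_zero[of "K y"]] show ?thesis by (simp add: abs_mult mult.commute)
        qed (simp add: K(2))
      qed (use Ki in auto)
      also have "\<dots> = \<eta> * I'" by (simp add: I'_def)
      finally have B': "\<bar>(LINT y|lborel. K y * partial v \<sigma> (?x y)) - partial v \<sigma> t\<bar> < \<epsilon> / 3" using \<eta> by linarith
      \<comment> \<open>Chain of approximations: \<open>- X / b n\<close> is the normalised sum,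
        \<open>Y\<close> the integral against the step function, \<open>- b n * Z\<close> the value
        after integration by parts, and \<open>Z\<close> is close to the derivative at
        \<open>t\<close>. Each link costs less than \<epsilon> / 3.\<close>
      define X where "X = 1 / ((real n)\<^sup>2 * (b n)\<^sup>2) * (\<Sum>w\<in>grid \<Omega> n. k ((w - t) / of_real (b n)) * s n w)"
      define Y where "Y = (LINT y|lborel. k y * ?S y)"
      define Z where "Z = (LINT y|lborel. K y * partial v \<sigma> (?x y))"
      have X1: "\<bar>X - Y\<bar> / b n < \<epsilon> / 3"
      proof -
        have "\<bar>X - Y\<bar> \<le> 2 * L * C * (real (card (grid \<Omega> n)) / (real n)\<^sup>2) / (real n * b n ^ 3)"
          using core(2) by (simp add: X_def Y_def)
        also have "\<dots> \<le> 2 * L * C * G / (real n * b n ^ 3)"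
          using G[OF elim(1)] elim(1) L C bn by (intro divide_right_mono mult_left_mono) (auto simp: divide_le_eq)
        finally have "\<bar>X - Y\<bar> / b n \<le> 2 * L * C * G / (real n * b n ^ 3) / b n"
          using bn by (intro divide_right_mono) auto
        also have "\<dots> = 2 * L * C * G * (1 / (real n * b n ^ 4))"
          by (simp add: eval_nat_numeral mult_ac)
        finally show ?thesis using elim(6) by linarith
      qed
      have X2: "\<bar>Y + b n * Z\<bar> / b n < \<epsilon> / 3"
      proof -
        have "\<bar>Y + b n * Z\<bar> \<le> (e n + M * (2 / real n)) * I" using A ibp(1)[of t "b n"] by (simp add: Y_def Z_def)
        then have "\<bar>Y + b n * Z\<bar> / b n \<le> (e n + M * (2 / real n)) * I / b n"
          using bn by (intro divide_right_mono) auto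
        also have "\<dots> = (e n / b n + 2 * M * (1 / (real n * b n))) * I"
          by (simp add: add_divide_distrib algebra_simps)
        finally show ?thesis using elim(5) by linarith
      qed
      have "- (1 / ((real n)\<^sup>2 * (b n) ^ 3) * (\<Sum>w\<in>grid \<Omega> n. k ((w - t) / of_real (b n)) * s n w)) = - X / b n"
        by (simp add: X_def power2_eq_square power3_eq_cube mult_ac)
      also have "\<dots> - partial v \<sigma> t = - (X - Y) / b n - (Y + b n * Z) / b n + (Z - partial v \<sigma> t)"
        using bn by (simp add: field_simps)
      also have "\<bar>\<dots>\<bar> \<le> \<bar>X - Y\<bar> / b n + \<bar>Y + b n * Z\<bar> / b n + \<bar>Z - partial v \<sigma> t\<bar>"
        using bn by (intro order_trans[OF abs_triangle_ineq add_mono[OF order_trans[OF abs_triangle_ineq4]]]) (auto simp: abs_divide abs_minus_commute)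
      also have "\<dots> < \<epsilon>" using X1 X2 B' unfolding Z_def by linarith
      finally show "dist (- (1 / ((real n)\<^sup>2 * (b n) ^ 3) * (\<Sum>w\<in>grid \<Omega> n. partial v K ((w - t) / of_real (b n)) * s n w)))
       (partial v \<sigma> t) < \<epsilon>"
        by (simp add: dist_real_def k_def)
    qed
  qed
qed

subsection \<open>The normalised second differences of the field\<close>

definition lin_comb :: "('t \<Rightarrow> 'w \<Rightarrow> real) \<Rightarrow> ('w \<Rightarrow> real) \<Rightarrow> bool" where
  "lin_comb Z X \<longleftrightarrow> (\<exists>T a. finite T \<and> X = (\<lambda>\<omega>. \<Sum>t\<in>T. a t * Z t \<omega>))"

lemma lin_comb_base: "lin_comb Z (Z t)"
  unfolding lin_comb_def by (intro exI[of _ "{t}"] exI[of _ "\<lambda>_. 1"]) auto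

lemma lin_comb_scale:
  assumes "lin_comb Z X"
  shows "lin_comb Z (\<lambda>\<omega>. c * X \<omega>)"
proof -
  obtain T a where "finite T" "X = (\<lambda>\<omega>. \<Sum>t\<in>T. a t * Z t \<omega>)" using assms unfolding lin_comb_def by blast
  then show ?thesis unfolding lin_comb_def
    by (intro exI[of _ T] exI[of _ "\<lambda>t. c * a t"]) (auto simp: sum_distrib_left mult.assoc)
qed

lemma lin_comb_add:
  assumes "lin_comb Z X" "lin_comb Z Y"
  shows "lin_comb Z (\<lambda>\<omega>. X \<omega> + Y \<omega>)"
proof -
  obtain S a where S: "finite S" "X = (\<lambda>\<omega>. \<Sum>t\<in>S. a t * Z t \<omega>)" using assms(1) unfolding lin_comb_def by blast
  obtain T b where T: "finite T" "Y = (\<lambda>\<omega>. \<Sum>t\<in>T. b t * Z t \<omega>)" using assms(2) unfolding lin_comb_def by blast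
  have "(\<Sum>t\<in>S. a t * Z t \<omega>) = (\<Sum>t\<in>S \<union> T. (if t \<in> S then a t else 0) * Z t \<omega>)" for \<omega>
    by (rule sum.mono_neutral_cong_left) (use S T in auto)
  moreover have "(\<Sum>t\<in>T. b t * Z t \<omega>) = (\<Sum>t\<in>S \<union> T. (if t \<in> T then b t else 0) * Z t \<omega>)" for \<omega>
    by (rule sum.mono_neutral_cong_left) (use S T in auto)
  ultimately show ?thesis unfolding lin_comb_def using S T
    by (intro exI[of _ "S \<union> T"] exI[of _ "\<lambda>t. (if t \<in> S then a t else 0) + (if t \<in> T then b t else 0)"])
      (auto simp: distrib_right sum.distrib)
qed

lemma lin_comb_sum:
  assumes "\<And>i. i \<in> I \<Longrightarrow> lin_comb Z (X i)"
  shows "lin_comb Z (\<lambda>\<omega>. \<Sum>i\<in>I. X i \<omega>)"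
  using assms
proof (induction I rule: infinite_finite_induct)
  case (insert i I)
  then show ?case by (simp add: lin_comb_add)
qed (auto simp: lin_comb_def intro!: exI[of _ "{}"])

lemma lin_comb_diff:
  assumes "lin_comb Z X" "lin_comb Z Y"
  shows "lin_comb Z (\<lambda>\<omega>. X \<omega> - Y \<omega>)"
  using lin_comb_add[OF assms(1) lin_comb_scale[OF assms(2), of "-1"]] by simp

text \<open>Kernel and bandwidth stay outside, since the fluctuation bounds serve both
  \<open>K\<close> and its partial derivatives.\<close>

locale isotropic_gaussian_field =
  fixes M :: "'w measure" and Z :: "complex \<Rightarrow> 'w \<Rightarrow> real" and R :: "real \<Rightarrow> real"
    and \<alpha> \<gamma> m :: real and \<Omega> :: "complex set" and f :: "complex \<Rightarrow> complex"
  assumes prob_M: "prob_space M" and gaussian: "gaussian_field M Z"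
    and mean: "\<And>t. (LINT \<omega>|M. Z t \<omega>) = m"
    and cov: "\<And>t s. covariance M (Z t) (Z s) = R (cmod (t - s))"
    and \<alpha>: "0 < \<alpha>" "\<alpha> < 2" and \<gamma>: "\<gamma> > 0"
    and expansion: "(\<lambda>t. R t - (R 0 - t powr \<alpha>)) \<in> o[at_right 0](\<lambda>t. t powr (\<alpha> + \<gamma>))"
    and R_diff: "\<And>j t. j < 4 \<Longrightarrow> t > 0 \<Longrightarrow> (deriv ^^ j) R field_differentiable (at t)"
    and R4: "\<exists>c\<^sub>0>0. \<forall>\<^sub>F t in at_right 0. \<bar>(deriv ^^ 4) R t\<bar> \<le> c\<^sub>0 * t powr (\<alpha> - 4)"
    and open_\<Omega>: "open \<Omega>" and bounded_\<Omega>: "bounded \<Omega>"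
    and diffeo_f: "diffeo 2 f"
begin

sublocale prob_space M by (rule prob_M)

text \<open>Normalised so that the variance has a finite positive limit when
  \<open>h \<noteq> 0\<close>.\<close>

definition sec_diff :: "nat \<Rightarrow> complex \<Rightarrow> complex \<Rightarrow> 'w \<Rightarrow> real" where
  "sec_diff n h w \<omega> = real n powr (\<alpha> / 2) *
     diff_op (h / of_nat n) (diff_op (h / of_nat n) (\<lambda>t. Z (f t) \<omega>)) w"

definition sec_diff_var :: "nat \<Rightarrow> complex \<Rightarrow> complex \<Rightarrow> real" where
  "sec_diff_var n h w = expectation (\<lambda>\<omega>. (sec_diff n h w \<omega>)\<^sup>2)"

definition limit_var :: "complex \<Rightarrow> complex \<Rightarrow> real" where
  "limit_var h t = (8 - 2 powr (\<alpha> + 1)) * cmod (dir_deriv h f t) powr \<alpha>"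

lemma f_C2: "cont_diff_on 2 UNIV f" and f_inj: "inj f" and f_jac: "jacobian_det f z > 0"
  using diffeo_f by (auto simp: diffeo_def)

lemma lin_comb_normal: "lin_comb Z X \<Longrightarrow> normal_rv M X"
  using gaussian unfolding lin_comb_def gaussian_field_def by blast

lemma lin_comb_moments: "lin_comb Z X \<Longrightarrow> all_moments M X"
  using normal_rv_all_moments[OF prob_M lin_comb_normal] .

lemma Z_moments: "all_moments M (Z t)"
  by (rule lin_comb_moments[OF lin_comb_base])

lemma product_moment: "expectation (\<lambda>\<omega>. Z s \<omega> * Z t \<omega>) = R (cmod (s - t)) + m\<^sup>2"
proof -
  have i: "integrable M (Z t)" for t by (rule all_moments_integrable[OF Z_moments])
  have ii: "integrable M (\<lambda>\<omega>. Z s \<omega> * Z t \<omega>)"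
    by (intro all_moments_integrable all_moments_mult Z_moments)
  have "R (cmod (s - t)) = expectation (\<lambda>\<omega>. Z s \<omega> * Z t \<omega> - m * Z t \<omega> - m * Z s \<omega> + m * m)"
    unfolding cov[of s t, symmetric] covariance_def mean by (simp add: algebra_simps)
  also have "\<dots> = expectation (\<lambda>\<omega>. Z s \<omega> * Z t \<omega>) - m * m - m * m + m * m"
    using i ii by (simp add: mean prob_space)
  finally show ?thesis by (simp add: power2_eq_square)
qed

text \<open>The multiples 0, 1 and 2 are left unevaluated to match the function \<open>G\<close> of
  \<open>second_difference_covariance\<close>.\<close>

lemma sec_diff_eq:
  "sec_diff n h w \<omega> = real n powr (\<alpha> / 2) *
    (Z (f (w + (2 * (1 / real n)) *\<^sub>R h)) \<omega> - 2 * Z (f (w + (1 * (1 / real n)) *\<^sub>R h)) \<omega> + Z (f (w + (0 * (1 / real n)) *\<^sub>R h)) \<omega>)"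
proof -
  have eqs: "w + (1 * (1 / real n)) *\<^sub>R h + h / of_nat n = w + (2 * (1 / real n)) *\<^sub>R h"
    "w + h / of_nat n = w + (1 * (1 / real n)) *\<^sub>R h"
    by (simp_all add: scaleR_conv_of_real field_simps)
  have "a - b - (b - c) = a - 2 * b + c" for a b c :: real by simp
  then show ?thesis
    by (simp only: sec_diff_def diff_op_def eqs mult_zero_left scaleR_zero_left add_0_right)
qed

lemma sec_diff_lin_comb: "lin_comb Z (sec_diff n h w)"
  unfolding sec_diff_eq[abs_def]
  by (intro lin_comb_scale lin_comb_add lin_comb_diff lin_comb_base)

lemma sec_diff_moments: "all_moments M (sec_diff n h w)"
  by (rule lin_comb_moments[OF sec_diff_lin_comb])

lemma sec_diff_mean: "expectation (sec_diff n h w) = 0"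
proof -
  have i: "integrable M (Z t)" for t by (rule all_moments_integrable[OF Z_moments])
  then show ?thesis unfolding sec_diff_eq[abs_def] by (simp add: mean)
qed

text \<open>The term \<open>m\<^sup>2\<close> of \<open>product_moment\<close> disappears, because
  the coefficients 1, -2, 1 sum to zero.\<close>

lemma sec_diff_product:
  fixes h w w' :: complex
  assumes n: "n \<ge> 1"
  defines "G \<equiv> \<lambda>x y. R (cmod (f (w + (x * (1 / real n)) *\<^sub>R h) - f (w' + (y * (1 / real n)) *\<^sub>R h)))"
  shows "expectation (\<lambda>\<omega>. sec_diff n h w \<omega> * sec_diff n h w' \<omega>) = real n powr \<alpha> *
    ((G 2 2 - 2 * G 2 1 + G 2 0) - 2 * (G 1 2 - 2 * G 1 1 + G 1 0) + (G 0 2 - 2 * G 0 1 + G 0 0))"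
proof -
  let ?N = "real n powr \<alpha>"
  define p where "p x = f (w + (x * (1 / real n)) *\<^sub>R h)" for x :: real
  define q where "q x = f (w' + (x * (1 / real n)) *\<^sub>R h)" for x :: real
  have ii: "integrable M (\<lambda>\<omega>. Z s \<omega> * Z t \<omega>)" for s t
    by (intro all_moments_integrable all_moments_mult Z_moments)
  have NN: "real n powr (\<alpha> / 2) * real n powr (\<alpha> / 2) = ?N" by (simp add: powr_add[symmetric])
  have "sec_diff n h w \<omega> * sec_diff n h w' \<omega> = ?N *
     ((Z (p 2) \<omega> - 2 * Z (p 1) \<omega> + Z (p 0) \<omega>) * (Z (q 2) \<omega> - 2 * Z (q 1) \<omega> + Z (q 0) \<omega>))" for \<omega>
    unfolding sec_diff_eq p_def[symmetric] q_def[symmetric] NN[symmetric] by (simp only: mult_ac)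
  also have "\<dots> \<omega> = ?N * (((Z (p 2) \<omega> * Z (q 2) \<omega> - 2 * (Z (p 2) \<omega> * Z (q 1) \<omega>) + Z (p 2) \<omega> * Z (q 0) \<omega>)
      - 2 * (Z (p 1) \<omega> * Z (q 2) \<omega> - 2 * (Z (p 1) \<omega> * Z (q 1) \<omega>) + Z (p 1) \<omega> * Z (q 0) \<omega>)
      + (Z (p 0) \<omega> * Z (q 2) \<omega> - 2 * (Z (p 0) \<omega> * Z (q 1) \<omega>) + Z (p 0) \<omega> * Z (q 0) \<omega>)))" for \<omega>
    by (simp add: algebra_simps)
  finally have "expectation (\<lambda>\<omega>. sec_diff n h w \<omega> * sec_diff n h w' \<omega>) = ?N *
     ((expectation (\<lambda>\<omega>. Z (p 2) \<omega> * Z (q 2) \<omega>) - 2 * expectation (\<lambda>\<omega>. Z (p 2) \<omega> * Z (q 1) \<omega>) + expectation (\<lambda>\<omega>. Z (p 2) \<omega> * Z (q 0) \<omega>))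
      - 2 * (expectation (\<lambda>\<omega>. Z (p 1) \<omega> * Z (q 2) \<omega>) - 2 * expectation (\<lambda>\<omega>. Z (p 1) \<omega> * Z (q 1) \<omega>) + expectation (\<lambda>\<omega>. Z (p 1) \<omega> * Z (q 0) \<omega>))
      + (expectation (\<lambda>\<omega>. Z (p 0) \<omega> * Z (q 2) \<omega>) - 2 * expectation (\<lambda>\<omega>. Z (p 0) \<omega> * Z (q 1) \<omega>) + expectation (\<lambda>\<omega>. Z (p 0) \<omega> * Z (q 0) \<omega>)))"
    using ii by simp
  also have "\<dots> = ?N * ((G 2 2 - 2 * G 2 1 + G 2 0) - 2 * (G 1 2 - 2 * G 1 1 + G 1 0) + (G 0 2 - 2 * G 0 1 + G 0 0))"
    unfolding product_moment G_def p_def[symmetric] q_def[symmetric] by simp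
  finally show ?thesis .
qed

lemma sec_diff_var_eq:
  assumes n: "n \<ge> 1"
  shows "sec_diff_var n h w = (1 / real n) powr (-\<alpha>) *
    (4 * (R 0 - R (cmod (f (w + (1 / real n) *\<^sub>R h) - f w)))
       + 4 * (R 0 - R (cmod (f (w + (2 * (1 / real n)) *\<^sub>R h) - f (w + (1 / real n) *\<^sub>R h))))
       - 2 * (R 0 - R (cmod (f (w + (2 * (1 / real n)) *\<^sub>R h) - f w))))"
proof -
  have N: "(1 / real n) powr (-\<alpha>) = real n powr \<alpha>"
    using n by (simp add: powr_divide powr_minus_divide)
  show ?thesis
    unfolding sec_diff_var_def power2_eq_square sec_diff_product[OF n] N
    by (simp add: norm_minus_commute)
qed

text \<open>The little-o relation with constant 1. The point \<open>t = 0\<close> is included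
  because \<open>0 powr x = 0\<close>, so that both sides vanish there.\<close>

lemma expansion_O: "\<exists>r>0. \<forall>t. 0 \<le> t \<and> t \<le> r \<longrightarrow> \<bar>R t - (R 0 - t powr \<alpha>)\<bar> \<le> t powr (\<alpha> + \<gamma>)"
proof -
  have "\<forall>\<^sub>F t in at_right 0. norm (R t - (R 0 - t powr \<alpha>)) \<le> 1 * norm (t powr (\<alpha> + \<gamma>))"
    by (rule landau_o.smallD[OF expansion]) simp
  then obtain b where b: "b > 0" "\<And>t. 0 < t \<Longrightarrow> t < b \<Longrightarrow> \<bar>R t - (R 0 - t powr \<alpha>)\<bar> \<le> t powr (\<alpha> + \<gamma>)"
    unfolding eventually_at_right_field by auto
  have "\<bar>R t - (R 0 - t powr \<alpha>)\<bar> \<le> t powr (\<alpha> + \<gamma>)" if "0 \<le> t" "t \<le> b / 2" for t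
    using b that by (cases "t = 0") auto
  then show ?thesis using b(1) by (intro exI[of _ "b / 2"]) auto
qed

lemma R_small: "\<exists>r>0. \<forall>t. 0 < t \<and> t \<le> r \<longrightarrow> \<bar>R t - R 0\<bar> \<le> 2 * t powr \<alpha>"
proof -
  obtain r where r: "r > 0" "\<And>t. 0 \<le> t \<Longrightarrow> t \<le> r \<Longrightarrow> \<bar>R t - (R 0 - t powr \<alpha>)\<bar> \<le> t powr (\<alpha> + \<gamma>)"
    using expansion_O by blast
  have "\<bar>R t - R 0\<bar> \<le> 2 * t powr \<alpha>" if t: "0 < t" "t \<le> min r 1" for t
  proof -
    have "t powr (\<alpha> + \<gamma>) \<le> t powr \<alpha>" using t \<gamma> by (intro powr_mono') auto
    then show ?thesis using r(2)[of t] t powr_ge_zero[of t \<alpha>] by (simp add: abs_le_iff)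
  qed
  then show ?thesis using r(1) by (intro exI[of _ "min r 1"]) auto
qed

text \<open>Step length \<delta> = 1 / n, uniformly over the compact closure of the domain.\<close>

lemma sec_diff_var_limit:
  assumes h: "h \<noteq> 0"
  shows "\<exists>C\<ge>0. \<forall>\<^sub>F n in sequentially. \<forall>w\<in>grid \<Omega> n.
    \<bar>sec_diff_var n h w - limit_var h w\<bar> \<le> C * (real n powr (-\<gamma>) + 1 / real n)"
proof -
  have S: "compact (closure \<Omega>)" using bounded_\<Omega> by (simp add: compact_closure)
  obtain C \<delta>0 where C: "C \<ge> 0" "\<delta>0 > 0" "\<And>\<delta> w. 0 < \<delta> \<Longrightarrow> \<delta> \<le> \<delta>0 \<Longrightarrow> w \<in> closure \<Omega> \<Longrightarrow>
    \<bar>\<delta> powr (-\<alpha>) * (4 * (R 0 - R (cmod (f (w + \<delta> *\<^sub>R h) - f w)))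
       + 4 * (R 0 - R (cmod (f (w + (2 * \<delta>) *\<^sub>R h) - f (w + \<delta> *\<^sub>R h))))
       - 2 * (R 0 - R (cmod (f (w + (2 * \<delta>) *\<^sub>R h) - f w))))
      - (8 - 2 powr (\<alpha> + 1)) * cmod (dir_deriv h f w) powr \<alpha>\<bar> \<le> C * (\<delta> powr \<gamma> + \<delta>)"
    using second_difference_variance[OF \<alpha>(1) \<gamma> expansion_O f_C2 f_jac h S] by (elim exE conjE) (rule that, auto)
  have "(\<lambda>n. 1 / real n) \<longlonglongrightarrow> 0" by (rule lim_const_over_n)
  then have "\<forall>\<^sub>F n in sequentially. 1 / real n < \<delta>0" using C(2) by (rule order_tendstoD)
  then have "\<forall>\<^sub>F n in sequentially. \<forall>w\<in>grid \<Omega> n.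
    \<bar>sec_diff_var n h w - limit_var h w\<bar> \<le> C * (real n powr (-\<gamma>) + 1 / real n)"
    using eventually_ge_at_top[of 1]
  proof eventually_elim
    case (elim n)
    show ?case
    proof
      fix w assume "w \<in> grid \<Omega> n"
      then have w: "w \<in> closure \<Omega>" using closure_subset by (auto simp: grid_def)
      have "real n powr (-\<gamma>) = (1 / real n) powr \<gamma>"
        using elim by (simp add: powr_divide powr_minus_divide)
      then show "\<bar>sec_diff_var n h w - limit_var h w\<bar> \<le> C * (real n powr (-\<gamma>) + 1 / real n)"
        unfolding sec_diff_var_eq[OF elim(2)] limit_var_def using C(3)[of "1 / real n" w] w elim by simp
    qed
  qed
  then show ?thesis using C(1) by blast
qed

lemma continuous_limit_var: "continuous_on UNIV (limit_var h)"
  if "h \<noteq> 0"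
proof -
  have "dir_deriv h f x \<noteq> 0" for x using jacobian_dir_deriv_nonzero[OF f_jac that] .
  then show ?thesis unfolding limit_var_def[abs_def]
    by (intro continuous_intros continuous_on_dir_deriv C2_imp_C1 f_C2) auto
qed

lemma sec_diff_var_bounded:
  assumes h: "h \<noteq> 0"
  shows "\<exists>C\<ge>0. \<forall>\<^sub>F n in sequentially. \<forall>w\<in>grid \<Omega> n. sec_diff_var n h w \<le> C"
proof -
  obtain C where C: "C \<ge> 0" and ev: "\<forall>\<^sub>F n in sequentially. \<forall>w\<in>grid \<Omega> n.
    \<bar>sec_diff_var n h w - limit_var h w\<bar> \<le> C * (real n powr (-\<gamma>) + 1 / real n)"
    using sec_diff_var_limit[OF h] by blast
  have "compact (closure \<Omega>)" using bounded_\<Omega> by (simp add: compact_closure)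
  from bounded_on_compact[OF continuous_limit_var[OF h] this]
  obtain B where B: "B \<ge> 1" "\<And>z. z \<in> closure \<Omega> \<Longrightarrow> \<bar>limit_var h z\<bar> \<le> B"
    unfolding real_norm_def by blast
  have "\<forall>\<^sub>F n in sequentially. \<forall>w\<in>grid \<Omega> n. sec_diff_var n h w \<le> B + 2 * C"
    using ev eventually_ge_at_top[of 1]
  proof eventually_elim
    case (elim n)
    show ?case
    proof
      fix w assume w: "w \<in> grid \<Omega> n"
      then have "\<bar>limit_var h w\<bar> \<le> B" using B(2)[of w] closure_subset by (auto simp: grid_def)
      moreover have "\<bar>sec_diff_var n h w - limit_var h w\<bar> \<le> C * (real n powr (-\<gamma>) + 1 / real n)" using elim w by blast
      moreover have "C * (real n powr (-\<gamma>) + 1 / real n) \<le> C * (1 + 1)"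
        using elim C \<gamma> powr_mono[of "-\<gamma>" 0 "real n"] by (intro mult_left_mono add_mono) auto
      ultimately have "\<bar>limit_var h w\<bar> \<le> B" "\<bar>sec_diff_var n h w - limit_var h w\<bar> \<le> 2 * C" by simp_all
      then show "sec_diff_var n h w \<le> B + 2 * C" by linarith
    qed
  qed
  then show ?thesis using B C by (intro exI[of _ "B + 2 * C"]) auto
qed

text \<open>Row sums of squared covariances are bounded uniformly in \<open>n\<close>. With \<delta>
  = 1 / n the powers of \<open>n\<close> combine so that the covariance depends on the lag only
  through n |w - w'|. The squared exponent 2 (\<alpha> - 3) is -2 - 2\<eta> with \<eta> = 2 -
  \<alpha>, which is positive exactly because \<alpha> < 2. Near pairs are bounded by the
  variances.\<close>

lemma sec_diff_covariance_sum:
  assumes h: "h \<noteq> 0"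
  shows "\<exists>U\<ge>0. \<forall>\<^sub>F n in sequentially. \<forall>w\<in>grid \<Omega> n.
    (\<Sum>w'\<in>grid \<Omega> n. (expectation (\<lambda>\<omega>. sec_diff n h w \<omega> * sec_diff n h w' \<omega>))\<^sup>2) \<le> U"
proof -
  have S: "compact (closure \<Omega>)" using bounded_\<Omega> by (simp add: compact_closure)
  obtain C where C: "C \<ge> 0" "\<forall>\<delta> w w'. 0 < \<delta> \<and> \<delta> \<le> 1 \<and> w \<in> closure \<Omega> \<and> w' \<in> closure \<Omega> \<and> w \<noteq> w' \<and> 4 * norm h * \<delta> \<le> norm (w - w') \<longrightarrow>
    (let G = (\<lambda>x y. R (cmod (f (w + (x * \<delta>) *\<^sub>R h) - f (w' + (y * \<delta>) *\<^sub>R h)))) in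
     \<bar>(G 2 2 - 2 * G 2 1 + G 2 0) - 2 * (G 1 2 - 2 * G 1 1 + G 1 0) + (G 0 2 - 2 * G 0 1 + G 0 0)\<bar>
       \<le> C * \<delta> ^ 3 * norm (w - w') powr (\<alpha> - 3))"
  proof -
    note * = second_difference_covariance[OF \<alpha> R_small _ R4 f_C2 f_inj f_jac S, of h]
    show ?thesis by (rule exE[OF *[OF R_diff]]; (assumption | elim conjE, rule that))
  qed
  obtain V where V: "V \<ge> 0" "\<forall>\<^sub>F n in sequentially. \<forall>w\<in>grid \<Omega> n. sec_diff_var n h w \<le> V"
    using sec_diff_var_bounded[OF h] by blast
  \<comment> \<open>One constant for the near bound \<open>V\<^sup>2\<close> and the far bound
    \<open>C\<^sup>2\<close>.\<close>
  define B where "B = V\<^sup>2 + C\<^sup>2"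
  have B: "B \<ge> 0" by (simp add: B_def)
  have \<eta>: "2 - \<alpha> > 0" using \<alpha> by simp
  have k0: "4 * norm h > 0" using h by simp
  obtain U where U: "U \<ge> 0" "\<forall>n\<ge>1. \<forall>w\<in>grid \<Omega> n. \<forall>g.
    (\<forall>w'\<in>grid \<Omega> n. g w' \<le> B \<and> (4 * norm h \<le> real n * norm (w - w') \<and> w \<noteq> w' \<longrightarrow> g w' \<le> B * (real n * norm (w - w')) powr (-2 - 2 * (2 - \<alpha>))))
    \<longrightarrow> (\<Sum>w'\<in>grid \<Omega> n. g w') \<le> U"
    using grid_power_sum_bounded[OF bounded_\<Omega> \<eta> B k0] by blast
  have "\<forall>\<^sub>F n in sequentially. \<forall>w\<in>grid \<Omega> n.
    (\<Sum>w'\<in>grid \<Omega> n. (expectation (\<lambda>\<omega>. sec_diff n h w \<omega> * sec_diff n h w' \<omega>))\<^sup>2) \<le> U"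
    using V(2) eventually_ge_at_top[of 1]
  proof eventually_elim
    case (elim n)
    show ?case
    proof
      fix w assume w: "w \<in> grid \<Omega> n"
      let ?c = "\<lambda>w'. expectation (\<lambda>\<omega>. sec_diff n h w \<omega> * sec_diff n h w' \<omega>)"
      have "(?c w')\<^sup>2 \<le> B \<and> (4 * norm h \<le> real n * norm (w - w') \<and> w \<noteq> w' \<longrightarrow> (?c w')\<^sup>2 \<le> B * (real n * norm (w - w')) powr (-2 - 2 * (2 - \<alpha>)))"
        if w': "w' \<in> grid \<Omega> n" for w'
      proof (intro conjI impI)
        have i: "integrable M (\<lambda>\<omega>. (sec_diff n h w \<omega>)\<^sup>2)" for w
          by (intro all_moments_integrable all_moments_power sec_diff_moments)
        have ip: "integrable M (\<lambda>\<omega>. sec_diff n h w \<omega> * sec_diff n h w' \<omega>)"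
          by (intro all_moments_integrable all_moments_mult sec_diff_moments)
        have "\<bar>?c w'\<bar> \<le> expectation (\<lambda>\<omega>. \<bar>sec_diff n h w \<omega> * sec_diff n h w' \<omega>\<bar>)"
          using integral_norm_bound[of M "\<lambda>\<omega>. sec_diff n h w \<omega> * sec_diff n h w' \<omega>"] by simp
        also have "\<dots> \<le> expectation (\<lambda>\<omega>. (1 / 2) * (sec_diff n h w \<omega>)\<^sup>2 + (1 / 2) * (sec_diff n h w' \<omega>)\<^sup>2)"
        proof (rule integral_mono)
          show "\<bar>sec_diff n h w \<omega> * sec_diff n h w' \<omega>\<bar> \<le> (1 / 2) * (sec_diff n h w \<omega>)\<^sup>2 + (1 / 2) * (sec_diff n h w' \<omega>)\<^sup>2" for \<omega>
            using sum_squares_bound[of "\<bar>sec_diff n h w \<omega>\<bar>" "\<bar>sec_diff n h w' \<omega>\<bar>"] by (simp add: abs_mult)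
        qed (use i ip in auto)
        also have "\<dots> = (1 / 2) * sec_diff_var n h w + (1 / 2) * sec_diff_var n h w'"
          using i by (simp add: sec_diff_var_def)
        also have "\<dots> \<le> V" using bspec[OF elim(1) w] bspec[OF elim(1) w'] by linarith
        finally have "(?c w')\<^sup>2 \<le> V\<^sup>2" by (intro power2_le_iff_abs_le[THEN iffD2]) (use V in auto)
        then show "(?c w')\<^sup>2 \<le> B" unfolding B_def using zero_le_power2[of C] by linarith
      next
        assume far: "4 * norm h \<le> real n * norm (w - w') \<and> w \<noteq> w'"
        have n: "real n > 0" using elim by simp
        have "w \<in> closure \<Omega>" "w' \<in> closure \<Omega>" using w w' closure_subset by (auto simp: grid_def)
        then have "\<bar>?c w'\<bar> \<le> real n powr \<alpha> * (C * (1 / real n) ^ 3 * norm (w - w') powr (\<alpha> - 3))"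
          unfolding sec_diff_product[OF elim(2)] abs_mult
          using C(2)[rule_format, of "1 / real n" w w'] far elim(2) n
          unfolding Let_def by (intro mult_mono) (auto simp: field_simps)
        \<comment> \<open>n^\<alpha> n^(-3) = n^(\<alpha>-3): normalisation and step length together
          make the bound scale invariant.\<close>
        also have "\<dots> = C * (real n * norm (w - w')) powr (\<alpha> - 3)"
          using n by (simp add: powr_mult powr_diff powr_numeral power_divide)
        finally have "\<bar>?c w'\<bar> \<le> C * (real n * norm (w - w')) powr (\<alpha> - 3)" .
        then have "(?c w')\<^sup>2 \<le> (C * (real n * norm (w - w')) powr (\<alpha> - 3))\<^sup>2"
          by (intro power2_le_iff_abs_le[THEN iffD2]) (use C in auto)
        also have "\<dots> = C\<^sup>2 * (real n * norm (w - w')) powr (-2 - 2 * (2 - \<alpha>))"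
          by (simp add: power_mult_distrib power2_eq_square powr_add[symmetric])
        also have "\<dots> \<le> B * (real n * norm (w - w')) powr (-2 - 2 * (2 - \<alpha>))"
          by (intro mult_right_mono) (auto simp: B_def)
        finally show "(?c w')\<^sup>2 \<le> B * (real n * norm (w - w')) powr (-2 - 2 * (2 - \<alpha>))" .
      qed
      then show "(\<Sum>w'\<in>grid \<Omega> n. (?c w')\<^sup>2) \<le> U"
        by (intro mp[OF spec[OF bspec[OF mp[OF spec[OF U(2)] elim(2)] w], of "\<lambda>w'. (?c w')\<^sup>2"]] ballI)
    qed
  qed
  then show ?thesis using U(1) by blast
qed

subsection \<open>Fluctuations of weighted sums of squares\<close>

definition fluct :: "nat \<Rightarrow> complex \<Rightarrow> (complex \<Rightarrow> real) \<Rightarrow> 'w \<Rightarrow> real" where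
  "fluct n h c \<omega> = (\<Sum>w\<in>grid \<Omega> n. c w * ((sec_diff n h w \<omega>)\<^sup>2 - sec_diff_var n h w))"

lemma fluct_moments: "all_moments M (fluct n h c)"
  unfolding fluct_def[abs_def]
  by (intro all_moments_sum all_moments_cmult all_moments_diff all_moments_power all_moments_const
      sec_diff_moments finite_measure_axioms)

text \<open>Nonnegative weights are absorbed as \<open>sqrt (c w)\<close> into the Gaussian
  variables, so that the form is again a plain sum of squares. The double sum of squared covariances
  then has at most \<open>card (grid \<Omega> n)\<close> rows, each bounded by
  \<open>B\<^sup>2 * U\<close>.\<close>

lemma fluct_moment_nonneg:
  assumes n: "n \<ge> 1" and U: "\<And>w. w \<in> grid \<Omega> n \<Longrightarrow>
      (\<Sum>w'\<in>grid \<Omega> n. (expectation (\<lambda>\<omega>. sec_diff n h w \<omega> * sec_diff n h w' \<omega>))\<^sup>2) \<le> U"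
    and c: "\<And>w. w \<in> grid \<Omega> n \<Longrightarrow> 0 \<le> c w" "\<And>w. w \<in> grid \<Omega> n \<Longrightarrow> c w \<le> B"
  shows "expectation (\<lambda>\<omega>. fluct n h c \<omega> ^ (2 * q)) \<le> chaos_const q * (B\<^sup>2 * U * real (card (grid \<Omega> n))) ^ q"
proof -
  note fin = finite_grid[OF bounded_\<Omega> n]
  let ?I = "grid \<Omega> n"
  define V where "V w \<omega> = sqrt (c w) * sec_diff n h w \<omega>" for w \<omega>
  have V: "lin_comb Z (V w)" for w unfolding V_def[abs_def] by (intro lin_comb_scale sec_diff_lin_comb)
  have mean0: "expectation (V w) = 0" for w unfolding V_def[abs_def] by (simp add: sec_diff_mean)
  have prod: "expectation (\<lambda>\<omega>. V w \<omega> * V w' \<omega>) = sqrt (c w) * sqrt (c w') * expectation (\<lambda>\<omega>. sec_diff n h w \<omega> * sec_diff n h w' \<omega>)" for w w'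
    by (simp add: V_def mult_ac flip: integral_mult_right_zero)
  have "fluct n h c \<omega> = (\<Sum>w\<in>?I. (V w \<omega>)\<^sup>2 - expectation (\<lambda>\<omega>. (V w \<omega>)\<^sup>2))" for \<omega>
    unfolding fluct_def
    by (intro sum.cong refl) (simp add: V_def power_mult_distrib c right_diff_distrib sec_diff_var_def)
  then have "expectation (\<lambda>\<omega>. fluct n h c \<omega> ^ (2 * q)) = expectation (\<lambda>\<omega>. (\<Sum>w\<in>?I. (V w \<omega>)\<^sup>2 - expectation (\<lambda>\<omega>. (V w \<omega>)\<^sup>2)) ^ (2 * q))"
    by simp
  also have "\<dots> \<le> chaos_const q * (\<Sum>w\<in>?I. \<Sum>w'\<in>?I. (expectation (\<lambda>\<omega>. V w \<omega> * V w' \<omega>))\<^sup>2) ^ q"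
    by (rule gaussian_sum_squares_moment[OF prob_M fin lin_comb_normal lin_comb_moments mean0])
      (intro lin_comb_sum lin_comb_scale V)+
  also have "\<dots> \<le> chaos_const q * (B\<^sup>2 * U * real (card ?I)) ^ q"
  proof (intro mult_left_mono power_mono)
    have "(\<Sum>w\<in>?I. \<Sum>w'\<in>?I. (expectation (\<lambda>\<omega>. V w \<omega> * V w' \<omega>))\<^sup>2)
      \<le> (\<Sum>w\<in>?I. \<Sum>w'\<in>?I. B\<^sup>2 * (expectation (\<lambda>\<omega>. sec_diff n h w \<omega> * sec_diff n h w' \<omega>))\<^sup>2)"
    proof (intro sum_mono)
      fix w w' assume w: "w \<in> ?I" "w' \<in> ?I"
      have "c w * c w' \<le> B * B" using c w order_trans[OF c(1)[OF w(1)] c(2)[OF w(1)]] by (intro mult_mono) auto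
      then show "(expectation (\<lambda>\<omega>. V w \<omega> * V w' \<omega>))\<^sup>2 \<le> B\<^sup>2 * (expectation (\<lambda>\<omega>. sec_diff n h w \<omega> * sec_diff n h w' \<omega>))\<^sup>2"
        unfolding prod power_mult_distrib using c w by (intro mult_right_mono) (auto simp: power2_eq_square[of B])
    qed
    also have "\<dots> = B\<^sup>2 * (\<Sum>w\<in>?I. \<Sum>w'\<in>?I. (expectation (\<lambda>\<omega>. sec_diff n h w \<omega> * sec_diff n h w' \<omega>))\<^sup>2)"
      by (simp add: sum_distrib_left)
    also have "\<dots> \<le> B\<^sup>2 * (\<Sum>w\<in>?I. U)" by (intro mult_left_mono sum_mono U) auto
    finally show "(\<Sum>w\<in>?I. \<Sum>w'\<in>?I. (expectation (\<lambda>\<omega>. V w \<omega> * V w' \<omega>))\<^sup>2) \<le> B\<^sup>2 * U * real (card ?I)" by (simp add: mult_ac)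
    show "0 \<le> chaos_const q" using normal_moment_pos[of q] by (simp add: chaos_const_def)
  qed (auto intro!: sum_nonneg)
  finally show ?thesis .
qed

text \<open>Kernels and their derivatives may change sign. The weights are split into positive and
  negative parts, at the price of a power of 2.\<close>

lemma fluct_moment:
  assumes n: "n \<ge> 1" and U: "\<And>w. w \<in> grid \<Omega> n \<Longrightarrow>
      (\<Sum>w'\<in>grid \<Omega> n. (expectation (\<lambda>\<omega>. sec_diff n h w \<omega> * sec_diff n h w' \<omega>))\<^sup>2) \<le> U"
    and c: "\<And>w. w \<in> grid \<Omega> n \<Longrightarrow> \<bar>c w\<bar> \<le> B"
  shows "expectation (\<lambda>\<omega>. fluct n h c \<omega> ^ (2 * q)) \<le> 2 ^ (2 * q + 1) * chaos_const q * (B\<^sup>2 * U * real (card (grid \<Omega> n))) ^ q"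
proof -
  define cp where "cp w = max 0 (c w)" for w
  define cn where "cn w = max 0 (- c w)" for w
  let ?K = "chaos_const q * (B\<^sup>2 * U * real (card (grid \<Omega> n))) ^ q"
  have e: "fluct n h c \<omega> = fluct n h cp \<omega> - fluct n h cn \<omega>" for \<omega>
    unfolding fluct_def sum_subtractf[symmetric] by (intro sum.cong refl) (auto simp: cp_def cn_def max_def algebra_simps)
  have pw: "(a - b) ^ (2 * q) \<le> 2 ^ (2 * q) * a ^ (2 * q) + 2 ^ (2 * q) * b ^ (2 * q)" for a b :: real
  proof -
    have "(a - b) ^ (2 * q) = \<bar>a - b\<bar> ^ (2 * q)" by (simp add: power_even_abs)
    also have "\<dots> \<le> (2 * max \<bar>a\<bar> \<bar>b\<bar>) ^ (2 * q)" by (intro power_mono) auto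
    also have "\<dots> = 2 ^ (2 * q) * (max \<bar>a\<bar> \<bar>b\<bar>) ^ (2 * q)" by (simp add: power_mult_distrib)
    also have "\<dots> \<le> 2 ^ (2 * q) * (\<bar>a\<bar> ^ (2 * q) + \<bar>b\<bar> ^ (2 * q))"
      by (intro mult_left_mono) (auto simp: max_def)
    finally show ?thesis by (simp add: power_even_abs distrib_left)
  qed
  have int: "integrable M (\<lambda>\<omega>. fluct n h c \<omega> ^ (2 * q))" for c
    by (rule all_moments_integrable_power[OF fluct_moments])
  have "expectation (\<lambda>\<omega>. fluct n h c \<omega> ^ (2 * q)) \<le> expectation (\<lambda>\<omega>. 2 ^ (2 * q) * fluct n h cp \<omega> ^ (2 * q) + 2 ^ (2 * q) * fluct n h cn \<omega> ^ (2 * q))"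
  proof (rule integral_mono[OF int])
    show "integrable M (\<lambda>\<omega>. 2 ^ (2 * q) * fluct n h cp \<omega> ^ (2 * q) + 2 ^ (2 * q) * fluct n h cn \<omega> ^ (2 * q))"
      by (intro Bochner_Integration.integrable_add integrable_mult_right int)
    show "fluct n h c \<omega> ^ (2 * q) \<le> 2 ^ (2 * q) * fluct n h cp \<omega> ^ (2 * q) + 2 ^ (2 * q) * fluct n h cn \<omega> ^ (2 * q)" for \<omega>
      unfolding e by (rule pw)
  qed
  also have "\<dots> = 2 ^ (2 * q) * expectation (\<lambda>\<omega>. fluct n h cp \<omega> ^ (2 * q)) + 2 ^ (2 * q) * expectation (\<lambda>\<omega>. fluct n h cn \<omega> ^ (2 * q))"
    using int by simp
  also have "\<dots> \<le> 2 ^ (2 * q) * ?K + 2 ^ (2 * q) * ?K"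
    by (intro add_mono mult_left_mono fluct_moment_nonneg n U)
      (use c in \<open>force simp: cp_def cn_def abs_le_iff intro: order_trans[OF abs_ge_zero]\<close>)+
  finally show ?thesis by (simp add: mult_ac)
qed

lemma fluct_tail:
  assumes n: "n \<ge> 1" and U: "\<And>w. w \<in> grid \<Omega> n \<Longrightarrow>
      (\<Sum>w'\<in>grid \<Omega> n. (expectation (\<lambda>\<omega>. sec_diff n h w \<omega> * sec_diff n h w' \<omega>))\<^sup>2) \<le> U"
    and c: "\<And>w. w \<in> grid \<Omega> n \<Longrightarrow> \<bar>c w\<bar> \<le> B" and \<epsilon>: "\<epsilon> > 0"
  shows "prob {\<omega>\<in>space M. \<epsilon> \<le> \<bar>fluct n h c \<omega>\<bar>}
    \<le> 2 ^ (2 * q + 1) * chaos_const q * (B\<^sup>2 * U * real (card (grid \<Omega> n))) ^ q / \<epsilon> ^ (2 * q)"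
proof -
  have [measurable]: "fluct n h c \<in> borel_measurable M" by (rule all_moments_measurable[OF fluct_moments])
  have "prob {\<omega>\<in>space M. \<epsilon> \<le> \<bar>fluct n h c \<omega>\<bar>} \<le> prob {\<omega>\<in>space M. \<epsilon> ^ (2 * q) \<le> fluct n h c \<omega> ^ (2 * q)}"
  proof (rule finite_measure_mono)
    have "\<epsilon> ^ (2 * q) \<le> x ^ (2 * q)" if "\<epsilon> \<le> \<bar>x\<bar>" for x :: real
      using power_mono[OF that, of "2 * q"] \<epsilon> by (simp add: power_even_abs)
    then show "{\<omega>\<in>space M. \<epsilon> \<le> \<bar>fluct n h c \<omega>\<bar>} \<subseteq> {\<omega>\<in>space M. \<epsilon> ^ (2 * q) \<le> fluct n h c \<omega> ^ (2 * q)}" by auto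
  qed measurable
  also have "\<dots> \<le> expectation (\<lambda>\<omega>. fluct n h c \<omega> ^ (2 * q)) / \<epsilon> ^ (2 * q)"
    by (rule integral_Markov_inequality_measure[where A = "space M"])
      (use \<epsilon> in \<open>auto intro!: all_moments_integrable_power fluct_moments\<close>)
  also have "\<dots> \<le> 2 ^ (2 * q + 1) * chaos_const q * (B\<^sup>2 * U * real (card (grid \<Omega> n))) ^ q / \<epsilon> ^ (2 * q)"
    using \<epsilon> by (intro divide_right_mono fluct_moment[OF n U c]) auto
  finally show ?thesis .
qed

text \<open>A union bound over polynomially many weight functions \<open>c n t\<close>; the number of moments is
  chosen according to \<open>\<beta>\<close>.\<close>

lemma fluct_uniform_on_net:
  assumes h: "h \<noteq> 0" and \<beta>: "\<beta> > 0" and C: "C \<ge> 0"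
    and c: "\<forall>\<^sub>F n in sequentially. \<forall>t\<in>grid \<Omega> n. \<forall>w\<in>grid \<Omega> n. \<bar>c n t w\<bar> \<le> C * real n powr (-1-\<beta>)"
  shows "AE \<omega> in M. \<forall>\<epsilon>>0. \<forall>\<^sub>F n in sequentially. \<forall>t\<in>grid \<Omega> n. \<bar>fluct n h (c n t) \<omega>\<bar> < \<epsilon>"
proof -
  obtain U where U: "U \<ge> 0" and evU: "\<forall>\<^sub>F n in sequentially. \<forall>w\<in>grid \<Omega> n.
    (\<Sum>w'\<in>grid \<Omega> n. (expectation (\<lambda>\<omega>. sec_diff n h w \<omega> * sec_diff n h w' \<omega>))\<^sup>2) \<le> U"
    using sec_diff_covariance_sum[OF h] by blast
  obtain G where G: "\<And>n. n \<ge> 1 \<Longrightarrow> real (card (grid \<Omega> n)) \<le> G * (real n)\<^sup>2" using card_grid_le[OF bounded_\<Omega>] by blast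
  have G0: "G \<ge> 0" using G[of 1] by (simp add: order_trans[OF of_nat_0_le_iff])
  \<comment> \<open>The moment of order \<open>2 * q\<close> is O(n^(-2\<beta>q)), hence O(n^(-4));
    the union over O(n^2) grid points leaves the summable n^(-2).\<close>
  obtain q :: nat where "2 / \<beta> < real q" using reals_Archimedean2 by blast
  then have q: "2 * \<beta> * real q \<ge> 4" using \<beta> by (simp add: field_simps)
  have meas: "{\<omega>\<in>space M. \<epsilon> \<le> \<bar>fluct n h c \<omega>\<bar>} \<in> sets M" for n c \<epsilon>
    using all_moments_measurable[OF fluct_moments, of n h c] by measurable
  have AE1: "AE \<omega> in M. \<forall>\<^sub>F n in sequentially. \<forall>t\<in>grid \<Omega> n. \<bar>fluct n h (c n t) \<omega>\<bar> < \<epsilon>" if \<epsilon>: "\<epsilon> > 0" for \<epsilon> :: real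
  proof -
    define A where "A n = (\<Union>t\<in>grid \<Omega> n. {\<omega>\<in>space M. \<epsilon> \<le> \<bar>fluct n h (c n t) \<omega>\<bar>})" for n
    obtain N where "\<forall>n\<ge>N. n \<ge> 1 \<and> (\<forall>w\<in>grid \<Omega> n.
        (\<Sum>w'\<in>grid \<Omega> n. (expectation (\<lambda>\<omega>. sec_diff n h w \<omega> * sec_diff n h w' \<omega>))\<^sup>2) \<le> U) \<and>
      (\<forall>t\<in>grid \<Omega> n. \<forall>w\<in>grid \<Omega> n. \<bar>c n t w\<bar> \<le> C * real n powr (-1-\<beta>))"
      using eventually_conj[OF eventually_ge_at_top[of 1] eventually_conj[OF evU c]] unfolding eventually_sequentially by blast
    then have N: "N \<ge> 1" "\<And>n. n \<ge> N \<Longrightarrow> \<forall>w\<in>grid \<Omega> n.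
        (\<Sum>w'\<in>grid \<Omega> n. (expectation (\<lambda>\<omega>. sec_diff n h w \<omega> * sec_diff n h w' \<omega>))\<^sup>2) \<le> U"
      "\<And>n. n \<ge> N \<Longrightarrow> \<forall>t\<in>grid \<Omega> n. \<forall>w\<in>grid \<Omega> n. \<bar>c n t w\<bar> \<le> C * real n powr (-1-\<beta>)"
      by auto
    define K where "K = G * (2 ^ (2 * q + 1) * chaos_const q * (C\<^sup>2 * U * G) ^ q / \<epsilon> ^ (2 * q))"
    have A_meas: "A n \<in> sets M" if "n \<ge> 1" for n
      unfolding A_def by (intro sets.finite_UN finite_grid[OF bounded_\<Omega> that] meas)
    have PA: "prob (A n) \<le> K * (1 / (real n)\<^sup>2)" if n: "n \<ge> N" for n
    proof -
      have n1: "n \<ge> 1" using n N by simp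
      have n0: "real n > 0" using n1 by simp
      let ?b = "(C * real n powr (-1-\<beta>))\<^sup>2 * U * real (card (grid \<Omega> n))"
      let ?T = "2 ^ (2 * q + 1) * chaos_const q * ?b ^ q / \<epsilon> ^ (2 * q)"
      have "?b \<le> (C * real n powr (-1-\<beta>))\<^sup>2 * U * (G * (real n)\<^sup>2)"
        using G[OF n1] U by (intro mult_left_mono) auto
      also have "\<dots> = C\<^sup>2 * U * G * (real n powr (-1-\<beta>) * real n powr (-1-\<beta>) * (real n powr 2))"
        using n0 by (simp add: power2_eq_square mult_ac powr_numeral)
      also have "real n powr (-1-\<beta>) * real n powr (-1-\<beta>) * (real n powr 2) = real n powr (-2*\<beta>)"
        by (simp only: powr_add[symmetric]) simp
      finally have "?b ^ q \<le> (C\<^sup>2 * U * G * real n powr (-2*\<beta>)) ^ q"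
        using U by (intro power_mono) auto
      also have "\<dots> = (C\<^sup>2 * U * G) ^ q * real n powr (-2*\<beta>*real q)"
      proof -
        have "(real n powr (-2*\<beta>)) ^ q = (real n powr (-2*\<beta>)) powr real q"
          using n0 by (simp add: powr_realpow)
        also have "\<dots> = real n powr (-2*\<beta>*real q)" by (rule powr_powr)
        finally show ?thesis by (simp only: power_mult_distrib)
      qed
      also have "\<dots> \<le> (C\<^sup>2 * U * G) ^ q * real n powr (-4)"
        using q U G0 n1 by (intro mult_left_mono powr_mono) (auto simp: algebra_simps)
      finally have b: "?b ^ q \<le> (C\<^sup>2 * U * G) ^ q * real n powr (-4)" .
      have cc: "chaos_const q \<ge> 0" using normal_moment_pos[of q] by (simp add: chaos_const_def)
      have "prob (A n) \<le> (\<Sum>t\<in>grid \<Omega> n. prob {\<omega>\<in>space M. \<epsilon> \<le> \<bar>fluct n h (c n t) \<omega>\<bar>})"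
        unfolding A_def by (intro finite_measure_subadditive_finite finite_grid[OF bounded_\<Omega> n1]) (use meas in auto)
      also have "\<dots> \<le> (\<Sum>t\<in>grid \<Omega> n. ?T)"
        by (intro sum_mono fluct_tail n1 \<epsilon>) (use N n in auto)
      also have "\<dots> = real (card (grid \<Omega> n)) * ?T" by simp
      also have "\<dots> \<le> (G * (real n)\<^sup>2) * (2 ^ (2 * q + 1) * chaos_const q * ((C\<^sup>2 * U * G) ^ q * real n powr (-4)) / \<epsilon> ^ (2 * q))"
        using G[OF n1] b \<epsilon> cc U G0 by (intro mult_mono divide_right_mono mult_left_mono) auto
      also have "real n powr (-4) = 1 / real n ^ 4" using n0 by (simp add: powr_minus_divide powr_numeral)
      also have "(G * (real n)\<^sup>2) * (2 ^ (2 * q + 1) * chaos_const q * ((C\<^sup>2 * U * G) ^ q * (1 / real n ^ 4)) / \<epsilon> ^ (2 * q)) = K * (1 / (real n)\<^sup>2)"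
        using n0 by (simp add: K_def power2_eq_square eval_nat_numeral mult_ac)
      finally show ?thesis .
    qed
    have "summable (\<lambda>n. K * (1 / (real n)\<^sup>2))"
      using inverse_power_summable[of 2, where 'a = real] by (intro summable_mult) (simp add: inverse_eq_divide power_one_over)
    then have "summable (\<lambda>n. K * (1 / (real (n + N))\<^sup>2))"
      using summable_iff_shift[of "\<lambda>n. K * (1 / (real n)\<^sup>2)" N] by simp
    then have "summable (\<lambda>n. prob (A (n + N)))"
    proof (rule summable_comparison_test'[where N = 0])
      show "norm (prob (A (n + N))) \<le> K * (1 / (real (n + N))\<^sup>2)" for n
        using PA[of "n + N"] by simp
    qed
    then have "AE \<omega> in M. \<forall>\<^sub>F n in sequentially. \<omega> \<in> space M - A (n + N)"
      by (intro borel_cantelli_AE1) (use A_meas N emeasure_finite in \<open>auto simp: less_top[symmetric]\<close>)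
    then show ?thesis
    proof (rule AE_mp[OF _ AE_I2], intro impI)
      fix \<omega> assume "\<omega> \<in> space M" and ev: "\<forall>\<^sub>F n in sequentially. \<omega> \<in> space M - A (n + N)"
      have "\<forall>\<^sub>F n in sequentially. \<omega> \<in> space M - A n"
        using ev eventually_sequentially_seg[of "\<lambda>n. \<omega> \<in> space M - A n" N] by simp
      then show "\<forall>\<^sub>F n in sequentially. \<forall>t\<in>grid \<Omega> n. \<bar>fluct n h (c n t) \<omega>\<bar> < \<epsilon>"
        by eventually_elim (auto simp: A_def not_le)
    qed
  qed
  \<comment> \<open>Countably many thresholds, so that a single null set serves every
    \<epsilon>.\<close>
  have "AE \<omega> in M. \<forall>j::nat. \<forall>\<^sub>F n in sequentially. \<forall>t\<in>grid \<Omega> n. \<bar>fluct n h (c n t) \<omega>\<bar> < 1 / real (Suc j)"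
    by (subst AE_all_countable) (intro allI AE1, simp)
  then show ?thesis
  proof (rule AE_mp[OF _ AE_I2], intro impI allI)
    fix \<omega> and \<epsilon> :: real
    assume ev: "\<forall>j::nat. \<forall>\<^sub>F n in sequentially. \<forall>t\<in>grid \<Omega> n. \<bar>fluct n h (c n t) \<omega>\<bar> < 1 / real (Suc j)" and \<epsilon>: "\<epsilon> > 0"
    obtain j where j: "1 / real (Suc j) < \<epsilon>" using nat_approx_posE[OF \<epsilon>] by blast
    show "\<forall>\<^sub>F n in sequentially. \<forall>t\<in>grid \<Omega> n. \<bar>fluct n h (c n t) \<omega>\<bar> < \<epsilon>"
      using ev[rule_format, of j] by eventually_elim (use j in force)
  qed
qed

text \<open>\<open>a\<close> is the power of the bandwidth in the normalisation: 2 for the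
  statistic, 3 for its derivatives. The net consists of the grid itself. Between \<open>t\<close>
  and its grid point the Lipschitz kernel changes each weight by O(1 / (n b^(a+1))) times 1 / n^2,
  so the average absolute deviation must stay bounded; this comes from the net lemma again, with the
  constant weights 1 / n^2.\<close>

lemma fluct_uniform:
  fixes k :: "complex \<Rightarrow> real"
  assumes h: "h \<noteq> 0" and \<Theta>: "compact \<Theta>" "\<Theta> \<subseteq> \<Omega>"
    and lip: "\<And>x y. \<bar>k x - k y\<bar> \<le> L * norm (x - y)" and L: "L \<ge> 0"
    and b: "\<And>n. n \<ge> 1 \<Longrightarrow> b n > 0" "b \<longlonglongrightarrow> 0"
    and \<beta>: "\<beta> > 0" "(\<lambda>n. 1 / (real n * b n ^ Suc a)) \<in> O(\<lambda>n. real n powr (-\<beta>))"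
  shows "AE \<omega> in M. uniform_limit \<Theta>
    (\<lambda>n t. 1 / ((real n)\<^sup>2 * b n ^ a) * (\<Sum>w\<in>grid \<Omega> n. k ((w - t) / of_real (b n)) * ((sec_diff n h w \<omega>)\<^sup>2 - sec_diff_var n h w)))
    (\<lambda>_. 0) sequentially"
proof -
  obtain \<rho> where \<rho>0: "\<rho> > 0" and \<rho>: "\<And>w. w \<in> \<Omega> \<Longrightarrow> norm w \<le> \<rho>" using bounded_\<Omega> unfolding bounded_pos by blast
  obtain D where D: "D > 0" "\<forall>\<^sub>F n in sequentially. norm (1 / (real n * b n ^ Suc a)) \<le> D * norm (real n powr (-\<beta>))"
    using \<beta>(2) by (elim landau_o.bigE)
  define c where "c n t w = 1 / ((real n)\<^sup>2 * b n ^ a) * k ((w - t) / of_real (b n))" for n t w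
  \<comment> \<open>For \<open>b n < 1\<close> the Lipschitz bound gives at most
    \<open>Ck / b n\<close> for the kernel at rescaled differences of points of \<Omega>.\<close>
  define Ck where "Ck = \<bar>k 0\<bar> + L * (2 * \<rho>)"
  have Ck: "Ck \<ge> 0" using L \<rho>0 by (simp add: Ck_def)
  have cb: "\<forall>\<^sub>F n in sequentially. \<forall>t\<in>grid \<Omega> n. \<forall>w\<in>grid \<Omega> n. \<bar>c n t w\<bar> \<le> (Ck * D) * real n powr (-1-\<beta>)"
    using D(2) eventually_ge_at_top[of 1] order_tendstoD(2)[OF b(2) zero_less_one]
  proof eventually_elim
    case (elim n)
    have bn: "b n > 0" "b n < 1" using elim b(1) by auto
    have n0: "real n > 0" using elim by simp
    show ?case
    proof (intro ballI)
      fix t w assume "t \<in> grid \<Omega> n" "w \<in> grid \<Omega> n"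
      then have "norm (w - t) \<le> 2 * \<rho>" using norm_triangle_ineq4[of w t] \<rho>[of w] \<rho>[of t] by (auto simp: grid_def)
      then have "L * norm ((w - t) / of_real (b n)) \<le> L * (2 * \<rho>) / b n"
        using L bn by (simp add: norm_divide divide_right_mono mult_left_mono)
      moreover have "\<bar>k 0\<bar> \<le> \<bar>k 0\<bar> / b n" using bn by (simp add: pos_le_divide_eq mult_left_le)
      ultimately have kb: "\<bar>k ((w - t) / of_real (b n))\<bar> \<le> Ck / b n"
        using lip[of "(w - t) / of_real (b n)" 0] by (simp add: Ck_def add_divide_distrib)
      have "\<bar>c n t w\<bar> = 1 / ((real n)\<^sup>2 * b n ^ a) * \<bar>k ((w - t) / of_real (b n))\<bar>"
        using bn by (simp add: c_def abs_mult)
      also have "\<dots> \<le> 1 / ((real n)\<^sup>2 * b n ^ a) * (Ck / b n)"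
        using kb bn by (intro mult_left_mono) auto
      also have "\<dots> = Ck * (1 / (real n * b n ^ Suc a)) * (1 / real n)" by (simp add: power2_eq_square)
      also have "\<dots> \<le> Ck * (D * real n powr (-\<beta>)) * (1 / real n)"
        using elim(1) bn Ck by (intro mult_right_mono mult_left_mono) auto
      also have "\<dots> = (Ck * D) * real n powr (-1-\<beta>)"
        using n0 by (simp add: powr_diff powr_minus_divide powr_minus)
      finally show "\<bar>c n t w\<bar> \<le> (Ck * D) * real n powr (-1-\<beta>)" .
    qed
  qed
  have AE1: "AE \<omega> in M. \<forall>\<epsilon>>0. \<forall>\<^sub>F n in sequentially. \<forall>t\<in>grid \<Omega> n. \<bar>fluct n h (c n t) \<omega>\<bar> < \<epsilon>"
    by (rule fluct_uniform_on_net[OF h \<beta>(1) _ cb]) (use Ck D in auto)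
  \<comment> \<open>Constant weights have order n^(-2) = n^(-1-1), so the net lemma applies with
    exponent 1.\<close>
  have "\<forall>\<^sub>F n in sequentially. \<forall>t\<in>grid \<Omega> n. \<forall>w\<in>grid \<Omega> n. \<bar>(\<lambda>n t w. 1 / (real n)\<^sup>2) n t w\<bar> \<le> 1 * real n powr (-1-1)"
    using eventually_ge_at_top[of 1] by eventually_elim (simp add: powr_minus_divide powr_numeral)
  then have AE2: "AE \<omega> in M. \<forall>\<epsilon>>0. \<forall>\<^sub>F n in sequentially. \<forall>t\<in>grid \<Omega> n. \<bar>fluct n h ((\<lambda>n t w. 1 / (real n)\<^sup>2) n t) \<omega>\<bar> < \<epsilon>"
    by (intro fluct_uniform_on_net[OF h zero_less_one, of 1]) auto
  obtain V where V: "V \<ge> 0" "\<forall>\<^sub>F n in sequentially. \<forall>w\<in>grid \<Omega> n. sec_diff_var n h w \<le> V"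
    using sec_diff_var_bounded[OF h] by blast
  obtain G where G: "\<And>n. n \<ge> 1 \<Longrightarrow> real (card (grid \<Omega> n)) \<le> G * (real n)\<^sup>2" using card_grid_le[OF bounded_\<Omega>] by blast
  have G0: "G \<ge> 0" using G[of 1] by (simp add: order_trans[OF of_nat_0_le_iff])
  obtain \<delta> where \<delta>: "\<delta> > 0" "(\<Union>t\<in>\<Theta>. cball t \<delta>) \<subseteq> \<Omega>"
    using compact_subset_open_imp_cball_epsilon_subset[OF \<Theta>(1) open_\<Omega> \<Theta>(2)] by blast
  \<comment> \<open>\<open>2 * L\<close> bounds the change of a weight up to rates, and
    \<open>2 * V * G + 1\<close> the average absolute deviation.\<close>
  define Q where "Q = 2 * L * (2 * V * G + 1)"
  have Q0: "Q \<ge> 0" using L V G0 by (simp add: Q_def)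
  have lim: "(\<lambda>n. Q * (D * real n powr (-\<beta>))) \<longlonglongrightarrow> 0"
    by (intro tendsto_mult_right_zero tendsto_neg_powr filterlim_real_sequentially) (use \<beta> in auto)
  have n2: "(\<lambda>n. 2 / real n) \<longlonglongrightarrow> 0" by (rule lim_const_over_n)
  show ?thesis
    using AE1 AE2
  proof eventually_elim
    case (elim \<omega>)
    let ?x = "\<lambda>n w. (sec_diff n h w \<omega>)\<^sup>2 - sec_diff_var n h w"
    have flc: "1 / ((real n)\<^sup>2 * b n ^ a) * (\<Sum>w\<in>grid \<Omega> n. k ((w - t) / of_real (b n)) * ?x n w) = fluct n h (c n t) \<omega>" for n t
      by (simp add: fluct_def c_def sum_distrib_left sum_divide_distrib mult_ac)
    show ?case
      unfolding flc
    proof (rule uniform_limitI)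
      fix \<epsilon> :: real assume \<epsilon>: "\<epsilon> > 0"
      then have \<epsilon>2: "\<epsilon> / 2 > 0" by simp
      show "\<forall>\<^sub>F n in sequentially. \<forall>t\<in>\<Theta>. dist (fluct n h (c n t) \<omega>) 0 < \<epsilon>"
        using elim(1)[rule_format, OF \<epsilon>2] elim(2)[rule_format, OF zero_less_one] D(2) V(2) eventually_ge_at_top[of 1]
          order_tendstoD(2)[OF lim \<epsilon>2] order_tendstoD(2)[OF n2 \<delta>(1)]
      proof eventually_elim
        case (elim n)
        have bn: "b n > 0" using elim b(1) by auto
        have n0: "real n > 0" using elim by simp
        show ?case
        proof
          fix t assume t: "t \<in> \<Theta>"
          define t' where "t' = grid_point n t"
          have tt: "norm (t' - t) \<le> 2 / real n" unfolding t'_def by (rule dist_grid_point[OF elim(5)])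
          then have "t' \<in> cball t \<delta>" using elim(7) by (simp add: dist_norm norm_minus_commute)
          then have t': "t' \<in> grid \<Omega> n" using \<delta>(2) t unfolding t'_def by (intro grid_point_in_grid) blast
          have cd: "\<bar>c n t w - c n t' w\<bar> \<le> 2 * L * (1 / (real n * b n ^ Suc a)) * (1 / (real n)\<^sup>2)" for w
          proof -
            have "c n t w - c n t' w = 1 / ((real n)\<^sup>2 * b n ^ a) * (k ((w - t) / of_real (b n)) - k ((w - t') / of_real (b n)))"
              by (simp add: c_def right_diff_distrib)
            moreover have "\<bar>k ((w - t) / of_real (b n)) - k ((w - t') / of_real (b n))\<bar> \<le> L * (2 / real n / b n)"
            proof -
              have "\<bar>k ((w - t) / of_real (b n)) - k ((w - t') / of_real (b n))\<bar> \<le> L * norm ((w - t) / of_real (b n) - (w - t') / of_real (b n))"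
                by (rule lip)
              also have "(w - t) / of_real (b n) - (w - t') / of_real (b n) = (t' - t) / of_real (b n)"
                by (simp add: diff_divide_distrib)
              also have "L * norm ((t' - t) / of_real (b n)) \<le> L * (2 / real n / b n)"
                using mult_left_mono[OF divide_right_mono[OF tt, of "b n"], of L] bn L by (simp add: norm_divide)
              finally show ?thesis .
            qed
            ultimately have "\<bar>c n t w - c n t' w\<bar> \<le> 1 / ((real n)\<^sup>2 * b n ^ a) * (L * (2 / real n / b n))"
              using bn by (simp only: abs_mult) (intro mult_mono, auto)
            also have "\<dots> = 2 * L * (1 / (real n * b n ^ Suc a)) * (1 / (real n)\<^sup>2)" by (simp add: power2_eq_square mult_ac)
            finally show ?thesis .
          qed
          let ?r = "1 / (real n * b n ^ Suc a)"
          have sv: "0 \<le> sec_diff_var n h w" for w by (simp add: sec_diff_var_def)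
          have sum_x: "(\<Sum>w\<in>grid \<Omega> n. 1 / (real n)\<^sup>2 * \<bar>?x n w\<bar>) \<le> 2 * V * G + 1"
          proof -
            \<comment> \<open>A deviation is at least \<open>- V\<close>, hence its absolute value
              is at most the deviation plus \<open>2 * V\<close>; this returns the sum of absolute
              values to a linear statistic.\<close>
            have "(\<Sum>w\<in>grid \<Omega> n. 1 / (real n)\<^sup>2 * \<bar>?x n w\<bar>) \<le> (\<Sum>w\<in>grid \<Omega> n. 1 / (real n)\<^sup>2 * (?x n w + 2 * V))"
            proof (intro sum_mono mult_left_mono)
              fix w assume "w \<in> grid \<Omega> n"
              then have "sec_diff_var n h w \<le> V" using elim(4) by blast
              then show "\<bar>?x n w\<bar> \<le> ?x n w + 2 * V"
                using sv[of w] zero_le_power2[of "sec_diff n h w \<omega>"] by linarith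
            qed auto
            also have "\<dots> = fluct n h (\<lambda>w. 1 / (real n)\<^sup>2) \<omega> + 2 * V * (real (card (grid \<Omega> n)) / (real n)\<^sup>2)"
              by (simp add: fluct_def distrib_left sum.distrib add_divide_distrib)
            also have "\<dots> \<le> 1 + 2 * V * G"
            proof (intro add_mono mult_left_mono)
              show "fluct n h (\<lambda>w. 1 / (real n)\<^sup>2) \<omega> \<le> 1" using elim(2) t' by (force simp: abs_less_iff)
              show "real (card (grid \<Omega> n)) / (real n)\<^sup>2 \<le> G" using G[OF elim(5)] n0 by (simp add: divide_le_eq)
            qed (use V in auto)
            finally show ?thesis by simp
          qed
          have eq: "fluct n h (c n t) \<omega> - fluct n h (c n t') \<omega> = (\<Sum>w\<in>grid \<Omega> n. (c n t w - c n t' w) * ?x n w)"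
            by (simp add: fluct_def sum_subtractf[symmetric] left_diff_distrib)
          have "\<bar>fluct n h (c n t) \<omega> - fluct n h (c n t') \<omega>\<bar> \<le> (\<Sum>w\<in>grid \<Omega> n. \<bar>(c n t w - c n t' w) * ?x n w\<bar>)"
            unfolding eq by (rule sum_abs)
          also have "\<dots> \<le> (\<Sum>w\<in>grid \<Omega> n. (2 * L * ?r) * (1 / (real n)\<^sup>2 * \<bar>?x n w\<bar>))"
          proof (rule sum_mono)
            fix w
            have "\<bar>(c n t w - c n t' w) * ?x n w\<bar> \<le> (2 * L * ?r * (1 / (real n)\<^sup>2)) * \<bar>?x n w\<bar>"
              unfolding abs_mult by (rule mult_right_mono[OF cd abs_ge_zero])
            then show "\<bar>(c n t w - c n t' w) * ?x n w\<bar> \<le> (2 * L * ?r) * (1 / (real n)\<^sup>2 * \<bar>?x n w\<bar>)"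
              by (simp only: mult.assoc)
          qed
          also have "\<dots> = (2 * L * ?r) * (\<Sum>w\<in>grid \<Omega> n. 1 / (real n)\<^sup>2 * \<bar>?x n w\<bar>)"
            by (simp only: sum_distrib_left)
          also have "\<dots> \<le> (2 * L * ?r) * (2 * V * G + 1)"
            using L bn by (intro mult_left_mono sum_x) auto
          also have "\<dots> = Q * ?r" by (simp only: Q_def mult_ac)
          also have "\<dots> \<le> Q * (D * real n powr (-\<beta>))"
            using elim(3) Q0 bn by (intro mult_left_mono) auto
          finally have "\<bar>fluct n h (c n t) \<omega> - fluct n h (c n t') \<omega>\<bar> < \<epsilon> / 2" using elim(6) by linarith
          moreover have "\<bar>fluct n h (c n t') \<omega>\<bar> < \<epsilon> / 2" using elim(1) t' by blast
          ultimately show "dist (fluct n h (c n t) \<omega>) 0 < \<epsilon>" unfolding dist_real_def by linarith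
        qed
      qed
    qed
  qed
qed

end

subsection \<open>The estimators as smooth functions of the statistics\<close>

text \<open>\<Phi> is merely continuous on an open set. The compact image of the limit is thickened
  to a compact set still inside \<open>V\<close>; eventually all values lie there, and uniform
  continuity takes over.\<close>

lemma uniform_limit_compose_open:
  fixes F :: "nat \<Rightarrow> 'a::topological_space \<Rightarrow> 'b::{heine_borel, real_normed_vector}" and \<Phi> :: "'b \<Rightarrow> 'c::metric_space"
  assumes F: "uniform_limit \<Theta> F l sequentially" and l: "continuous_on \<Theta> l" and \<Theta>: "compact \<Theta>"
    and V: "open V" "\<And>t. t \<in> \<Theta> \<Longrightarrow> l t \<in> V" and \<Phi>: "continuous_on V \<Phi>"
  shows "\<forall>\<^sub>F n in sequentially. \<forall>t\<in>\<Theta>. F n t \<in> V"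
    "uniform_limit \<Theta> (\<lambda>n t. \<Phi> (F n t)) (\<lambda>t. \<Phi> (l t)) sequentially"
proof -
  have K: "compact (l ` \<Theta>)" "l ` \<Theta> \<subseteq> V" using l \<Theta> V by (auto intro: compact_continuous_image)
  obtain e where e: "e > 0" "(\<Union>x\<in>l ` \<Theta>. cball x e) \<subseteq> V"
    using compact_subset_open_imp_cball_epsilon_subset[OF K(1) V(1) K(2)] by blast
  define K' where "K' = (\<Union>x\<in>l ` \<Theta>. cball x e)"
  have K': "compact K'" unfolding K'_def by (rule compact_minkowski_sum_cball[OF K(1)])
  have near: "\<forall>\<^sub>F n in sequentially. \<forall>t\<in>\<Theta>. F n t \<in> K'"
    using uniform_limitD[OF F e(1)] by eventually_elim (force simp: K'_def dist_commute intro: less_imp_le)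
  then show "\<forall>\<^sub>F n in sequentially. \<forall>t\<in>\<Theta>. F n t \<in> V"
    by eventually_elim (use e(2) K'_def in blast)
  have lK: "l t \<in> K'" if "t \<in> \<Theta>" for t using that e(1) by (force simp: K'_def)
  have uc: "uniformly_continuous_on K' \<Phi>"
    by (rule compact_uniformly_continuous[OF continuous_on_subset[OF \<Phi>] K']) (use e(2) K'_def in simp)
  show "uniform_limit \<Theta> (\<lambda>n t. \<Phi> (F n t)) (\<lambda>t. \<Phi> (l t)) sequentially"
  proof (rule uniform_limitI)
    fix \<epsilon> :: real assume "\<epsilon> > 0"
    then obtain d where d: "d > 0" "\<And>x y. x \<in> K' \<Longrightarrow> y \<in> K' \<Longrightarrow> dist y x < d \<Longrightarrow> dist (\<Phi> y) (\<Phi> x) < \<epsilon>"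
      using uc unfolding uniformly_continuous_on_def by metis
    show "\<forall>\<^sub>F n in sequentially. \<forall>t\<in>\<Theta>. dist (\<Phi> (F n t)) (\<Phi> (l t)) < \<epsilon>"
      using near uniform_limitD[OF F d(1)] by eventually_elim (use d(2) lK in blast)
  qed
qed

lemma uniform_limit_Pair:
  assumes "uniform_limit \<Theta> F f A" "uniform_limit \<Theta> G g A"
  shows "uniform_limit \<Theta> (\<lambda>n t. (F n t, G n t)) (\<lambda>t. (f t, g t)) A"
proof (rule uniform_limitI)
  fix e :: real assume "e > 0"
  then have "e / 2 > 0" by simp
  show "\<forall>\<^sub>F n in A. \<forall>t\<in>\<Theta>. dist (F n t, G n t) (f t, g t) < e"
    using uniform_limitD[OF assms(1) \<open>e / 2 > 0\<close>] uniform_limitD[OF assms(2) \<open>e / 2 > 0\<close>]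
  proof eventually_elim
    case (elim n)
    show ?case
    proof
      fix t assume "t \<in> \<Theta>"
      then have "dist (F n t) (f t) + dist (G n t) (g t) < e" using elim by fastforce
      moreover have "dist (F n t, G n t) (f t, g t) \<le> dist (F n t) (f t) + dist (G n t) (g t)"
        unfolding dist_Pair_Pair by (rule sqrt_sum_squares_le_sum) auto
      ultimately show "dist (F n t, G n t) (f t, g t) < e" by linarith
    qed
  qed
qed

lemma sup_dist_tendsto_0:
  assumes F: "uniform_limit \<Theta> F l sequentially"
  shows "(\<lambda>n. sup_dist \<Theta> (F n) l) \<longlonglongrightarrow> 0"
proof (rule order_tendstoI)
  fix a :: ennreal assume "0 < a"
  \<comment> \<open>\<open>a\<close> may be infinite; a finite radius below it is needed for the
    metric statement.\<close>
  then obtain r where r: "0 < r" "r < a" using dense by blast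
  then have fin: "r < top" by (meson less_top_ennreal order.strict_trans2 top_greatest)
  define e where "e = enn2real r"
  have e: "ennreal e = r" "e > 0" using fin r by (auto simp: e_def enn2real_positive_iff)
  show "\<forall>\<^sub>F n in sequentially. sup_dist \<Theta> (F n) l < a"
    using uniform_limitD[OF F e(2)]
  proof eventually_elim
    case (elim n)
    have "sup_dist \<Theta> (F n) l \<le> ennreal e"
      unfolding sup_dist_def using elim by (intro SUP_least ennreal_leI) (auto simp: dist_norm less_imp_le)
    then show ?case using r e by simp
  qed
qed auto

text \<open>Inverts the map from r to (8 - 2^(\<alpha>+1)) r^\<alpha>, so that limiting variances
  turn back into lengths.\<close>

definition W_fun :: "real \<Rightarrow> real \<Rightarrow> real" where
  "W_fun \<alpha> x = (x / (8 - 2 powr (\<alpha> + 1))) powr (1 / \<alpha>)"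

definition W_fun' :: "real \<Rightarrow> real \<Rightarrow> real \<Rightarrow> real" where
  "W_fun' \<alpha> x x' = (1 / \<alpha>) * (x / (8 - 2 powr (\<alpha> + 1))) powr (1 / \<alpha> - 1) * (x' / (8 - 2 powr (\<alpha> + 1)))"

text \<open>With \<open>a\<close>, \<open>c\<close>, \<open>e\<close> the squared lengths of the
  derivative of \<open>f\<close> along 1, \<open>\<i>\<close> and \<open>1 + \<i>\<close>, the
  difference \<open>e - a - c\<close> is twice an inner product, and this is four times the
  determinant of the first fundamental form.\<close>

definition disc :: "real \<Rightarrow> real \<Rightarrow> real \<Rightarrow> real" where
  "disc a c e = 4 * a * c - (e - a - c)\<^sup>2"

text \<open>Four times the squared modulus of the Wirtinger derivative of \<open>f\<close>, when
  evaluated at the limits.\<close>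

definition S_fun :: "real \<Rightarrow> real \<Rightarrow> real \<Rightarrow> real" where
  "S_fun a c e = sqrt (disc a c e) + a + c"

definition mu_fun :: "real \<Rightarrow> real \<Rightarrow> real \<Rightarrow> complex" where
  "mu_fun a c e = of_real ((a - c) / S_fun a c e) + \<i> * of_real ((e - a - c) / S_fun a c e)"

text \<open>Derivative along a curve, as an explicit function of values and derivatives. Its
  continuity turns uniform convergence of both into uniform convergence of the derivative of the
  composition.\<close>

definition S_fun' :: "real \<Rightarrow> real \<Rightarrow> real \<Rightarrow> real \<Rightarrow> real \<Rightarrow> real \<Rightarrow> real" where
  "S_fun' a c e a' c' e' =
     (4 * a' * c + 4 * a * c' - 2 * (e - a - c) * (e' - a' - c')) / (2 * sqrt (disc a c e)) + a' + c'"

definition mu_fun' :: "real \<Rightarrow> real \<Rightarrow> real \<Rightarrow> real \<Rightarrow> real \<Rightarrow> real \<Rightarrow> complex" where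
  "mu_fun' a c e a' c' e' =
     of_real (((a' - c') * S_fun a c e - (a - c) * S_fun' a c e a' c' e') / (S_fun a c e * S_fun a c e))
     + \<i> * of_real (((e' - a' - c') * S_fun a c e - (e - a - c) * S_fun' a c e a' c' e') / (S_fun a c e * S_fun a c e))"

text \<open>The value at \<alpha> = 2 is 0; below it the limiting variances do not degenerate and
  can be inverted.\<close>

lemma kappa_pos: "\<alpha> < 2 \<Longrightarrow> (0::real) < 8 - 2 powr (\<alpha> + 1)"
  using powr_less_mono[of "\<alpha> + 1" 3 2] by (simp add: powr_numeral)

lemma S_fun_pos: "0 \<le> a \<Longrightarrow> 0 \<le> c \<Longrightarrow> disc a c e > 0 \<Longrightarrow> S_fun a c e > 0"
  by (simp add: S_fun_def add_pos_nonneg)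

lemma W_fun_derivative:
  assumes x: "(x has_real_derivative x') (at s)" and pos: "x s > 0" and \<alpha>: "\<alpha> < 2"
  shows "((\<lambda>s. W_fun \<alpha> (x s)) has_real_derivative W_fun' \<alpha> (x s) x') (at s)"
  unfolding W_fun_def
  by (rule DERIV_cong[OF DERIV_fun_powr[OF DERIV_cdivide[OF x]]])
    (use pos kappa_pos[OF \<alpha>] in \<open>simp_all add: W_fun'_def\<close>)

lemma mu_fun_derivative:
  assumes a: "(a has_real_derivative a') (at s)" and c: "(c has_real_derivative c') (at s)"
    and e: "(e has_real_derivative e') (at s)"
    and pos: "0 \<le> a s" "0 \<le> c s" "disc (a s) (c s) (e s) > 0"
  shows "((\<lambda>s. mu_fun (a s) (c s) (e s)) has_vector_derivative mu_fun' (a s) (c s) (e s) a' c' e') (at s)"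
proof -
  have d: "((\<lambda>s. disc (a s) (c s) (e s)) has_real_derivative
      4 * a' * c s + 4 * a s * c' - 2 * (e s - a s - c s) * (e' - a' - c')) (at s)"
    unfolding disc_def by (auto intro!: derivative_eq_intros a c e simp: algebra_simps)
  have S: "((\<lambda>s. S_fun (a s) (c s) (e s)) has_real_derivative S_fun' (a s) (c s) (e s) a' c' e') (at s)"
    unfolding S_fun_def
    by (rule DERIV_cong[OF DERIV_add[OF DERIV_add[OF DERIV_chain2[OF DERIV_real_sqrt[OF pos(3)] d] a] c]])
      (use pos in \<open>simp add: S_fun'_def field_simps\<close>)
  have S0: "S_fun (a s) (c s) (e s) \<noteq> 0" using S_fun_pos[OF pos] by simp
  have "((\<lambda>s. (a s - c s) / S_fun (a s) (c s) (e s)) has_vector_derivative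
      ((a' - c') * S_fun (a s) (c s) (e s) - (a s - c s) * S_fun' (a s) (c s) (e s) a' c' e') / (S_fun (a s) (c s) (e s) * S_fun (a s) (c s) (e s))) (at s)"
    "((\<lambda>s. (e s - a s - c s) / S_fun (a s) (c s) (e s)) has_vector_derivative
      ((e' - a' - c') * S_fun (a s) (c s) (e s) - (e s - a s - c s) * S_fun' (a s) (c s) (e s) a' c' e') / (S_fun (a s) (c s) (e s) * S_fun (a s) (c s) (e s))) (at s)"
    unfolding has_real_derivative_iff_has_vector_derivative[symmetric]
    by (intro DERIV_divide DERIV_diff a c e S S0)+
  from this[THEN bounded_linear.has_vector_derivative[OF bounded_linear_of_real[where 'a = complex]]]
  show ?thesis
    unfolding mu_fun_def mu_fun'_def
    by (intro has_vector_derivative_add has_vector_derivative_mult_right)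
qed

text \<open>Strict inequalities make this set open and keep powers and square root away from their
  singular points. On it the estimators are smooth functions of the three statistics.\<close>

definition stat_domain :: "real \<Rightarrow> (real \<times> real \<times> real) set" where
  "stat_domain \<alpha> = {(x, y, z). 0 < x \<and> 0 < y \<and> 0 < z \<and>
     disc ((W_fun \<alpha> x)\<^sup>2) ((W_fun \<alpha> y)\<^sup>2) ((W_fun \<alpha> z)\<^sup>2) > 0}"

definition mu_stat :: "real \<Rightarrow> real \<times> real \<times> real \<Rightarrow> complex" where
  "mu_stat \<alpha> = (\<lambda>(x, y, z). mu_fun ((W_fun \<alpha> x)\<^sup>2) ((W_fun \<alpha> y)\<^sup>2) ((W_fun \<alpha> z)\<^sup>2))"

definition tau_stat :: "real \<Rightarrow> real \<times> real \<times> real \<Rightarrow> real" where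
  "tau_stat \<alpha> = (\<lambda>(x, y, z). (ln (S_fun ((W_fun \<alpha> x)\<^sup>2) ((W_fun \<alpha> y)\<^sup>2) ((W_fun \<alpha> z)\<^sup>2)) - ln 4) / 2)"

definition mu_stat' :: "real \<Rightarrow> (real \<times> real \<times> real) \<times> (real \<times> real \<times> real) \<Rightarrow> complex" where
  "mu_stat' \<alpha> = (\<lambda>((x, y, z), (x', y', z')).
     mu_fun' ((W_fun \<alpha> x)\<^sup>2) ((W_fun \<alpha> y)\<^sup>2) ((W_fun \<alpha> z)\<^sup>2)
       (2 * W_fun \<alpha> x * W_fun' \<alpha> x x') (2 * W_fun \<alpha> y * W_fun' \<alpha> y y') (2 * W_fun \<alpha> z * W_fun' \<alpha> z z'))"

lemma continuous_on_W_fun: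
  assumes "\<alpha> < 2" "continuous_on S f" "\<And>x. x \<in> S \<Longrightarrow> f x > 0"
  shows "continuous_on S (\<lambda>x. W_fun \<alpha> (f x))"
  unfolding W_fun_def using kappa_pos[OF assms(1)] assms(3)
  by (intro continuous_intros assms(2)) (auto simp: less_imp_neq[symmetric] order_less_imp_not_eq2)

lemma continuous_on_W_fun':
  assumes "\<alpha> < 2" "continuous_on S f" "continuous_on S g" "\<And>x. x \<in> S \<Longrightarrow> f x > 0"
  shows "continuous_on S (\<lambda>x. W_fun' \<alpha> (f x) (g x))"
  unfolding W_fun'_def using kappa_pos[OF assms(1)] assms(4)
  by (intro continuous_intros assms(2,3)) (auto simp: less_imp_neq[symmetric] order_less_imp_not_eq2)

lemma stat_domain_D:
  assumes "p \<in> stat_domain \<alpha>"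
  shows "fst p > 0" "fst (snd p) > 0" "snd (snd p) > 0"
    "disc ((W_fun \<alpha> (fst p))\<^sup>2) ((W_fun \<alpha> (fst (snd p)))\<^sup>2) ((W_fun \<alpha> (snd (snd p)))\<^sup>2) > 0"
  using assms by (auto simp: stat_domain_def)

lemma open_stat_domain:
  assumes \<alpha>: "\<alpha> < 2"
  shows "open (stat_domain \<alpha>)"
proof -
  define P where "P = {p :: real \<times> real \<times> real. 0 < fst p \<and> 0 < fst (snd p) \<and> 0 < snd (snd p)}"
  have "open P" unfolding P_def by (intro open_Collect_conj open_Collect_less continuous_intros)
  moreover have "continuous_on P (\<lambda>p. disc ((W_fun \<alpha> (fst p))\<^sup>2) ((W_fun \<alpha> (fst (snd p)))\<^sup>2) ((W_fun \<alpha> (snd (snd p)))\<^sup>2))"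
    unfolding disc_def by (intro continuous_intros continuous_on_W_fun[OF \<alpha>]) (auto simp: P_def)
  ultimately have "open (P \<inter> (\<lambda>p. disc ((W_fun \<alpha> (fst p))\<^sup>2) ((W_fun \<alpha> (fst (snd p)))\<^sup>2) ((W_fun \<alpha> (snd (snd p)))\<^sup>2)) -` {0<..})"
    by (intro continuous_open_preimage open_greaterThan)
  also have "\<dots> = stat_domain \<alpha>" by (auto simp: P_def stat_domain_def)
  finally show ?thesis .
qed

lemma stat_S_pos:
  assumes "p \<in> stat_domain \<alpha>"
  shows "S_fun ((W_fun \<alpha> (fst p))\<^sup>2) ((W_fun \<alpha> (fst (snd p)))\<^sup>2) ((W_fun \<alpha> (snd (snd p)))\<^sup>2) > 0"
  using stat_domain_D[OF assms] by (intro S_fun_pos) auto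

lemma continuous_on_S_stat_domain:
  assumes \<alpha>: "\<alpha> < 2"
  shows "continuous_on (stat_domain \<alpha>) (\<lambda>p. S_fun ((W_fun \<alpha> (fst p))\<^sup>2) ((W_fun \<alpha> (fst (snd p)))\<^sup>2) ((W_fun \<alpha> (snd (snd p)))\<^sup>2))"
  unfolding S_fun_def disc_def
  by (intro continuous_intros continuous_on_W_fun[OF \<alpha>]) (auto dest: stat_domain_D)

lemma continuous_on_mu_stat:
  assumes \<alpha>: "\<alpha> < 2"
  shows "continuous_on (stat_domain \<alpha>) (mu_stat \<alpha>)"
  unfolding mu_stat_def mu_fun_def case_prod_unfold
  by (intro continuous_intros continuous_on_S_stat_domain[OF \<alpha>] continuous_on_W_fun[OF \<alpha>])
    (auto dest: stat_domain_D stat_S_pos)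

lemma continuous_on_tau_stat:
  assumes \<alpha>: "\<alpha> < 2"
  shows "continuous_on (stat_domain \<alpha>) (tau_stat \<alpha>)"
  unfolding tau_stat_def case_prod_unfold
  by (intro continuous_intros continuous_on_S_stat_domain[OF \<alpha>]) (auto dest: stat_S_pos)

lemma continuous_on_mu_stat':
  assumes \<alpha>: "\<alpha> < 2"
  shows "continuous_on (stat_domain \<alpha> \<times> UNIV) (mu_stat' \<alpha>)"
proof -
  have S: "continuous_on (stat_domain \<alpha> \<times> UNIV) (\<lambda>q. S_fun ((W_fun \<alpha> (fst (fst q)))\<^sup>2) ((W_fun \<alpha> (fst (snd (fst q))))\<^sup>2) ((W_fun \<alpha> (snd (snd (fst q))))\<^sup>2))"
    by (rule continuous_on_compose2[OF continuous_on_S_stat_domain[OF \<alpha>]]) (auto intro!: continuous_intros)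
  show ?thesis
    unfolding mu_stat'_def mu_fun'_def S_fun'_def disc_def case_prod_unfold
    by (intro continuous_intros S continuous_on_W_fun[OF \<alpha>] continuous_on_W_fun'[OF \<alpha>])
      (auto dest: stat_domain_D stat_S_pos simp: disc_def)
qed

lemma mu_stat_derivative:
  assumes \<alpha>: "\<alpha> < 2"
    and x: "(x has_real_derivative x') (at s)" and y: "(y has_real_derivative y') (at s)"
    and z: "(z has_real_derivative z') (at s)" and dom: "(x s, y s, z s) \<in> stat_domain \<alpha>"
  shows "((\<lambda>s. mu_stat \<alpha> (x s, y s, z s)) has_vector_derivative mu_stat' \<alpha> ((x s, y s, z s), (x', y', z'))) (at s)"
proof -
  note D = stat_domain_D[OF dom, simplified]
  have sq: "((\<lambda>s. (W_fun \<alpha> (u s))\<^sup>2) has_real_derivative 2 * W_fun \<alpha> (u s) * W_fun' \<alpha> (u s) u') (at s)"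
    if "(u has_real_derivative u') (at s)" "u s > 0" for u u'
    by (rule DERIV_cong[OF DERIV_power[OF W_fun_derivative[OF that \<alpha>]]]) simp
  show ?thesis
    unfolding mu_stat_def mu_stat'_def case_prod_conv
    by (rule mu_fun_derivative[OF sq[OF x D(1)] sq[OF y D(2)] sq[OF z D(3)]]) (use D in auto)
qed

subsection \<open>The limits\<close>

text \<open>Here \<open>a\<close> and \<open>b\<close> are the partials of \<open>f\<close>, so that
  \<open>p\<close> and \<open>q\<close> are its two Wirtinger derivatives. With J the Jacobian, 4
  |p|^2 = |a|^2 + |b|^2 + 2 J, and 4 q cnj(p) has real part |a|^2 - |b|^2 and imaginary part |a +
  b|^2 - |a|^2 - |b|^2. Dividing the second by the first gives q / p.\<close>

lemma dilatation_algebra: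
  fixes a b :: complex
  assumes J: "Re a * Im b - Re b * Im a > 0"
  defines "p \<equiv> (a - \<i> * b) / 2" and "q \<equiv> (a + \<i> * b) / 2"
  shows "disc ((cmod a)\<^sup>2) ((cmod b)\<^sup>2) ((cmod (a + b))\<^sup>2) > 0"
    "S_fun ((cmod a)\<^sup>2) ((cmod b)\<^sup>2) ((cmod (a + b))\<^sup>2) = 4 * (cmod p)\<^sup>2"
    "p \<noteq> 0" "mu_fun ((cmod a)\<^sup>2) ((cmod b)\<^sup>2) ((cmod (a + b))\<^sup>2) = q / p"
proof -
  let ?J = "Re a * Im b - Re b * Im a"
  have d: "disc ((cmod a)\<^sup>2) ((cmod b)\<^sup>2) ((cmod (a + b))\<^sup>2) = (2 * ?J)\<^sup>2"
    unfolding disc_def cmod_power2 by (simp add: power2_eq_square algebra_simps)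
  then show "disc ((cmod a)\<^sup>2) ((cmod b)\<^sup>2) ((cmod (a + b))\<^sup>2) > 0" using J by simp
  \<comment> \<open>Positivity of the Jacobian selects the root; for a reversed orientation the sign
    of J would be lost.\<close>
  have s: "sqrt ((2 * ?J)\<^sup>2) = 2 * ?J" using J by simp
  show S: "S_fun ((cmod a)\<^sup>2) ((cmod b)\<^sup>2) ((cmod (a + b))\<^sup>2) = 4 * (cmod p)\<^sup>2"
  proof -
    have "4 * (cmod p)\<^sup>2 = (Re a + Im b)\<^sup>2 + (Im a - Re b)\<^sup>2"
      unfolding cmod_power2 by (simp add: p_def power_divide)
    then show ?thesis
      unfolding S_fun_def d s unfolding cmod_power2 by (simp add: power2_eq_square algebra_simps)
  qed
  have "S_fun ((cmod a)\<^sup>2) ((cmod b)\<^sup>2) ((cmod (a + b))\<^sup>2) > 0"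
    using d J by (intro S_fun_pos) auto
  then show p0: "p \<noteq> 0" unfolding S by auto
  have "mu_fun ((cmod a)\<^sup>2) ((cmod b)\<^sup>2) ((cmod (a + b))\<^sup>2) * of_real (4 * (cmod p)\<^sup>2)
      = of_real ((cmod a)\<^sup>2 - (cmod b)\<^sup>2) + \<i> * of_real ((cmod (a + b))\<^sup>2 - (cmod a)\<^sup>2 - (cmod b)\<^sup>2)"
    unfolding mu_fun_def S using p0 by (simp add: field_simps)
  also have "\<dots> = 4 * (q * cnj p)"
    unfolding cmod_power2 by (simp add: complex_eq_iff p_def q_def power2_eq_square algebra_simps)
  also have "\<dots> = q / p * (4 * (p * cnj p))" using p0 by simp
  also have "\<dots> = q / p * of_real (4 * (cmod p)\<^sup>2)"
    by (simp only: complex_norm_square of_real_mult) simp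
  finally have "mu_fun ((cmod a)\<^sup>2) ((cmod b)\<^sup>2) ((cmod (a + b))\<^sup>2) * of_real (4 * (cmod p)\<^sup>2)
      = q / p * of_real (4 * (cmod p)\<^sup>2)" .
  moreover have "of_real (4 * (cmod p)\<^sup>2) \<noteq> (0::complex)" using p0 by simp
  ultimately show "mu_fun ((cmod a)\<^sup>2) ((cmod b)\<^sup>2) ((cmod (a + b))\<^sup>2) = q / p"
    using mult_right_cancel by blast
qed

lemma W_fun_limit:
  assumes "0 < \<alpha>" "\<alpha> < 2" "r > 0"
  shows "W_fun \<alpha> ((8 - 2 powr (\<alpha> + 1)) * r powr \<alpha>) = r"
  using kappa_pos[OF assms(2)] assms by (simp add: W_fun_def powr_powr)

lemma lipschitz_of_bounded_partials:
  fixes g :: "complex \<Rightarrow> real"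
  assumes g: "cont_diff_on (Suc 0) UNIV g" and b: "bounded (range (partial 1 g))" "bounded (range (partial \<i> g))"
  shows "\<exists>L\<ge>0. \<forall>x y. \<bar>g x - g y\<bar> \<le> L * norm (x - y)"
proof -
  obtain B1 B2 where B: "\<And>z. norm (partial 1 g z) \<le> B1" "\<And>z. norm (partial \<i> g z) \<le> B2"
    using b unfolding bounded_iff by (metis rangeI)
  have "\<bar>g x - g y\<bar> \<le> 2 * max B1 B2 * norm (x - y)" for x y
    unfolding real_norm_def[symmetric]
    by (rule C1_lipschitz[OF g convex_UNIV]) (use B in \<open>auto simp: le_max_iff_disj\<close>)
  moreover have "0 \<le> 2 * max B1 B2" using order_trans[OF norm_ge_zero B(1)] by (simp add: le_max_iff_disj)
  ultimately show ?thesis by blast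
qed

section \<open>Almost sure convergence of the statistics\<close>

context isotropic_gaussian_field
begin

abbreviation limit_stat :: "complex \<Rightarrow> real \<times> real \<times> real" where
  "limit_stat t \<equiv> (limit_var 1 t, limit_var \<i> t, limit_var (1 + \<i>) t)"

abbreviation B_triple :: "(complex \<Rightarrow> real) \<Rightarrow> (nat \<Rightarrow> real) \<Rightarrow> 'w \<Rightarrow> nat \<Rightarrow> complex \<Rightarrow> real \<times> real \<times> real" where
  "B_triple K b \<omega> n t \<equiv> (B_stat \<alpha> K \<Omega> (\<lambda>t. Z (f t) \<omega>) n (b n) 1 t,
     B_stat \<alpha> K \<Omega> (\<lambda>t. Z (f t) \<omega>) n (b n) \<i> t, B_stat \<alpha> K \<Omega> (\<lambda>t. Z (f t) \<omega>) n (b n) (1 + \<i>) t)"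

lemma W_limit_var: "h \<noteq> 0 \<Longrightarrow> W_fun \<alpha> (limit_var h t) = cmod (dir_deriv h f t)"
  unfolding limit_var_def using jacobian_dir_deriv_nonzero[OF f_jac] by (intro W_fun_limit \<alpha>) simp

lemma limit_var_pos: "h \<noteq> 0 \<Longrightarrow> limit_var h t > 0"
  unfolding limit_var_def using jacobian_dir_deriv_nonzero[OF f_jac] kappa_pos[OF \<alpha>(2)] by simp

lemma one_plus_i_nonzero: "1 + \<i> \<noteq> (0::complex)"
  by (simp add: complex_eq_iff)

lemma limit_stat_facts:
  shows "limit_stat t \<in> stat_domain \<alpha>" "mu_stat \<alpha> (limit_stat t) = dilatation f t"
    "tau_stat \<alpha> (limit_stat t) = log_scale f t"
proof -
  let ?a = "partial 1 f t" and ?b = "partial \<i> f t"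
  have J: "Re ?a * Im ?b - Re ?b * Im ?a > 0" using f_jac[of t] by (simp add: jacobian_det_def)
  have W: "W_fun \<alpha> (limit_var 1 t) = cmod ?a" "W_fun \<alpha> (limit_var \<i> t) = cmod ?b" "W_fun \<alpha> (limit_var (1 + \<i>) t) = cmod (?a + ?b)"
    using W_limit_var[of 1 t] W_limit_var[of \<i> t] W_limit_var[OF one_plus_i_nonzero, of t] by (simp_all add: dir_deriv_def)
  note alg = dilatation_algebra[OF J]
  show "limit_stat t \<in> stat_domain \<alpha>"
    using alg(1) limit_var_pos[of 1 t] limit_var_pos[of \<i> t] limit_var_pos[OF one_plus_i_nonzero, of t]
    by (simp add: stat_domain_def W)
  show "mu_stat \<alpha> (limit_stat t) = dilatation f t"
    using alg(4) by (simp add: mu_stat_def W dilatation_def wirtinger_def wirtinger_bar_def)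
  have "ln (4 * (cmod (wirtinger f t))\<^sup>2) = ln 4 + 2 * ln (cmod (wirtinger f t))"
    using alg(3) by (simp add: wirtinger_def ln_mult ln_realpow)
  then show "tau_stat \<alpha> (limit_stat t) = log_scale f t"
    using alg(2) by (simp add: tau_stat_def W log_scale_def wirtinger_def)
qed

lemma continuous_on_limit_stat: "continuous_on UNIV limit_stat"
  by (intro continuous_intros continuous_limit_var one_plus_i_nonzero) auto

lemma mu_hat_eq: "mu_hat \<alpha> K \<Omega> (\<lambda>t. Z (f t) \<omega>) n (b n) t = mu_stat \<alpha> (B_triple K b \<omega> n t)"
  by (simp add: mu_hat_def mu_stat_def mu_fun_def S_stat_def S_fun_def disc_def A_stat_def C_stat_def D_stat_def
      W_stat_def W_fun_def)

lemma tau_hat_eq: "tau_hat \<alpha> K \<Omega> (\<lambda>t. Z (f t) \<omega>) n (b n) t = tau_stat \<alpha> (B_triple K b \<omega> n t)"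
  by (simp add: tau_hat_def tau_stat_def S_stat_def S_fun_def disc_def A_stat_def C_stat_def D_stat_def
      W_stat_def W_fun_def)

lemma estimators_definedI:
  assumes "B_triple K b \<omega> n t \<in> stat_domain \<alpha>"
  shows "estimators_defined \<alpha> K \<Omega> (\<lambda>t. Z (f t) \<omega>) n (b n) t"
  using stat_domain_D[OF assms] stat_S_pos[OF assms]
  by (simp add: estimators_defined_def S_stat_def S_fun_def disc_def A_stat_def C_stat_def D_stat_def
      W_stat_def W_fun_def)

lemma B_stat_eq:
  "B_stat \<alpha> K \<Omega> (\<lambda>t. Z (f t) \<omega>) n (b n) h t =
    1 / ((real n)\<^sup>2 * (b n)\<^sup>2) * (\<Sum>w\<in>grid \<Omega> n. K ((w - t) / of_real (b n)) * (sec_diff n h w \<omega>)\<^sup>2)"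
proof -
  have "(real n powr (\<alpha> / 2))\<^sup>2 = real n powr \<alpha>" by (simp add: power2_eq_square powr_add[symmetric])
  then show ?thesis by (simp add: B_stat_def sec_diff_def power_mult_distrib mult_ac)
qed

text \<open>Each square is its mean plus a centred part: the first is handled by
  \<open>kernel_mean_convergence\<close>, the second by \<open>fluct_uniform\<close> with exponent
  2. The same rate \<open>1 / (n b^3)\<close> serves both.\<close>

lemma B_stat_converges:
  assumes h: "h \<noteq> 0" and \<Theta>: "compact \<Theta>" "\<Theta> \<subseteq> \<Omega>"
    and K: "integrable lborel K" "(LINT x|lborel. K x) = 1"
    and lip: "\<And>x y. \<bar>K x - K y\<bar> \<le> L * norm (x - y)" and L: "L \<ge> 0"
    and b: "\<And>n. n \<ge> 1 \<Longrightarrow> b n > 0" "b \<longlonglongrightarrow> 0"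
    and \<beta>: "\<beta> > 0" "(\<lambda>n. 1 / (real n * b n ^ 3)) \<in> O(\<lambda>n. real n powr (-\<beta>))"
  shows "AE \<omega> in M. uniform_limit \<Theta> (\<lambda>n. B_stat \<alpha> K \<Omega> (\<lambda>t. Z (f t) \<omega>) n (b n) h) (limit_var h) sequentially"
proof -
  have np: "(\<lambda>n. real n powr (-\<beta>)) \<longlonglongrightarrow> 0" if "\<beta> > 0" for \<beta>
    by (intro tendsto_neg_powr filterlim_real_sequentially) (use that in auto)
  obtain D where D: "\<forall>\<^sub>F n in sequentially. norm (1 / (real n * b n ^ 3)) \<le> D * norm (real n powr (-\<beta>))"
    using \<beta>(2) by (elim landau_o.bigE)
  have b3: "(\<lambda>n. 1 / (real n * b n ^ 3)) \<longlonglongrightarrow> 0"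
  proof (rule Lim_null_comparison)
    show "\<forall>\<^sub>F n in sequentially. norm (1 / (real n * b n ^ 3)) \<le> D * real n powr (-\<beta>)" using D by simp
    show "(\<lambda>n. D * real n powr (-\<beta>)) \<longlonglongrightarrow> 0" by (rule tendsto_mult_right_zero[OF np[OF \<beta>(1)]])
  qed
  obtain C where C: "\<forall>\<^sub>F n in sequentially. \<forall>w\<in>grid \<Omega> n.
    \<bar>sec_diff_var n h w - limit_var h w\<bar> \<le> C * (real n powr (-\<gamma>) + 1 / real n)"
    using sec_diff_var_limit[OF h] by blast
  have e: "(\<lambda>n. C * (real n powr (-\<gamma>) + 1 / real n)) \<longlonglongrightarrow> 0"
    by (intro tendsto_mult_right_zero tendsto_add_zero np \<gamma> lim_const_over_n)
  have mean: "uniform_limit \<Theta>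
    (\<lambda>n t. 1 / ((real n)\<^sup>2 * (b n)\<^sup>2) * (\<Sum>w\<in>grid \<Omega> n. K ((w - t) / of_real (b n)) * sec_diff_var n h w))
    (\<lambda>t. limit_var h t * (LINT x|lborel. K x)) sequentially"
    by (rule kernel_mean_convergence[OF open_\<Omega> bounded_\<Omega> \<Theta> K(1) lip L b b3 continuous_limit_var[OF h] C e])
  have "(\<lambda>n. 1 / (real n * b n ^ Suc 2)) \<in> O(\<lambda>n. real n powr (-\<beta>))" using \<beta>(2) by (simp add: eval_nat_numeral)
  have "AE \<omega> in M. uniform_limit \<Theta>
    (\<lambda>n t. 1 / ((real n)\<^sup>2 * b n ^ 2) * (\<Sum>w\<in>grid \<Omega> n. K ((w - t) / of_real (b n)) * ((sec_diff n h w \<omega>)\<^sup>2 - sec_diff_var n h w)))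
    (\<lambda>_. 0) sequentially"
    by (rule fluct_uniform[OF h \<Theta> lip L _ b(2) \<beta>(1) \<open>(\<lambda>n. 1 / (real n * b n ^ Suc 2)) \<in> _\<close>]) (rule b(1))
  then show ?thesis
  proof eventually_elim
    case (elim \<omega>)
    have "(\<Sum>w\<in>grid \<Omega> n. k w * (x w - y w)) + (\<Sum>w\<in>grid \<Omega> n. k w * y w) = (\<Sum>w\<in>grid \<Omega> n. k w * x w)"
      for n and k x y :: "complex \<Rightarrow> real"
      by (simp add: sum.distrib[symmetric] distrib_left[symmetric])
    with uniform_limit_add[OF elim mean]
    show ?case unfolding B_stat_eq by (simp only: distrib_left[symmetric] K(2) mult_1_right add_0_left)
  qed
qed

lemma B_triple_converges:
  assumes \<Theta>: "compact \<Theta>" "\<Theta> \<subseteq> \<Omega>"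
    and K: "integrable lborel K" "(LINT x|lborel. K x) = 1"
    and lip: "\<And>x y. \<bar>K x - K y\<bar> \<le> L * norm (x - y)" and L: "L \<ge> 0"
    and b: "\<And>n. n \<ge> 1 \<Longrightarrow> b n > 0" "b \<longlonglongrightarrow> 0"
    and \<beta>: "\<beta> > 0" "(\<lambda>n. 1 / (real n * b n ^ 3)) \<in> O(\<lambda>n. real n powr (-\<beta>))"
  shows "AE \<omega> in M. uniform_limit \<Theta> (B_triple K b \<omega>) limit_stat sequentially"
proof -
  have *: "AE \<omega> in M. uniform_limit \<Theta> (\<lambda>n. B_stat \<alpha> K \<Omega> (\<lambda>t. Z (f t) \<omega>) n (b n) h) (limit_var h) sequentially"
    if "h \<noteq> 0" for h
    by (rule B_stat_converges[OF that \<Theta> K lip L _ b(2) \<beta>]) (rule b(1))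
  have "AE \<omega> in M. uniform_limit \<Theta> (\<lambda>n. B_stat \<alpha> K \<Omega> (\<lambda>t. Z (f t) \<omega>) n (b n) 1) (limit_var 1) sequentially"
    "AE \<omega> in M. uniform_limit \<Theta> (\<lambda>n. B_stat \<alpha> K \<Omega> (\<lambda>t. Z (f t) \<omega>) n (b n) \<i>) (limit_var \<i>) sequentially"
    by (rule *; simp)+
  with *[OF one_plus_i_nonzero] show ?thesis
    by eventually_elim (intro uniform_limit_Pair)
qed

end

section \<open>Derivatives of the statistics and of their limits\<close>

context isotropic_gaussian_field
begin

text \<open>The length is written as the power \<alpha> / 2 of an inner product, which is
  differentiable and positive; the derivative along \<open>h\<close> is itself continuously
  differentiable because \<open>f\<close> has two continuous orders of derivatives.\<close>

lemma limit_var_C1: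
  assumes h: "h \<noteq> 0"
  shows "cont_diff_on (Suc 0) UNIV (limit_var h)"
proof -
  let ?g = "dir_deriv h f" and ?\<kappa> = "8 - 2 powr (\<alpha> + 1)"
  define dg where "dg v z = Re h *\<^sub>R partial v (partial 1 f) z + Im h *\<^sub>R partial v (partial \<i> f) z" for v z
  define dl where "dl v z = ?\<kappa> * ((\<alpha> / 2) * (?g z \<bullet> ?g z) powr (\<alpha> / 2 - 1) * (2 * (?g z \<bullet> dg v z)))" for v z
  have C2: "\<And>z. has_partial v (partial u f) z" "continuous_on UNIV (partial v (partial u f))"
    if "v \<in> {1, \<i>}" "u \<in> {1, \<i>}" for u v
    using f_C2 that by (auto simp: numeral_2_eq_2)
  have N0: "?g z \<bullet> ?g z > 0" for z using jacobian_dir_deriv_nonzero[OF f_jac h] by simp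
  have lv: "limit_var h = (\<lambda>z. ?\<kappa> * (?g z \<bullet> ?g z) powr (\<alpha> / 2))"
  proof
    fix z
    have "cmod (?g z) powr \<alpha> = ((?g z \<bullet> ?g z) powr (1 / 2)) powr \<alpha>"
      using N0[of z] by (simp add: norm_eq_sqrt_inner powr_half_sqrt less_imp_le)
    then show "limit_var h z = ?\<kappa> * (?g z \<bullet> ?g z) powr (\<alpha> / 2)"
      by (simp add: limit_var_def powr_powr)
  qed
  have d: "((\<lambda>x. limit_var h (z + x *\<^sub>R v)) has_vector_derivative dl v z) (at 0)" if v: "v \<in> {1, \<i>}" for v z
  proof -
    have "((\<lambda>x. ?g (z + x *\<^sub>R v)) has_vector_derivative dg v z) (at 0)"
      using has_partial_shift[of v "partial 1 f" z 0] has_partial_shift[of v "partial \<i> f" z 0] C2(1)[OF v]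
      unfolding dir_deriv_def dg_def
      by (auto intro!: derivative_eq_intros simp: has_vector_derivative_def algebra_simps)
    then have "((\<lambda>x. ?g (z + x *\<^sub>R v)) has_derivative (\<lambda>x. x *\<^sub>R dg v z)) (at 0)"
      by (simp add: has_vector_derivative_def)
    from has_derivative_inner[OF this this]
    have "((\<lambda>x. ?g (z + x *\<^sub>R v) \<bullet> ?g (z + x *\<^sub>R v)) has_real_derivative 2 * (?g z \<bullet> dg v z)) (at 0)"
      unfolding has_field_derivative_def by (rule has_derivative_eq_rhs) (auto simp: inner_commute)
    from DERIV_cmult[OF DERIV_fun_powr[OF this, of "\<alpha> / 2"], of ?\<kappa>] N0[of z]
    show ?thesis
      unfolding has_real_derivative_iff_has_vector_derivative[symmetric] lv dl_def by simp
  qed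
  have p: "has_partial v (limit_var h) z" "partial v (limit_var h) = dl v" if "v \<in> {1, \<i>}" for v z
    using partial_eqI[OF d[OF that]] by auto
  have "continuous_on UNIV (dl v)" if v: "v \<in> {1, \<i>}" for v
    unfolding dl_def[abs_def] dg_def
    by (intro continuous_intros C2(2)[OF v] continuous_on_dir_deriv C2_imp_C1 f_C2) (use N0 in \<open>auto simp: less_le\<close>)
  then show ?thesis using continuous_limit_var[OF h] p by auto
qed

text \<open>The inner derivative of (w - t) / b in \<open>t\<close> is -1 / b, whence the sign and
  the third power of the bandwidth.\<close>

definition dB_stat :: "complex \<Rightarrow> (complex \<Rightarrow> real) \<Rightarrow> (nat \<Rightarrow> real) \<Rightarrow> 'w \<Rightarrow> complex \<Rightarrow> nat \<Rightarrow> complex \<Rightarrow> real" where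
  "dB_stat v K b \<omega> h n t =
    - (1 / ((real n)\<^sup>2 * (b n) ^ 3) * (\<Sum>w\<in>grid \<Omega> n. partial v K ((w - t) / of_real (b n)) * (sec_diff n h w \<omega>)\<^sup>2))"

lemma B_stat_derivative:
  assumes K: "\<And>z. has_partial v K z" and b: "b n > 0"
  shows "((\<lambda>x. B_stat \<alpha> K \<Omega> (\<lambda>t. Z (f t) \<omega>) n (b n) h (t + x *\<^sub>R v)) has_real_derivative dB_stat v K b \<omega> h n t) (at 0)"
proof -
  have dK: "((\<lambda>x. K (z + x *\<^sub>R v)) has_real_derivative partial v K z) (at 0)" for z
    using has_partial_shift[of v K z 0] K by (simp add: has_real_derivative_iff_has_vector_derivative)
  have d: "((\<lambda>x. K ((w - (t + x *\<^sub>R v)) / of_real (b n))) has_real_derivative partial v K ((w - t) / of_real (b n)) * (- 1 / b n)) (at 0)" for w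
  proof -
    have "(w - (t + x *\<^sub>R v)) / of_real (b n) = (w - t) / of_real (b n) + (- 1 / b n * x) *\<^sub>R v" for x
      using b by (simp add: scaleR_conv_of_real field_simps)
    moreover have "((\<lambda>x. K ((w - t) / of_real (b n) + (- 1 / b n * x) *\<^sub>R v)) has_real_derivative partial v K ((w - t) / of_real (b n)) * (- 1 / b n)) (at 0)"
      by (rule DERIV_chain2[where f = "\<lambda>x. K ((w - t) / of_real (b n) + x *\<^sub>R v)" and g = "\<lambda>x. - 1 / b n * x"])
        (use dK b in \<open>auto intro!: derivative_eq_intros\<close>)
    ultimately show ?thesis by simp
  qed
  have "((\<lambda>x. \<Sum>w\<in>grid \<Omega> n. K ((w - (t + x *\<^sub>R v)) / of_real (b n)) * (sec_diff n h w \<omega>)\<^sup>2) has_real_derivative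
      (\<Sum>w\<in>grid \<Omega> n. partial v K ((w - t) / of_real (b n)) * (- 1 / b n) * (sec_diff n h w \<omega>)\<^sup>2)) (at 0)"
    by (intro DERIV_sum DERIV_cmult_right d)
  from DERIV_cmult[OF this, of "1 / ((real n)\<^sup>2 * (b n)\<^sup>2)"]
  show ?thesis unfolding B_stat_eq
  proof (rule DERIV_cong)
    have "(\<Sum>w\<in>grid \<Omega> n. partial v K ((w - t) / of_real (b n)) * (- 1 / b n) * (sec_diff n h w \<omega>)\<^sup>2)
        = (- 1 / b n) * (\<Sum>w\<in>grid \<Omega> n. partial v K ((w - t) / of_real (b n)) * (sec_diff n h w \<omega>)\<^sup>2)"
      by (simp only: sum_distrib_left mult_ac)
    then show "1 / ((real n)\<^sup>2 * (b n)\<^sup>2) * (\<Sum>w\<in>grid \<Omega> n. partial v K ((w - t) / of_real (b n)) * (- 1 / b n) * (sec_diff n h w \<omega>)\<^sup>2) = dB_stat v K b \<omega> h n t"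
      by (simp add: dB_stat_def power2_eq_square power3_eq_cube)
  qed
qed

text \<open>Mean and centred part as for the statistic itself, with exponent 3. The extra
  requirement is that the bias of the variances, of order n^(-\<gamma>) + 1/n, be o(b).\<close>

lemma dB_stat_converges:
  assumes h: "h \<noteq> 0" and \<Theta>: "compact \<Theta>" "\<Theta> \<subseteq> \<Omega>" and v: "v \<in> {1, \<i>}"
    and K: "cont_diff_on (Suc 0) UNIV K" "\<And>z. norm z > \<rho>K \<Longrightarrow> K z = 0" "(LINT x|lborel. K x) = 1"
    and lip: "\<And>x y. \<bar>partial v K x - partial v K y\<bar> \<le> L * norm (x - y)" and L: "L \<ge> 0"
    and b: "\<And>n. n \<ge> 1 \<Longrightarrow> b n > 0" "b \<longlonglongrightarrow> 0"
    and \<beta>: "\<beta> > 0" "\<beta> > 1 - 4 * \<gamma>" "(\<lambda>n. 1 / (real n * b n ^ 4)) \<in> O(\<lambda>n. real n powr (-\<beta>))"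
  shows "AE \<omega> in M. uniform_limit \<Theta> (dB_stat v K b \<omega> h) (partial v (limit_var h)) sequentially"
proof -
  have np: "(\<lambda>n. real n powr (-\<beta>)) \<longlonglongrightarrow> 0" if "\<beta> > 0" for \<beta>
    by (intro tendsto_neg_powr filterlim_real_sequentially) (use that in auto)
  obtain D where D: "\<forall>\<^sub>F n in sequentially. norm (1 / (real n * b n ^ 4)) \<le> D * norm (real n powr (-\<beta>))"
    using \<beta>(3) by (elim landau_o.bigE)
  have b4: "(\<lambda>n. 1 / (real n * b n ^ 4)) \<longlonglongrightarrow> 0"
  proof (rule Lim_null_comparison)
    show "\<forall>\<^sub>F n in sequentially. norm (1 / (real n * b n ^ 4)) \<le> D * real n powr (-\<beta>)" using D by simp
    show "(\<lambda>n. D * real n powr (-\<beta>)) \<longlonglongrightarrow> 0" by (rule tendsto_mult_right_zero[OF np[OF \<beta>(1)]])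
  qed
  obtain C where C: "\<forall>\<^sub>F n in sequentially. \<forall>w\<in>grid \<Omega> n.
    \<bar>sec_diff_var n h w - limit_var h w\<bar> \<le> C * (real n powr (-\<gamma>) + 1 / real n)"
    using sec_diff_var_limit[OF h] by blast
  \<comment> \<open>The rate hypothesis concerns the fourth power of the bandwidth, so the quotient
    n^(-\<gamma>) / b is treated through its fourth power.\<close>
  have fourth: "(\<lambda>n. x n) \<longlonglongrightarrow> 0" if x: "(\<lambda>n. x n ^ 4) \<longlonglongrightarrow> 0" for x :: "nat \<Rightarrow> real"
  proof -
    have "(\<lambda>n. root 4 (x n ^ 4)) \<longlonglongrightarrow> root 4 0" by (rule tendsto_real_root[OF x])
    moreover have "root 4 (y ^ 4) = \<bar>y\<bar>" for y :: real
      using real_root_power_cancel[of 4 "\<bar>y\<bar>"] by (simp add: power_even_abs)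
    ultimately have "(\<lambda>n. \<bar>x n\<bar>) \<longlonglongrightarrow> 0" by simp
    then show ?thesis by (simp add: tendsto_rabs_zero_iff)
  qed
  \<comment> \<open>n^(-4\<gamma>) / b^4 = n^(1-4\<gamma>) / (n b^4) = O(n^(1-4\<gamma>-\<beta>)),
    which tends to 0 since \<beta> > 1 - 4\<gamma>.\<close>
  have g: "(\<lambda>n. real n powr (-\<gamma>) / b n) \<longlonglongrightarrow> 0"
  proof (rule fourth, rule Lim_null_comparison)
    show "\<forall>\<^sub>F n in sequentially. norm ((real n powr (-\<gamma>) / b n) ^ 4) \<le> D * real n powr (-(\<beta> - (1 - 4 * \<gamma>)))"
      using D eventually_ge_at_top[of 1]
    proof eventually_elim
      case (elim n)
      then have n: "real n > 0" "b n > 0" using b(1) by auto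
      have "(real n powr (-\<gamma>)) ^ 4 = real n powr (-\<gamma> * 4)"
        using n powr_powr[of "real n" "-\<gamma>" 4] by (simp add: powr_numeral)
      then have "(real n powr (-\<gamma>) / b n) ^ 4 = real n powr (-\<gamma> * 4) / b n ^ 4" by (simp add: power_divide)
      also have "real n powr (-\<gamma> * 4) = real n powr (1 - 4 * \<gamma>) * (1 / real n)"
        using n by (simp add: powr_diff powr_minus_divide mult.commute)
      also have "real n powr (1 - 4 * \<gamma>) * (1 / real n) / b n ^ 4 = real n powr (1 - 4 * \<gamma>) * (1 / (real n * b n ^ 4))"
        by simp
      also have "\<dots> \<le> real n powr (1 - 4 * \<gamma>) * (D * real n powr (-\<beta>))"
        using elim(1) n by (intro mult_left_mono) auto
      also have "\<dots> = D * (real n powr (1 - 4 * \<gamma>) * real n powr (-\<beta>))" by (simp only: mult_ac)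
      also have "real n powr (1 - 4 * \<gamma>) * real n powr (-\<beta>) = real n powr (-(\<beta> - (1 - 4 * \<gamma>)))"
        by (simp add: powr_add[symmetric])
      finally show ?case using n by simp
    qed
    show "(\<lambda>n. D * real n powr (-(\<beta> - (1 - 4 * \<gamma>)))) \<longlonglongrightarrow> 0"
      by (rule tendsto_mult_right_zero[OF np]) (use \<beta> in simp)
  qed
  have nb: "(\<lambda>n. 1 / real n / b n) \<longlonglongrightarrow> 0"
  proof (rule Lim_null_comparison[OF _ b4])
    show "\<forall>\<^sub>F n in sequentially. norm (1 / real n / b n) \<le> 1 / (real n * b n ^ 4)"
      using eventually_ge_at_top[of 1] order_tendstoD(2)[OF b(2) zero_less_one]
    proof eventually_elim
      case (elim n)
      then have n: "b n > 0" using b(1) by auto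
      then have "b n ^ 4 \<le> b n ^ 1" using elim by (intro power_decreasing) auto
      then have "1 / (real n * b n) \<le> 1 / (real n * b n ^ 4)"
        using elim n by (intro divide_left_mono mult_left_mono) auto
      then show ?case using n by simp
    qed
  qed
  have e: "(\<lambda>n. C * (real n powr (-\<gamma>) + 1 / real n) / b n) \<longlonglongrightarrow> 0"
  proof -
    have "C * (x + y) / z = C * (x / z + y / z)" for x y z :: real
      by (simp only: add_divide_distrib[symmetric] times_divide_eq_right)
    then show ?thesis using tendsto_mult_right_zero[OF tendsto_add_zero[OF g nb], of C] by (simp only:)
  qed
  have mean: "uniform_limit \<Theta>
    (\<lambda>n t. - (1 / ((real n)\<^sup>2 * (b n) ^ 3) * (\<Sum>w\<in>grid \<Omega> n. partial v K ((w - t) / of_real (b n)) * sec_diff_var n h w)))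
    (partial v (limit_var h)) sequentially"
    by (rule kernel_derivative_mean_convergence[OF open_\<Omega> bounded_\<Omega> \<Theta> v K(1) _ K(3) lip L _ b(2) b4 limit_var_C1[OF h] C e])
      (rule K(2) b(1); assumption)+
  have "(\<lambda>n. 1 / (real n * b n ^ Suc 3)) \<in> O(\<lambda>n. real n powr (-\<beta>))" using \<beta>(3) by (simp add: eval_nat_numeral)
  have "AE \<omega> in M. uniform_limit \<Theta>
    (\<lambda>n t. 1 / ((real n)\<^sup>2 * b n ^ 3) * (\<Sum>w\<in>grid \<Omega> n. partial v K ((w - t) / of_real (b n)) * ((sec_diff n h w \<omega>)\<^sup>2 - sec_diff_var n h w)))
    (\<lambda>_. 0) sequentially"
    by (rule fluct_uniform[OF h \<Theta> lip L _ b(2) \<beta>(1) \<open>(\<lambda>n. 1 / (real n * b n ^ Suc 3)) \<in> _\<close>]) (rule b(1))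
  then show ?thesis
  proof eventually_elim
    case (elim \<omega>)
    have "(\<Sum>w\<in>grid \<Omega> n. k w * (x w - y w)) + (\<Sum>w\<in>grid \<Omega> n. k w * y w) = (\<Sum>w\<in>grid \<Omega> n. k w * x w)"
      for n and k x y :: "complex \<Rightarrow> real"
      by (simp add: sum.distrib[symmetric] distrib_left[symmetric])
    with uniform_limit_add[OF uniform_limit_uminus[OF elim] mean]
    show ?case unfolding dB_stat_def[abs_def] by (simp only: minus_add_distrib[symmetric] distrib_left[symmetric] minus_zero add_0_left)
  qed
qed

text \<open>Convergence is uniform on compact sets, whereas derivatives at points of \<Theta> call
  for an open set; hence an open set enclosed between two compact ones.\<close>

lemma open_neighbourhood:
  assumes \<Theta>: "compact \<Theta>" "\<Theta> \<subseteq> \<Omega>"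
  shows "\<exists>U \<Theta>'. open U \<and> compact \<Theta>' \<and> \<Theta> \<subseteq> U \<and> U \<subseteq> \<Theta>' \<and> \<Theta>' \<subseteq> \<Omega>"
proof -
  obtain e where e: "e > 0" "(\<Union>x\<in>\<Theta>. cball x e) \<subseteq> \<Omega>"
    using compact_subset_open_imp_cball_epsilon_subset[OF \<Theta>(1) open_\<Omega> \<Theta>(2)] by blast
  show ?thesis
  proof (intro exI conjI)
    show "open (\<Union>x\<in>\<Theta>. ball x e)" by auto
    show "compact (\<Union>x\<in>\<Theta>. cball x e)" by (rule compact_minkowski_sum_cball[OF \<Theta>(1)])
    show "\<Theta> \<subseteq> (\<Union>x\<in>\<Theta>. ball x e)" using e(1) by force
    show "(\<Union>x\<in>\<Theta>. ball x e) \<subseteq> (\<Union>x\<in>\<Theta>. cball x e)" by force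
  qed (rule e(2))
qed

lemma estimators_converge:
  assumes \<Theta>: "compact \<Theta>"
    and B: "uniform_limit \<Theta> (B_triple K b \<omega>) limit_stat sequentially"
  shows "\<forall>\<^sub>F n in sequentially. \<forall>t\<in>\<Theta>. B_triple K b \<omega> n t \<in> stat_domain \<alpha>"
    "uniform_limit \<Theta> (\<lambda>n. mu_hat \<alpha> K \<Omega> (\<lambda>t. Z (f t) \<omega>) n (b n)) (dilatation f) sequentially"
    "uniform_limit \<Theta> (\<lambda>n. tau_hat \<alpha> K \<Omega> (\<lambda>t. Z (f t) \<omega>) n (b n)) (log_scale f) sequentially"
proof -
  have l: "continuous_on \<Theta> limit_stat" by (rule continuous_on_subset[OF continuous_on_limit_stat]) simp
  note c = uniform_limit_compose_open[OF B l \<Theta> open_stat_domain[OF \<alpha>(2)] limit_stat_facts(1)]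
  show "\<forall>\<^sub>F n in sequentially. \<forall>t\<in>\<Theta>. B_triple K b \<omega> n t \<in> stat_domain \<alpha>"
    by (rule c(1)[OF continuous_on_mu_stat[OF \<alpha>(2)]])
  show "uniform_limit \<Theta> (\<lambda>n. mu_hat \<alpha> K \<Omega> (\<lambda>t. Z (f t) \<omega>) n (b n)) (dilatation f) sequentially"
    using c(2)[OF continuous_on_mu_stat[OF \<alpha>(2)]] unfolding mu_hat_eq[abs_def] limit_stat_facts(2) .
  show "uniform_limit \<Theta> (\<lambda>n. tau_hat \<alpha> K \<Omega> (\<lambda>t. Z (f t) \<omega>) n (b n)) (log_scale f) sequentially"
    using c(2)[OF continuous_on_tau_stat[OF \<alpha>(2)]] unfolding tau_hat_eq[abs_def] limit_stat_facts(3) .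
qed

lemma partial_mu_hat:
  assumes K: "\<And>z. has_partial v K z" and b: "b n > 0" and dom: "B_triple K b \<omega> n t \<in> stat_domain \<alpha>"
  shows "has_partial v (mu_hat \<alpha> K \<Omega> (\<lambda>t. Z (f t) \<omega>) n (b n)) t"
    "partial v (mu_hat \<alpha> K \<Omega> (\<lambda>t. Z (f t) \<omega>) n (b n)) t
      = mu_stat' \<alpha> (B_triple K b \<omega> n t, (dB_stat v K b \<omega> 1 n t, dB_stat v K b \<omega> \<i> n t, dB_stat v K b \<omega> (1 + \<i>) n t))"
proof -
  note d = B_stat_derivative[where K = K and v = v and b = b and n = n and \<omega> = \<omega> and t = t, OF K b]
  have "((\<lambda>s. mu_stat \<alpha> (B_triple K b \<omega> n (t + s *\<^sub>R v))) has_vector_derivative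
      mu_stat' \<alpha> (B_triple K b \<omega> n (t + 0 *\<^sub>R v), (dB_stat v K b \<omega> 1 n t, dB_stat v K b \<omega> \<i> n t, dB_stat v K b \<omega> (1 + \<i>) n t))) (at 0)"
    by (rule mu_stat_derivative[OF \<alpha>(2) d d d]) (use dom in simp)
  then have "((\<lambda>s. mu_hat \<alpha> K \<Omega> (\<lambda>t. Z (f t) \<omega>) n (b n) (t + s *\<^sub>R v)) has_vector_derivative
      mu_stat' \<alpha> (B_triple K b \<omega> n t, (dB_stat v K b \<omega> 1 n t, dB_stat v K b \<omega> \<i> n t, dB_stat v K b \<omega> (1 + \<i>) n t))) (at 0)"
    unfolding mu_hat_eq by simp
  from partial_eqI[OF this]
  show "has_partial v (mu_hat \<alpha> K \<Omega> (\<lambda>t. Z (f t) \<omega>) n (b n)) t"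
    "partial v (mu_hat \<alpha> K \<Omega> (\<lambda>t. Z (f t) \<omega>) n (b n)) t
      = mu_stat' \<alpha> (B_triple K b \<omega> n t, (dB_stat v K b \<omega> 1 n t, dB_stat v K b \<omega> \<i> n t, dB_stat v K b \<omega> (1 + \<i>) n t))" .
qed

text \<open>The dilatation is the same function of the limits as the estimator is of the statistics,
  so both derivatives are values of \<open>mu_stat'\<close>; their convergence is reduced to its
  continuity.\<close>

lemma partial_dilatation:
  assumes v: "v \<in> {1, \<i>}"
  shows "partial v (dilatation f) t
      = mu_stat' \<alpha> (limit_stat t, (partial v (limit_var 1) t, partial v (limit_var \<i>) t, partial v (limit_var (1 + \<i>)) t))"
proof -
  have d: "((\<lambda>x. limit_var h (t + x *\<^sub>R v)) has_real_derivative partial v (limit_var h) t) (at 0)" if "h \<noteq> 0" for h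
    using has_partial_shift[of v "limit_var h" t 0] limit_var_C1[OF that] v
    by (auto simp: has_real_derivative_iff_has_vector_derivative)
  have "((\<lambda>s. mu_stat \<alpha> (limit_stat (t + s *\<^sub>R v))) has_vector_derivative
      mu_stat' \<alpha> (limit_stat (t + 0 *\<^sub>R v), (partial v (limit_var 1) t, partial v (limit_var \<i>) t, partial v (limit_var (1 + \<i>)) t))) (at 0)"
    by (rule mu_stat_derivative[OF \<alpha>(2) d d d[OF one_plus_i_nonzero] limit_stat_facts(1)]) simp_all
  then show ?thesis unfolding limit_stat_facts(2) using partial_eqI(2)[of "dilatation f"] by simp
qed

lemma partial_mu_hat_converges:
  assumes \<Theta>: "compact \<Theta>" and v: "v \<in> {1, \<i>}" and K: "\<And>z. has_partial v K z"
    and b: "\<And>n. n \<ge> 1 \<Longrightarrow> b n > 0"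
    and B: "uniform_limit \<Theta> (B_triple K b \<omega>) limit_stat sequentially"
    and dB: "\<And>h. h \<in> {1, \<i>, 1 + \<i>} \<Longrightarrow> uniform_limit \<Theta> (dB_stat v K b \<omega> h) (partial v (limit_var h)) sequentially"
  shows "uniform_limit \<Theta> (\<lambda>n. partial v (mu_hat \<alpha> K \<Omega> (\<lambda>t. Z (f t) \<omega>) n (b n))) (partial v (dilatation f)) sequentially"
proof -
  note dom = estimators_converge(1)[OF \<Theta> B]
  have h: "(1::complex) \<noteq> 0" "\<i> \<noteq> 0" by auto
  define dl where "dl t = (partial v (limit_var 1) t, partial v (limit_var \<i>) t, partial v (limit_var (1 + \<i>)) t)" for t
  define F where "F n t = (B_triple K b \<omega> n t, (dB_stat v K b \<omega> 1 n t, dB_stat v K b \<omega> \<i> n t, dB_stat v K b \<omega> (1 + \<i>) n t))" for n t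
  have cl: "continuous_on UNIV (partial v (limit_var h))" if "h \<noteq> 0" for h
    using limit_var_C1[OF that] v by auto
  have "continuous_on UNIV (\<lambda>t. (limit_stat t, dl t))"
    unfolding dl_def by (intro continuous_on_Pair continuous_limit_var cl h one_plus_i_nonzero)
  then have c: "continuous_on \<Theta> (\<lambda>t. (limit_stat t, dl t))"
    by (rule continuous_on_subset) simp
  have F: "uniform_limit \<Theta> F (\<lambda>t. (limit_stat t, dl t)) sequentially"
    unfolding dl_def F_def by (rule uniform_limit_Pair[OF B]) (intro uniform_limit_Pair dB; simp)
  have lim: "uniform_limit \<Theta> (\<lambda>n t. mu_stat' \<alpha> (F n t)) (\<lambda>t. mu_stat' \<alpha> (limit_stat t, dl t)) sequentially"
    by (rule uniform_limit_compose_open(2)[OF F c \<Theta> open_Times[OF open_stat_domain[OF \<alpha>(2)] open_UNIV] _ continuous_on_mu_stat'[OF \<alpha>(2)]])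
      (use limit_stat_facts(1) in blast)
  \<comment> \<open>The formula for the derivative holds only once the statistics lie in the domain,
    hence for large \<open>n\<close>.\<close>
  have eq: "\<forall>\<^sub>F n in sequentially. \<forall>t\<in>\<Theta>. mu_stat' \<alpha> (F n t) = partial v (mu_hat \<alpha> K \<Omega> (\<lambda>t. Z (f t) \<omega>) n (b n)) t"
    using dom eventually_ge_at_top[of 1]
  proof eventually_elim
    case (elim n)
    then show ?case using partial_mu_hat(2)[where K = K and v = v and b = b and n = n, OF K b] unfolding F_def by simp
  qed
  have eq': "partial v (dilatation f) t = mu_stat' \<alpha> (limit_stat t, dl t)" for t
    unfolding dl_def by (rule partial_dilatation[OF v])
  show "uniform_limit \<Theta> (\<lambda>n. partial v (mu_hat \<alpha> K \<Omega> (\<lambda>t. Z (f t) \<omega>) n (b n))) (partial v (dilatation f)) sequentially"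
  proof (rule uniform_limitI)
    fix e :: real assume "e > 0"
    from uniform_limitD[OF lim this] eq
    show "\<forall>\<^sub>F n in sequentially. \<forall>t\<in>\<Theta>. dist (partial v (mu_hat \<alpha> K \<Omega> (\<lambda>t. Z (f t) \<omega>) n (b n)) t) (partial v (dilatation f) t) < e"
      by eventually_elim (simp add: eq')
  qed
qed

end

text \<open>Bounded first partials of \<open>K\<close> make it Lipschitz, and bounded second
  partials do the same for its first partials; these constants feed the mean and fluctuation bounds.
  The open sets \<open>U\<close> record that, near \<Theta> and for large \<open>n\<close>, the
  total functions \<open>powr\<close>, \<open>sqrt\<close>, \<open>ln\<close> and
  \<open>partial\<close> have their usual meaning.\<close>

theorem mainTheorem4:
  fixes M :: "'w measure"
    and Z :: "complex \<Rightarrow> 'w \<Rightarrow> real"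
    and R :: "real \<Rightarrow> real"
    and \<alpha> \<gamma> m :: real
    and \<Omega> :: "complex set"
    and f :: "complex \<Rightarrow> complex"
    and K :: "complex \<Rightarrow> real"
    and b :: "nat \<Rightarrow> real"
  assumes "prob_space M"
    and "gaussian_field M Z"
    and "\<And>t. (LINT \<omega>|M. Z t \<omega>) = m"
    and "\<And>t s. covariance M (Z t) (Z s) = R (cmod (t - s))"
    and "0 < \<alpha>" and "\<alpha> < 2" and "\<gamma> > 0"
    and "(\<lambda>t. R t - (R 0 - t powr \<alpha>)) \<in> o[at_right 0](\<lambda>t. t powr (\<alpha> + \<gamma>))"
    and "\<And>j t. j < 4 \<Longrightarrow> t > 0 \<Longrightarrow> (deriv ^^ j) R field_differentiable (at t)"
    and "continuous_on {0<..} ((deriv ^^ 4) R)"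
    and "\<exists>c\<^sub>0>0. \<forall>\<^sub>F t in at_right 0. \<bar>(deriv ^^ 4) R t\<bar> \<le> c\<^sub>0 * t powr (\<alpha> - 4)"
    and "open \<Omega>" and "connected \<Omega>" and "\<Omega> \<noteq> {}" and "bounded \<Omega>" and "simply_connected \<Omega>"
    and "diffeo 2 f"
    and "cont_diff_on 2 UNIV K"
    and "\<And>v. v \<in> {1, \<i>} \<Longrightarrow> bounded (range (partial v K))"
    and "\<And>v w. v \<in> {1, \<i>} \<Longrightarrow> w \<in> {1, \<i>} \<Longrightarrow> bounded (range (partial w (partial v K)))"
    and "integrable lborel K" and "(LINT x|lborel. K x) = 1"
    and "integrable lborel (\<lambda>x. cmod x * K x)"
    and "\<And>n. n \<ge> 1 \<Longrightarrow> b n > 0" and "b \<longlonglongrightarrow> 0"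
    and "\<exists>\<beta>>0. (\<lambda>n. 1 / (real n * b n ^ 3)) \<in> O(\<lambda>n. real n powr (- \<beta>))"
  shows "(\<forall>\<Theta>. compact \<Theta> \<and> \<Theta> \<subseteq> \<Omega> \<longrightarrow>
      (\<exists>U. open U \<and> \<Theta> \<subseteq> U \<and> U \<subseteq> \<Omega> \<and>
        (AE \<omega> in M. \<forall>\<^sub>F n in sequentially. \<forall>t\<in>U.
          estimators_defined \<alpha> K \<Omega> (\<lambda>t. Z (f t) \<omega>) n (b n) t)) \<and>
      (AE \<omega> in M.
        (\<lambda>n. sup_dist \<Theta> (mu_hat \<alpha> K \<Omega> (\<lambda>t. Z (f t) \<omega>) n (b n)) (dilatation f)) \<longlonglongrightarrow> 0 \<and>
        (\<lambda>n. sup_dist \<Theta> (tau_hat \<alpha> K \<Omega> (\<lambda>t. Z (f t) \<omega>) n (b n)) (log_scale f)) \<longlonglongrightarrow> 0)) \<and>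
      (compact (closure {x. K x \<noteq> 0}) \<and> diffeo 3 f \<and>
      (\<exists>\<beta>>0. \<beta> > 1 - 4 * \<gamma> \<and> (\<lambda>n. 1 / (real n * b n ^ 4)) \<in> O(\<lambda>n. real n powr (- \<beta>))) \<longrightarrow>
      (\<forall>\<Theta>. compact \<Theta> \<and> \<Theta> \<subseteq> \<Omega> \<longrightarrow>
        (\<exists>U. open U \<and> \<Theta> \<subseteq> U \<and> U \<subseteq> \<Omega> \<and>
          (AE \<omega> in M. \<forall>\<^sub>F n in sequentially. \<forall>t\<in>U. \<forall>v\<in>{1, \<i>}.
            has_partial v (mu_hat \<alpha> K \<Omega> (\<lambda>t. Z (f t) \<omega>) n (b n)) t)) \<and>
        (AE \<omega> in M.
          (\<lambda>n. sup_dist \<Theta> (wirtinger (mu_hat \<alpha> K \<Omega> (\<lambda>t. Z (f t) \<omega>) n (b n)))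
            (wirtinger (dilatation f))) \<longlonglongrightarrow> 0)))"
proof -
  note K2 = assms(18) and K' = assms(19) and K'' = assms(20) and Kint = assms(21,22) and b = assms(24,25)
  have "isotropic_gaussian_field M Z R \<alpha> \<gamma> m \<Omega> f"
    by (rule isotropic_gaussian_field.intro) (fact assms)+
  then interpret isotropic_gaussian_field M Z R \<alpha> \<gamma> m \<Omega> f .
  obtain \<beta> where \<beta>: "\<beta> > 0" "(\<lambda>n. 1 / (real n * b n ^ 3)) \<in> O(\<lambda>n. real n powr (- \<beta>))"
    using assms(26) by blast
  have K1: "cont_diff_on (Suc 0) UNIV K" by (rule C2_imp_C1[OF K2])
  obtain L where L: "L \<ge> 0" "\<And>x y. \<bar>K x - K y\<bar> \<le> L * norm (x - y)"
    using lipschitz_of_bounded_partials[OF K1 K' K'] by auto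
  have B: "AE \<omega> in M. uniform_limit \<Theta> (B_triple K b \<omega>) limit_stat sequentially" if "compact \<Theta>" "\<Theta> \<subseteq> \<Omega>" for \<Theta>
    by (rule B_triple_converges[OF that Kint L(2,1) _ b(2) \<beta>]) (rule b(1))
  have part1: "(\<exists>U. open U \<and> \<Theta> \<subseteq> U \<and> U \<subseteq> \<Omega> \<and>
        (AE \<omega> in M. \<forall>\<^sub>F n in sequentially. \<forall>t\<in>U.
          estimators_defined \<alpha> K \<Omega> (\<lambda>t. Z (f t) \<omega>) n (b n) t)) \<and>
      (AE \<omega> in M.
        (\<lambda>n. sup_dist \<Theta> (mu_hat \<alpha> K \<Omega> (\<lambda>t. Z (f t) \<omega>) n (b n)) (dilatation f)) \<longlonglongrightarrow> 0 \<and>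
        (\<lambda>n. sup_dist \<Theta> (tau_hat \<alpha> K \<Omega> (\<lambda>t. Z (f t) \<omega>) n (b n)) (log_scale f)) \<longlonglongrightarrow> 0)"
    if \<Theta>: "compact \<Theta>" "\<Theta> \<subseteq> \<Omega>" for \<Theta>
  proof
    \<comment> \<open>Convergence is applied on the larger compact set, which puts the statistics
      into the domain at every point of \<open>U\<close>.\<close>
    obtain U \<Theta>' where U: "open U" "compact \<Theta>'" "\<Theta> \<subseteq> U" "U \<subseteq> \<Theta>'" "\<Theta>' \<subseteq> \<Omega>"
      using open_neighbourhood[OF \<Theta>] by blast
    have "AE \<omega> in M. \<forall>\<^sub>F n in sequentially. \<forall>t\<in>U. estimators_defined \<alpha> K \<Omega> (\<lambda>t. Z (f t) \<omega>) n (b n) t"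
      using B[OF U(2,5)]
    proof eventually_elim
      case (elim \<omega>)
      from estimators_converge(1)[OF U(2) elim] show ?case
        by eventually_elim (use estimators_definedI U(4) in blast)
    qed
    then show "\<exists>U. open U \<and> \<Theta> \<subseteq> U \<and> U \<subseteq> \<Omega> \<and>
        (AE \<omega> in M. \<forall>\<^sub>F n in sequentially. \<forall>t\<in>U. estimators_defined \<alpha> K \<Omega> (\<lambda>t. Z (f t) \<omega>) n (b n) t)"
      using U by blast
    show "AE \<omega> in M.
        (\<lambda>n. sup_dist \<Theta> (mu_hat \<alpha> K \<Omega> (\<lambda>t. Z (f t) \<omega>) n (b n)) (dilatation f)) \<longlonglongrightarrow> 0 \<and>
        (\<lambda>n. sup_dist \<Theta> (tau_hat \<alpha> K \<Omega> (\<lambda>t. Z (f t) \<omega>) n (b n)) (log_scale f)) \<longlonglongrightarrow> 0"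
      using B[OF \<Theta>]
    proof eventually_elim
      case (elim \<omega>)
      show ?case
        by (intro conjI sup_dist_tendsto_0 estimators_converge(2,3)[OF \<Theta>(1) elim])
    qed
  qed
  have part2: "(\<exists>U. open U \<and> \<Theta> \<subseteq> U \<and> U \<subseteq> \<Omega> \<and>
          (AE \<omega> in M. \<forall>\<^sub>F n in sequentially. \<forall>t\<in>U. \<forall>v\<in>{1, \<i>}.
            has_partial v (mu_hat \<alpha> K \<Omega> (\<lambda>t. Z (f t) \<omega>) n (b n)) t)) \<and>
        (AE \<omega> in M.
          (\<lambda>n. sup_dist \<Theta> (wirtinger (mu_hat \<alpha> K \<Omega> (\<lambda>t. Z (f t) \<omega>) n (b n)))
            (wirtinger (dilatation f))) \<longlonglongrightarrow> 0)"
    if supp: "compact (closure {x. K x \<noteq> 0})"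
      and \<beta>': "\<exists>\<beta>>0. \<beta> > 1 - 4 * \<gamma> \<and> (\<lambda>n. 1 / (real n * b n ^ 4)) \<in> O(\<lambda>n. real n powr (- \<beta>))"
      and \<Theta>: "compact \<Theta>" "\<Theta> \<subseteq> \<Omega>" for \<Theta>
  proof
    obtain \<beta>' where \<beta>': "\<beta>' > 0" "\<beta>' > 1 - 4 * \<gamma>" "(\<lambda>n. 1 / (real n * b n ^ 4)) \<in> O(\<lambda>n. real n powr (- \<beta>'))"
      using \<beta>' by blast
    \<comment> \<open>Compact support becomes vanishing beyond a radius, the form used for the
      integration by parts.\<close>
    obtain \<rho> where \<rho>: "\<forall>x\<in>closure {x. K x \<noteq> 0}. norm x \<le> \<rho>"
      using compact_imp_bounded[OF supp] unfolding bounded_iff by blast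
    have K0: "K z = 0" if "norm z > \<rho>" for z
      using \<rho> that closure_subset[of "{x. K x \<noteq> 0}"] by force
    have hpK: "has_partial v K z" if "v \<in> {1, \<i>}" for v z using K1 that by auto
    have dB: "AE \<omega> in M. \<forall>v\<in>{1, \<i>}. \<forall>h\<in>{1, \<i>, 1 + \<i>}.
        uniform_limit \<Theta> (dB_stat v K b \<omega> h) (partial v (limit_var h)) sequentially" if \<Theta>: "compact \<Theta>" "\<Theta> \<subseteq> \<Omega>" for \<Theta>
    proof (intro AE_finite_allI)
      fix v h assume v: "v \<in> {1, \<i>}" and "h \<in> {1, \<i>, 1 + \<i>}"
      then have h: "h \<noteq> 0" using one_plus_i_nonzero by auto
      obtain L' where L': "L' \<ge> 0" "\<And>x y. \<bar>partial v K x - partial v K y\<bar> \<le> L' * norm (x - y)"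
        using lipschitz_of_bounded_partials[OF C2_partial[OF K2 v] K''[OF v] K''[OF v]] by auto
      show "AE \<omega> in M. uniform_limit \<Theta> (dB_stat v K b \<omega> h) (partial v (limit_var h)) sequentially"
        by (rule dB_stat_converges[OF h \<Theta> v K1 _ Kint(2) L'(2,1) _ b(2) \<beta>']) (rule K0 b(1); assumption)+
    qed auto
    obtain U \<Theta>' where U: "open U" "compact \<Theta>'" "\<Theta> \<subseteq> U" "U \<subseteq> \<Theta>'" "\<Theta>' \<subseteq> \<Omega>"
      using open_neighbourhood[OF \<Theta>] by blast
    have "AE \<omega> in M. \<forall>\<^sub>F n in sequentially. \<forall>t\<in>U. \<forall>v\<in>{1, \<i>}.
            has_partial v (mu_hat \<alpha> K \<Omega> (\<lambda>t. Z (f t) \<omega>) n (b n)) t"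
      using B[OF U(2,5)]
    proof eventually_elim
      case (elim \<omega>)
      from estimators_converge(1)[OF U(2) elim] eventually_ge_at_top[of 1] show ?case
      proof eventually_elim
        case (elim n)
        show ?case
        proof (intro ballI)
          fix t v assume "t \<in> U" and v: "v \<in> {1, \<i>}"
          then have "B_triple K b \<omega> n t \<in> stat_domain \<alpha>" using elim U(4) by blast
          then show "has_partial v (mu_hat \<alpha> K \<Omega> (\<lambda>t. Z (f t) \<omega>) n (b n)) t"
            using partial_mu_hat(1)[where K = K and v = v and b = b and n = n, OF hpK[OF v] b(1)[OF elim(2)]] by blast
        qed
      qed
    qed
    then show "\<exists>U. open U \<and> \<Theta> \<subseteq> U \<and> U \<subseteq> \<Omega> \<and>
          (AE \<omega> in M. \<forall>\<^sub>F n in sequentially. \<forall>t\<in>U. \<forall>v\<in>{1, \<i>}.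
            has_partial v (mu_hat \<alpha> K \<Omega> (\<lambda>t. Z (f t) \<omega>) n (b n)) t)"
      using U by blast
    show "AE \<omega> in M. (\<lambda>n. sup_dist \<Theta> (wirtinger (mu_hat \<alpha> K \<Omega> (\<lambda>t. Z (f t) \<omega>) n (b n)))
            (wirtinger (dilatation f))) \<longlonglongrightarrow> 0"
      using B[OF \<Theta>] dB[OF \<Theta>]
    proof eventually_elim
      case (elim \<omega>)
      have p: "uniform_limit \<Theta> (\<lambda>n. partial v (mu_hat \<alpha> K \<Omega> (\<lambda>t. Z (f t) \<omega>) n (b n))) (partial v (dilatation f)) sequentially"
        if v: "v \<in> {1, \<i>}" for v
        by (rule partial_mu_hat_converges[OF \<Theta>(1) v hpK[OF v] _ elim(1)]) (use b(1) elim(2) v in auto)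
      \<comment> \<open>The Wirtinger derivative is a fixed linear combination of the two partials,
        so it inherits their uniform convergence.\<close>
      have "uniform_limit \<Theta> (\<lambda>n. wirtinger (mu_hat \<alpha> K \<Omega> (\<lambda>t. Z (f t) \<omega>) n (b n))) (wirtinger (dilatation f)) sequentially"
        unfolding wirtinger_def[abs_def]
        by (intro bounded_linear.uniform_limit[OF bounded_linear_divide] uniform_limit_minus
            bounded_linear.uniform_limit[OF bounded_linear_mult_right] p) auto
      then show ?case by (rule sup_dist_tendsto_0)
    qed
  qed
  show ?thesis
  proof (intro conjI[OF _ impI] allI impI; elim conjE)
  qed (rule part1 part2; assumption)+
qed

end
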